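(* Let $K$ be a commutative ring, let $A,B$ be $K$-algebras, let $M_1,\dots,M_n$ be $A\otimes B^o$-modules, all of $A,B,M_1,\dots,M_n$ being projective as $K$-modules, and let $m_1,\dots,m_n\geq 1$ be integers. Put $M=\bigoplus_{i=1}^n M_i^{m_i}$, $M'=\bigoplus_{i=1}^n M_i$ and $\tilde M=\bigoplus_{i=1}^n M_i^{m_i-1}$, so that $M=\tilde M\oplus M'$. Then there is a split short exact sequence of graded $K$-modules $$0\longrightarrow \prod_{i,j=1}^{n}\mathrm{Ext}^{*-1}_{A\otimes B^o}(M_i,M_j)^{m_im_j-1}\xrightarrow{\ l^*\ } HH^*\begin{pmatrix}A&M\\0&B\end{pmatrix}\xrightarrow{\ r^*\ } HH^*\begin{pmatrix}A&M'\\0&B\end{pmatrix}\longrightarrow 0,$$ where $l^*=l^*_{M',\tilde M}$ and $r^*=r^*_{M',\tilde M}$ are the morphisms defined in the context (with $N=M'$ and with $\tilde M$ in the role of $M$).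
   Context: Conventions. $K$ is a commutative ring, $\otimes=\otimes_K$. Algebras are associative unital $K$-algebras; modules over an algebra are unital left modules; $T^o$ is the opposite algebra of $T$. For algebras $A,B$ and an $A\otimes B^o$-module $M$, $\begin{pmatrix}A&M\\0&B\end{pmatrix}$ is the triangular matrix algebra with product $\begin{pmatrix}a&m\\0&b\end{pmatrix}\begin{pmatrix}a'&m'\\0&b'\end{pmatrix}=\begin{pmatrix}aa'&am'+mb'\\0&bb'\end{pmatrix}$. $HH^*T=H^*(T,T)$ is Hochschild cohomology. $\mathrm{Ext}^{-1}=0$. All algebras $A,B$ and all $A\otimes B^o$-modules considered are $K$-projective. Bar complex. For an algebra $T$, $C^T_n=T^{\otimes(n+2)}$ ($n\ge 0$) with differential $a_0\otimes\cdots\otimes a_{n+1}\mapsto\sum_{i=0}^n(-1)^i a_0\otimes\cdots\otimes a_ia_{i+1}\otimes\cdots\otimes a_{n+1}$; $C^{T+}_*$ is its augmentation, with $C^{T+}_{-1}=T$. For a $T\otimes T^o$-module $\Lambda$, $C^*(T,\Lambda)=\mathrm{Hom}_{T\otimes T^o}(C^T_*,\Lambda)$ and $C^*(T)=C^*(T,T)$. Triangular complex. $C^{A,B^o}_*$ is the complex whose part of degree $n\ge 0$ is $\bigoplus_{p+q=n-1;\ p,q\ge -1}C^{A+}_p\otimes C^{B^o+}_q$, with differential $d\otimes 1+(-1)^{p+1}1\otimes d$ (the summand $p=q=-1$, of degree $-1$, is discarded). For an $A\otimes B^o$-module $M$ put $C^{A,B^o}_*M=C^{A,B^o}_*\otimes_{A\otimes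 B^o}M$; the summands with $q=-1$ form the subcomplex $C^A_*M=C^A_*\otimes_AM$ and those with $p=-1$ the subcomplex $C^{B^o}_*M=M\otimes_BC^B_*$. Put $C^*_{tri}(M,N)=\mathrm{Hom}_{A\otimes B^o}(C^{A,B^o}_*M,N)$. Restriction to the two subcomplexes and adjunction give $i^{A*}_{M,N}:C^*_{tri}(M,N)\to C^*(A,\mathrm{Hom}_{B^o}(M,N))$ and $i^{B^o*}_{M,N}:C^*_{tri}(M,N)\to C^*(B,\mathrm{Hom}_A(M,N))$; $i^*_{M,N}=(i^{A*}_{M,N},i^{B^o*}_{M,N})$. The structure maps $A\to\mathrm{End}_{B^o}M$, $B\to(\mathrm{End}_AM)^o$ induce $\alpha^*_M:C^*(A)\to C^*(A,\mathrm{End}_{B^o}M)$ and $\beta^*_M:C^*(B)\to C^*(B,\mathrm{End}_AM)$. Cones. The cone of $f:X^*\to Y^*$ has degree $n$ part $X^n\oplus Y^{n-1}$ and differential $(x,y)\mapsto(dx,f(x)-dy)$. Put $\Sigma^*_{M,N}=\mathrm{cone}(i^*_{M,N})$; its cohomology is $\mathrm{Ext}^{*-1}_{A\otimes B^o}(M,N)$. Let $\mathcal C^*\{M\}$ be the cone of $\lambda^*_M:C^*(A)\times C^*_{tri}(M,M)\times C^*(B)\to C^*(A,\mathrm{End}_{B^o}M)\times C^*(B,\mathrm{End}_AM)$ whose only possibly nonzero components are $\alpha^*_M,\beta^*_M,i^{A*}_{M,M},i^{B^o*}_{M,M}$. By a known theorem (Bendiffalah–Guin, 2004), $\mathcal C^*\{M\}$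 is homotopy equivalent to $C^*\begin{pmatrix}A&M\\0&B\end{pmatrix}$, and $HH^*\begin{pmatrix}A&M\\0&B\end{pmatrix}$ is identified with $H^*(\mathcal C^*\{M\})$. Morphisms. $l^*_M:\mathrm{Ext}^{*-1}_{A\otimes B^o}(M,M)\to HH^*\begin{pmatrix}A&M\\0&B\end{pmatrix}$ is induced by the inclusion $\Sigma^*_{M,M}\subset\mathcal C^*\{M\}$. For $A\otimes B^o$-modules $M,N$: $r^*_{N,M}:HH^*\begin{pmatrix}A&M\oplus N\\0&B\end{pmatrix}\to HH^*\begin{pmatrix}A&N\\0&B\end{pmatrix}$ is induced by the projection $\mathcal C^*\{M\oplus N\}\to\mathcal C^*\{N\}$ which is the identity on $C^*(A),C^*(B)$ and projects each of $C^*_{tri}(M\oplus N,M\oplus N)$, $C^*(A,\mathrm{End}_{B^o}(M\oplus N))$, $C^*(B,\mathrm{End}_A(M\oplus N))$ onto its component attached to $(N,N)$; and $l^*_{N,M}:\mathrm{Ext}^{*-1}(N,M)\times\mathrm{Ext}^{*-1}(M,M)\times\mathrm{Ext}^{*-1}(M,N)\to HH^*\begin{pmatrix}A&M\oplus N\\0&B\end{pmatrix}$ is the restriction of $l^*_{M\oplus N}$ to this submodule of $\mathrm{Ext}^{*-1}_{A\otimes B^o}(M\oplus N,M\oplus N)$. *)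

theory Defs
  imports "HOL-Algebra.Module" "HOL-Algebra.AbelCoset" "HOL-Library.FuncSet"
begin

section \<open>Modules, algebras and bimodules over a commutative ring\<close>

text \<open>
  \<^const>\<open>module\<close> is the library's notion of a module over a commutative ring; its record type
  carries unused ring fields \<^const>\<open>mult\<close> and \<^const>\<open>one\<close>, left undefined below except for
  algebras. The library's \<^const>\<open>algebra\<close> is commutative, hence the next definition.
\<close>

definition assoc_algebra :: "'k ring \<Rightarrow> ('k, 'a) module \<Rightarrow> bool" where
  "assoc_algebra K A \<longleftrightarrow> module K A \<and> ring A \<and>
     (\<forall>k\<in>carrier K. \<forall>x\<in>carrier A. \<forall>y\<in>carrier A.
        (k \<odot>\<^bsub>A\<^esub> x) \<otimes>\<^bsub>A\<^esub> y = k \<odot>\<^bsub>A\<^esub> (x \<otimes>\<^bsub>A\<^esub> y) \<and>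
        x \<otimes>\<^bsub>A\<^esub> (k \<odot>\<^bsub>A\<^esub> y) = k \<odot>\<^bsub>A\<^esub> (x \<otimes>\<^bsub>A\<^esub> y))"

definition opp :: "('k, 'a) module \<Rightarrow> ('k, 'a) module" where
  "opp A = A\<lparr>mult := (\<lambda>x y. y \<otimes>\<^bsub>A\<^esub> x)\<rparr>"

text \<open>
  A (unital left) module over \<open>A \<otimes>\<^sub>K B\<^sup>o\<close> is a \<open>K\<close>-module with commuting unital actions
  of \<open>A\<close> on the left and of \<open>B\<close> on the right, both \<open>K\<close>-bilinear:
  \<open>(a \<otimes> b) m = a m b\<close>.
\<close>

record ('k, 'm, 'a, 'b) bimod = "('k, 'm) module" +
  lact :: "'a \<Rightarrow> 'm \<Rightarrow> 'm"
  ract :: "'m \<Rightarrow> 'b \<Rightarrow> 'm"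

definition as_module :: "('k, 'm, 'a, 'b) bimod \<Rightarrow> ('k, 'm) module" where
  "as_module M = module.truncate M"

definition bimodule ::
  "'k ring \<Rightarrow> ('k, 'a) module \<Rightarrow> ('k, 'b) module \<Rightarrow> ('k, 'm, 'a, 'b) bimod \<Rightarrow> bool" where
  "bimodule K A B M \<longleftrightarrow> module K M \<and>
     (\<forall>a\<in>carrier A. \<forall>x\<in>carrier M. lact M a x \<in> carrier M) \<and>
     (\<forall>x\<in>carrier M. \<forall>b\<in>carrier B. ract M x b \<in> carrier M) \<and>
     (\<forall>a\<in>carrier A. \<forall>x\<in>carrier M. \<forall>y\<in>carrier M.
        lact M a (x \<oplus>\<^bsub>M\<^esub> y) = lact M a x \<oplus>\<^bsub>M\<^esub> lact M a y) \<and>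
     (\<forall>a\<in>carrier A. \<forall>a'\<in>carrier A. \<forall>x\<in>carrier M.
        lact M (a \<oplus>\<^bsub>A\<^esub> a') x = lact M a x \<oplus>\<^bsub>M\<^esub> lact M a' x \<and>
        lact M (a \<otimes>\<^bsub>A\<^esub> a') x = lact M a (lact M a' x)) \<and>
     (\<forall>x\<in>carrier M. lact M \<one>\<^bsub>A\<^esub> x = x) \<and>
     (\<forall>b\<in>carrier B. \<forall>x\<in>carrier M. \<forall>y\<in>carrier M.
        ract M (x \<oplus>\<^bsub>M\<^esub> y) b = ract M x b \<oplus>\<^bsub>M\<^esub> ract M y b) \<and>
     (\<forall>b\<in>carrier B. \<forall>b'\<in>carrier B. \<forall>x\<in>carrier M.
        ract M x (b \<oplus>\<^bsub>B\<^esub> b') = ract M x b \<oplus>\<^bsub>M\<^esub> ract M x b' \<and>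
        ract M x (b \<otimes>\<^bsub>B\<^esub> b') = ract M (ract M x b) b') \<and>
     (\<forall>x\<in>carrier M. ract M x \<one>\<^bsub>B\<^esub> = x) \<and>
     (\<forall>a\<in>carrier A. \<forall>b\<in>carrier B. \<forall>x\<in>carrier M.
        ract M (lact M a x) b = lact M a (ract M x b)) \<and>
     (\<forall>k\<in>carrier K. \<forall>a\<in>carrier A. \<forall>x\<in>carrier M.
        lact M (k \<odot>\<^bsub>A\<^esub> a) x = k \<odot>\<^bsub>M\<^esub> lact M a x \<and>
        lact M a (k \<odot>\<^bsub>M\<^esub> x) = k \<odot>\<^bsub>M\<^esub> lact M a x) \<and>
     (\<forall>k\<in>carrier K. \<forall>b\<in>carrier B. \<forall>x\<in>carrier M.
        ract M x (k \<odot>\<^bsub>B\<^esub> b) = k \<odot>\<^bsub>M\<^esub> ract M x b \<and>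
        ract M (k \<odot>\<^bsub>M\<^esub> x) b = k \<odot>\<^bsub>M\<^esub> ract M x b)"

definition linmap ::
  "'k ring \<Rightarrow> ('k, 'm, 'x) module_scheme \<Rightarrow> ('k, 'n, 'y) module_scheme \<Rightarrow> ('m \<Rightarrow> 'n) \<Rightarrow> bool" where
  "linmap K M N f \<longleftrightarrow> f \<in> carrier M \<rightarrow> carrier N \<and>
     (\<forall>x\<in>carrier M. \<forall>y\<in>carrier M. f (x \<oplus>\<^bsub>M\<^esub> y) = f x \<oplus>\<^bsub>N\<^esub> f y) \<and>
     (\<forall>k\<in>carrier K. \<forall>x\<in>carrier M. f (k \<odot>\<^bsub>M\<^esub> x) = k \<odot>\<^bsub>N\<^esub> f x)"

definition left_linear ::
  "('k, 'a) module \<Rightarrow> ('k, 'm, 'a, 'b) bimod \<Rightarrow> ('k, 'n, 'a, 'c) bimod \<Rightarrow> ('m \<Rightarrow> 'n) \<Rightarrow> bool" where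
  "left_linear A M N f \<longleftrightarrow>
     (\<forall>a\<in>carrier A. \<forall>x\<in>carrier M. f (lact M a x) = lact N a (f x))"

definition right_linear ::
  "('k, 'b) module \<Rightarrow> ('k, 'm, 'a, 'b) bimod \<Rightarrow> ('k, 'n, 'c, 'b) bimod \<Rightarrow> ('m \<Rightarrow> 'n) \<Rightarrow> bool" where
  "right_linear B M N f \<longleftrightarrow>
     (\<forall>b\<in>carrier B. \<forall>x\<in>carrier M. f (ract M x b) = ract N (f x) b)"

definition bimod_hom ::
  "'k ring \<Rightarrow> ('k, 'a) module \<Rightarrow> ('k, 'b) module \<Rightarrow> ('k, 'm, 'a, 'b) bimod \<Rightarrow>
   ('k, 'n, 'a, 'b) bimod \<Rightarrow> ('m \<Rightarrow> 'n) \<Rightarrow> bool" where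
  "bimod_hom K A B M N f \<longleftrightarrow> linmap K M N f \<and> left_linear A M N f \<and> right_linear B M N f"

definition lin_iso ::
  "'k ring \<Rightarrow> ('k, 'm, 'x) module_scheme \<Rightarrow> ('k, 'n, 'y) module_scheme \<Rightarrow> ('m \<Rightarrow> 'n) \<Rightarrow> bool" where
  "lin_iso K M N f \<longleftrightarrow> linmap K M N f \<and> bij_betw f (carrier M) (carrier N)"

text \<open>
  Projectivity is the lifting property. HOL cannot quantify over types inside a formula, so the
  test epimorphisms \<open>X \<rightarrow> Y\<close> have carriers in fixed types. Nothing is lost: \<open>Y\<close> may be \<open>P\<close> itself
  and the type chosen for \<open>X\<close> contains a free module on the set \<open>carrier P\<close> (finitely supported
  functions \<open>'p \<Rightarrow> 'k\<close>, respectively cosets of finitely supported integer combinations of formal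
  symbols \<open>a \<otimes> p \<otimes> b\<close>). So the property below makes \<open>P\<close> a direct summand of a free module,
  which gives the lifting property for all modules whatsoever.
\<close>

definition projective_module :: "'k ring \<Rightarrow> ('k, 'p) module \<Rightarrow> bool" where
  "projective_module K P \<longleftrightarrow> module K P \<and>
     (\<forall>(X :: ('k, 'p \<Rightarrow> 'k) module) (Y :: ('k, 'p) module) g f.
        module K X \<longrightarrow> module K Y \<longrightarrow> linmap K X Y g \<longrightarrow> g ` carrier X = carrier Y \<longrightarrow>
        linmap K P Y f \<longrightarrow>
        (\<exists>h. linmap K P X h \<and> (\<forall>p\<in>carrier P. g (h p) = f p)))"

definition projective_bimodule ::
  "'k ring \<Rightarrow> ('k, 'a) module \<Rightarrow> ('k, 'b) module \<Rightarrow> ('k, 'p, 'a, 'b) bimod \<Rightarrow> bool" where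
  "projective_bimodule K A B P \<longleftrightarrow> bimodule K A B P \<and>
     (\<forall>(X :: ('k, ('a \<times> 'p \<times> 'b \<Rightarrow> int) set, 'a, 'b) bimod) (Y :: ('k, 'p, 'a, 'b) bimod) g f.
        bimodule K A B X \<longrightarrow> bimodule K A B Y \<longrightarrow> bimod_hom K A B X Y g \<longrightarrow>
        g ` carrier X = carrier Y \<longrightarrow> bimod_hom K A B P Y f \<longrightarrow>
        (\<exists>h. bimod_hom K A B P X h \<and> (\<forall>p\<in>carrier P. g (h p) = f p)))"

text \<open>An algebra as bimodule over itself.\<close>

definition regular :: "('k, 'a) module \<Rightarrow> ('k, 'a, 'a, 'a) bimod" where
  "regular A = \<lparr>carrier = carrier A, mult = undefined, one = undefined,
     zero = \<zero>\<^bsub>A\<^esub>, add = add A, smult = smult A, lact = mult A, ract = mult A\<rparr>"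

definition tri_algebra ::
  "('k, 'a) module \<Rightarrow> ('k, 'm, 'a, 'b) bimod \<Rightarrow> ('k, 'b) module \<Rightarrow> ('k, 'a \<times> 'm \<times> 'b) module" where
  "tri_algebra A M B =
     \<lparr>carrier = carrier A \<times> carrier M \<times> carrier B,
      mult = (\<lambda>(a, m, b) (a', m', b'). (a \<otimes>\<^bsub>A\<^esub> a', lact M a m' \<oplus>\<^bsub>M\<^esub> ract M m b', b \<otimes>\<^bsub>B\<^esub> b')),
      one = (\<one>\<^bsub>A\<^esub>, \<zero>\<^bsub>M\<^esub>, \<one>\<^bsub>B\<^esub>),
      zero = (\<zero>\<^bsub>A\<^esub>, \<zero>\<^bsub>M\<^esub>, \<zero>\<^bsub>B\<^esub>),
      add = (\<lambda>(a, m, b) (a', m', b'). (a \<oplus>\<^bsub>A\<^esub> a', m \<oplus>\<^bsub>M\<^esub> m', b \<oplus>\<^bsub>B\<^esub> b')),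
      smult = (\<lambda>k (a, m, b). (k \<odot>\<^bsub>A\<^esub> a, k \<odot>\<^bsub>M\<^esub> m, k \<odot>\<^bsub>B\<^esub> b))\<rparr>"


section \<open>Constructions with modules\<close>

text \<open>
  The module of functions in \<open>C\<close>, all with domain \<open>S\<close> and values in \<open>N\<close>, under pointwise operations.
\<close>

definition fun_module :: "'s set \<Rightarrow> ('k, 'n, 'x) module_scheme \<Rightarrow> ('s \<Rightarrow> 'n) set \<Rightarrow> ('k, 's \<Rightarrow> 'n) module" where
  "fun_module S N C = \<lparr>carrier = C, mult = undefined, one = undefined,
     zero = (\<lambda>x\<in>S. \<zero>\<^bsub>N\<^esub>), add = (\<lambda>f g. \<lambda>x\<in>S. f x \<oplus>\<^bsub>N\<^esub> g x), smult = (\<lambda>k f. \<lambda>x\<in>S. k \<odot>\<^bsub>N\<^esub> f x)\<rparr>"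

definition prod_module :: "('k, 'x) module \<Rightarrow> ('k, 'y) module \<Rightarrow> ('k, 'x \<times> 'y) module" where
  "prod_module X Y = \<lparr>carrier = carrier X \<times> carrier Y, mult = undefined, one = undefined,
     zero = (\<zero>\<^bsub>X\<^esub>, \<zero>\<^bsub>Y\<^esub>), add = (\<lambda>(x, y) (x', y'). (x \<oplus>\<^bsub>X\<^esub> x', y \<oplus>\<^bsub>Y\<^esub> y')),
     smult = (\<lambda>k (x, y). (k \<odot>\<^bsub>X\<^esub> x, k \<odot>\<^bsub>Y\<^esub> y))\<rparr>"

definition family_product :: "'i set \<Rightarrow> ('i \<Rightarrow> ('k, 'x) module) \<Rightarrow> ('k, 'i \<Rightarrow> 'x) module" where
  "family_product I F = \<lparr>carrier = (\<Pi>\<^sub>E i\<in>I. carrier (F i)), mult = undefined, one = undefined,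
     zero = (\<lambda>i\<in>I. \<zero>\<^bsub>F i\<^esub>), add = (\<lambda>x y. \<lambda>i\<in>I. x i \<oplus>\<^bsub>F i\<^esub> y i),
     smult = (\<lambda>k x. \<lambda>i\<in>I. k \<odot>\<^bsub>F i\<^esub> x i)\<rparr>"

definition zero_submodule :: "('k, 'x) module \<Rightarrow> ('k, 'x) module" where
  "zero_submodule X = X\<lparr>carrier := {\<zero>\<^bsub>X\<^esub>}\<rparr>"

definition quotient_module :: "('k, 'x) module \<Rightarrow> 'x set \<Rightarrow> ('k, 'x set) module" where
  "quotient_module X H = \<lparr>carrier = a_rcosets\<^bsub>X\<^esub> H, mult = undefined, one = undefined,
     zero = H, add = (<+>\<^bsub>X\<^esub>), smult = (\<lambda>k c. \<Union>x\<in>c. H +>\<^bsub>X\<^esub> (k \<odot>\<^bsub>X\<^esub> x))\<rparr>"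

definition split_exact ::
  "'k ring \<Rightarrow> ('k, 'x) module \<Rightarrow> ('k, 'y) module \<Rightarrow> ('k, 'z) module \<Rightarrow> ('x \<Rightarrow> 'y) \<Rightarrow> ('y \<Rightarrow> 'z) \<Rightarrow> bool" where
  "split_exact K X Y Z l r \<longleftrightarrow>
     module K X \<and> module K Y \<and> module K Z \<and> linmap K X Y l \<and> linmap K Y Z r \<and>
     inj_on l (carrier X) \<and> l ` carrier X = {y \<in> carrier Y. r y = \<zero>\<^bsub>Z\<^esub>} \<and>
     r ` carrier Y = carrier Z \<and>
     (\<exists>s. linmap K Z Y s \<and> (\<forall>z\<in>carrier Z. r (s z) = z))"


section \<open>Cochain complexes\<close>

text \<open>Cochain complexes in degrees \<open>n \<ge> 0\<close>; the module in degree \<open>-1\<close> is zero.\<close>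

record ('k, 'x) cochains =
  deg :: "nat \<Rightarrow> ('k, 'x) module"
  diff :: "nat \<Rightarrow> 'x \<Rightarrow> 'x"

definition cocycles :: "('k, 'x) cochains \<Rightarrow> nat \<Rightarrow> ('k, 'x) module" where
  "cocycles X n = (deg X n)\<lparr>carrier := {x \<in> carrier (deg X n). diff X n x = \<zero>\<^bsub>deg X (Suc n)\<^esub>}\<rparr>"

definition coboundaries :: "('k, 'x) cochains \<Rightarrow> nat \<Rightarrow> 'x set" where
  "coboundaries X n =
     (case n of 0 \<Rightarrow> {\<zero>\<^bsub>deg X 0\<^esub>} | Suc m \<Rightarrow> diff X m ` carrier (deg X m))"

definition cohomology :: "('k, 'x) cochains \<Rightarrow> nat \<Rightarrow> ('k, 'x set) module" where
  "cohomology X n = quotient_module (cocycles X n) (coboundaries X n)"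

text \<open>The map \<open>[x] \<mapsto> [f x]\<close> induced in degree \<open>n\<close> by a cochain map with target \<open>Y\<close>.\<close>

definition coh_map :: "('k, 'y) cochains \<Rightarrow> nat \<Rightarrow> ('x \<Rightarrow> 'y) \<Rightarrow> 'x set \<Rightarrow> 'y set" where
  "coh_map Y n f c = (\<Union>x\<in>c. coboundaries Y n +>\<^bsub>deg Y n\<^esub> f x)"

definition previous :: "(nat \<Rightarrow> ('k, 'x) module) \<Rightarrow> nat \<Rightarrow> ('k, 'x) module" where
  "previous F n = (case n of 0 \<Rightarrow> zero_submodule (F 0) | Suc m \<Rightarrow> F m)"

definition prod_cochains :: "('k, 'x) cochains \<Rightarrow> ('k, 'y) cochains \<Rightarrow> ('k, 'x \<times> 'y) cochains" where
  "prod_cochains X Y = \<lparr>deg = (\<lambda>n. prod_module (deg X n) (deg Y n)),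
     diff = (\<lambda>n (x, y). (diff X n x, diff Y n y))\<rparr>"

text \<open>In degree \<open>0\<close> the second component is \<open>0\<close>, so only \<open>f x\<close> remains of \<open>f x - d y\<close>.\<close>

definition cone ::
  "('k, 'x) cochains \<Rightarrow> ('k, 'y) cochains \<Rightarrow> (nat \<Rightarrow> 'x \<Rightarrow> 'y) \<Rightarrow> ('k, 'x \<times> 'y) cochains" where
  "cone X Y f = \<lparr>deg = (\<lambda>n. prod_module (deg X n) (previous (deg Y) n)),
     diff = (\<lambda>n (x, y). (diff X n x,
       (case n of 0 \<Rightarrow> f 0 x | Suc m \<Rightarrow> f n x \<ominus>\<^bsub>deg Y n\<^esub> diff Y m y)))\<rparr>"


section \<open>The Hochschild complex\<close>

text \<open>
  Homomorphisms out of a tensor product over \<open>K\<close> are encoded by its universal property: the tensor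
  \<open>a\<^sub>0 \<otimes> \<dots> \<otimes> a\<^sub>r\<close> is represented by the list \<open>[a\<^sub>0, \<dots>, a\<^sub>r]\<close>, a homomorphism by a
  \<open>K\<close>-multilinear function of such lists. Thus \<open>Hom\<^bsub>T\<otimes>T\<^sup>o\<^esub>(T\<^bsup>\<otimes>(n+2)\<^esup>, \<Lambda>)\<close> consists of the multilinear
  functions of lists of length \<open>n+2\<close> that commute with the outer actions of \<open>T\<close>.
\<close>

definition tensor_words :: "('k, 't) module \<Rightarrow> nat \<Rightarrow> 't list set" where
  "tensor_words T r = {w. length w = r \<and> set w \<subseteq> carrier T}"

definition multilinear ::
  "'k ring \<Rightarrow> ('k, 't) module \<Rightarrow> nat \<Rightarrow> ('k, 'n, 'x) module_scheme \<Rightarrow> ('t list \<Rightarrow> 'n) \<Rightarrow> bool" where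
  "multilinear K T r N f \<longleftrightarrow>
     (\<forall>w\<in>tensor_words T r. \<forall>i<r. linmap K T N (\<lambda>x. f (w[i := x])))"

text \<open>\<open>face T i\<close> sends \<open>a\<^sub>0 \<otimes> \<dots> \<otimes> a\<^sub>r\<close> to \<open>a\<^sub>0 \<otimes> \<dots> \<otimes> a\<^sub>ia\<^sub>i\<^sub>+\<^sub>1 \<otimes> \<dots> \<otimes> a\<^sub>r\<close>.\<close>

definition face :: "('k, 't) module \<Rightarrow> nat \<Rightarrow> 't list \<Rightarrow> 't list" where
  "face T i w = take i w @ (w ! i \<otimes>\<^bsub>T\<^esub> w ! Suc i) # drop (i + 2) w"

definition signed :: "('k, 'n, 'x) module_scheme \<Rightarrow> nat \<Rightarrow> 'n \<Rightarrow> 'n" where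
  "signed N i x = (if even i then x else \<ominus>\<^bsub>N\<^esub> x)"

definition hochschild :: "'k ring \<Rightarrow> ('k, 't) module \<Rightarrow> ('k, 'l, 't, 't) bimod \<Rightarrow> ('k, 't list \<Rightarrow> 'l) cochains" where
  "hochschild K T \<Lambda> =
     \<lparr>deg = (\<lambda>n. fun_module (tensor_words T (n + 2)) \<Lambda>
        {f \<in> tensor_words T (n + 2) \<rightarrow>\<^sub>E carrier \<Lambda>. multilinear K T (n + 2) \<Lambda> f \<and>
           (\<forall>w\<in>tensor_words T (n + 2). \<forall>t\<in>carrier T.
              f (w[0 := t \<otimes>\<^bsub>T\<^esub> w ! 0]) = lact \<Lambda> t (f w) \<and>
              f (w[n + 1 := w ! (n + 1) \<otimes>\<^bsub>T\<^esub> t]) = ract \<Lambda> (f w) t)}),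
      diff = (\<lambda>n f. \<lambda>w\<in>tensor_words T (n + 3).
        \<Oplus>\<^bsub>\<Lambda>\<^esub>i\<in>{..n + 1}. signed \<Lambda> i (f (face T i w)))\<rparr>"

definition HH :: "'k ring \<Rightarrow> ('k, 't) module \<Rightarrow> nat \<Rightarrow> ('k, ('t list \<Rightarrow> 't) set) module" where
  "HH K T = cohomology (hochschild K T (regular T))"


section \<open>The triangular complex\<close>

text \<open>
  \<open>Hom\<^bsub>B\<^sup>o\<^esub>(M, N)\<close> as a bimodule over \<open>A\<close> and \<open>Hom\<^bsub>A\<^esub>(M, N)\<close> as a bimodule over \<open>B\<close>; in the latter
  \<open>(b h)(m) = h (m b)\<close> and \<open>(h b)(m) = h m b\<close>.
\<close>

definition hom_right ::
  "'k ring \<Rightarrow> ('k, 'b) module \<Rightarrow> ('k, 'm, 'a, 'b) bimod \<Rightarrow> ('k, 'n, 'a, 'b) bimod \<Rightarrow>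
   ('k, 'm \<Rightarrow> 'n, 'a, 'a) bimod" where
  "hom_right K B M N = module.extend
     (fun_module (carrier M) N
        {h \<in> carrier M \<rightarrow>\<^sub>E carrier N. linmap K M N h \<and> right_linear B M N h})
     \<lparr>lact = (\<lambda>a h. \<lambda>x\<in>carrier M. lact N a (h x)), ract = (\<lambda>h a. \<lambda>x\<in>carrier M. h (lact M a x))\<rparr>"

definition hom_left ::
  "'k ring \<Rightarrow> ('k, 'a) module \<Rightarrow> ('k, 'm, 'a, 'b) bimod \<Rightarrow> ('k, 'n, 'a, 'b) bimod \<Rightarrow>
   ('k, 'm \<Rightarrow> 'n, 'b, 'b) bimod" where
  "hom_left K A M N = module.extend
     (fun_module (carrier M) N
        {h \<in> carrier M \<rightarrow>\<^sub>E carrier N. linmap K M N h \<and> left_linear A M N h})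
     \<lparr>lact = (\<lambda>b h. \<lambda>x\<in>carrier M. h (ract M x b)), ract = (\<lambda>h b. \<lambda>x\<in>carrier M. ract N (h x) b)\<rparr>"

text \<open>
  Generators of \<open>C\<^bsup>A,B\<^sup>o\<^esup>\<^sub>n \<otimes>\<^bsub>A\<otimes>B\<^sup>o\<^esub> M\<close>: triples \<open>(as, bs, m)\<close> standing for \<open>as \<otimes> bs \<otimes> m\<close> with
  \<open>as \<in> A\<^bsup>\<otimes>(p+2)\<^esup>\<close>, \<open>bs \<in> (B\<^sup>o)\<^bsup>\<otimes>(q+2)\<^esup>\<close>, \<open>p + q = n - 1\<close> and \<open>p, q \<ge> -1\<close>. The direct sum over
  \<open>(p, q)\<close> is the disjoint union over the possible lengths \<open>p + 2\<close>, \<open>q + 2\<close>. Since \<open>n \<ge> 0\<close> the pair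
  \<open>p = q = -1\<close> does not occur. Products of entries of \<open>bs\<close> are products in \<open>B\<^sup>o\<close>, and the action of
  \<open>B\<^sup>o\<close> on modules is \<^const>\<open>ract\<close>.
\<close>

definition tri_words ::
  "('k, 'a) module \<Rightarrow> ('k, 'b) module \<Rightarrow> ('k, 'm, 'a, 'b) bimod \<Rightarrow> nat \<Rightarrow> ('a list \<times> 'b list \<times> 'm) set" where
  "tri_words A B M n = {(as, bs, m). as \<noteq> [] \<and> bs \<noteq> [] \<and> length as + length bs = n + 3 \<and>
     set as \<subseteq> carrier A \<and> set bs \<subseteq> carrier (opp B) \<and> m \<in> carrier M}"

text \<open>
  The conditions in \<open>tri_hom\<close>: multilinearity; \<open>A \<otimes> B\<^sup>o\<close>-linearity for the action on the first
  entries; and compatibility with \<open>\<otimes>\<^bsub>A\<otimes>B\<^sup>o\<^esub> M\<close>, where \<open>A \<otimes> B\<^sup>o\<close> acts from the right on the last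
  entries.
\<close>

definition tri_hom ::
  "'k ring \<Rightarrow> ('k, 'a) module \<Rightarrow> ('k, 'b) module \<Rightarrow> ('k, 'm, 'a, 'b) bimod \<Rightarrow>
   ('k, 'n, 'a, 'b) bimod \<Rightarrow> nat \<Rightarrow> ('a list \<times> 'b list \<times> 'm \<Rightarrow> 'n) set" where
  "tri_hom K A B M N n = {f \<in> tri_words A B M n \<rightarrow>\<^sub>E carrier N. \<forall>(as, bs, m)\<in>tri_words A B M n.
     (\<forall>i<length as. linmap K A N (\<lambda>x. f (as[i := x], bs, m))) \<and>
     (\<forall>j<length bs. linmap K B N (\<lambda>y. f (as, bs[j := y], m))) \<and>
     linmap K M N (\<lambda>z. f (as, bs, z)) \<and>
     (\<forall>a\<in>carrier A. f (as[0 := a \<otimes>\<^bsub>A\<^esub> as ! 0], bs, m) = lact N a (f (as, bs, m))) \<and>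
     (\<forall>b\<in>carrier B. f (as, bs[0 := b \<otimes>\<^bsub>opp B\<^esub> bs ! 0], m) = ract N (f (as, bs, m)) b) \<and>
     (\<forall>a\<in>carrier A. f (as[length as - 1 := last as \<otimes>\<^bsub>A\<^esub> a], bs, m) = f (as, bs, lact M a m)) \<and>
     (\<forall>b\<in>carrier B. f (as, bs[length bs - 1 := last bs \<otimes>\<^bsub>opp B\<^esub> b], m) = f (as, bs, ract M m b))}"

text \<open>The sign \<open>(-1)\<^bsup>p+1\<^esup>\<close> is \<open>(-1)\<^bsup>length as - 1\<^esup>\<close>; the augmented bar differential on \<open>as\<close> has
  the faces \<open>i = 0, \<dots>, p\<close>, that is \<open>i < length as - 1\<close> (none if \<open>p = -1\<close>).\<close>

definition tri_complex ::
  "'k ring \<Rightarrow> ('k, 'a) module \<Rightarrow> ('k, 'b) module \<Rightarrow> ('k, 'm, 'a, 'b) bimod \<Rightarrow>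
   ('k, 'n, 'a, 'b) bimod \<Rightarrow> ('k, 'a list \<times> 'b list \<times> 'm \<Rightarrow> 'n) cochains" where
  "tri_complex K A B M N =
     \<lparr>deg = (\<lambda>n. fun_module (tri_words A B M n) N (tri_hom K A B M N n)),
      diff = (\<lambda>n f. \<lambda>(as, bs, m)\<in>tri_words A B M (n + 1).
        (\<Oplus>\<^bsub>N\<^esub>i\<in>{..<length as - 1}. signed N i (f (face A i as, bs, m))) \<oplus>\<^bsub>N\<^esub>
        signed N (length as - 1)
          (\<Oplus>\<^bsub>N\<^esub>j\<in>{..<length bs - 1}. signed N j (f (as, face (opp B) j bs, m))))\<rparr>"

definition iA ::
  "('k, 'a) module \<Rightarrow> ('k, 'b) module \<Rightarrow> ('k, 'm, 'a, 'b) bimod \<Rightarrow> nat \<Rightarrow>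
   ('a list \<times> 'b list \<times> 'm \<Rightarrow> 'n) \<Rightarrow> ('a list \<Rightarrow> 'm \<Rightarrow> 'n)" where
  "iA A B M n f = (\<lambda>w\<in>tensor_words A (n + 2). \<lambda>m\<in>carrier M. f (w, [\<one>\<^bsub>B\<^esub>], m))"

text \<open>
  The identification of the summand \<open>p = -1\<close> with \<open>M \<otimes>\<^sub>B C\<^bsup>B\<^esup>\<^sub>*\<close> reverses words in \<open>B\<^sup>o\<close>. Reversal
  multiplies the bar differential \<open>C\<^sub>n \<rightarrow> C\<^bsub>n-1\<^esub>\<close> by \<open>(-1)\<^bsup>n\<^esup>\<close>, so an isomorphism of complexes needs the
  usual sign \<open>(-1)\<^bsup>n(n+1)/2\<^esup>\<close> in degree \<open>n\<close>.
\<close>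

definition iB ::
  "('k, 'a) module \<Rightarrow> ('k, 'b) module \<Rightarrow> ('k, 'm, 'a, 'b) bimod \<Rightarrow> ('k, 'n, 'a, 'b) bimod \<Rightarrow> nat \<Rightarrow>
   ('a list \<times> 'b list \<times> 'm \<Rightarrow> 'n) \<Rightarrow> ('b list \<Rightarrow> 'm \<Rightarrow> 'n)" where
  "iB A B M N n f =
     (\<lambda>w\<in>tensor_words B (n + 2). \<lambda>m\<in>carrier M. signed N (n * (n + 1) div 2) (f ([\<one>\<^bsub>A\<^esub>], rev w, m)))"

definition alphaM ::
  "('k, 'a) module \<Rightarrow> ('k, 'm, 'a, 'b) bimod \<Rightarrow> nat \<Rightarrow> ('a list \<Rightarrow> 'a) \<Rightarrow> ('a list \<Rightarrow> 'm \<Rightarrow> 'm)" where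
  "alphaM A M n f = (\<lambda>w\<in>tensor_words A (n + 2). \<lambda>m\<in>carrier M. lact M (f w) m)"

definition betaM ::
  "('k, 'b) module \<Rightarrow> ('k, 'm, 'a, 'b) bimod \<Rightarrow> nat \<Rightarrow> ('b list \<Rightarrow> 'b) \<Rightarrow> ('b list \<Rightarrow> 'm \<Rightarrow> 'm)" where
  "betaM B M n f = (\<lambda>w\<in>tensor_words B (n + 2). \<lambda>m\<in>carrier M. ract M m (f w))"


section \<open>The cones\<close>

definition end_complex ::
  "'k ring \<Rightarrow> ('k, 'a) module \<Rightarrow> ('k, 'b) module \<Rightarrow> ('k, 'm, 'a, 'b) bimod \<Rightarrow>
   ('k, 'n, 'a, 'b) bimod \<Rightarrow> ('k, ('a list \<Rightarrow> 'm \<Rightarrow> 'n) \<times> ('b list \<Rightarrow> 'm \<Rightarrow> 'n)) cochains" where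
  "end_complex K A B M N =
     prod_cochains (hochschild K A (hom_right K B M N)) (hochschild K B (hom_left K A M N))"

definition Sigma_complex ::
  "'k ring \<Rightarrow> ('k, 'a) module \<Rightarrow> ('k, 'b) module \<Rightarrow> ('k, 'm, 'a, 'b) bimod \<Rightarrow> ('k, 'n, 'a, 'b) bimod \<Rightarrow>
   ('k, ('a list \<times> 'b list \<times> 'm \<Rightarrow> 'n) \<times> ('a list \<Rightarrow> 'm \<Rightarrow> 'n) \<times> ('b list \<Rightarrow> 'm \<Rightarrow> 'n)) cochains" where
  "Sigma_complex K A B M N =
     cone (tri_complex K A B M N) (end_complex K A B M N) (\<lambda>n f. (iA A B M n f, iB A B M N n f))"

text \<open>\<open>C_cone K A B M\<close> is the complex written \<open>\<C>\<^sup>*{M}\<close>, the cone of \<open>\<lambda>\<^sub>M\<close>.\<close>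

definition C_cone ::
  "'k ring \<Rightarrow> ('k, 'a) module \<Rightarrow> ('k, 'b) module \<Rightarrow> ('k, 'm, 'a, 'b) bimod \<Rightarrow>
   ('k, (('a list \<Rightarrow> 'a) \<times> ('a list \<times> 'b list \<times> 'm \<Rightarrow> 'm) \<times> ('b list \<Rightarrow> 'b)) \<times>
        ('a list \<Rightarrow> 'm \<Rightarrow> 'm) \<times> ('b list \<Rightarrow> 'm \<Rightarrow> 'm)) cochains" where
  "C_cone K A B M =
     cone
       (prod_cochains (hochschild K A (regular A))
          (prod_cochains (tri_complex K A B M M) (hochschild K B (regular B))))
       (end_complex K A B M M)
       (\<lambda>n (f, g, h).
          (alphaM A M n f \<oplus>\<^bsub>deg (hochschild K A (hom_right K B M M)) n\<^esub> iA A B M n g,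
           betaM B M n h \<oplus>\<^bsub>deg (hochschild K B (hom_left K A M M)) n\<^esub> iB A B M M n g))"

text \<open>
  Functoriality: bimodule homomorphisms \<open>u : X' \<rightarrow> X\<close> and \<open>v : Y \<rightarrow> Y'\<close> induce maps from each of the
  complexes attached to \<open>(X, Y)\<close> to the one attached to \<open>(X', Y')\<close>.
\<close>

definition tri_map ::
  "('k, 'a) module \<Rightarrow> ('k, 'b) module \<Rightarrow> ('k, 'x, 'a, 'b) bimod \<Rightarrow> nat \<Rightarrow> ('x \<Rightarrow> 'm) \<Rightarrow> ('n \<Rightarrow> 'y) \<Rightarrow>
   ('a list \<times> 'b list \<times> 'm \<Rightarrow> 'n) \<Rightarrow> ('a list \<times> 'b list \<times> 'x \<Rightarrow> 'y)" where
  "tri_map A B X' n u v g = (\<lambda>(as, bs, x)\<in>tri_words A B X' n. v (g (as, bs, u x)))"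

definition hom_map ::
  "('k, 't) module \<Rightarrow> ('k, 'x, 'a, 'b) bimod \<Rightarrow> nat \<Rightarrow> ('x \<Rightarrow> 'm) \<Rightarrow> ('n \<Rightarrow> 'y) \<Rightarrow>
   ('t list \<Rightarrow> 'm \<Rightarrow> 'n) \<Rightarrow> ('t list \<Rightarrow> 'x \<Rightarrow> 'y)" where
  "hom_map T X' n u v f = (\<lambda>w\<in>tensor_words T (n + 2). \<lambda>x\<in>carrier X'. v (f w (u x)))"

text \<open>The second component of the cone in degree \<open>n\<close> lives in degree \<open>n - 1\<close>; for \<open>n = 0\<close> it is the
  zero cochain of degree \<open>0\<close> (see \<^const>\<open>previous\<close>), so truncated subtraction is what is wanted.\<close>

definition Sigma_map ::
  "('k, 'a) module \<Rightarrow> ('k, 'b) module \<Rightarrow> ('k, 'x, 'a, 'b) bimod \<Rightarrow> nat \<Rightarrow> ('x \<Rightarrow> 'm) \<Rightarrow> ('n \<Rightarrow> 'y) \<Rightarrow>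
   ('a list \<times> 'b list \<times> 'm \<Rightarrow> 'n) \<times> ('a list \<Rightarrow> 'm \<Rightarrow> 'n) \<times> ('b list \<Rightarrow> 'm \<Rightarrow> 'n) \<Rightarrow>
   ('a list \<times> 'b list \<times> 'x \<Rightarrow> 'y) \<times> ('a list \<Rightarrow> 'x \<Rightarrow> 'y) \<times> ('b list \<Rightarrow> 'x \<Rightarrow> 'y)" where
  "Sigma_map A B X' n u v = (\<lambda>(g, f, h).
     (tri_map A B X' n u v g, hom_map A X' (n - 1) u v f, hom_map B X' (n - 1) u v h))"

definition Sigma_coh_map ::
  "'k ring \<Rightarrow> ('k, 'a) module \<Rightarrow> ('k, 'b) module \<Rightarrow> ('k, 'x, 'a, 'b) bimod \<Rightarrow> ('k, 'y, 'a, 'b) bimod \<Rightarrow>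
   nat \<Rightarrow> ('x \<Rightarrow> 'm) \<Rightarrow> ('n \<Rightarrow> 'y) \<Rightarrow>
   (('a list \<times> 'b list \<times> 'm \<Rightarrow> 'n) \<times> ('a list \<Rightarrow> 'm \<Rightarrow> 'n) \<times> ('b list \<Rightarrow> 'm \<Rightarrow> 'n)) set \<Rightarrow>
   (('a list \<times> 'b list \<times> 'x \<Rightarrow> 'y) \<times> ('a list \<Rightarrow> 'x \<Rightarrow> 'y) \<times> ('b list \<Rightarrow> 'x \<Rightarrow> 'y)) set" where
  "Sigma_coh_map K A B X' Y' n u v = coh_map (Sigma_complex K A B X' Y') n (Sigma_map A B X' n u v)"

text \<open>The map \<open>l\<^sub>M\<close>, with values in the cohomology of \<open>\<C>\<^sup>*{M}\<close>.\<close>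

definition l_cone where
  "l_cone K A B M n =
     coh_map (C_cone K A B M) n
       (\<lambda>(g, y). ((\<zero>\<^bsub>deg (hochschild K A (regular A)) n\<^esub>, g, \<zero>\<^bsub>deg (hochschild K B (regular B)) n\<^esub>), y))"

text \<open>
  The maps \<open>r\<^bsub>N,M\<^esub>\<close> and \<open>l\<^bsub>N,M\<^esub>\<close>, for a module \<open>X = M \<oplus> N\<close> with inclusions \<open>iM, iN\<close> and projections
  \<open>pM, pN\<close>. The component attached to \<open>(N, N)\<close> of an endomorphism-valued cochain is its composite
  with \<open>iN\<close> and \<open>pN\<close>; similarly \<open>Ext(N, M)\<close>, \<open>Ext(M, M)\<close>, \<open>Ext(M, N)\<close> are embedded into \<open>Ext(X, X)\<close>
  by means of the inclusions and projections.
\<close>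

definition r_cone where
  "r_cone K A B N iN pN n =
     coh_map (C_cone K A B N) n
       (\<lambda>((f, g, h), (x, y)). ((f, tri_map A B N n iN pN g, h),
          (hom_map A N (n - 1) iN pN x, hom_map B N (n - 1) iN pN y)))"

definition l_cone_sum where
  "l_cone_sum K A B X iN pN iM pM n = (\<lambda>(eNM, eMM, eMN).
     l_cone K A B X n
       (Sigma_coh_map K A B X X n pN iM eNM \<oplus>\<^bsub>cohomology (Sigma_complex K A B X X) n\<^esub>
        Sigma_coh_map K A B X X n pM iM eMM \<oplus>\<^bsub>cohomology (Sigma_complex K A B X X) n\<^esub>
        Sigma_coh_map K A B X X n pM iN eMN))"


section \<open>Ext\<close>

definition projective_resolution ::
  "'k ring \<Rightarrow> ('k, 'a) module \<Rightarrow> ('k, 'b) module \<Rightarrow> ('k, 'm, 'a, 'b) bimod \<Rightarrow>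
   (nat \<Rightarrow> ('k, 'p, 'a, 'b) bimod) \<Rightarrow> (nat \<Rightarrow> 'p \<Rightarrow> 'p) \<Rightarrow> ('p \<Rightarrow> 'm) \<Rightarrow> bool" where
  "projective_resolution K A B M P d e \<longleftrightarrow>
     (\<forall>n. projective_bimodule K A B (P n)) \<and>
     (\<forall>n. bimod_hom K A B (P (Suc n)) (P n) (d n)) \<and> bimod_hom K A B (P 0) M e \<and>
     e ` carrier (P 0) = carrier M \<and>
     {x \<in> carrier (P 0). e x = \<zero>\<^bsub>M\<^esub>} = d 0 ` carrier (P 1) \<and>
     (\<forall>n. {x \<in> carrier (P (Suc n)). d n x = \<zero>\<^bsub>P n\<^esub>} = d (Suc n) ` carrier (P (Suc (Suc n))))"

definition hom_complex ::
  "'k ring \<Rightarrow> ('k, 'a) module \<Rightarrow> ('k, 'b) module \<Rightarrow> (nat \<Rightarrow> ('k, 'p, 'a, 'b) bimod) \<Rightarrow>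
   (nat \<Rightarrow> 'p \<Rightarrow> 'p) \<Rightarrow> ('k, 'n, 'a, 'b) bimod \<Rightarrow> ('k, 'p \<Rightarrow> 'n) cochains" where
  "hom_complex K A B P d N =
     \<lparr>deg = (\<lambda>n. fun_module (carrier (P n)) N
        {f \<in> carrier (P n) \<rightarrow>\<^sub>E carrier N. bimod_hom K A B (P n) N f}),
      diff = (\<lambda>n f. \<lambda>x\<in>carrier (P (Suc n)). f (d n x))\<rparr>"

text \<open>\<open>Ext\<^bsub>A\<otimes>B\<^sup>o\<^esub>(M, N)\<close> in degree \<open>n\<close>, computed with a projective resolution \<open>(P, d)\<close> of \<open>M\<close>.\<close>

definition Ext ::
  "'k ring \<Rightarrow> ('k, 'a) module \<Rightarrow> ('k, 'b) module \<Rightarrow> (nat \<Rightarrow> ('k, 'p, 'a, 'b) bimod) \<Rightarrow>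
   (nat \<Rightarrow> 'p \<Rightarrow> 'p) \<Rightarrow> ('k, 'n, 'a, 'b) bimod \<Rightarrow> nat \<Rightarrow> ('k, ('p \<Rightarrow> 'n) set) module" where
  "Ext K A B P d N n = cohomology (hom_complex K A B P d N) n"

text \<open>The graded module \<open>Ext\<^bsup>*-1\<^esup>\<close>, with \<open>Ext\<^bsup>-1\<^esup> = 0\<close>.\<close>

definition Ext_shift ::
  "'k ring \<Rightarrow> ('k, 'a) module \<Rightarrow> ('k, 'b) module \<Rightarrow> (nat \<Rightarrow> ('k, 'p, 'a, 'b) bimod) \<Rightarrow>
   (nat \<Rightarrow> 'p \<Rightarrow> 'p) \<Rightarrow> ('k, 'n, 'a, 'b) bimod \<Rightarrow> nat \<Rightarrow> ('k, ('p \<Rightarrow> 'n) set) module" where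
  "Ext_shift K A B P d N = previous (Ext K A B P d N)"


section \<open>Direct sums of copies of modules\<close>

definition bimod_sum :: "'i set \<Rightarrow> ('i \<Rightarrow> ('k, 'm, 'a, 'b) bimod) \<Rightarrow> ('k, 'i \<Rightarrow> 'm, 'a, 'b) bimod" where
  "bimod_sum I F = module.extend (family_product I (\<lambda>i. as_module (F i)))
     \<lparr>lact = (\<lambda>a x. \<lambda>i\<in>I. lact (F i) a (x i)), ract = (\<lambda>x b. \<lambda>i\<in>I. ract (F i) (x i) b)\<rparr>"

text \<open>
  The \<open>s\<close>-th copy of \<open>M\<^sub>i\<close> has index \<open>(i, s)\<close>. The modules \<open>M\<close>, \<open>M'\<close> and \<open>M\<^sub>0\<close> are the sums
  over \<open>1 \<le> s \<le> m\<^sub>i\<close>, over \<open>s = 1\<close>, and over \<open>2 \<le> s \<le> m\<^sub>i\<close>.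
\<close>

definition all_copies :: "nat \<Rightarrow> (nat \<Rightarrow> nat) \<Rightarrow> (nat \<times> nat) set" where
  "all_copies n m = (SIGMA i:{1..n}. {1..m i})"

definition first_copies :: "nat \<Rightarrow> (nat \<times> nat) set" where
  "first_copies n = (SIGMA i:{1..n}. {1})"

definition other_copies :: "nat \<Rightarrow> (nat \<Rightarrow> nat) \<Rightarrow> (nat \<times> nat) set" where
  "other_copies n m = (SIGMA i:{1..n}. {2..m i})"

definition copies_sum :: "(nat \<Rightarrow> ('k, 'm, 'a, 'b) bimod) \<Rightarrow> (nat \<times> nat) set \<Rightarrow> ('k, nat \<times> nat \<Rightarrow> 'm, 'a, 'b) bimod" where
  "copies_sum M I = bimod_sum I (\<lambda>(i, s). M i)"

text \<open>Inclusion of a partial sum (extension by zero) and of a single summand. The corresponding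
  projections are \<open>\<lambda>x. restrict x J\<close> and \<open>\<lambda>x. x p\<close>.\<close>

definition incl_part :: "(nat \<Rightarrow> ('k, 'm, 'a, 'b) bimod) \<Rightarrow> (nat \<times> nat) set \<Rightarrow> (nat \<times> nat) set \<Rightarrow> (nat \<times> nat \<Rightarrow> 'm) \<Rightarrow> (nat \<times> nat \<Rightarrow> 'm)" where
  "incl_part M I J x = (\<lambda>p\<in>I. if p \<in> J then x p else \<zero>\<^bsub>M (fst p)\<^esub>)"

definition incl_one :: "(nat \<Rightarrow> ('k, 'm, 'a, 'b) bimod) \<Rightarrow> (nat \<times> nat) set \<Rightarrow> nat \<times> nat \<Rightarrow> 'm \<Rightarrow> (nat \<times> nat \<Rightarrow> 'm)" where
  "incl_one M I p x = (\<lambda>q\<in>I. if q = p then x else \<zero>\<^bsub>M (fst q)\<^esub>)"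

text \<open>
  Index set of \<open>\<Prod>\<^bsub>i,j\<^esub> E\<^bsub>ij\<^esub>\<^bsup>m\<^sub>im\<^sub>j-1\<^esup>\<close>: for each \<open>(i, j)\<close> the exponent is the number of pairs
  \<open>(s, t)\<close> (from the \<open>s\<close>-th copy of \<open>M\<^sub>i\<close> to the \<open>t\<close>-th copy of \<open>M\<^sub>j\<close>) other than \<open>(1, 1)\<close>.
\<close>

definition power_index :: "nat \<Rightarrow> (nat \<Rightarrow> nat) \<Rightarrow> ((nat \<times> nat) \<times> (nat \<times> nat)) set" where
  "power_index n m = (SIGMA (i, j):{1..n} \<times> {1..n}. {1..m i} \<times> {1..m j} - {(1, 1)})"

lemma card_power_index:
  assumes "1 \<le> m i" "1 \<le> m j"
  shows "card ({1..m i} \<times> {1..m j} - {(1, 1)}) = m i * m j - (1 :: nat)"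
  using assms by (simp add: card_Diff_subset)

definition Ext_power ::
  "nat \<Rightarrow> (nat \<Rightarrow> nat) \<Rightarrow> (nat \<Rightarrow> nat \<Rightarrow> ('k, 'e) module) \<Rightarrow> ('k, (nat \<times> nat) \<times> (nat \<times> nat) \<Rightarrow> 'e) module" where
  "Ext_power n m E = family_product (power_index n m) (\<lambda>((i, j), (s, t)). E i j)"

text \<open>
  Additivity of \<open>Ext\<close>: classes \<open>e ((i, j), (s, t))\<close> attached to \<open>(M\<^sub>i, M\<^sub>j)\<close> for \<open>(i, s) \<in> I\<close>,
  \<open>(j, t) \<in> J\<close> assemble to a class attached to the sums over \<open>I\<close> and over \<open>J\<close>.
\<close>

definition Ext_assemble where
  "Ext_assemble K A B M k I J e =
     (\<Oplus>\<^bsub>cohomology (Sigma_complex K A B (copies_sum M I) (copies_sum M J)) k\<^esub>x\<in>I \<times> J.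
        (case x of ((i, s), (j, t)) \<Rightarrow>
           Sigma_coh_map K A B (copies_sum M I) (copies_sum M J) k
             (\<lambda>y. y (i, s)) (incl_one M J (j, t)) (e ((i, j), (s, t)))))"

text \<open>
  The maps \<open>l\<^bsub>M',M\<^sub>0\<^esub>\<close> and \<open>r\<^bsub>M',M\<^sub>0\<^esub>\<close>, with values in the cohomology of the cones. Here
  \<open>\<Prod>\<^bsub>i,j\<^esub> Ext(M\<^sub>i, M\<^sub>j)\<^bsup>m\<^sub>im\<^sub>j-1\<^esup> = Ext(M', M\<^sub>0) \<times> Ext(M\<^sub>0, M\<^sub>0) \<times> Ext(M\<^sub>0, M')\<close> by additivity.
\<close>

definition l_map where
  "l_map K A B M n m k e =
     (let I = all_copies n m; F = first_copies n; R = other_copies n m in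
      l_cone_sum K A B (copies_sum M I)
        (incl_part M I F) (\<lambda>x. restrict x F) (incl_part M I R) (\<lambda>x. restrict x R) k
        (Ext_assemble K A B M k F R e, Ext_assemble K A B M k R R e, Ext_assemble K A B M k R F e))"

definition r_map where
  "r_map K A B M n m k =
     (let I = all_copies n m; F = first_copies n in
      r_cone K A B (copies_sum M F) (incl_part M I F) (\<lambda>x. restrict x F) k)"

end

theory Submission
  imports Defs
begin

text \<open>
  The complex \<open>\<C>\<^sup>*{M}\<close> consists of \<open>C\<^sup>*(A)\<close>, \<open>C\<^sup>*(B)\<close> and \<open>\<Sigma>\<^bsub>M,M\<^esub>\<close>, and \<open>\<Sigma>\<^bsub>M,M\<^esub>\<close> decomposes into the
  blocks \<open>\<Sigma>\<^bsub>p,q\<^esub>\<close> attached to pairs \<open>(p, q)\<close> of summands of \<open>M\<close>. The restriction map \<open>r\<close> to \<open>\<C>\<^sup>*{M'}\<close> is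
  surjective, and its kernel is the sum of the blocks for which \<open>p\<close> and \<open>q\<close> are not both first copies.
  The cochains of \<open>A\<close> and \<open>B\<close> reach \<open>\<Sigma>\<^bsub>M,M\<^esub>\<close> only through the action on \<open>M\<close>, which is diagonal with equal
  entries for different copies of the same \<open>M\<^sub>i\<close>. Hence the projection of the cone onto an off-diagonal
  block is a cochain map, and so is the projection onto a diagonal block minus the projection onto the
  block of the corresponding first copy. These maps retract the kernel of \<open>r\<close>, so that the short exact
  sequence of complexes splits and stays split exact in cohomology.
\<close>

section \<open>Linear maps\<close>

text \<open>Two obstacles shape the argument. Subtracting the first-copy block from a diagonal block
  must not spoil the retraction. It does not, because a pair of first copies is never a block of the
  kernel of \<open>r\<close>: the subtracted term is zero on that kernel, while on the twisting term
  it removes exactly what has to be removed. The hypothesis \<open>1 <= m i\<close> guarantees that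
  such a reference block exists. Secondly, extension by zero is a linear section of \<open>r\<close>
  that in general does not commute with the differentials, since the twisting term of M also has
  entries on diagonal blocks outside M'. It becomes a cochain map after composition with the
  projection along the kernel of \<open>r\<close>. Cochains are multilinear functions of several
  shapes. Fixing all arguments except the module element turns each of them into a linear map
  between bimodules, and identities between block projections and inclusions into identities between
  the bimodule maps that define them. The identifications of Ext and HH with cohomology of cones
  enter through a final transport along the given isomorphisms.\<close>

lemma linmapI:
  assumes "\<And>x. x \<in> carrier M \<Longrightarrow> f x \<in> carrier N"
    and "\<And>x y. x \<in> carrier M \<Longrightarrow> y \<in> carrier M \<Longrightarrow> f (x \<oplus>\<^bsub>M\<^esub> y) = f x \<oplus>\<^bsub>N\<^esub> f y"
    and "\<And>k x. k \<in> carrier K \<Longrightarrow> x \<in> carrier M \<Longrightarrow> f (k \<odot>\<^bsub>M\<^esub> x) = k \<odot>\<^bsub>N\<^esub> f x"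
  shows "linmap K M N f"
  using assms by (auto simp: linmap_def)

lemma linmap_closed: "linmap K M N f \<Longrightarrow> x \<in> carrier M \<Longrightarrow> f x \<in> carrier N"
  and linmap_add: "linmap K M N f \<Longrightarrow> x \<in> carrier M \<Longrightarrow> y \<in> carrier M \<Longrightarrow> f (x \<oplus>\<^bsub>M\<^esub> y) = f x \<oplus>\<^bsub>N\<^esub> f y"
  and linmap_smult: "linmap K M N f \<Longrightarrow> k \<in> carrier K \<Longrightarrow> x \<in> carrier M \<Longrightarrow> f (k \<odot>\<^bsub>M\<^esub> x) = k \<odot>\<^bsub>N\<^esub> f x"
  by (auto simp: linmap_def)

text \<open>The carrier of \<open>M\<close> is closed under both operations, so agreement there is
  all that linearity sees. This allows a function to be replaced by its \<open>restrict\<close> and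
  back.\<close>

lemma linmap_cong:
  assumes "linmap K M N f" "module K M" "\<And>x. x \<in> carrier M \<Longrightarrow> g x = f x"
  shows "linmap K M N g"
proof -
  interpret M: module K M by fact
  show ?thesis using assms(1,3) by (auto simp: linmap_def)
qed

lemma linmap_zero:
  assumes "linmap K M N f" "module K M" "module K N"
  shows "f \<zero>\<^bsub>M\<^esub> = \<zero>\<^bsub>N\<^esub>"
proof -
  interpret M: module K M by fact
  interpret N: module K N by fact
  \<comment> \<open>\<open>linmap\<close> has no clause for zero; zero is therefore written as the
    scalar zero times zero.\<close>
  have "f (\<zero>\<^bsub>K\<^esub> \<odot>\<^bsub>M\<^esub> \<zero>\<^bsub>M\<^esub>) = \<zero>\<^bsub>K\<^esub> \<odot>\<^bsub>N\<^esub> f \<zero>\<^bsub>M\<^esub>"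
    by (rule linmap_smult[OF assms(1)]) auto
  then show ?thesis using linmap_closed[OF assms(1)] by simp
qed

lemma linmap_a_inv:
  assumes "linmap K M N f" "module K M" "module K N" "x \<in> carrier M"
  shows "f (\<ominus>\<^bsub>M\<^esub> x) = \<ominus>\<^bsub>N\<^esub> f x"
proof -
  interpret M: module K M by fact
  interpret N: module K N by fact
  have "f (\<ominus>\<^bsub>M\<^esub> x) \<oplus>\<^bsub>N\<^esub> f x = f (\<ominus>\<^bsub>M\<^esub> x \<oplus>\<^bsub>M\<^esub> x)"
    using linmap_add[OF assms(1)] assms(4) by simp
  also have "\<dots> = \<zero>\<^bsub>N\<^esub>" using assms(4) linmap_zero[OF assms(1-3)] by (simp add: M.l_neg)
  finally show ?thesis
    using N.minus_equality[of "f (\<ominus>\<^bsub>M\<^esub> x)" "f x"] linmap_closed[OF assms(1)] assms(4) by simp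
qed

lemma linmap_minus:
  assumes "linmap K M N f" "module K M" "module K N" "x \<in> carrier M" "y \<in> carrier M"
  shows "f (x \<ominus>\<^bsub>M\<^esub> y) = f x \<ominus>\<^bsub>N\<^esub> f y"
proof -
  interpret M: module K M by fact
  show ?thesis
    using assms by (simp add: a_minus_def linmap_a_inv linmap_add[OF assms(1)])
qed

lemma linmap_finsum:
  assumes "linmap K M N f" "module K M" "module K N" "\<And>a. a \<in> S \<Longrightarrow> g a \<in> carrier M"
  shows "f (finsum M g S) = finsum N (\<lambda>a. f (g a)) S"
proof -
  interpret M: module K M by fact
  interpret N: module K N by fact
  show ?thesis using assms(4)
  \<comment> \<open>Over an infinite index set both sums are zero by convention.\<close>
  proof (induction S rule: infinite_finite_induct)
    case (insert a S)
    then have "g \<in> S \<rightarrow> carrier M" "(\<lambda>a. f (g a)) \<in> S \<rightarrow> carrier N"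
      using linmap_closed[OF assms(1)] by auto
    with insert show ?case
      using linmap_closed[OF assms(1)] by (simp add: linmap_add[OF assms(1)])
  qed (simp_all add: linmap_zero[OF assms(1-3)])
qed

lemma signed_closed: "module K N \<Longrightarrow> x \<in> carrier N \<Longrightarrow> signed N i x \<in> carrier N"
  by (simp add: signed_def module_def abelian_group.a_inv_closed)

lemma linmap_signed:
  assumes "linmap K M N f" "module K M" "module K N" "x \<in> carrier M"
  shows "f (signed M i x) = signed N i (f x)"
  using assms by (simp add: signed_def linmap_a_inv)

lemma linmap_comp: "linmap K M N f \<Longrightarrow> linmap K N P g \<Longrightarrow> linmap K M P (\<lambda>x. g (f x))"
  by (auto simp: linmap_def Pi_iff)

lemma linmap_plus_fun:
  assumes "linmap K M N f" "linmap K M N g" "module K N"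
  shows "linmap K M N (\<lambda>x. f x \<oplus>\<^bsub>N\<^esub> g x)"
proof -
  interpret N: module K N by fact
  note c = linmap_closed[OF assms(1)] linmap_closed[OF assms(2)]
  show ?thesis
    by (rule linmapI)
      (auto simp: c linmap_add[OF assms(1)] linmap_add[OF assms(2)] linmap_smult[OF assms(1)]
        linmap_smult[OF assms(2)] N.smult_r_distr N.a_ac)
qed

lemma linmap_smult_fun:
  assumes "linmap K M N f" "module K N" "k \<in> carrier K"
  shows "linmap K M N (\<lambda>x. k \<odot>\<^bsub>N\<^esub> f x)"
proof -
  interpret N: module K N by fact
  note c = linmap_closed[OF assms(1)]
  show ?thesis
  proof (rule linmapI)
    fix l x assume l: "l \<in> carrier K" and x: "x \<in> carrier M"
    \<comment> \<open>Commutativity of \<open>K\<close>: this is what makes multiplication by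
      \<open>k\<close> linear.\<close>
    have "k \<odot>\<^bsub>N\<^esub> (l \<odot>\<^bsub>N\<^esub> f x) = l \<odot>\<^bsub>N\<^esub> (k \<odot>\<^bsub>N\<^esub> f x)"
      using l x assms(3) c N.smult_assoc1[symmetric] N.R.m_comm by simp
    then show "k \<odot>\<^bsub>N\<^esub> f (l \<odot>\<^bsub>M\<^esub> x) = l \<odot>\<^bsub>N\<^esub> (k \<odot>\<^bsub>N\<^esub> f x)"
      using l x by (simp add: linmap_smult[OF assms(1)])
  qed (use assms(3) c in \<open>auto simp: linmap_add[OF assms(1)] N.smult_r_distr\<close>)
qed

lemma linmap_zero_fun:
  assumes "module K N" shows "linmap K M N (\<lambda>x. \<zero>\<^bsub>N\<^esub>)"
proof -
  interpret N: module K N by fact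
  show ?thesis by (rule linmapI) auto
qed

lemma linmap_a_inv_fun:
  assumes "linmap K M N f" "module K N"
  shows "linmap K M N (\<lambda>x. \<ominus>\<^bsub>N\<^esub> f x)"
proof -
  interpret N: module K N by fact
  note c = linmap_closed[OF assms(1)]
  show ?thesis
    by (rule linmapI)
      (auto simp: c linmap_add[OF assms(1)] linmap_smult[OF assms(1)] N.smult_r_minus N.minus_add)
qed

lemma linmap_minus_fun:
  assumes "linmap K M N f" "linmap K M N g" "module K N"
  shows "linmap K M N (\<lambda>x. f x \<ominus>\<^bsub>N\<^esub> g x)"
  unfolding a_minus_def by (intro linmap_plus_fun linmap_a_inv_fun assms)

lemma linmap_signed_fun:
  assumes "linmap K M N f" "module K N"
  shows "linmap K M N (\<lambda>x. signed N i (f x))"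
  unfolding signed_def by (cases "even i") (simp_all add: assms linmap_a_inv_fun)

lemma linmap_finsum_fun:
  assumes "\<And>a. a \<in> S \<Longrightarrow> linmap K M N (f a)" "module K N"
  shows "linmap K M N (\<lambda>x. finsum N (\<lambda>a. f a x) S)"
proof -
  interpret N: module K N by fact
  have c: "f a x \<in> carrier N" if "a \<in> S" "x \<in> carrier M" for a x
    using assms(1) that linmap_closed by metis
  show ?thesis
  proof (rule linmapI)
    fix x y assume xy: "x \<in> carrier M" "y \<in> carrier M"
    have "finsum N (\<lambda>a. f a (x \<oplus>\<^bsub>M\<^esub> y)) S = finsum N (\<lambda>a. f a x \<oplus>\<^bsub>N\<^esub> f a y) S"
      using xy c by (intro N.finsum_cong' refl) (auto simp: linmap_add[OF assms(1)])
    also have "\<dots> = finsum N (\<lambda>a. f a x) S \<oplus>\<^bsub>N\<^esub> finsum N (\<lambda>a. f a y) S"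
      using xy c by (intro N.finsum_addf) auto
    finally show "finsum N (\<lambda>a. f a (x \<oplus>\<^bsub>M\<^esub> y)) S = finsum N (\<lambda>a. f a x) S \<oplus>\<^bsub>N\<^esub> finsum N (\<lambda>a. f a y) S" .
  next
    fix k x assume kx: "k \<in> carrier K" "x \<in> carrier M"
    \<comment> \<open>Multiplication by \<open>k\<close> is itself a linear map, so
      \<open>linmap_finsum\<close> moves it through the sum.\<close>
    have "linmap K N N (\<lambda>z. k \<odot>\<^bsub>N\<^esub> z)"
      by (rule linmap_smult_fun[OF _ assms(2) kx(1)]) (auto intro: linmapI)
    then have "k \<odot>\<^bsub>N\<^esub> finsum N (\<lambda>a. f a x) S = finsum N (\<lambda>a. k \<odot>\<^bsub>N\<^esub> f a x) S"
      using linmap_finsum[where g="\<lambda>a. f a x" and S=S] assms(2) c kx by blast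
    also have "\<dots> = finsum N (\<lambda>a. f a (k \<odot>\<^bsub>M\<^esub> x)) S"
      using kx c by (intro N.finsum_cong' refl) (auto simp: linmap_smult[OF assms(1)])
    finally show "finsum N (\<lambda>a. f a (k \<odot>\<^bsub>M\<^esub> x)) S = k \<odot>\<^bsub>N\<^esub> finsum N (\<lambda>a. f a x) S" by simp
  qed (use c in \<open>auto intro!: N.finsum_closed\<close>)
qed

lemma linmap_id: "linmap K M M (\<lambda>x. x)"
  by (auto intro: linmapI)

lemma signed_Suc:
  assumes "module K N" "x \<in> carrier N"
  shows "signed N (Suc i) x = \<ominus>\<^bsub>N\<^esub> signed N i x"
proof -
  interpret N: module K N by fact
  show ?thesis using assms by (simp add: signed_def)
qed

lemma signed_signed:
  assumes "module K N" "x \<in> carrier N"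
  shows "signed N i (signed N j x) = signed N (i + j) x"
proof -
  interpret N: module K N by fact
  show ?thesis using assms by (auto simp: signed_def)
qed

lemma signed_cong: "even i \<longleftrightarrow> even j \<Longrightarrow> signed N i x = signed N j x"
  by (simp add: signed_def)

lemma linmap_signed_id: "module K N \<Longrightarrow> linmap K N N (signed N i)"
  by (rule linmap_signed_fun[OF linmap_id])

text \<open>The identifications of HH with the cohomology of the cones are inverted by
  \<open>inv_into\<close> in the theorem. Linearity follows from applying the left inverse law to
  the expected value, which lies in the carrier of the module \<open>M\<close>.\<close>

lemma lin_iso_inv_into:
  assumes "lin_iso K M N f" "module K M"
  shows "lin_iso K N M (inv_into (carrier M) f)"
proof -
  interpret M: module K M by fact
  have l: "linmap K M N f" and b: "bij_betw f (carrier M) (carrier N)"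
    using assms by (auto simp: lin_iso_def)
  let ?g = "inv_into (carrier M) f"
  have gc: "?g y \<in> carrier M" if "y \<in> carrier N" for y
    using b that by (metis bij_betw_imp_surj_on inv_into_into)
  have fg: "f (?g y) = y" if "y \<in> carrier N" for y
    using b that by (metis bij_betw_inv_into_right)
  have gf: "?g (f x) = x" if "x \<in> carrier M" for x
    using b that by (metis bij_betw_inv_into_left)
  have "linmap K N M ?g"
  proof (rule linmapI)
    fix x y assume "x \<in> carrier N" "y \<in> carrier N"
    then show "?g (x \<oplus>\<^bsub>N\<^esub> y) = ?g x \<oplus>\<^bsub>M\<^esub> ?g y"
      using gf[of "?g x \<oplus>\<^bsub>M\<^esub> ?g y"] by (simp add: gc fg linmap_add[OF l])
  next
    fix k x assume "k \<in> carrier K" "x \<in> carrier N"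
    then show "?g (k \<odot>\<^bsub>N\<^esub> x) = k \<odot>\<^bsub>M\<^esub> ?g x"
      using gf[of "k \<odot>\<^bsub>M\<^esub> ?g x"] by (simp add: gc fg linmap_smult[OF l])
  qed (use gc in auto)
  then show ?thesis using b by (simp add: lin_iso_def bij_betw_inv_into)
qed

section \<open>Constructions with modules\<close>

text \<open>Module axioms can be checked after applying maps that respect the operations and
  separate points. Function modules use evaluations, products their projections, submodules the
  inclusion. \<open>cring K\<close> is a separate hypothesis because an empty family
  \<open>I\<close> would say nothing about \<open>K\<close>.\<close>

lemma module_by_separating_maps:
  assumes "cring K" and N: "\<And>i. i \<in> I \<Longrightarrow> module K (N i)"
    and ev: "\<And>i x. i \<in> I \<Longrightarrow> x \<in> carrier Q \<Longrightarrow> ev i x \<in> carrier (N i)"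
    and inj: "\<And>x y. x \<in> carrier Q \<Longrightarrow> y \<in> carrier Q \<Longrightarrow> (\<And>i. i \<in> I \<Longrightarrow> ev i x = ev i y) \<Longrightarrow> x = y"
    and zero: "\<zero>\<^bsub>Q\<^esub> \<in> carrier Q" "\<And>i. i \<in> I \<Longrightarrow> ev i \<zero>\<^bsub>Q\<^esub> = \<zero>\<^bsub>N i\<^esub>"
    and add: "\<And>x y. x \<in> carrier Q \<Longrightarrow> y \<in> carrier Q \<Longrightarrow> x \<oplus>\<^bsub>Q\<^esub> y \<in> carrier Q"
      "\<And>i x y. i \<in> I \<Longrightarrow> x \<in> carrier Q \<Longrightarrow> y \<in> carrier Q \<Longrightarrow> ev i (x \<oplus>\<^bsub>Q\<^esub> y) = ev i x \<oplus>\<^bsub>N i\<^esub> ev i y"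
    and smult: "\<And>k x. k \<in> carrier K \<Longrightarrow> x \<in> carrier Q \<Longrightarrow> k \<odot>\<^bsub>Q\<^esub> x \<in> carrier Q"
      "\<And>i k x. i \<in> I \<Longrightarrow> k \<in> carrier K \<Longrightarrow> x \<in> carrier Q \<Longrightarrow> ev i (k \<odot>\<^bsub>Q\<^esub> x) = k \<odot>\<^bsub>N i\<^esub> ev i x"
  shows "module K Q"
proof -
  interpret K: cring K by fact
  have ag: "abelian_group (N i)" if "i \<in> I" for i using N[OF that] by (simp add: module_def)
  have am: "abelian_monoid (N i)" if "i \<in> I" for i using ag[OF that] by (simp add: abelian_group_def)
  note simps = zero add smult ev
    abelian_monoid.a_closed[OF am] module.smult_closed[OF N] abelian_monoid.zero_closed[OF am]
  show ?thesis
  proof (rule moduleI[OF assms(1)])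
    show "abelian_group Q"
    proof (rule abelian_groupI)
      fix x assume x: "x \<in> carrier Q"
      \<comment> \<open>The candidate negative comes from scalar multiplication by -1.\<close>
      let ?y = "(\<ominus>\<^bsub>K\<^esub> \<one>\<^bsub>K\<^esub>) \<odot>\<^bsub>Q\<^esub> x"
      have "?y \<oplus>\<^bsub>Q\<^esub> x = \<zero>\<^bsub>Q\<^esub>"
      proof (rule inj)
        fix i assume i: "i \<in> I"
        interpret Ni: module K "N i" by (rule N[OF i])
        show "ev i (?y \<oplus>\<^bsub>Q\<^esub> x) = ev i \<zero>\<^bsub>Q\<^esub>"
          using i x by (simp add: zero add smult ev Ni.smult_l_minus Ni.l_neg)
      qed (use x in \<open>auto simp: zero add smult\<close>)
      then show "\<exists>y\<in>carrier Q. y \<oplus>\<^bsub>Q\<^esub> x = \<zero>\<^bsub>Q\<^esub>"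
        using x smult by (intro bexI[of _ ?y]) auto
    qed (auto intro!: inj simp: simps abelian_monoid.a_assoc[OF am] abelian_monoid.l_zero[OF am]
        intro!: abelian_monoid.a_comm[OF am ev ev])
  qed (auto intro!: inj simp: simps module.smult_l_distr[OF N] module.smult_r_distr[OF N]
      module.smult_assoc1[OF N] module.smult_one[OF N])
qed

text \<open>Equations pass to homomorphic images. With the class map as \<open>f\<close> this gives
  cohomology; with the identity it transfers a module structure to a record that has the same
  carrier, sums and scalar multiples.\<close>

lemma module_by_surjection:
  assumes X: "module K X" and Q: "carrier Q = f ` carrier X" "\<zero>\<^bsub>Q\<^esub> = f \<zero>\<^bsub>X\<^esub>"
    "\<And>x y. x \<in> carrier X \<Longrightarrow> y \<in> carrier X \<Longrightarrow> f x \<oplus>\<^bsub>Q\<^esub> f y = f (x \<oplus>\<^bsub>X\<^esub> y)"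
    "\<And>k x. k \<in> carrier K \<Longrightarrow> x \<in> carrier X \<Longrightarrow> k \<odot>\<^bsub>Q\<^esub> f x = f (k \<odot>\<^bsub>X\<^esub> x)"
  shows "module K Q"
proof -
  interpret X: module K X by fact
  show ?thesis
  proof (rule moduleI)
    show "abelian_group Q"
    proof (rule abelian_groupI)
      fix x assume "x \<in> carrier Q"
      then obtain x' where x': "x = f x'" "x' \<in> carrier X" using Q by auto
      then show "\<exists>y\<in>carrier Q. y \<oplus>\<^bsub>Q\<^esub> x = \<zero>\<^bsub>Q\<^esub>"
        using Q by (intro bexI[of _ "f (\<ominus>\<^bsub>X\<^esub> x')"]) (auto simp: X.l_neg)
    qed (auto simp: Q X.a_assoc intro!: arg_cong[where f=f] X.a_comm)
  qed (auto simp: Q X.smult_l_distr X.smult_r_distr X.smult_assoc1 intro: X.R.is_cring)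
qed

lemma fun_module_simps [simp]:
  "carrier (fun_module S N C) = C" "\<zero>\<^bsub>fun_module S N C\<^esub> = (\<lambda>x\<in>S. \<zero>\<^bsub>N\<^esub>)"
  "f \<oplus>\<^bsub>fun_module S N C\<^esub> g = (\<lambda>x\<in>S. f x \<oplus>\<^bsub>N\<^esub> g x)"
  "k \<odot>\<^bsub>fun_module S N C\<^esub> f = (\<lambda>x\<in>S. k \<odot>\<^bsub>N\<^esub> f x)"
  by (simp_all add: fun_module_def)

text \<open>Evaluations at the points of \<open>S\<close> separate, since members of
  \<open>C\<close> are extensional.\<close>

lemma module_fun_module:
  assumes "module K N" "C \<subseteq> S \<rightarrow>\<^sub>E carrier N" "(\<lambda>x\<in>S. \<zero>\<^bsub>N\<^esub>) \<in> C"
    "\<And>f g. f \<in> C \<Longrightarrow> g \<in> C \<Longrightarrow> (\<lambda>x\<in>S. f x \<oplus>\<^bsub>N\<^esub> g x) \<in> C"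
    "\<And>k f. k \<in> carrier K \<Longrightarrow> f \<in> C \<Longrightarrow> (\<lambda>x\<in>S. k \<odot>\<^bsub>N\<^esub> f x) \<in> C"
  shows "module K (fun_module S N C)"
proof (rule module_by_separating_maps[where I=S and N="\<lambda>_. N" and ev="\<lambda>s f. f s"])
  fix f g assume "f \<in> carrier (fun_module S N C)" "g \<in> carrier (fun_module S N C)" "\<And>s. s \<in> S \<Longrightarrow> f s = g s"
  then show "f = g" using assms(2) by (auto intro!: PiE_ext[where k=S])
qed (use assms in \<open>auto simp: module_def\<close>)

lemma linmap_fun_module_eval:
  assumes "C \<subseteq> S \<rightarrow>\<^sub>E carrier N" "s \<in> S"
  shows "linmap K (fun_module S N C) N (\<lambda>f. f s)"
  using assms by (intro linmapI) auto

text \<open>Linearity into a function module is tested at each point. Differentials and induced maps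
  on complexes of functions obtain their linearity this way.\<close>

lemma linmap_into_fun_module:
  assumes "\<And>x. x \<in> carrier X \<Longrightarrow> \<phi> x \<in> C" "C \<subseteq> S \<rightarrow>\<^sub>E carrier N"
    "\<And>s. s \<in> S \<Longrightarrow> linmap K X N (\<lambda>x. \<phi> x s)" "module K X"
  shows "linmap K X (fun_module S N C) \<phi>"
proof -
  interpret X: module K X by fact
  have e: "\<phi> x \<in> extensional S" if "x \<in> carrier X" for x
    using assms(1,2) that by (fastforce simp: PiE_def)
  show ?thesis
    by (rule linmapI) (auto simp: assms(1) intro!: extensionalityI[OF e]
       linmap_add[OF assms(3)] linmap_smult[OF assms(3)])
qed

lemma prod_module_simps [simp]:
  "carrier (prod_module X Y) = carrier X \<times> carrier Y" "\<zero>\<^bsub>prod_module X Y\<^esub> = (\<zero>\<^bsub>X\<^esub>, \<zero>\<^bsub>Y\<^esub>)"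
  "(x, y) \<oplus>\<^bsub>prod_module X Y\<^esub> (x', y') = (x \<oplus>\<^bsub>X\<^esub> x', y \<oplus>\<^bsub>Y\<^esub> y')"
  "k \<odot>\<^bsub>prod_module X Y\<^esub> (x, y) = (k \<odot>\<^bsub>X\<^esub> x, k \<odot>\<^bsub>Y\<^esub> y)"
  by (simp_all add: prod_module_def)

lemma module_prod_module:
  assumes "module K X" "module K Y"
  shows "module K (prod_module X Y)"
proof -
  interpret X: module K X by fact
  interpret Y: module K Y by fact
  show ?thesis
  proof (rule moduleI)
    show "abelian_group (prod_module X Y)"
    proof (rule abelian_groupI)
      fix z assume "z \<in> carrier (prod_module X Y)"
      then show "\<exists>w\<in>carrier (prod_module X Y). w \<oplus>\<^bsub>prod_module X Y\<^esub> z = \<zero>\<^bsub>prod_module X Y\<^esub>"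
        by (intro bexI[of _ "(\<ominus>\<^bsub>X\<^esub> fst z, \<ominus>\<^bsub>Y\<^esub> snd z)"]) (auto simp: X.l_neg Y.l_neg)
    qed (auto simp: X.a_assoc Y.a_assoc intro!: X.a_comm Y.a_comm)
  qed (auto simp: X.smult_l_distr X.smult_r_distr X.smult_assoc1
      Y.smult_l_distr Y.smult_r_distr Y.smult_assoc1 X.R.is_cring)
qed

lemma linmap_fst: "linmap K (prod_module X Y) X fst"
  and linmap_snd: "linmap K (prod_module X Y) Y snd"
  by (auto intro: linmapI)

lemma linmap_Pair: "linmap K Z X f \<Longrightarrow> linmap K Z Y g \<Longrightarrow> linmap K Z (prod_module X Y) (\<lambda>z. (f z, g z))"
  by (auto simp: linmap_def)

lemma family_product_simps [simp]:
  "carrier (family_product I F) = (\<Pi>\<^sub>E i\<in>I. carrier (F i))" "\<zero>\<^bsub>family_product I F\<^esub> = (\<lambda>i\<in>I. \<zero>\<^bsub>F i\<^esub>)"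
  "x \<oplus>\<^bsub>family_product I F\<^esub> y = (\<lambda>i\<in>I. x i \<oplus>\<^bsub>F i\<^esub> y i)"
  "k \<odot>\<^bsub>family_product I F\<^esub> x = (\<lambda>i\<in>I. k \<odot>\<^bsub>F i\<^esub> x i)"
  by (simp_all add: family_product_def)

lemma module_family_product:
  assumes "cring K" "\<And>i. i \<in> I \<Longrightarrow> module K (F i)"
  shows "module K (family_product I F)"
proof -
  have ag: "abelian_monoid (F i)" if "i \<in> I" for i
    using assms(2)[OF that] by (simp add: module_def abelian_group_def)
  show ?thesis
  proof (rule module_by_separating_maps[where I=I and N=F and ev="\<lambda>i x. x i"])
    fix x y assume "x \<in> carrier (family_product I F)" "y \<in> carrier (family_product I F)"
      "\<And>i. i \<in> I \<Longrightarrow> x i = y i"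
    then show "x = y" by (auto intro: PiE_ext)
  qed (auto simp: assms abelian_monoid.zero_closed[OF ag] PiE_mem[where S=I]
        intro!: abelian_monoid.a_closed[OF ag] module.smult_closed[OF assms(2)])
qed

lemma linmap_family_product_proj: "i \<in> I \<Longrightarrow> linmap K (family_product I F) (F i) (\<lambda>x. x i)"
  by (rule linmapI) auto

lemma module_carrier_update:
  assumes "module K X" "H \<subseteq> carrier X" "\<zero>\<^bsub>X\<^esub> \<in> H" "\<And>x y. x \<in> H \<Longrightarrow> y \<in> H \<Longrightarrow> x \<oplus>\<^bsub>X\<^esub> y \<in> H"
    "\<And>k x. k \<in> carrier K \<Longrightarrow> x \<in> H \<Longrightarrow> k \<odot>\<^bsub>X\<^esub> x \<in> H"
  shows "module K (X\<lparr>carrier := H\<rparr>)"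
  using assms by - (rule module_by_separating_maps[where I="{()}" and N="\<lambda>_. X" and ev="\<lambda>_ x. x"],
    auto simp: module_def)

lemma module_zero_submodule: "module K X \<Longrightarrow> module K (zero_submodule X)"
  unfolding zero_submodule_def
  by (rule module_carrier_update)
    (auto simp: module.smult_r_null abelian_monoid.zero_closed abelian_monoid.l_zero module_def abelian_group_def)

lemma linmap_from_subset:
  "linmap K X Y f \<Longrightarrow> H \<subseteq> carrier X \<Longrightarrow> linmap K (X\<lparr>carrier := H\<rparr>) Y f"
  by (auto simp: linmap_def subset_iff Pi_iff)

section \<open>Cohomology\<close>

definition cochain_complex :: "'k ring \<Rightarrow> ('k, 'x) cochains \<Rightarrow> bool" where
  "cochain_complex K X \<longleftrightarrow> (\<forall>n. module K (deg X n)) \<and>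
     (\<forall>n. linmap K (deg X n) (deg X (Suc n)) (diff X n)) \<and>
     (\<forall>n. \<forall>x\<in>carrier (deg X n). diff X (Suc n) (diff X n x) = \<zero>\<^bsub>deg X (Suc (Suc n))\<^esub>)"

definition cochain_map ::
  "'k ring \<Rightarrow> ('k, 'x) cochains \<Rightarrow> ('k, 'y) cochains \<Rightarrow> (nat \<Rightarrow> 'x \<Rightarrow> 'y) \<Rightarrow> bool" where
  "cochain_map K X Y \<phi> \<longleftrightarrow> (\<forall>n. linmap K (deg X n) (deg Y n) (\<phi> n)) \<and>
     (\<forall>n. \<forall>x\<in>carrier (deg X n). \<phi> (Suc n) (diff X n x) = diff Y n (\<phi> n x))"

definition coh_class :: "('k, 'x) cochains \<Rightarrow> nat \<Rightarrow> 'x \<Rightarrow> 'x set" where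
  "coh_class X n z = coboundaries X n +>\<^bsub>deg X n\<^esub> z"

lemma cochain_complexD:
  assumes "cochain_complex K X"
  shows "module K (deg X n)" "linmap K (deg X n) (deg X (Suc n)) (diff X n)"
    "x \<in> carrier (deg X n) \<Longrightarrow> diff X (Suc n) (diff X n x) = \<zero>\<^bsub>deg X (Suc (Suc n))\<^esub>"
  using assms by (auto simp: cochain_complex_def)

lemma cochain_mapD:
  assumes "cochain_map K X Y \<phi>"
  shows "linmap K (deg X n) (deg Y n) (\<phi> n)"
    "x \<in> carrier (deg X n) \<Longrightarrow> \<phi> (Suc n) (diff X n x) = diff Y n (\<phi> n x)"
  using assms by (auto simp: cochain_map_def)

lemma cochain_map_comp:
  assumes "cochain_map K X Y \<phi>" "cochain_map K Y Z \<psi>"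
  shows "cochain_map K X Z (\<lambda>n x. \<psi> n (\<phi> n x))"
  using assms linmap_closed[OF cochain_mapD(1)[OF assms(1)]]
  by (auto simp: cochain_map_def intro: linmap_comp)

lemma cochain_map_minus:
  assumes "cochain_map K X Y \<phi>" "cochain_map K X Y \<psi>" "cochain_complex K Y"
  shows "cochain_map K X Y (\<lambda>n x. \<phi> n x \<ominus>\<^bsub>deg Y n\<^esub> \<psi> n x)"
  using cochain_mapD[OF assms(1)] cochain_mapD[OF assms(2)]
    linmap_closed[OF cochain_mapD(1)[OF assms(1)]] linmap_closed[OF cochain_mapD(1)[OF assms(2)]]
  by (auto simp: cochain_map_def linmap_minus[OF cochain_complexD(2)[OF assms(3)]] cochain_complexD(1)[OF assms(3)]
      intro!: linmap_minus_fun)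

lemma cochain_map_finsum:
  assumes "\<And>a. a \<in> S \<Longrightarrow> cochain_map K X Y (\<phi> a)" "cochain_complex K X" "cochain_complex K Y"
  shows "cochain_map K X Y (\<lambda>n x. finsum (deg Y n) (\<lambda>a. \<phi> a n x) S)"
  unfolding cochain_map_def
proof (intro conjI allI ballI)
  fix n x assume x: "x \<in> carrier (deg X n)"
  have c: "\<phi> a n x \<in> carrier (deg Y n)" if "a \<in> S" for a
    using linmap_closed[OF cochain_mapD(1)[OF assms(1)[OF that]]] x by simp
  interpret Y: module K "deg Y (Suc n)" by (rule cochain_complexD[OF assms(3)])
  have "diff Y n (finsum (deg Y n) (\<lambda>a. \<phi> a n x) S) = finsum (deg Y (Suc n)) (\<lambda>a. diff Y n (\<phi> a n x)) S"
    by (rule linmap_finsum) (use c cochain_complexD[OF assms(3)] in auto)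
  also have "\<dots> = finsum (deg Y (Suc n)) (\<lambda>a. \<phi> a (Suc n) (diff X n x)) S"
    using x linmap_closed[OF cochain_mapD(1)[OF assms(1)]] linmap_closed[OF cochain_complexD(2)[OF assms(2)]]
      linmap_closed[OF cochain_complexD(2)[OF assms(3)]]
    by (intro Y.finsum_cong') (auto simp: cochain_mapD(2)[OF assms(1)])
  finally show "finsum (deg Y (Suc n)) (\<lambda>a. \<phi> a (Suc n) (diff X n x)) S =
    diff Y n (finsum (deg Y n) (\<lambda>a. \<phi> a n x) S)" by simp
qed (auto intro!: linmap_finsum_fun cochain_mapD[OF assms(1)] cochain_complexD[OF assms(3)])

lemma cocycles_simps [simp]:
  "\<zero>\<^bsub>cocycles X n\<^esub> = \<zero>\<^bsub>deg X n\<^esub>" "add (cocycles X n) = add (deg X n)" "smult (cocycles X n) = smult (deg X n)"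
  "carrier (cocycles X n) = {x \<in> carrier (deg X n). diff X n x = \<zero>\<^bsub>deg X (Suc n)\<^esub>}"
  by (simp_all add: cocycles_def)

context
  fixes K :: "'k ring" and X :: "('k, 'x) cochains"
  assumes cc: "cochain_complex K X"
begin

lemma module_cocycles: "module K (cocycles X n)"
  unfolding cocycles_def
proof (rule module_carrier_update)
  interpret D: module K "deg X n" by (rule cochain_complexD[OF cc])
  interpret E: module K "deg X (Suc n)" by (rule cochain_complexD[OF cc])
  note d = cochain_complexD(2)[OF cc, of n]
  show "module K (deg X n)" by (rule cochain_complexD[OF cc])
  show "\<zero>\<^bsub>deg X n\<^esub> \<in> {x \<in> carrier (deg X n). diff X n x = \<zero>\<^bsub>deg X (Suc n)\<^esub>}"
    using linmap_zero[OF d cochain_complexD(1)[OF cc] cochain_complexD(1)[OF cc]] by simp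
qed (auto simp: linmap_add[OF cochain_complexD(2)[OF cc]] linmap_smult[OF cochain_complexD(2)[OF cc]]
    module.smult_closed[OF cochain_complexD(1)[OF cc]] module.smult_r_null[OF cochain_complexD(1)[OF cc]]
    abelian_monoid.a_closed abelian_monoid.l_zero abelian_monoid.zero_closed
    cochain_complexD(1)[OF cc, unfolded module_def abelian_group_def])

lemma linmap_cocycles: "linmap K (cocycles X n) (deg X n) (\<lambda>x. x)"
  unfolding cocycles_def by (rule linmap_from_subset[OF linmap_id]) auto

lemma coboundaries_subset: "coboundaries X n \<subseteq> carrier (cocycles X n)"
  using linmap_closed[OF cochain_complexD(2)[OF cc]] cochain_complexD(3)[OF cc]
    linmap_zero[OF cochain_complexD(2)[OF cc] cochain_complexD(1)[OF cc] cochain_complexD(1)[OF cc]]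
    abelian_monoid.zero_closed[of "deg X 0"] cochain_complexD(1)[OF cc, of 0, unfolded module_def abelian_group_def]
  by (cases n) (auto simp: coboundaries_def)

text \<open>In degree zero the coboundaries are the zero cochain alone, in positive degree the image
  of a linear map; hence the case distinction on the degree.\<close>

lemma coboundaries_closed:
  "\<zero>\<^bsub>deg X n\<^esub> \<in> coboundaries X n"
  "x \<in> coboundaries X n \<Longrightarrow> y \<in> coboundaries X n \<Longrightarrow> x \<oplus>\<^bsub>deg X n\<^esub> y \<in> coboundaries X n"
  "k \<in> carrier K \<Longrightarrow> x \<in> coboundaries X n \<Longrightarrow> k \<odot>\<^bsub>deg X n\<^esub> x \<in> coboundaries X n"
  "x \<in> coboundaries X n \<Longrightarrow> \<ominus>\<^bsub>deg X n\<^esub> x \<in> coboundaries X n"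
proof -
  interpret D: module K "deg X m" for m by (rule cochain_complexD[OF cc])
  note d = cochain_complexD(2)[OF cc]
  show "\<zero>\<^bsub>deg X n\<^esub> \<in> coboundaries X n"
    using linmap_zero[OF d D.module_axioms D.module_axioms, symmetric]
    by (cases n) (auto simp: coboundaries_def)
  show "x \<oplus>\<^bsub>deg X n\<^esub> y \<in> coboundaries X n" if "x \<in> coboundaries X n" "y \<in> coboundaries X n"
    using that by (cases n) (auto simp: coboundaries_def linmap_add[OF d, symmetric])
  show "k \<odot>\<^bsub>deg X n\<^esub> x \<in> coboundaries X n" if "k \<in> carrier K" "x \<in> coboundaries X n"
    using that by (cases n) (auto simp: coboundaries_def linmap_smult[OF d, symmetric])
  show "\<ominus>\<^bsub>deg X n\<^esub> x \<in> coboundaries X n" if "x \<in> coboundaries X n"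
    using that by (cases n)
      (auto simp: coboundaries_def linmap_a_inv[OF d D.module_axioms D.module_axioms, symmetric])
qed

lemma mem_coh_class:
  "x \<in> coh_class X n z \<longleftrightarrow> (\<exists>b\<in>coboundaries X n. x = b \<oplus>\<^bsub>deg X n\<^esub> z)"
  by (auto simp: coh_class_def a_r_coset_def')

lemma coh_class_eq_iff:
  assumes z: "z \<in> carrier (deg X n)" "z' \<in> carrier (deg X n)"
  shows "coh_class X n z = coh_class X n z' \<longleftrightarrow> z \<ominus>\<^bsub>deg X n\<^esub> z' \<in> coboundaries X n"
proof -
  interpret D: module K "deg X n" by (rule cochain_complexD[OF cc])
  have bc: "b \<in> carrier (deg X n)" if "b \<in> coboundaries X n" for b
    using coboundaries_subset that by auto
  show ?thesis
  proof
    assume eq: "coh_class X n z = coh_class X n z'"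
    have "\<zero>\<^bsub>deg X n\<^esub> \<oplus>\<^bsub>deg X n\<^esub> z \<in> coh_class X n z" using coboundaries_closed(1) mem_coh_class by blast
    then obtain b where b: "b \<in> coboundaries X n" "z = b \<oplus>\<^bsub>deg X n\<^esub> z'"
      using eq z by (auto simp: mem_coh_class)
    then show "z \<ominus>\<^bsub>deg X n\<^esub> z' \<in> coboundaries X n"
      using bc[OF b(1)] z by (simp add: a_minus_def D.a_assoc D.r_neg)
  next
    assume b: "z \<ominus>\<^bsub>deg X n\<^esub> z' \<in> coboundaries X n"
    \<comment> \<open>One inclusion suffices: the hypothesis is symmetric in \<open>u\<close> and
      \<open>v\<close> up to sign, and coboundaries are closed under negatives.\<close>
    have sub: "coh_class X n u \<subseteq> coh_class X n v"
      if uv: "u \<in> carrier (deg X n)" "v \<in> carrier (deg X n)" and d: "u \<ominus>\<^bsub>deg X n\<^esub> v \<in> coboundaries X n" for u v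
    proof
      fix x assume "x \<in> coh_class X n u"
      then obtain b where "b \<in> coboundaries X n" "x = b \<oplus>\<^bsub>deg X n\<^esub> u" by (auto simp: mem_coh_class)
      moreover have "b \<oplus>\<^bsub>deg X n\<^esub> u = (b \<oplus>\<^bsub>deg X n\<^esub> (u \<ominus>\<^bsub>deg X n\<^esub> v)) \<oplus>\<^bsub>deg X n\<^esub> v" if "b \<in> carrier (deg X n)" for b
        using that uv by (simp add: a_minus_def D.a_assoc D.l_neg)
      ultimately show "x \<in> coh_class X n v"
        using coboundaries_closed(2) d bc by (auto simp: mem_coh_class)
    qed
    have "\<ominus>\<^bsub>deg X n\<^esub> (z \<ominus>\<^bsub>deg X n\<^esub> z') = z' \<ominus>\<^bsub>deg X n\<^esub> z"
      using z by (simp add: a_minus_def D.minus_add D.a_comm)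
    then show "coh_class X n z = coh_class X n z'"
      using sub[OF z b] sub[OF z(2,1)] coboundaries_closed(4)[OF b] by auto
  qed
qed

text \<open>Operations on the quotient are defined through sums and unions of cosets. In terms of
  representing cocycles they take their usual form, and afterwards they are handled in this form
  only.\<close>

lemma cohomology_ops:
  shows carrier_cohomology: "carrier (cohomology X n) = coh_class X n ` carrier (cocycles X n)"
    and zero_cohomology: "\<zero>\<^bsub>cohomology X n\<^esub> = coh_class X n \<zero>\<^bsub>deg X n\<^esub>"
    and add_cohomology: "x \<in> carrier (cocycles X n) \<Longrightarrow> y \<in> carrier (cocycles X n) \<Longrightarrow>
      coh_class X n x \<oplus>\<^bsub>cohomology X n\<^esub> coh_class X n y = coh_class X n (x \<oplus>\<^bsub>deg X n\<^esub> y)"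
    and smult_cohomology: "k \<in> carrier K \<Longrightarrow> x \<in> carrier (cocycles X n) \<Longrightarrow>
      k \<odot>\<^bsub>cohomology X n\<^esub> coh_class X n x = coh_class X n (k \<odot>\<^bsub>deg X n\<^esub> x)"
proof -
  interpret D: module K "deg X n" by (rule cochain_complexD[OF cc])
  interpret Z: module K "cocycles X n" by (rule module_cocycles)
  have cos: "coboundaries X n +>\<^bsub>cocycles X n\<^esub> x = coh_class X n x" for x
    by (simp add: coh_class_def a_r_coset_def')
  have bc: "b \<in> carrier (deg X n)" if "b \<in> coboundaries X n" for b
    using coboundaries_subset that by auto
  show "carrier (cohomology X n) = coh_class X n ` carrier (cocycles X n)"
    unfolding cohomology_def quotient_module_def A_RCOSETS_def' by (auto simp: cos)
  show "\<zero>\<^bsub>cohomology X n\<^esub> = coh_class X n \<zero>\<^bsub>deg X n\<^esub>"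
    using bc by (force simp: cohomology_def quotient_module_def coh_class_def a_r_coset_def')
  {
    assume x: "x \<in> carrier (cocycles X n)" and y: "y \<in> carrier (cocycles X n)"
    have "coboundaries X n \<noteq> {}" using coboundaries_closed(1) by blast
    interpret H: abelian_subgroup "coboundaries X n" "deg X n"
    proof (rule abelian_subgroupI3)
      show "additive_subgroup (coboundaries X n) (deg X n)"
        using bc coboundaries_closed \<open>coboundaries X n \<noteq> {}\<close>
        by (intro additive_subgroupI D.add.subgroupI) (auto simp: a_inv_def)
    qed (rule D.M.abelian_group_axioms)
    show "coh_class X n x \<oplus>\<^bsub>cohomology X n\<^esub> coh_class X n y = coh_class X n (x \<oplus>\<^bsub>deg X n\<^esub> y)"
      using H.a_rcos_sum[of x y] x y
      by (simp add: cohomology_def quotient_module_def coh_class_def set_add_def')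
  }
  {
    assume k: "k \<in> carrier K" and x: "x \<in> carrier (cocycles X n)"
    \<comment> \<open>Scalar multiplication of a class is a union over its members. Each member
      contributes the same coset, because \<open>k\<close> times a coboundary is a
      coboundary.\<close>
    have "coh_class X n (k \<odot>\<^bsub>deg X n\<^esub> y) = coh_class X n (k \<odot>\<^bsub>deg X n\<^esub> x)" if y: "y \<in> coh_class X n x" for y
    proof -
      obtain b where b: "b \<in> coboundaries X n" "y = b \<oplus>\<^bsub>deg X n\<^esub> x" using y by (auto simp: mem_coh_class)
      have "k \<odot>\<^bsub>deg X n\<^esub> y \<ominus>\<^bsub>deg X n\<^esub> k \<odot>\<^bsub>deg X n\<^esub> x = k \<odot>\<^bsub>deg X n\<^esub> b"
        using b bc x k by (simp add: a_minus_def D.smult_r_distr D.a_assoc D.r_neg)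
      then show ?thesis using b bc x k by (subst coh_class_eq_iff) (auto intro: coboundaries_closed)
    qed
    \<comment> \<open>The class is nonempty, so the union equals that common coset.\<close>
    moreover have "\<zero>\<^bsub>deg X n\<^esub> \<oplus>\<^bsub>deg X n\<^esub> x \<in> coh_class X n x"
      using coboundaries_closed(1) mem_coh_class by blast
    ultimately show "k \<odot>\<^bsub>cohomology X n\<^esub> coh_class X n x = coh_class X n (k \<odot>\<^bsub>deg X n\<^esub> x)"
      by (auto simp: cohomology_def quotient_module_def cos)
  }
qed

lemma module_cohomology: "module K (cohomology X n)"
  by (rule module_by_surjection[OF module_cocycles, where f="coh_class X n"])
    (auto simp only: cohomology_ops cocycles_simps(1-3))

lemma linmap_coh_class: "linmap K (cocycles X n) (cohomology X n) (coh_class X n)"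
  by (rule linmapI) (auto simp only: cohomology_ops cocycles_simps(1-3))

lemma coh_class_eq_zero_iff:
  assumes "z \<in> carrier (deg X n)"
  shows "coh_class X n z = \<zero>\<^bsub>cohomology X n\<^esub> \<longleftrightarrow> z \<in> coboundaries X n"
proof -
  interpret D: module K "deg X n" by (rule cochain_complexD[OF cc])
  have "z \<ominus>\<^bsub>deg X n\<^esub> \<zero>\<^bsub>deg X n\<^esub> = z"
    using assms D.minus_equality[of "\<zero>\<^bsub>deg X n\<^esub>" "\<zero>\<^bsub>deg X n\<^esub>"] by (simp add: a_minus_def)
  then show ?thesis using assms by (simp add: cohomology_ops coh_class_eq_iff)
qed

text \<open>Taking classes is linear on the module of cocycles, so the sum is first read inside that
  module.\<close>

lemma coh_class_finsum:
  assumes "\<And>a. a \<in> S \<Longrightarrow> g a \<in> carrier (cocycles X n)"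
  shows "coh_class X n (finsum (deg X n) g S) = finsum (cohomology X n) (\<lambda>a. coh_class X n (g a)) S"
  using linmap_finsum[OF linmap_coh_class module_cocycles module_cohomology, of S g]
    linmap_finsum[OF linmap_cocycles module_cocycles cochain_complexD(1)[OF cc], of S g] assms by simp

end

context
  fixes K :: "'k ring" and X :: "('k, 'x) cochains" and Y :: "('k, 'y) cochains" and \<phi>
  assumes cX: "cochain_complex K X" and cY: "cochain_complex K Y" and \<phi>: "cochain_map K X Y \<phi>"
begin

lemma cochain_map_cocycles: "z \<in> carrier (cocycles X n) \<Longrightarrow> \<phi> n z \<in> carrier (cocycles Y n)"
  using cochain_mapD(2)[OF \<phi>, of z n, symmetric] linmap_closed[OF cochain_mapD(1)[OF \<phi>]]
    linmap_zero[OF cochain_mapD(1)[OF \<phi>] cochain_complexD(1)[OF cX] cochain_complexD(1)[OF cY]] by simp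

lemma cochain_map_coboundaries:
  assumes "b \<in> coboundaries X n" shows "\<phi> n b \<in> coboundaries Y n"
proof (cases n)
  case 0
  then show ?thesis using assms
    linmap_zero[OF cochain_mapD(1)[OF \<phi>] cochain_complexD(1)[OF cX] cochain_complexD(1)[OF cY]]
    by (simp add: coboundaries_def)
next
  case (Suc m)
  then show ?thesis using assms linmap_closed[OF cochain_mapD(1)[OF \<phi>]]
    by (auto simp: coboundaries_def cochain_mapD(2)[OF \<phi>])
qed

text \<open>\<open>coh_map\<close> collects the values on all members of a class. Members differ by
  coboundaries, whose images are coboundaries again, so every member yields the same coset.\<close>

lemma coh_map_class:
  assumes z: "z \<in> carrier (cocycles X n)"
  shows "coh_map Y n (\<phi> n) (coh_class X n z) = coh_class Y n (\<phi> n z)"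
proof -
  interpret DX: module K "deg X n" by (rule cochain_complexD[OF cX])
  interpret DY: module K "deg Y n" by (rule cochain_complexD[OF cY])
  have "coh_class Y n (\<phi> n x) = coh_class Y n (\<phi> n z)" if x: "x \<in> coh_class X n z" for x
  proof -
    obtain b where b: "b \<in> coboundaries X n" "x = b \<oplus>\<^bsub>deg X n\<^esub> z" using x by (auto simp: mem_coh_class[OF cX])
    have bc: "b \<in> carrier (deg X n)" using coboundaries_subset[OF cX] b by auto
    have c: "\<phi> n b \<in> carrier (deg Y n)" "\<phi> n z \<in> carrier (deg Y n)"
      using linmap_closed[OF cochain_mapD(1)[OF \<phi>]] bc z by auto
    have "\<phi> n x = \<phi> n b \<oplus>\<^bsub>deg Y n\<^esub> \<phi> n z"
      using b bc z by (simp add: linmap_add[OF cochain_mapD(1)[OF \<phi>]])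
    then have "\<phi> n x \<ominus>\<^bsub>deg Y n\<^esub> \<phi> n z = \<phi> n b" using c by (simp add: a_minus_def DY.a_assoc DY.r_neg)
    then show ?thesis
      using c \<open>\<phi> n x = _\<close> cochain_map_coboundaries[OF b(1)] by (subst coh_class_eq_iff[OF cY]) auto
  qed
  moreover have "\<zero>\<^bsub>deg X n\<^esub> \<oplus>\<^bsub>deg X n\<^esub> z \<in> coh_class X n z"
    using coboundaries_closed(1)[OF cX] mem_coh_class[OF cX] by blast
  ultimately show ?thesis by (auto simp: coh_map_def coh_class_def[symmetric])
qed

lemma linmap_coh_map: "linmap K (cohomology X n) (cohomology Y n) (coh_map Y n (\<phi> n))"
proof -
  interpret ZX: module K "cocycles X n" by (rule module_cocycles[OF cX])
  note ops = cochain_map_cocycles add_cohomology[OF cX] add_cohomology[OF cY]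
    smult_cohomology[OF cX] smult_cohomology[OF cY]
  have sub: "z \<in> carrier (cocycles X n) \<Longrightarrow> z \<in> carrier (deg X n)" for z by simp
  have ZX: "x \<in> carrier (cocycles X n) \<Longrightarrow> y \<in> carrier (cocycles X n) \<Longrightarrow> x \<oplus>\<^bsub>deg X n\<^esub> y \<in> carrier (cocycles X n)"
    "k \<in> carrier K \<Longrightarrow> x \<in> carrier (cocycles X n) \<Longrightarrow> k \<odot>\<^bsub>deg X n\<^esub> x \<in> carrier (cocycles X n)" for k x y
    using ZX.a_closed[of x y] ZX.smult_closed[of k x] by simp_all
  show ?thesis
    by (rule linmapI) (auto simp: carrier_cohomology[OF cX] carrier_cohomology[OF cY] coh_map_class ops ZX
      linmap_add[OF cochain_mapD(1)[OF \<phi>] sub sub] linmap_smult[OF cochain_mapD(1)[OF \<phi>] _ sub]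
      simp del: cocycles_simps(4))
qed

end

text \<open>A class consists of cochains, so only values on the carrier matter. Cochain maps that
  agree there but differ as HOL functions become interchangeable.\<close>

lemma coh_map_cong:
  assumes X: "cochain_complex K X" and eq: "\<And>x. x \<in> carrier (deg X n) \<Longrightarrow> f x = g x"
    and c: "c \<in> carrier (cohomology X n)"
  shows "coh_map Y n f c = coh_map Y n g c"
proof -
  interpret X: module K "deg X n" by (rule cochain_complexD[OF X])
  have "c \<subseteq> carrier (deg X n)"
    using c coboundaries_subset[OF X, of n] by (auto simp: carrier_cohomology[OF X] mem_coh_class[OF X] subset_iff)
  then have "f x = g x" if "x \<in> c" for x using eq that by blast
  then show ?thesis by (simp add: coh_map_def)
qed

lemma coh_map_comp:
  assumes "cochain_complex K X" "cochain_complex K Y" "cochain_complex K Z"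
    "cochain_map K X Y \<phi>" "cochain_map K Y Z \<psi>" "c \<in> carrier (cohomology X n)"
  shows "coh_map Z n (\<psi> n) (coh_map Y n (\<phi> n) c) = coh_map Z n (\<lambda>x. \<psi> n (\<phi> n x)) c"
  using assms(6) coh_map_class[OF assms(1,3) cochain_map_comp[OF assms(4,5)]]
  by (auto simp: carrier_cohomology[OF assms(1)] coh_map_class[OF assms(1,2,4)]
    coh_map_class[OF assms(2,3,5)] cochain_map_cocycles[OF assms(1,2,4)] simp del: cocycles_simps(4))

section \<open>Split exact sequences in cohomology\<close>

lemma module_minus_zero:
  assumes "module K N" "x \<in> carrier N"
  shows "x \<ominus>\<^bsub>N\<^esub> \<zero>\<^bsub>N\<^esub> = x"
proof -
  interpret N: module K N by fact
  show ?thesis using assms(2) N.minus_equality[of "\<zero>\<^bsub>N\<^esub>" "\<zero>\<^bsub>N\<^esub>"] by (simp add: a_minus_def)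
qed

lemma module_minus_eq_zeroD:
  assumes "module K N" "x \<in> carrier N" "y \<in> carrier N" "x \<ominus>\<^bsub>N\<^esub> y = \<zero>\<^bsub>N\<^esub>"
  shows "x = y"
proof -
  interpret N: module K N by fact
  have "(x \<ominus>\<^bsub>N\<^esub> y) \<oplus>\<^bsub>N\<^esub> y = x"
    using assms(2,3) by (simp add: a_minus_def N.a_assoc N.l_neg)
  then show ?thesis using assms by simp
qed

text \<open>The maps \<open>L p\<close> and \<open>D p\<close> make the sum of the
  \<open>X p\<close> a direct summand of \<open>Y\<close> as a complex: \<open>D\<close> after
  \<open>L\<close> is the identity matrix, and the sum of \<open>L p\<close> after
  \<open>D p\<close> is the identity on the kernel of \<open>r\<close>. Such equations between
  cochain maps survive in cohomology, whereas a bare short exact sequence of complexes would only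
  yield a long exact one. Of the section \<open>j\<close> just linearity is asked, since a
  compatible section can be built from it.\<close>

lemma split_exact_cohomology:
  fixes K :: "'k ring" and X :: "'i \<Rightarrow> ('k, 'x) cochains" and Y :: "('k, 'y) cochains"
    and Z :: "('k, 'z) cochains"
  assumes P: "finite P"
    and cX: "\<And>p. p \<in> P \<Longrightarrow> cochain_complex K (X p)"
    and cY: "cochain_complex K Y" and cZ: "cochain_complex K Z"
    and L: "\<And>p. p \<in> P \<Longrightarrow> cochain_map K (X p) Y (L p)"
    and D: "\<And>p. p \<in> P \<Longrightarrow> cochain_map K Y (X p) (D p)"
    and r: "cochain_map K Y Z r"
    and j: "\<And>n. linmap K (deg Z n) (deg Y n) (j n)"
    and DL: "\<And>p q n e. p \<in> P \<Longrightarrow> q \<in> P \<Longrightarrow> e \<in> carrier (deg (X q) n) \<Longrightarrow>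
      D p n (L q n e) = (if p = q then e else \<zero>\<^bsub>deg (X p) n\<^esub>)"
    and rL: "\<And>p n e. p \<in> P \<Longrightarrow> e \<in> carrier (deg (X p) n) \<Longrightarrow> r n (L p n e) = \<zero>\<^bsub>deg Z n\<^esub>"
    and LD: "\<And>n c. c \<in> carrier (deg Y n) \<Longrightarrow> r n c = \<zero>\<^bsub>deg Z n\<^esub> \<Longrightarrow>
      finsum (deg Y n) (\<lambda>p. L p n (D p n c)) P = c"
    and rj: "\<And>n z. z \<in> carrier (deg Z n) \<Longrightarrow> r n (j n z) = z"
  shows "split_exact K (family_product P (\<lambda>p. cohomology (X p) n)) (cohomology Y n) (cohomology Z n)
    (\<lambda>e. finsum (cohomology Y n) (\<lambda>p. coh_map Y n (L p n) (e p)) P) (coh_map Z n (r n))"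
proof -
  interpret MY: module K "deg Y i" for i by (rule cochain_complexD[OF cY])
  interpret MZ: module K "deg Z i" for i by (rule cochain_complexD[OF cZ])
  interpret HY: module K "cohomology Y n" by (rule module_cohomology[OF cY])
  interpret HZ: module K "cohomology Z n" by (rule module_cohomology[OF cZ])
  have HX: "module K (cohomology (X p) n)" if "p \<in> P" for p by (rule module_cohomology[OF cX[OF that]])
  have mX: "module K (deg (X p) n)" if "p \<in> P" for p n by (rule cochain_complexD[OF cX[OF that]])
  let ?E = "family_product P (\<lambda>p. cohomology (X p) n)"
  let ?l = "\<lambda>e. finsum (cohomology Y n) (\<lambda>p. coh_map Y n (L p n) (e p)) P"
  let ?r = "coh_map Z n (r n)"
  have HL: "linmap K (cohomology (X p) n) (cohomology Y n) (coh_map Y n (L p n))" if "p \<in> P" for p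
    by (rule linmap_coh_map[OF cX[OF that] cY L[OF that]])
  have HD: "linmap K (cohomology Y n) (cohomology (X p) n) (coh_map (X p) n (D p n))" if "p \<in> P" for p
    by (rule linmap_coh_map[OF cY cX[OF that] D[OF that]])
  have Hr: "linmap K (cohomology Y n) (cohomology Z n) ?r"
    by (rule linmap_coh_map[OF cY cZ r])
  have mE: "module K ?E" by (rule module_family_product) (auto intro: HX module.axioms(1)[OF cochain_complexD(1)[OF cY]])
  have ll: "linmap K ?E (cohomology Y n) ?l"
  proof (rule linmap_finsum_fun)
    fix p assume p: "p \<in> P"
    show "linmap K ?E (cohomology Y n) (\<lambda>e. coh_map Y n (L p n) (e p))"
      by (rule linmap_comp[OF linmap_family_product_proj[OF p, where F="\<lambda>p. cohomology (X p) n"] HL[OF p]])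
  qed (rule HY.module_axioms)
  have HLc: "coh_map Y n (L p n) (e p) \<in> carrier (cohomology Y n)" if "e \<in> carrier ?E" "p \<in> P" for e p
    using linmap_closed[OF HL] that by auto

  \<comment> \<open>The matrix identity for \<open>D\<close> and \<open>L\<close> descends to
    classes by evaluation on a representing cocycle.\<close>
  have DLc: "coh_map (X p) n (D p n) (coh_map Y n (L q n) c) =
      (if p = q then c else \<zero>\<^bsub>cohomology (X p) n\<^esub>)"
    if pq: "p \<in> P" "q \<in> P" and c: "c \<in> carrier (cohomology (X q) n)" for p q c
  proof -
    obtain z where z: "c = coh_class (X q) n z" "z \<in> carrier (cocycles (X q) n)"
      using c by (auto simp: carrier_cohomology[OF cX[OF pq(2)]] simp del: cocycles_simps(4))
    have "coh_map (X p) n (D p n) (coh_map Y n (L q n) c) = coh_class (X p) n (D p n (L q n z))"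
      using z pq by (simp add: coh_map_class[OF cX cY L] coh_map_class[OF cY cX D]
          cochain_map_cocycles[OF cX cY L] del: cocycles_simps(4))
    then show ?thesis using z pq
      by (auto simp: DL zero_cohomology[OF cX])
  qed
  have rLc: "?r (coh_map Y n (L p n) c) = \<zero>\<^bsub>cohomology Z n\<^esub>"
    if p: "p \<in> P" and c: "c \<in> carrier (cohomology (X p) n)" for p c
  proof -
    obtain z where z: "c = coh_class (X p) n z" "z \<in> carrier (cocycles (X p) n)"
      using c by (auto simp: carrier_cohomology[OF cX[OF p]] simp del: cocycles_simps(4))
    have "?r (coh_map Y n (L p n) c) = coh_class Z n (r n (L p n z))"
      using z p by (simp add: coh_map_class[OF cX cY L] coh_map_class[OF cY cZ r]
          cochain_map_cocycles[OF cX cY L] del: cocycles_simps(4))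
    then show ?thesis using z p by (auto simp: rL zero_cohomology[OF cZ])
  qed

  have inj: "inj_on ?l (carrier ?E)"
  proof (rule inj_onI)
    \<comment> \<open>\<open>D p\<close> recovers coordinate \<open>p\<close> of \<open>e\<close>:
      in the sum over \<open>q\<close> only \<open>q = p\<close> survives.\<close>
    have D_l: "coh_map (X p) n (D p n) (?l e) = e p" if p: "p \<in> P" and e: "e \<in> carrier ?E" for p e
    proof -
      interpret Hp: module K "cohomology (X p) n" by (rule HX[OF p])
      have ep: "e q \<in> carrier (cohomology (X q) n)" if "q \<in> P" for q using e that by auto
      have "coh_map (X p) n (D p n) (?l e) =
          finsum (cohomology (X p) n) (\<lambda>q. coh_map (X p) n (D p n) (coh_map Y n (L q n) (e q))) P"
        by (rule linmap_finsum[OF HD[OF p] HY.module_axioms Hp.module_axioms HLc[OF e]])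
      also have "\<dots> = finsum (cohomology (X p) n) (\<lambda>q. if p = q then e p else \<zero>\<^bsub>cohomology (X p) n\<^esub>) P"
        using ep[OF p] ep by (intro Hp.finsum_cong' refl) (auto simp: DLc p)
      also have "\<dots> = e p"
        using Hp.finsum_singleton[OF p P, of "\<lambda>_. e p"] ep[OF p] by simp
      finally show ?thesis .
    qed
    fix e e' assume e: "e \<in> carrier ?E" "e' \<in> carrier ?E" and eq: "?l e = ?l e'"
    show "e = e'"
      using D_l[OF _ e(1)] D_l[OF _ e(2)] eq e by (auto intro!: PiE_ext[where k=P])
  qed

  \<comment> \<open>The sum of the \<open>L p m (D p m z)\<close> projects onto the kernel of
    \<open>r\<close>. \<open>E\<close> is the complementary projection; as a difference of cochain
    maps it is again one.\<close>
  define E where "E m z = z \<ominus>\<^bsub>deg Y m\<^esub> finsum (deg Y m) (\<lambda>p. L p m (D p m z)) P" for m z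
  have id: "cochain_map K Y Y (\<lambda>m z. z)" by (simp add: cochain_map_def linmap_id)
  have E: "cochain_map K Y Y E"
    unfolding E_def
    by (intro cochain_map_minus cochain_map_finsum cY id cochain_map_comp[OF D L])
  have LDc: "L p m (D p m z) \<in> carrier (deg Y m)" if "z \<in> carrier (deg Y m)" "p \<in> P" for p m z
    using linmap_closed[OF cochain_mapD(1)[OF cochain_map_comp[OF D L]]] that by auto
  have minus_self: "z \<ominus>\<^bsub>deg Y m\<^esub> z = \<zero>\<^bsub>deg Y m\<^esub>" if "z \<in> carrier (deg Y m)" for z m
    using that by (simp add: a_minus_def MY.r_neg)
  have E_zero: "E m z = \<zero>\<^bsub>deg Y m\<^esub>" if "z \<in> carrier (deg Y m)" "r m z = \<zero>\<^bsub>deg Z m\<^esub>" for z m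
    using LD[OF that] that by (simp add: E_def minus_self)
  have rE: "r m (E m z) = r m z" if z: "z \<in> carrier (deg Y m)" for z m
  proof -
    have "r m (finsum (deg Y m) (\<lambda>p. L p m (D p m z)) P) = finsum (deg Z m) (\<lambda>p. r m (L p m (D p m z))) P"
      by (rule linmap_finsum[OF cochain_mapD(1)[OF r]]) (auto intro: LDc[OF z] MY.module_axioms MZ.module_axioms)
    also have "\<dots> = finsum (deg Z m) (\<lambda>p. \<zero>\<^bsub>deg Z m\<^esub>) P"
      using linmap_closed[OF cochain_mapD(1)[OF D]] z by (intro MZ.finsum_cong' refl) (auto simp: rL)
    finally have "r m (finsum (deg Y m) (\<lambda>p. L p m (D p m z)) P) = \<zero>\<^bsub>deg Z m\<^esub>" by simp
    moreover have "r m (E m z) = r m z \<ominus>\<^bsub>deg Z m\<^esub> r m (finsum (deg Y m) (\<lambda>p. L p m (D p m z)) P)"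
      unfolding E_def using z LDc[OF z]
      by (intro linmap_minus[OF cochain_mapD(1)[OF r]])
        (auto intro!: MY.module_axioms MZ.module_axioms MY.finsum_closed)
    moreover have "r m z \<ominus>\<^bsub>deg Z m\<^esub> \<zero>\<^bsub>deg Z m\<^esub> = r m z"
      by (rule module_minus_zero[OF MZ.module_axioms linmap_closed[OF cochain_mapD(1)[OF r] z]])
    ultimately show ?thesis by simp
  qed
  text \<open>\<open>j\<close> need not commute with the differentials, but the defect lies in the kernel of \<open>r\<close>,
    which \<open>E\<close> annihilates.\<close>
  have S: "cochain_map K Z Y (\<lambda>m z. E m (j m z))"
    unfolding cochain_map_def
  proof (intro conjI allI ballI)
    fix m z assume z: "z \<in> carrier (deg Z m)"
    note dY = linmap_closed[OF cochain_complexD(2)[OF cY]] and dZ = linmap_closed[OF cochain_complexD(2)[OF cZ]]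
    have c: "j m z \<in> carrier (deg Y m)" "j (Suc m) (diff Z m z) \<in> carrier (deg Y (Suc m))"
        "diff Y m (j m z) \<in> carrier (deg Y (Suc m))"
      using linmap_closed[OF j] dY dZ z by auto
    let ?c = "j (Suc m) (diff Z m z) \<ominus>\<^bsub>deg Y (Suc m)\<^esub> diff Y m (j m z)"
    have "r (Suc m) ?c = r (Suc m) (j (Suc m) (diff Z m z)) \<ominus>\<^bsub>deg Z (Suc m)\<^esub> r (Suc m) (diff Y m (j m z))"
      by (rule linmap_minus[OF cochain_mapD(1)[OF r] MY.module_axioms MZ.module_axioms c(2,3)])
    also have "\<dots> = \<zero>\<^bsub>deg Z (Suc m)\<^esub>"
      using c z dZ by (simp add: cochain_mapD(2)[OF r] rj a_minus_def MZ.r_neg)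
    finally have "E (Suc m) ?c = \<zero>\<^bsub>deg Y (Suc m)\<^esub>" using c by (intro E_zero) auto
    then have "E (Suc m) (j (Suc m) (diff Z m z)) = E (Suc m) (diff Y m (j m z))"
      using linmap_minus[OF cochain_mapD(1)[OF E] MY.module_axioms MY.module_axioms c(2,3)]
        linmap_closed[OF cochain_mapD(1)[OF E]] c
      by - (rule module_minus_eq_zeroD[OF MY.module_axioms], auto)
    then show "E (Suc m) (j (Suc m) (diff Z m z)) = diff Y m (E m (j m z))"
      by (simp only: cochain_mapD(2)[OF E c(1)])
  qed (intro linmap_comp[OF j] cochain_mapD(1)[OF E])
  have rS: "r m (E m (j m z)) = z" if "z \<in> carrier (deg Z m)" for m z
    using rE linmap_closed[OF j] that rj by simp

  let ?s = "coh_map Y n (\<lambda>z. E n (j n z))"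
  have ls: "linmap K (cohomology Z n) (cohomology Y n) ?s"
    by (rule linmap_coh_map[OF cZ cY S])
  have rs: "?r (?s c) = c" if c: "c \<in> carrier (cohomology Z n)" for c
  proof -
    obtain z where z: "c = coh_class Z n z" "z \<in> carrier (cocycles Z n)"
      using c by (auto simp: carrier_cohomology[OF cZ] simp del: cocycles_simps(4))
    have "?r (?s c) = coh_class Z n (r n (E n (j n z)))"
      using z by (simp add: coh_map_class[OF cZ cY S] coh_map_class[OF cY cZ r]
          cochain_map_cocycles[OF cZ cY S] del: cocycles_simps(4))
    then show ?thesis using z rS by simp
  qed
  have surj: "?r ` carrier (cohomology Y n) = carrier (cohomology Z n)"
  proof
    show "carrier (cohomology Z n) \<subseteq> ?r ` carrier (cohomology Y n)"
      using linmap_closed[OF ls] rs by (metis imageI subsetI)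
  qed (use linmap_closed[OF Hr] in blast)

  \<comment> \<open>The image of a representative under \<open>r\<close> vanishes only in
    cohomology. The representative is changed by a coboundary until its image is zero as a cochain;
    then \<open>LD\<close> applies.\<close>
  have ker: "y \<in> ?l ` carrier ?E"
    if y: "y \<in> carrier (cohomology Y n)" "?r y = \<zero>\<^bsub>cohomology Z n\<^esub>" for y
  proof -
    obtain z where z: "y = coh_class Y n z" "z \<in> carrier (cocycles Y n)"
      using y by (auto simp: carrier_cohomology[OF cY] simp del: cocycles_simps(4))
    have "r n z \<in> coboundaries Z n"
      using y z linmap_closed[OF cochain_mapD(1)[OF r]]
      by (auto simp: coh_map_class[OF cY cZ r] coh_class_eq_zero_iff[OF cZ])
    then obtain z' where z': "z' \<in> carrier (cocycles Y n)" "y = coh_class Y n z'" "r n z' = \<zero>\<^bsub>deg Z n\<^esub>"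
    proof (cases n)
      \<comment> \<open>In degree zero the only coboundary is zero, so \<open>z\<close> itself
        serves.\<close>
      case 0
      then show ?thesis using that z \<open>r n z \<in> _\<close> by (auto simp: coboundaries_def)
    next
      case (Suc m)
      then obtain w where w: "w \<in> carrier (deg Z m)" "r n z = diff Z m w"
        using \<open>r n z \<in> _\<close> by (auto simp: coboundaries_def)
      \<comment> \<open>As \<open>r\<close> commutes with the differentials and \<open>j\<close> is
        a section, \<open>r\<close> sends this coboundary to \<open>diff Z m w\<close>, which is
        \<open>r n z\<close>.\<close>
      let ?b = "diff Y m (j m w)"
      have jw: "j m w \<in> carrier (deg Y m)" using linmap_closed[OF j] w by simp
      then have b: "?b \<in> coboundaries Y n" by (auto simp: coboundaries_def Suc)
      then have bc: "?b \<in> carrier (cocycles Y n)" using coboundaries_subset[OF cY] by blast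
      let ?z = "z \<ominus>\<^bsub>deg Y n\<^esub> ?b"
      have "z \<ominus>\<^bsub>deg Y n\<^esub> ?z = ?b"
        using z(2) bc by (simp add: a_minus_def MY.minus_add MY.a_assoc[symmetric] MY.r_neg)
      then have "y = coh_class Y n ?z"
        using z bc b by (subst z(1), subst coh_class_eq_iff[OF cY]) auto
      moreover have "?z \<in> carrier (cocycles Y n)"
        using z(2) bc MZ.r_neg linmap_minus[OF cochain_complexD(2)[OF cY] MY.module_axioms MY.module_axioms, of z n ?b]
        by (simp add: minus_self)
      moreover have "r n ?z = r n z \<ominus>\<^bsub>deg Z n\<^esub> r n ?b"
        using z bc by (intro linmap_minus[OF cochain_mapD(1)[OF r] MY.module_axioms MZ.module_axioms]) auto
      then have "r n ?z = \<zero>\<^bsub>deg Z n\<^esub>"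
        using w jw cochain_mapD(2)[OF r jw] rj linmap_closed[OF cochain_complexD(2)[OF cZ] w(1)]
        by (simp add: Suc a_minus_def MZ.r_neg)
      ultimately show ?thesis using that by blast
    qed
    have z'c: "z' \<in> carrier (deg Y n)" using z' by simp
    have Dz: "D p n z' \<in> carrier (cocycles (X p) n)" if "p \<in> P" for p
      by (rule cochain_map_cocycles[OF cY cX[OF that] D[OF that] z'(1)])
    \<comment> \<open>The preimage is given by its coordinates, which are classes because
      \<open>D p\<close> preserves cocycles.\<close>
    let ?e = "\<lambda>p\<in>P. coh_class (X p) n (D p n z')"
    have e: "?e \<in> carrier ?E"
      using linmap_closed[OF linmap_coh_class[OF cX]] Dz by (auto simp del: cocycles_simps)
    have "y = coh_class Y n (finsum (deg Y n) (\<lambda>p. L p n (D p n z')) P)"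
      using z' LD[OF z'c] by simp
    also have "\<dots> = finsum (cohomology Y n) (\<lambda>p. coh_class Y n (L p n (D p n z'))) P"
      by (rule coh_class_finsum[OF cY cochain_map_cocycles[OF cX cY L Dz]])
    also have "\<dots> = ?l ?e"
      using HLc[OF e] by (intro HY.finsum_cong' refl) (auto simp: coh_map_class[OF cX cY L Dz])
    finally show ?thesis using e by blast
  qed
  have im: "?l ` carrier ?E \<subseteq> {y \<in> carrier (cohomology Y n). ?r y = \<zero>\<^bsub>cohomology Z n\<^esub>}"
  proof (rule image_subsetI)
    fix e assume e: "e \<in> carrier ?E"
    have "?r (?l e) = finsum (cohomology Z n) (\<lambda>p. ?r (coh_map Y n (L p n) (e p))) P"
      by (rule linmap_finsum[OF Hr HY.module_axioms HZ.module_axioms HLc[OF e]])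
    also have "\<dots> = finsum (cohomology Z n) (\<lambda>p. \<zero>\<^bsub>cohomology Z n\<^esub>) P"
      using e by (intro HZ.finsum_cong' refl rLc) auto
    finally show "?l e \<in> {y \<in> carrier (cohomology Y n). ?r y = \<zero>\<^bsub>cohomology Z n\<^esub>}"
      using linmap_closed[OF ll e] by simp
  qed
  have "?l ` carrier ?E = {y \<in> carrier (cohomology Y n). ?r y = \<zero>\<^bsub>cohomology Z n\<^esub>}"
    by (intro equalityI im) (use ker in blast)
  then show ?thesis
    unfolding split_exact_def
    by (intro conjI exI[of _ ?s] ballI)
      (assumption | rule mE HY.module_axioms HZ.module_axioms ll Hr inj surj ls rs)+
qed

text \<open>Exactness and the splitting are conjugated by isomorphisms at all three places. The
  identifications of Ext and of HH with the cohomology of cones are fed in here.\<close>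

lemma split_exact_transport:
  assumes se: "split_exact K X Y Z l r"
    and X': "module K X'" "lin_iso K X' X \<theta>"
    and Y': "module K Y'" "lin_iso K Y' Y \<phi>"
    and Z': "module K Z'" "lin_iso K Z' Z \<phi>'"
  shows "split_exact K X' Y' Z' (\<lambda>x. inv_into (carrier Y') \<phi> (l (\<theta> x)))
    (\<lambda>y. inv_into (carrier Z') \<phi>' (r (\<phi> y)))"
proof -
  let ?i = "inv_into (carrier Y') \<phi>" and ?i' = "inv_into (carrier Z') \<phi>'"
  note se = se[unfolded split_exact_def]
  have l: "linmap K X Y l" and r: "linmap K Y Z r" and mX: "module K X" and mY: "module K Y" and mZ: "module K Z"
    using se by auto
  have lr: "r (l x) = \<zero>\<^bsub>Z\<^esub>" if "x \<in> carrier X" for x using se that by blast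
  obtain s where s: "linmap K Z Y s" "\<And>z. z \<in> carrier Z \<Longrightarrow> r (s z) = z" using se by blast
  have iso: "linmap K X' X \<theta>" "linmap K Y' Y \<phi>" "linmap K Z' Z \<phi>'"
      "bij_betw \<theta> (carrier X') (carrier X)" "bij_betw \<phi> (carrier Y') (carrier Y)" "bij_betw \<phi>' (carrier Z') (carrier Z)"
    using X' Y' Z' by (auto simp: lin_iso_def)
  have inv: "linmap K Y Y' ?i" "linmap K Z Z' ?i'" "bij_betw ?i (carrier Y) (carrier Y')" "bij_betw ?i' (carrier Z) (carrier Z')"
    using lin_iso_inv_into[OF Y'(2,1)] lin_iso_inv_into[OF Z'(2,1)] by (auto simp: lin_iso_def)
  have f: "\<phi> (?i y) = y" if "y \<in> carrier Y" for y using iso(5) that by (metis bij_betw_inv_into_right)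
  have f': "?i (\<phi> y) = y" if "y \<in> carrier Y'" for y using iso(5) that by (metis bij_betw_inv_into_left)
  have g': "?i' (\<phi>' z) = z" if "z \<in> carrier Z'" for z using iso(6) that by (metis bij_betw_inv_into_left)
  \<comment> \<open>The kernel condition is stated in \<open>Z'\<close>, so the inverse of
    \<open>\<phi>'\<close> has to reflect zero.\<close>
  have i'0: "?i' z = \<zero>\<^bsub>Z'\<^esub> \<longleftrightarrow> z = \<zero>\<^bsub>Z\<^esub>" if "z \<in> carrier Z" for z
    using linmap_zero[OF inv(2) mZ Z'(1)] inv(4) that mZ
    by (metis abelian_group_def abelian_monoid.zero_closed bij_betw_imp_inj_on inj_onD module_def)
  let ?L = "\<lambda>x. ?i (l (\<theta> x))" and ?R = "\<lambda>y. ?i' (r (\<phi> y))"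
  have L: "linmap K X' Y' ?L" by (rule linmap_comp[OF iso(1) linmap_comp[OF l inv(1)]])
  have R: "linmap K Y' Z' ?R" by (rule linmap_comp[OF iso(2) linmap_comp[OF r inv(2)]])
  have \<theta>c: "\<theta> x \<in> carrier X" if "x \<in> carrier X'" for x using linmap_closed[OF iso(1) that] .
  have lc: "l x \<in> carrier Y" if "x \<in> carrier X" for x using linmap_closed[OF l that] .
  have "inj_on ?L (carrier X')"
  proof (rule inj_onI)
    fix x y assume xy: "x \<in> carrier X'" "y \<in> carrier X'" "?L x = ?L y"
    then have "l (\<theta> x) = l (\<theta> y)" using f \<theta>c lc by metis
    then have "\<theta> x = \<theta> y" using se \<theta>c xy by (auto dest: inj_onD)
    then show "x = y" using iso(4) xy by (auto simp: bij_betw_def dest: inj_onD)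
  qed
  moreover have "?L ` carrier X' = {y \<in> carrier Y'. ?R y = \<zero>\<^bsub>Z'\<^esub>}"
  proof (intro equalityI subsetI)
    fix y assume "y \<in> ?L ` carrier X'"
    then obtain x where x: "x \<in> carrier X'" "y = ?L x" by blast
    then have "r (\<phi> y) = \<zero>\<^bsub>Z\<^esub>" using f \<theta>c lc lr by simp
    then show "y \<in> {y \<in> carrier Y'. ?R y = \<zero>\<^bsub>Z'\<^esub>}"
      using x linmap_closed[OF L] linmap_zero[OF inv(2) mZ Z'(1)] by simp
  next
    fix y assume y: "y \<in> {y \<in> carrier Y'. ?R y = \<zero>\<^bsub>Z'\<^esub>}"
    then have py: "\<phi> y \<in> carrier Y" using linmap_closed[OF iso(2)] by simp
    then have "r (\<phi> y) = \<zero>\<^bsub>Z\<^esub>" using y i'0 linmap_closed[OF r] by simp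
    then obtain x where x: "x \<in> carrier X" "\<phi> y = l x" using se py by blast
    then obtain x' where "x' \<in> carrier X'" "x = \<theta> x'" using iso(4) by (auto simp: bij_betw_def)
    then show "y \<in> ?L ` carrier X'" using x f'[of y] y by (intro image_eqI[of _ _ x']) auto
  qed
  moreover have s': "linmap K Z' Y' (\<lambda>z. ?i (s (\<phi>' z)))"
    by (rule linmap_comp[OF iso(3) linmap_comp[OF s(1) inv(1)]])
  moreover have rs': "?R (?i (s (\<phi>' z))) = z" if "z \<in> carrier Z'" for z
    using that f s(2) g' linmap_closed[OF s(1)] linmap_closed[OF iso(3)] by simp
  moreover have "?R ` carrier Y' = carrier Z'"
    using linmap_closed[OF R] linmap_closed[OF s'] rs' by force
  ultimately show ?thesis
    unfolding split_exact_def using X' Y' Z' L R by blast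
qed

text \<open>Bridges the sum over blocks produced by the splitting argument and the maps
  \<open>l_map\<close> and \<open>r_map\<close> of the theorem, which are compared with it on
  carriers.\<close>

lemma split_exact_cong:
  assumes "split_exact K X Y Z l r" "\<And>x. x \<in> carrier X \<Longrightarrow> l' x = l x"
    "\<And>y. y \<in> carrier Y \<Longrightarrow> r' y = r y"
  shows "split_exact K X Y Z l' r'"
proof -
  note se = assms(1)[unfolded split_exact_def]
  have "linmap K X Y l'" "linmap K Y Z r'" using se assms(2,3) by (auto intro: linmap_cong)
  moreover have "inj_on l' (carrier X)" "l' ` carrier X = l ` carrier X" "r' ` carrier Y = r ` carrier Y"
    using se assms(2,3) by (auto simp: inj_on_def)
  moreover obtain s where s: "linmap K Z Y s" "\<And>z. z \<in> carrier Z \<Longrightarrow> r (s z) = z" using se by blast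
  then have "\<forall>z\<in>carrier Z. r' (s z) = z" using assms(3) linmap_closed by metis
  ultimately show ?thesis unfolding split_exact_def using se assms(2,3) s(1) by auto
qed

section \<open>The Hochschild complex\<close>

lemma finsum_lessThan_Suc:
  assumes "module K N" "\<And>i. i < Suc n \<Longrightarrow> f i \<in> carrier N"
  shows "finsum N f {..<Suc n} = f n \<oplus>\<^bsub>N\<^esub> finsum N f {..<n}"
proof -
  interpret N: module K N by fact
  show ?thesis using assms(2) unfolding lessThan_Suc by (intro N.finsum_insert) auto
qed

text \<open>Terms cancel in pairs: the face identity matches \<open>(i, j)\<close> with
  \<open>j < i\<close> against \<open>(j, i - 1)\<close>, whose total sign is opposite. The
  induction adds one row and one column to the array of terms; the two carry the same values with
  opposite signs.\<close>

lemma alternating_double_sum_zero: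
  fixes K :: "'k ring"
  assumes N: "module K N" and c: "\<And>i j. i < Suc r \<Longrightarrow> j < r \<Longrightarrow> c i j \<in> carrier N"
    and face: "\<And>i j. j < i \<Longrightarrow> i < Suc r \<Longrightarrow> c i j = c j (i - 1)"
  shows "finsum N (\<lambda>i. signed N i (finsum N (\<lambda>j. signed N j (c i j)) {..<r})) {..<Suc r} = \<zero>\<^bsub>N\<^esub>"
  using c face
proof (induction r)
  interpret N: module K N by (rule N)
  case 0
  then show ?case using signed_def by (simp add: finsum_lessThan_Suc[OF N] signed_def)
next
  interpret N: module K N by (rule N)
  case (Suc r)
  note sc = signed_closed[OF N]
  let ?S = "\<lambda>i k. finsum N (\<lambda>j. signed N j (c i j)) {..<k}"
  have cS: "?S i k \<in> carrier N" if "i < Suc (Suc r)" "k \<le> Suc r" for i k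
    using that Suc.prems(1) by (intro N.finsum_closed) (auto intro!: sc)
  \<comment> \<open>The new column \<open>j = r\<close> of the enlarged array.\<close>
  let ?t = "finsum N (\<lambda>i. signed N (i + r) (c i r)) {..<Suc r}"
  have tc: "?t \<in> carrier N" using Suc.prems(1) by (intro N.finsum_closed) (auto intro!: sc)
  \<comment> \<open>By the face identity the new row \<open>i = Suc r\<close> repeats the entries of
    the new column, with every sign changed.\<close>
  have last: "signed N (Suc r) (?S (Suc r) (Suc r)) = \<ominus>\<^bsub>N\<^esub> ?t"
  proof -
    have "signed N (Suc r) (?S (Suc r) (Suc r)) =
        finsum N (\<lambda>j. signed N (Suc r) (signed N j (c (Suc r) j))) {..<Suc r}"
      by (rule linmap_finsum[OF linmap_signed_id[OF N] N N]) (auto intro!: sc Suc.prems(1))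
    also have "\<dots> = finsum N (\<lambda>j. \<ominus>\<^bsub>N\<^esub> signed N (j + r) (c j r)) {..<Suc r}"
    proof (intro N.finsum_cong' refl)
      fix j assume j: "j \<in> {..<Suc r}"
      then have "c (Suc r) j = c j r" using Suc.prems(2)[of j "Suc r"] by simp
      then show "signed N (Suc r) (signed N j (c (Suc r) j)) = \<ominus>\<^bsub>N\<^esub> signed N (j + r) (c j r)"
        using j Suc.prems(1)[of j r]
        by (simp add: signed_signed[OF N] signed_Suc[OF N, symmetric] add.commute)
    qed (use Suc.prems(1) sc in auto)
    also have "\<dots> = \<ominus>\<^bsub>N\<^esub> ?t"
      using linmap_finsum[OF linmap_a_inv_fun[OF linmap_id N] N N, where S="{..<Suc r}" and g="\<lambda>i. signed N (i + r) (c i r)"]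
        Suc.prems(1) sc by simp
    finally show ?thesis .
  qed
  have "finsum N (\<lambda>i. signed N i (?S i (Suc r))) {..<Suc r} =
      finsum N (\<lambda>i. signed N (i + r) (c i r) \<oplus>\<^bsub>N\<^esub> signed N i (?S i r)) {..<Suc r}"
  proof (intro N.finsum_cong' refl)
    fix i assume i: "i \<in> {..<Suc r}"
    have "?S i (Suc r) = signed N r (c i r) \<oplus>\<^bsub>N\<^esub> ?S i r"
      using i Suc.prems(1) by (intro finsum_lessThan_Suc[OF N]) (auto intro!: sc)
    then show "signed N i (?S i (Suc r)) = signed N (i + r) (c i r) \<oplus>\<^bsub>N\<^esub> signed N i (?S i r)"
      using i Suc.prems(1)[of i r] cS[of i r]
      by (simp add: linmap_add[OF linmap_signed_id[OF N]] sc signed_signed[OF N])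
  qed (use Suc.prems(1) cS sc in auto)
  also have "\<dots> = ?t \<oplus>\<^bsub>N\<^esub> finsum N (\<lambda>i. signed N i (?S i r)) {..<Suc r}"
    using Suc.prems(1) cS sc by (intro N.finsum_addf) auto
  \<comment> \<open>What remains is the smaller array, zero by induction.\<close>
  also have "\<dots> = ?t"
    using Suc.IH Suc.prems tc by simp
  finally have "finsum N (\<lambda>i. signed N i (?S i (Suc r))) {..<Suc r} = ?t" .
  moreover have "finsum N (\<lambda>i. signed N i (?S i (Suc r))) {..<Suc (Suc r)} =
      signed N (Suc r) (?S (Suc r) (Suc r)) \<oplus>\<^bsub>N\<^esub> finsum N (\<lambda>i. signed N i (?S i (Suc r))) {..<Suc r}"
    using cS by (intro finsum_lessThan_Suc[OF N]) (auto intro!: sc)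
  ultimately show ?case using last tc by (simp add: N.l_neg)
qed

lemma assoc_algebraD:
  assumes "assoc_algebra K T"
  shows "module K T" "ring T"
    "a \<in> carrier T \<Longrightarrow> linmap K T T (\<lambda>x. a \<otimes>\<^bsub>T\<^esub> x)" "a \<in> carrier T \<Longrightarrow> linmap K T T (\<lambda>x. x \<otimes>\<^bsub>T\<^esub> a)"
  using assms ring.ring_simprules(5,13,23)[of T]
  by (auto simp: assoc_algebra_def intro!: linmapI)

lemma opp_simps [simp]:
  "carrier (opp T) = carrier T" "\<one>\<^bsub>opp T\<^esub> = \<one>\<^bsub>T\<^esub>" "\<zero>\<^bsub>opp T\<^esub> = \<zero>\<^bsub>T\<^esub>" "add (opp T) = add T"
  "smult (opp T) = smult T" "x \<otimes>\<^bsub>opp T\<^esub> y = y \<otimes>\<^bsub>T\<^esub> x"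
  by (simp_all add: opp_def)

lemma linmap_opp [simp]: "linmap K (opp T) N f = linmap K T N f"
  by (simp add: linmap_def)

lemma assoc_algebra_opp:
  assumes "assoc_algebra K T" shows "assoc_algebra K (opp T)"
proof -
  have m: "module K T" and r: "ring T" using assms by (auto simp: assoc_algebra_def)
  interpret T: ring T by (rule r)
  interpret M: module K T by (rule m)
  have "module K (opp T)"
    by (rule module_by_surjection[OF m, where f="\<lambda>x. x"]) auto
  moreover have "ring (opp T)"
  proof (rule ringI)
    show "abelian_group (opp T)" using \<open>module K (opp T)\<close> by (simp add: module_def)
    show "Group.monoid (opp T)" by (rule monoidI) (auto simp: T.m_assoc)
  qed (auto simp: T.l_distr T.r_distr)
  ultimately show ?thesis using assms by (simp add: assoc_algebra_def)
qed

section \<open>Words and their faces\<close>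

lemma tensor_words_update: "w \<in> tensor_words T r \<Longrightarrow> x \<in> carrier T \<Longrightarrow> w[i := x] \<in> tensor_words T r"
  by (auto simp: tensor_words_def dest: set_update_subset_insert[THEN subsetD])

lemma tensor_words_nth: "w \<in> tensor_words T r \<Longrightarrow> i < r \<Longrightarrow> w ! i \<in> carrier T"
  by (auto simp: tensor_words_def subset_iff)

lemma tensor_words_length: "w \<in> tensor_words T r \<Longrightarrow> length w = r"
  by (simp add: tensor_words_def)

lemma tensor_words_opp [simp]: "tensor_words (opp T) r = tensor_words T r"
  by (simp add: tensor_words_def)

lemma length_face: "length w = Suc r \<Longrightarrow> i < r \<Longrightarrow> length (face T i w) = r"
  by (simp add: face_def)

text \<open>A description by entries turns identities between faces into case distinctions on an
  index, without further manipulation of \<open>take\<close> and \<open>drop\<close>.\<close>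

lemma nth_face:
  assumes "length w = Suc r" "i < r" "k < r"
  shows "face T i w ! k = (if k < i then w ! k else if k = i then w ! i \<otimes>\<^bsub>T\<^esub> w ! Suc i else w ! Suc k)"
proof -
  consider "k < i" | "k = i" | d where "k = i + Suc d"
    by (metis less_iff_Suc_add linorder_neqE_nat add_Suc_right)
  then show ?thesis using assms by cases (auto simp: face_def nth_append)
qed

context
  fixes K :: "'k ring" and T :: "('k, 't) module"
  assumes T: "assoc_algebra K T"
begin

interpretation T: ring T by (rule assoc_algebraD(2)[OF T])

lemma face_closed:
  assumes "w \<in> tensor_words T (Suc r)" "i < r"
  shows "face T i w \<in> tensor_words T r"
  using assms length_face[of w r i T] nth_face[of w r i _ T] tensor_words_nth[OF assms(1)]
  by (auto simp: tensor_words_def in_set_conv_nth subset_iff)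

lemma face_face:
  assumes w: "w \<in> tensor_words T (Suc (Suc r))" and ij: "j < i" "i < Suc r"
  shows "face T j (face T i w) = face T (i - 1) (face T j w)"
proof (rule nth_equalityI)
  have l: "length w = Suc (Suc r)" using w by (simp add: tensor_words_def)
  have j: "j < r" using ij by simp
  obtain i' where i': "i = Suc i'" "j \<le> i'" "i' < r" using ij by (cases i) auto
  note f = length_face[of _ r, OF length_face[OF l]] nth_face[of _ r, OF length_face[OF l]]
    nth_face[OF l] tensor_words_nth[OF w]
  show "length (face T j (face T i w)) = length (face T (i - 1) (face T j w))" using i' j by (simp add: f)
  fix k assume "k < length (face T j (face T i w))"
  then have k: "k < r" using ij j by (simp add: f)
  \<comment> \<open>The position of \<open>k\<close> relative to the two merged places. Only
    \<open>k = j = i'\<close>, where three neighbours are multiplied together, needs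
    associativity.\<close>
  consider "k < j" | "k = j" "j < i'" | "k = j" "j = i'" | "j < k" "k < i'" | "j < k" "k = i'" | "i' < k"
    using i' by linarith
  then show "face T j (face T i w) ! k = face T (i - 1) (face T j w) ! k"
    using i' j k by cases (simp_all add: f T.m_assoc)
qed

text \<open>Changing one letter changes one letter of a face, and if that letter is among the two
  being merged, its new value is multiplied by its neighbour. Multiplication is linear, which is why
  multilinearity survives the differential.\<close>

lemma face_update:
  assumes w: "w \<in> tensor_words T (Suc r)" and i: "i < r" and j: "j < Suc r"
  shows "face T i (w[j := x]) =
    (if j < i then (face T i w)[j := x] else if j = i then (face T i w)[i := x \<otimes>\<^bsub>T\<^esub> w ! Suc i]
     else if j = Suc i then (face T i w)[i := w ! i \<otimes>\<^bsub>T\<^esub> x] else (face T i w)[j - 1 := x])"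
proof -
  have l: "length w = Suc r" using w by (simp add: tensor_words_def)
  then have l': "length (w[j := x]) = Suc r" by simp
  note f = length_face[OF l] nth_face[OF l] length_face[OF l'] nth_face[OF l']
  show ?thesis using i j l
    by (intro nth_equalityI) (auto simp: f nth_list_update)
qed

lemma linmap_face:
  assumes f: "\<And>v k. v \<in> tensor_words T r \<Longrightarrow> k < r \<Longrightarrow> linmap K T N (\<lambda>x. f (v[k := x]))"
    and w: "w \<in> tensor_words T (Suc r)" and i: "i < r" and j: "j < Suc r"
  shows "linmap K T N (\<lambda>x. f (face T i (w[j := x])))"
  unfolding face_update[OF w i j]
  using f[OF face_closed[OF w i]] linmap_comp[OF assoc_algebraD(3)[OF T] f[OF face_closed[OF w i] i]]
    linmap_comp[OF assoc_algebraD(4)[OF T] f[OF face_closed[OF w i] i]] i j tensor_words_nth[OF w]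
  by (cases "j < i"; cases "j = i"; cases "j = Suc i"; simp)

lemma face_outer_left:
  assumes w: "w \<in> tensor_words T (Suc r)" and i: "i < r" and t: "t \<in> carrier T"
  shows "face T i (w[0 := t \<otimes>\<^bsub>T\<^esub> w ! 0]) = (face T i w)[0 := t \<otimes>\<^bsub>T\<^esub> face T i w ! 0]"
  using i t tensor_words_nth[OF w] by (auto simp: face_update[OF w i] nth_face[OF tensor_words_length[OF w] i] T.m_assoc)

lemma face_outer_right:
  assumes w: "w \<in> tensor_words T (Suc r)" and i: "i < r" and t: "t \<in> carrier T"
  shows "face T i (w[r := w ! r \<otimes>\<^bsub>T\<^esub> t]) = (face T i w)[r - 1 := face T i w ! (r - 1) \<otimes>\<^bsub>T\<^esub> t]"
proof (cases "r = Suc i")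
  \<comment> \<open>This face multiplies the final two letters, so the outer factor enters a triple
    product.\<close>
  case True
  then show ?thesis using t tensor_words_nth[OF w] i
    by (simp add: face_update[OF w i] nth_face[OF tensor_words_length[OF w] i] T.m_assoc)
next
  case False
  then have "Suc (r - 1) = r" "r - 1 < r" "r - 1 \<noteq> i" "\<not> r - 1 < i" "r - Suc 0 \<noteq> i" using i by auto
  then show ?thesis using i False
    by (simp add: face_update[OF w i] nth_face[OF tensor_words_length[OF w] i])
qed

end

text \<open>Neighbours in the reversed word are neighbours in the word in opposite order, and
  \<open>opp T\<close> multiplies them back in the original order. The reflection of the face index
  is the source of the sign in \<open>iB\<close>.\<close>

lemma face_opp_rev:
  assumes "length w = Suc r" "j < r"
  shows "face (opp T) j (rev w) = rev (face T (r - 1 - j) w)"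
proof (rule nth_equalityI)
  have l: "length (rev w) = Suc r" using assms by simp
  have j: "r - 1 - j < r" using assms by simp
  have "length (face T (r - Suc j) w) = r" using length_face[OF assms(1), of "r - Suc j" T] assms(2) by simp
  note lf = this length_face[OF l assms(2), of "opp T"]
  show "length (face (opp T) j (rev w)) = length (rev (face T (r - 1 - j) w))" by (simp add: lf)
  fix k assume "k < length (face (opp T) j (rev w))"
  then have k: "k < r" by (simp add: lf)
  then have R: "rev (face T (r - 1 - j) w) ! k = face T (r - 1 - j) w ! (r - 1 - k)"
    using lf by (simp add: rev_nth)
  have rev: "rev w ! i = w ! (r - i)" if "i < Suc r" for i using that assms(1) by (simp add: rev_nth)
  have k': "r - 1 - k < r" using k by simp
  consider "k < j" | "k = j" | "j < k" by linarith
  then show "face (opp T) j (rev w) ! k = rev (face T (r - 1 - j) w) ! k"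
  proof cases
    case 1
    then have "\<not> r - 1 - k < r - 1 - j" "r - 1 - k \<noteq> r - 1 - j" "Suc (r - 1 - k) = r - k"
      using k assms(2) by linarith+
    then show ?thesis unfolding R nth_face[OF l assms(2) k] nth_face[OF assms(1) j k'] using 1 k by (simp add: rev)
  next
    case 2
    then have "Suc (r - 1 - j) = r - j" "r - 1 - j = r - Suc j" using k assms(2) by linarith+
    then show ?thesis unfolding R nth_face[OF l assms(2) k] nth_face[OF assms(1) j k'] using 2 k by (simp add: rev)
  next
    case 3
    then have "r - 1 - k < r - 1 - j" "r - 1 - k = r - Suc k" using k assms(2) by linarith+
    then show ?thesis unfolding R nth_face[OF l assms(2) k] nth_face[OF assms(1) j k'] using 3 k by (simp add: rev)
  qed
qed

text \<open>The part of a bimodule structure that makes cochain modules closed under their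
  operations and lets the outer actions pass through the alternating sum of the
  differential.\<close>

definition coefficients :: "'k ring \<Rightarrow> ('k, 't) module \<Rightarrow> ('k, 'l, 't, 't) bimod \<Rightarrow> bool" where
  "coefficients K T \<Lambda> \<longleftrightarrow> module K \<Lambda> \<and>
     (\<forall>t\<in>carrier T. linmap K \<Lambda> \<Lambda> (lact \<Lambda> t) \<and> linmap K \<Lambda> \<Lambda> (\<lambda>x. ract \<Lambda> x t))"

text \<open>The carrier stays folded on the right, so that facts about \<open>fun_module\<close>
  apply without unpacking multilinearity.\<close>

lemma deg_hochschild:
  "deg (hochschild K T \<Lambda>) n = fun_module (tensor_words T (n + 2)) \<Lambda> (carrier (deg (hochschild K T \<Lambda>) n))"
  by (simp add: hochschild_def)

lemma carrier_hochschild: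
  "f \<in> carrier (deg (hochschild K T \<Lambda>) n) \<longleftrightarrow>
     f \<in> tensor_words T (n + 2) \<rightarrow>\<^sub>E carrier \<Lambda> \<and> 
     (\<forall>w\<in>tensor_words T (n + 2). \<forall>i<n + 2. linmap K T \<Lambda> (\<lambda>x. f (w[i := x]))) \<and>
     (\<forall>w\<in>tensor_words T (n + 2). \<forall>t\<in>carrier T. f (w[0 := t \<otimes>\<^bsub>T\<^esub> w ! 0]) = lact \<Lambda> t (f w)) \<and>
     (\<forall>w\<in>tensor_words T (n + 2). \<forall>t\<in>carrier T. f (w[n + 1 := w ! (n + 1) \<otimes>\<^bsub>T\<^esub> t]) = ract \<Lambda> (f w) t)"
  by (auto simp: hochschild_def multilinear_def)

lemma hochschild_subset: "carrier (deg (hochschild K T \<Lambda>) n) \<subseteq> tensor_words T (n + 2) \<rightarrow>\<^sub>E carrier \<Lambda>"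
  by (auto simp: carrier_hochschild)

lemma diff_hochschild:
  "diff (hochschild K T \<Lambda>) n f = (\<lambda>w\<in>tensor_words T (n + 3).
     finsum \<Lambda> (\<lambda>i. signed \<Lambda> i (f (face T i w))) {..<n + 2})"
  by (simp add: hochschild_def lessThan_Suc_atMost)

context
  fixes K :: "'k ring" and T :: "('k, 't) module" and \<Lambda> :: "('k, 'l, 't, 't) bimod"
  assumes T: "assoc_algebra K T" and \<Lambda>: "coefficients K T \<Lambda>"
begin

interpretation T: ring T by (rule assoc_algebraD(2)[OF T])
interpretation L: module K \<Lambda> using \<Lambda> by (simp add: coefficients_def)

lemma coefficientsD:
  "module K \<Lambda>" "t \<in> carrier T \<Longrightarrow> linmap K \<Lambda> \<Lambda> (lact \<Lambda> t)" "t \<in> carrier T \<Longrightarrow> linmap K \<Lambda> \<Lambda> (\<lambda>x. ract \<Lambda> x t)"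
  using \<Lambda> by (auto simp: coefficients_def)

text \<open>All arguments occurring in the conditions are again words over \<open>T\<close>, so the
  conditions can be tested on the unrestricted function.\<close>

lemma restrict_in_hochschild:
  assumes "\<And>w. w \<in> tensor_words T (n + 2) \<Longrightarrow> f w \<in> carrier \<Lambda>"
    "\<And>w i. w \<in> tensor_words T (n + 2) \<Longrightarrow> i < n + 2 \<Longrightarrow> linmap K T \<Lambda> (\<lambda>x. f (w[i := x]))"
    "\<And>w t. w \<in> tensor_words T (n + 2) \<Longrightarrow> t \<in> carrier T \<Longrightarrow> f (w[0 := t \<otimes>\<^bsub>T\<^esub> w ! 0]) = lact \<Lambda> t (f w)"
    "\<And>w t. w \<in> tensor_words T (n + 2) \<Longrightarrow> t \<in> carrier T \<Longrightarrow> f (w[n + 1 := w ! (n + 1) \<otimes>\<^bsub>T\<^esub> t]) = ract \<Lambda> (f w) t"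
  shows "restrict f (tensor_words T (n + 2)) \<in> carrier (deg (hochschild K T \<Lambda>) n)"
  unfolding carrier_hochschild
proof (intro conjI ballI allI impI)
  fix w i assume w: "w \<in> tensor_words T (n + 2)" and i: "i < n + 2"
  show "linmap K T \<Lambda> (\<lambda>x. restrict f (tensor_words T (n + 2)) (w[i := x]))"
    by (rule linmap_cong[OF assms(2)[OF w i] assoc_algebraD(1)[OF T]])
      (use w in \<open>simp add: tensor_words_update\<close>)
qed (use assms in \<open>auto simp: tensor_words_update tensor_words_nth\<close>)

lemma module_hochschild: "module K (deg (hochschild K T \<Lambda>) n)"
proof (subst deg_hochschild, rule module_fun_module[OF coefficientsD(1) hochschild_subset])
  show "(\<lambda>w\<in>tensor_words T (n + 2). \<zero>\<^bsub>\<Lambda>\<^esub>) \<in> carrier (deg (hochschild K T \<Lambda>) n)"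
    by (rule restrict_in_hochschild)
      (auto simp: linmap_zero_fun[OF coefficientsD(1)] linmap_zero[OF coefficientsD(2) coefficientsD(1,1)]
        linmap_zero[OF coefficientsD(3) coefficientsD(1,1)])
next
  fix f g assume f: "f \<in> carrier (deg (hochschild K T \<Lambda>) n)" and g: "g \<in> carrier (deg (hochschild K T \<Lambda>) n)"
  have c: "f w \<in> carrier \<Lambda>" "g w \<in> carrier \<Lambda>" if "w \<in> tensor_words T (n + 2)" for w
    using f g hochschild_subset that by blast+
  show "(\<lambda>w\<in>tensor_words T (n + 2). f w \<oplus>\<^bsub>\<Lambda>\<^esub> g w) \<in> carrier (deg (hochschild K T \<Lambda>) n)"
    by (rule restrict_in_hochschild)
      (use f g in \<open>auto simp: c carrier_hochschild linmap_add[OF coefficientsD(2)] linmap_add[OF coefficientsD(3)]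
         intro!: linmap_plus_fun coefficientsD(1)\<close>)
next
  fix k f assume k: "k \<in> carrier K" and f: "f \<in> carrier (deg (hochschild K T \<Lambda>) n)"
  have c: "f w \<in> carrier \<Lambda>" if "w \<in> tensor_words T (n + 2)" for w
    using f hochschild_subset that by blast
  show "(\<lambda>w\<in>tensor_words T (n + 2). k \<odot>\<^bsub>\<Lambda>\<^esub> f w) \<in> carrier (deg (hochschild K T \<Lambda>) n)"
    by (rule restrict_in_hochschild)
      (use k f in \<open>auto simp: c carrier_hochschild linmap_smult[OF coefficientsD(2)] linmap_smult[OF coefficientsD(3)]
         intro!: linmap_smult_fun coefficientsD(1)\<close>)
qed

lemma linmap_hochschild_eval:
  "w \<in> tensor_words T (n + 2) \<Longrightarrow> linmap K (deg (hochschild K T \<Lambda>) n) \<Lambda> (\<lambda>f. f w)"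
  by (subst deg_hochschild) (rule linmap_fun_module_eval[OF hochschild_subset])

lemma diff_hochschild_closed:
  assumes f: "f \<in> carrier (deg (hochschild K T \<Lambda>) n)"
  shows "diff (hochschild K T \<Lambda>) n f \<in> carrier (deg (hochschild K T \<Lambda>) (Suc n))"
proof -
  note fD = f[unfolded carrier_hochschild]
  have fc: "f w \<in> carrier \<Lambda>" if "w \<in> tensor_words T (n + 2)" for w
    using f hochschild_subset that by blast
  have n3: "n + 3 = Suc (n + 2)" "Suc n + 2 = Suc (n + 2)" by simp_all
  let ?d = "\<lambda>w. finsum \<Lambda> (\<lambda>i. signed \<Lambda> i (f (face T i w))) {..<n + 2}"
  have face: "face T i w \<in> tensor_words T (n + 2)" if "w \<in> tensor_words T (Suc (n + 2))" "i < n + 2" for i w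
    by (rule face_closed[OF T that])
  have sc: "signed \<Lambda> i (f (face T i w)) \<in> carrier \<Lambda>" if "w \<in> tensor_words T (Suc (n + 2))" "i < n + 2" for i w
    by (rule signed_closed[OF coefficientsD(1) fc[OF face[OF that]]])
  \<comment> \<open>Each outer action is a linear operator, so it commutes with the alternating sum.
    Together with the behaviour of faces on the outer letters this gives both equivariance
    conditions.\<close>
  have act: "h (?d w) = finsum \<Lambda> (\<lambda>i. signed \<Lambda> i (h (f (face T i w)))) {..<n + 2}"
    if h: "linmap K \<Lambda> \<Lambda> h" and w: "w \<in> tensor_words T (Suc (n + 2))" for h w
  proof -
    have "h (?d w) = finsum \<Lambda> (\<lambda>i. h (signed \<Lambda> i (f (face T i w)))) {..<n + 2}"
      using w by (intro linmap_finsum[OF h] coefficientsD(1) sc) auto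
    also have "\<dots> = finsum \<Lambda> (\<lambda>i. signed \<Lambda> i (h (f (face T i w)))) {..<n + 2}"
      using w by (intro L.finsum_cong' refl)
        (auto intro!: signed_closed[OF coefficientsD(1)] linmap_closed[OF h] fc face
          linmap_signed[OF h coefficientsD(1,1)])
    finally show ?thesis .
  qed
  have "restrict ?d (tensor_words T (Suc n + 2)) \<in> carrier (deg (hochschild K T \<Lambda>) (Suc n))"
  proof (rule restrict_in_hochschild)
    fix w assume "w \<in> tensor_words T (Suc n + 2)"
    then have w: "w \<in> tensor_words T (Suc (n + 2))" by simp
    show "?d w \<in> carrier \<Lambda>" using sc[OF w] by (intro L.finsum_closed) auto
    show "linmap K T \<Lambda> (\<lambda>x. ?d (w[i := x]))" if i: "i < Suc n + 2" for i
      using fD i by (intro linmap_finsum_fun linmap_signed_fun linmap_face[OF T _ w] coefficientsD(1)) auto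
    fix t assume t: "t \<in> carrier T"
    have "?d (w[0 := t \<otimes>\<^bsub>T\<^esub> w ! 0]) = finsum \<Lambda> (\<lambda>i. signed \<Lambda> i (lact \<Lambda> t (f (face T i w)))) {..<n + 2}"
      using fD t face[OF w] fc by (intro L.finsum_cong' refl)
        (auto simp: face_outer_left[OF T w] intro!: signed_closed[OF coefficientsD(1)] linmap_closed[OF coefficientsD(2)])
    then show "?d (w[0 := t \<otimes>\<^bsub>T\<^esub> w ! 0]) = lact \<Lambda> t (?d w)"
      using act[OF coefficientsD(2)[OF t] w] by simp
    have "?d (w[n + 2 := w ! (n + 2) \<otimes>\<^bsub>T\<^esub> t]) = finsum \<Lambda> (\<lambda>i. signed \<Lambda> i (ract \<Lambda> (f (face T i w)) t)) {..<n + 2}"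
      using fD t face[OF w] fc by (intro L.finsum_cong' refl)
        (auto simp: face_outer_right[OF T w, of _ t, simplified] intro!: signed_closed[OF coefficientsD(1)] linmap_closed[OF coefficientsD(3)])
    then show "?d (w[Suc n + 1 := w ! (Suc n + 1) \<otimes>\<^bsub>T\<^esub> t]) = ract \<Lambda> (?d w) t"
      using act[OF coefficientsD(3)[OF t] w] by simp
  qed
  then show ?thesis by (simp add: diff_hochschild numeral_3_eq_3)
qed

lemma cochain_complex_hochschild: "cochain_complex K (hochschild K T \<Lambda>)"
  unfolding cochain_complex_def
proof (intro conjI allI ballI)
  fix n
  show "module K (deg (hochschild K T \<Lambda>) n)" by (rule module_hochschild)
  have face: "face T i w \<in> tensor_words T (n + 2)" if "w \<in> tensor_words T (n + 3)" "i < n + 2" for i w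
    using face_closed[OF T, of w "n + 2" i] that by (simp add: numeral_3_eq_3)
  show "linmap K (deg (hochschild K T \<Lambda>) n) (deg (hochschild K T \<Lambda>) (Suc n)) (diff (hochschild K T \<Lambda>) n)"
  proof (subst deg_hochschild[of K T \<Lambda> "Suc n"],
      rule linmap_into_fun_module[OF diff_hochschild_closed hochschild_subset _ module_hochschild])
    fix w assume "w \<in> tensor_words T (Suc n + 2)"
    then have w: "w \<in> tensor_words T (n + 3)" by (simp add: numeral_3_eq_3)
    show "linmap K (deg (hochschild K T \<Lambda>) n) \<Lambda> (\<lambda>f. diff (hochschild K T \<Lambda>) n f w)"
      using w face[OF w] by (simp add: diff_hochschild)
        (intro linmap_finsum_fun linmap_signed_fun linmap_hochschild_eval[of _ n, simplified] coefficientsD(1), simp)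
  qed
  fix f assume f: "f \<in> carrier (deg (hochschild K T \<Lambda>) n)"
  have fc: "f w \<in> carrier \<Lambda>" if "w \<in> tensor_words T (n + 2)" for w
    using f hochschild_subset that by blast
  show "diff (hochschild K T \<Lambda>) (Suc n) (diff (hochschild K T \<Lambda>) n f) = \<zero>\<^bsub>deg (hochschild K T \<Lambda>) (Suc (Suc n))\<^esub>"
  proof -
    have "finsum \<Lambda> (\<lambda>i. signed \<Lambda> i (diff (hochschild K T \<Lambda>) n f (face T i w))) {..<Suc n + 2} = \<zero>\<^bsub>\<Lambda>\<^esub>"
      if w: "w \<in> tensor_words T (Suc n + 3)" for w
    proof -
      have w': "w \<in> tensor_words T (Suc (Suc (n + 2)))" using w by (simp add: numeral_3_eq_3)
      have f1: "face T i w \<in> tensor_words T (n + 3)" if "i < n + 3" for i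
        using face_closed[OF T w', of i] that by (simp add: numeral_3_eq_3)
      have "finsum \<Lambda> (\<lambda>i. signed \<Lambda> i (diff (hochschild K T \<Lambda>) n f (face T i w))) {..<Suc (n + 2)} =
        finsum \<Lambda> (\<lambda>i. signed \<Lambda> i (finsum \<Lambda> (\<lambda>j. signed \<Lambda> j (f (face T j (face T i w)))) {..<n + 2})) {..<Suc (n + 2)}"
        using f1 face fc by (intro L.finsum_cong' refl)
         (auto simp: diff_hochschild intro!: signed_closed[OF coefficientsD(1)] L.finsum_closed)
      also have "\<dots> = \<zero>\<^bsub>\<Lambda>\<^esub>"
        using f1 face fc by (intro alternating_double_sum_zero[OF coefficientsD(1)])
          (auto simp: face_face[OF T w'])
      finally show ?thesis by simp
    qed
    then show ?thesis
      by (subst diff_hochschild, subst deg_hochschild) (auto simp: numeral_3_eq_3 intro!: restrict_ext)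
  qed
qed

end

text \<open>The differential merges letters of the word and only adds values in
  \<open>\<Lambda>\<close>, so it is natural for linear maps of coefficients that respect both
  actions. The structure maps \<alpha>, \<beta> and the maps induced on Hom coefficients are all
  instances.\<close>

lemma cochain_map_hochschild:
  fixes K :: "'k ring"
  assumes T: "assoc_algebra K T" and \<Lambda>: "coefficients K T \<Lambda>" and \<Lambda>': "coefficients K T \<Lambda>'"
    and \<theta>: "linmap K \<Lambda> \<Lambda>' \<theta>"
    and l: "\<And>t x. t \<in> carrier T \<Longrightarrow> x \<in> carrier \<Lambda> \<Longrightarrow> \<theta> (lact \<Lambda> t x) = lact \<Lambda>' t (\<theta> x)"
    and r: "\<And>t x. t \<in> carrier T \<Longrightarrow> x \<in> carrier \<Lambda> \<Longrightarrow> \<theta> (ract \<Lambda> x t) = ract \<Lambda>' (\<theta> x) t"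
  shows "cochain_map K (hochschild K T \<Lambda>) (hochschild K T \<Lambda>') (\<lambda>n f. \<lambda>w\<in>tensor_words T (n + 2). \<theta> (f w))"
  unfolding cochain_map_def
proof (intro conjI allI ballI)
  interpret L': module K \<Lambda>' by (rule coefficientsD(1)[OF T \<Lambda>'])
  fix n
  have c: "f w \<in> carrier \<Lambda>" if "f \<in> carrier (deg (hochschild K T \<Lambda>) n)" "w \<in> tensor_words T (n + 2)" for f w
    using hochschild_subset that by blast
  show "linmap K (deg (hochschild K T \<Lambda>) n) (deg (hochschild K T \<Lambda>') n) (\<lambda>f. \<lambda>w\<in>tensor_words T (n + 2). \<theta> (f w))"
  proof (subst deg_hochschild[of K T \<Lambda>' n], rule linmap_into_fun_module[OF _ hochschild_subset _ module_hochschild[OF T \<Lambda>]])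
    fix f assume f: "f \<in> carrier (deg (hochschild K T \<Lambda>) n)"
    show "(\<lambda>w\<in>tensor_words T (n + 2). \<theta> (f w)) \<in> carrier (deg (hochschild K T \<Lambda>') n)"
      by (rule restrict_in_hochschild[OF T \<Lambda>'])
        (use f in \<open>auto simp: c carrier_hochschild l r intro!: linmap_closed[OF \<theta>] linmap_comp[OF _ \<theta>]\<close>)
  next
    fix w assume w: "w \<in> tensor_words T (n + 2)"
    then show "linmap K (deg (hochschild K T \<Lambda>) n) \<Lambda>' (\<lambda>f. (\<lambda>w\<in>tensor_words T (n + 2). \<theta> (f w)) w)"
      by (simp only: restrict_apply' if_True)
        (rule linmap_comp[OF linmap_hochschild_eval[OF T \<Lambda> w] \<theta>])
  qed
  fix f assume f: "f \<in> carrier (deg (hochschild K T \<Lambda>) n)"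
  have face: "face T i w \<in> tensor_words T (n + 2)" if "w \<in> tensor_words T (n + 3)" "i < n + 2" for i w
    using face_closed[OF T, of w "n + 2" i] that by (simp add: numeral_3_eq_3)
  have "\<theta> (finsum \<Lambda> (\<lambda>i. signed \<Lambda> i (f (face T i w))) {..<n + 2}) =
      finsum \<Lambda>' (\<lambda>i. signed \<Lambda>' i ((\<lambda>w\<in>tensor_words T (n + 2). \<theta> (f w)) (face T i w))) {..<n + 2}"
    if w: "w \<in> tensor_words T (n + 3)" for w
  proof -
    have "\<theta> (finsum \<Lambda> (\<lambda>i. signed \<Lambda> i (f (face T i w))) {..<n + 2}) =
        finsum \<Lambda>' (\<lambda>i. \<theta> (signed \<Lambda> i (f (face T i w)))) {..<n + 2}"
      using c[OF f face[OF w]]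
      by (intro linmap_finsum[OF \<theta>] coefficientsD(1)[OF T \<Lambda>] coefficientsD(1)[OF T \<Lambda>']
          signed_closed[OF coefficientsD(1)[OF T \<Lambda>]]) auto
    also have "\<dots> = finsum \<Lambda>' (\<lambda>i. signed \<Lambda>' i ((\<lambda>w\<in>tensor_words T (n + 2). \<theta> (f w)) (face T i w))) {..<n + 2}"
      using c[OF f face[OF w]] face[OF w]
      by (intro L'.finsum_cong' refl)
        (auto simp: linmap_signed[OF \<theta> coefficientsD(1)[OF T \<Lambda>] coefficientsD(1)[OF T \<Lambda>']]
          intro!: signed_closed[OF coefficientsD(1)[OF T \<Lambda>']] linmap_closed[OF \<theta>])
    finally show ?thesis .
  qed
  then show "(\<lambda>w\<in>tensor_words T (Suc n + 2). \<theta> (diff (hochschild K T \<Lambda>) n f w)) =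
      diff (hochschild K T \<Lambda>') n (\<lambda>w\<in>tensor_words T (n + 2). \<theta> (f w))"
    unfolding diff_hochschild by (auto simp: numeral_3_eq_3 intro!: restrict_ext)
qed

section \<open>Alternating sums\<close>

definition alternating_sum :: "('k, 'n, 'x) module_scheme \<Rightarrow> nat \<Rightarrow> (nat \<Rightarrow> 'n) \<Rightarrow> 'n" where
  "alternating_sum N r g = finsum N (\<lambda>i. signed N i (g i)) {..<r}"

lemma alternating_sum_closed:
  assumes "module K N" "\<And>i. i < r \<Longrightarrow> g i \<in> carrier N"
  shows "alternating_sum N r g \<in> carrier N"
proof -
  interpret N: module K N by fact
  show ?thesis unfolding alternating_sum_def
    using assms by (intro N.finsum_closed) (auto intro!: signed_closed[OF assms(1)])
qed

lemma alternating_sum_0 [simp]: "module K N \<Longrightarrow> alternating_sum N 0 g = \<zero>\<^bsub>N\<^esub>"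
  by (simp add: alternating_sum_def abelian_monoid.finsum_empty module_def abelian_group_def)

lemma alternating_sum_cong:
  assumes "module K N" "\<And>i. i < r \<Longrightarrow> g i \<in> carrier N" "\<And>i. i < r \<Longrightarrow> g i = h i"
  shows "alternating_sum N r g = alternating_sum N r h"
proof -
  interpret N: module K N by fact
  show ?thesis unfolding alternating_sum_def
    using assms by (intro N.finsum_cong' refl) (auto intro!: signed_closed[OF assms(1)])
qed

lemma linmap_alternating_sum:
  assumes h: "linmap K N N' h" and N: "module K N" "module K N'" and g: "\<And>i. i < r \<Longrightarrow> g i \<in> carrier N"
  shows "h (alternating_sum N r g) = alternating_sum N' r (\<lambda>i. h (g i))"
proof -
  interpret N': module K N' by fact
  have "h (alternating_sum N r g) = finsum N' (\<lambda>i. h (signed N i (g i))) {..<r}"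
    unfolding alternating_sum_def using g by (intro linmap_finsum[OF h N]) (auto intro!: signed_closed[OF N(1)])
  also have "\<dots> = alternating_sum N' r (\<lambda>i. h (g i))"
    unfolding alternating_sum_def using g
    by (intro N'.finsum_cong' refl) (auto intro!: signed_closed[OF N(2)] linmap_closed[OF h] linmap_signed[OF h N])
  finally show ?thesis .
qed

lemma linmap_alternating_sum_fun:
  assumes "\<And>i. i < r \<Longrightarrow> linmap K X N (g i)" "module K N"
  shows "linmap K X N (\<lambda>x. alternating_sum N r (\<lambda>i. g i x))"
  unfolding alternating_sum_def using assms by (intro linmap_finsum_fun linmap_signed_fun) auto

lemma alternating_sum_Suc:
  assumes "module K N" "\<And>i. i < Suc r \<Longrightarrow> g i \<in> carrier N"
  shows "alternating_sum N (Suc r) g = signed N r (g r) \<oplus>\<^bsub>N\<^esub> alternating_sum N r g"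
  unfolding alternating_sum_def using assms
  by (intro finsum_lessThan_Suc[OF assms(1)]) (auto intro!: signed_closed[OF assms(1)])

lemma alternating_sum_add:
  fixes K :: "'k ring"
  assumes "module K N" "\<And>i. i < r \<Longrightarrow> g i \<in> carrier N" "\<And>i. i < r \<Longrightarrow> h i \<in> carrier N"
  shows "alternating_sum N r (\<lambda>i. g i \<oplus>\<^bsub>N\<^esub> h i) = alternating_sum N r g \<oplus>\<^bsub>N\<^esub> alternating_sum N r h"
proof -
  interpret N: module K N by fact
  have "alternating_sum N r (\<lambda>i. g i \<oplus>\<^bsub>N\<^esub> h i) = finsum N (\<lambda>i. signed N i (g i) \<oplus>\<^bsub>N\<^esub> signed N i (h i)) {..<r}"
    unfolding alternating_sum_def using assms
    by (intro N.finsum_cong' refl)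
      (auto intro!: signed_closed[OF assms(1)] linmap_add[OF linmap_signed_id[OF assms(1)]])
  then show ?thesis unfolding alternating_sum_def using assms
    by (simp add: N.finsum_addf Pi_iff signed_closed[OF assms(1)])
qed

lemma alternating_sum_signed:
  fixes K :: "'k ring"
  assumes "module K N" "\<And>i. i < r \<Longrightarrow> g i \<in> carrier N"
  shows "alternating_sum N r (\<lambda>i. signed N k (g i)) = signed N k (alternating_sum N r g)"
  using linmap_alternating_sum[OF linmap_signed_id[OF assms(1)] assms(1,1)] assms(2) by metis

text \<open>The mixed terms of the triangular differential apply one face to each list, in either
  order; this identifies the two resulting double sums.\<close>

lemma alternating_sum_swap:
  fixes K :: "'k ring"
  assumes N: "module K N" and g: "\<And>i j. i < r \<Longrightarrow> j < q \<Longrightarrow> g i j \<in> carrier N"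
  shows "alternating_sum N q (\<lambda>j. alternating_sum N r (\<lambda>i. g i j)) =
    alternating_sum N r (\<lambda>i. alternating_sum N q (g i))"
  using g
proof (induction r)
  case 0
  have "alternating_sum N q (\<lambda>j. \<zero>\<^bsub>N\<^esub>) = \<zero>\<^bsub>N\<^esub>"
    using linmap_alternating_sum[OF linmap_zero_fun[OF N] N N, of q "\<lambda>_. \<zero>\<^bsub>N\<^esub>"] N
    by (simp add: module_def abelian_group_def abelian_monoid.zero_closed)
  then show ?case by (simp add: alternating_sum_0[OF N])
next
  case (Suc r)
  have c: "alternating_sum N q (g i) \<in> carrier N" if "i < Suc r" for i
    using that Suc.prems by (intro alternating_sum_closed[OF N]) auto
  have "alternating_sum N q (\<lambda>j. alternating_sum N (Suc r) (\<lambda>i. g i j)) =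
      alternating_sum N q (\<lambda>j. signed N r (g r j) \<oplus>\<^bsub>N\<^esub> alternating_sum N r (\<lambda>i. g i j))"
    using Suc.prems by (intro alternating_sum_cong[OF N] alternating_sum_closed[OF N] alternating_sum_Suc[OF N]) auto
  also have "\<dots> = signed N r (alternating_sum N q (g r)) \<oplus>\<^bsub>N\<^esub> alternating_sum N q (\<lambda>j. alternating_sum N r (\<lambda>i. g i j))"
    using Suc.prems
    by (subst alternating_sum_add[OF N]) (auto intro!: signed_closed[OF N] alternating_sum_closed[OF N]
      simp: alternating_sum_signed[OF N])
  also have "\<dots> = alternating_sum N (Suc r) (\<lambda>i. alternating_sum N q (g i))"
    using Suc c by (simp add: alternating_sum_Suc[OF N])
  finally show ?case .
qed

text \<open>\<open>r\<close> stands for the number of faces of a word of length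
  \<open>r + 1\<close>, and each face has \<open>r - 1\<close> faces. A word of one letter has none;
  then the outer sum is empty, so the truncated \<open>r - 1\<close> does no harm.\<close>

lemma alternating_sum_faces_zero:
  fixes K :: "'k ring"
  assumes "module K N" "\<And>i j. i < r \<Longrightarrow> j < r - 1 \<Longrightarrow> c i j \<in> carrier N"
    and "\<And>i j. j < i \<Longrightarrow> i < r \<Longrightarrow> c i j = c j (i - 1)"
  shows "alternating_sum N r (\<lambda>i. alternating_sum N (r - 1) (c i)) = \<zero>\<^bsub>N\<^esub>"
  using assms alternating_double_sum_zero[OF assms(1), of "r - 1" c]
  by (cases r) (simp_all add: alternating_sum_def abelian_monoid.finsum_empty module_def abelian_group_def)

section \<open>Bimodules\<close>

lemma bimoduleD:
  assumes "bimodule K A B M"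
  shows "module K M"
    and "a \<in> carrier A \<Longrightarrow> linmap K M M (lact M a)"
    and "b \<in> carrier B \<Longrightarrow> linmap K M M (\<lambda>x. ract M x b)"
    and "x \<in> carrier M \<Longrightarrow> linmap K A M (\<lambda>a. lact M a x)"
    and "x \<in> carrier M \<Longrightarrow> linmap K B M (\<lambda>b. ract M x b)"
    and "a \<in> carrier A \<Longrightarrow> a' \<in> carrier A \<Longrightarrow> x \<in> carrier M \<Longrightarrow> lact M (a \<otimes>\<^bsub>A\<^esub> a') x = lact M a (lact M a' x)"
    and "b \<in> carrier B \<Longrightarrow> b' \<in> carrier B \<Longrightarrow> x \<in> carrier M \<Longrightarrow> ract M x (b \<otimes>\<^bsub>B\<^esub> b') = ract M (ract M x b) b'"
    and "x \<in> carrier M \<Longrightarrow> lact M \<one>\<^bsub>A\<^esub> x = x"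
    and "x \<in> carrier M \<Longrightarrow> ract M x \<one>\<^bsub>B\<^esub> = x"
    and "a \<in> carrier A \<Longrightarrow> b \<in> carrier B \<Longrightarrow> x \<in> carrier M \<Longrightarrow> ract M (lact M a x) b = lact M a (ract M x b)"
  using assms by (auto simp: bimodule_def intro!: linmapI)

lemma bimodule_closed:
  assumes "bimodule K A B M" "x \<in> carrier M"
  shows "a \<in> carrier A \<Longrightarrow> lact M a x \<in> carrier M" "b \<in> carrier B \<Longrightarrow> ract M x b \<in> carrier M"
  using assms by (auto simp: bimodule_def)

lemma module_extend_simps [simp]:
  "carrier (module.extend X e) = carrier X" "\<zero>\<^bsub>module.extend X e\<^esub> = \<zero>\<^bsub>X\<^esub>" "add (module.extend X e) = add X"
  "smult (module.extend X e) = smult X" "module.more (module.extend X e) = e"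
  by (simp_all add: module.extend_def)

lemma module_extend: "module K X \<Longrightarrow> module K (module.extend X e)"
  by (rule module_by_surjection[where f="\<lambda>x. x"]) auto

lemma linmap_extend [simp]: "linmap K X (module.extend Y e) f = linmap K X Y f"
  by (simp add: linmap_def)

lemma linmap_extend' [simp]: "linmap K (module.extend X e) Y f = linmap K X Y f"
  by (simp add: linmap_def)

lemma coefficients_regular:
  assumes "assoc_algebra K T"
  shows "coefficients K T (regular T)"
proof -
  have "module K (regular T)"
    by (rule module_by_surjection[OF assoc_algebraD(1)[OF assms], where f="\<lambda>x. x"]) (auto simp: regular_def)
  moreover have "linmap K (regular T) (regular T) f = linmap K T T f" for f
    by (simp add: linmap_def regular_def)
  ultimately show ?thesis using assoc_algebraD(3,4)[OF assms]
    by (simp add: coefficients_def) (simp add: regular_def eta_contract_eq)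
qed

text \<open>This treats right linear and left linear maps at once: \<open>S\<close> consists of the pairs of right
  multiplications, or of left multiplications, by a ring element.\<close>

definition intertwiners ::
  "'k ring \<Rightarrow> ('k, 'm, 'x) module_scheme \<Rightarrow> ('k, 'n, 'y) module_scheme \<Rightarrow>
   (('m \<Rightarrow> 'm) \<times> ('n \<Rightarrow> 'n)) set \<Rightarrow> ('m \<Rightarrow> 'n) set" where
  "intertwiners K M N S = {h \<in> carrier M \<rightarrow>\<^sub>E carrier N. linmap K M N h \<and>
     (\<forall>(\<phi>, \<psi>)\<in>S. \<forall>x\<in>carrier M. h (\<phi> x) = \<psi> (h x))}"

lemma restrict_in_intertwiners:
  assumes "module K M" "linmap K M N h" "\<And>\<phi> \<psi> x. (\<phi>, \<psi>) \<in> S \<Longrightarrow> x \<in> carrier M \<Longrightarrow> \<phi> x \<in> carrier M"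
    "\<And>\<phi> \<psi> x. (\<phi>, \<psi>) \<in> S \<Longrightarrow> x \<in> carrier M \<Longrightarrow> h (\<phi> x) = \<psi> (h x)"
  shows "restrict h (carrier M) \<in> intertwiners K M N S"
proof -
  have "linmap K M N (restrict h (carrier M))" by (rule linmap_cong[OF assms(2,1)]) simp
  then show ?thesis using assms(3,4) linmap_closed[OF assms(2)] by (auto simp: intertwiners_def)
qed

lemma module_intertwiners:
  assumes "module K M" "module K N" "\<And>\<phi> \<psi> x. (\<phi>, \<psi>) \<in> S \<Longrightarrow> x \<in> carrier M \<Longrightarrow> \<phi> x \<in> carrier M"
    "\<And>\<phi> \<psi>. (\<phi>, \<psi>) \<in> S \<Longrightarrow> linmap K N N \<psi>"
  shows "module K (fun_module (carrier M) N (intertwiners K M N S))"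
proof (rule module_fun_module[OF assms(2)])
  have r: "restrict h (carrier M) \<in> intertwiners K M N S" if "linmap K M N h"
    "\<And>\<phi> \<psi> x. (\<phi>, \<psi>) \<in> S \<Longrightarrow> x \<in> carrier M \<Longrightarrow> h (\<phi> x) = \<psi> (h x)" for h
    using that assms(1,3) by (intro restrict_in_intertwiners) auto
  show "(\<lambda>x\<in>carrier M. \<zero>\<^bsub>N\<^esub>) \<in> intertwiners K M N S"
    by (intro r linmap_zero_fun assms(2)) (metis linmap_zero[OF assms(4) assms(2,2)])
  fix f assume f: "f \<in> intertwiners K M N S"
  have fc: "f x \<in> carrier N" if "x \<in> carrier M" for x using f that by (auto simp: intertwiners_def)
  show "(\<lambda>x\<in>carrier M. f x \<oplus>\<^bsub>N\<^esub> g x) \<in> intertwiners K M N S" if g: "g \<in> intertwiners K M N S" for g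
  proof -
    have gc: "g x \<in> carrier N" if "x \<in> carrier M" for x using g that by (auto simp: intertwiners_def)
    show ?thesis using f g
      by (intro r linmap_plus_fun assms(2))
        (auto simp: intertwiners_def linmap_add[OF assms(4)] fc gc split: prod.splits)
  qed
  show "(\<lambda>x\<in>carrier M. k \<odot>\<^bsub>N\<^esub> f x) \<in> intertwiners K M N S" if k: "k \<in> carrier K" for k
    using f k by (intro r linmap_smult_fun assms(2))
      (auto simp: intertwiners_def linmap_smult[OF assms(4)] fc split: prod.splits)
qed (auto simp: intertwiners_def)

lemma linmap_into_intertwiners:
  assumes "module K X" "\<And>x. x \<in> carrier X \<Longrightarrow> \<phi> x \<in> intertwiners K M N S"
    "\<And>m. m \<in> carrier M \<Longrightarrow> linmap K X N (\<lambda>x. \<phi> x m)"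
  shows "linmap K X (fun_module (carrier M) N (intertwiners K M N S)) \<phi>"
  by (rule linmap_into_fun_module[OF assms(2) _ assms(3,1)]) (auto simp: intertwiners_def)

lemma linmap_intertwiners_eval:
  assumes "m \<in> carrier M"
  shows "linmap K (fun_module (carrier M) N (intertwiners K M N S)) N (\<lambda>h. h m)"
  by (rule linmap_fun_module_eval[OF _ assms]) (auto simp: intertwiners_def)

definition right_ops ::
  "('k, 'b) module \<Rightarrow> ('k, 'm, 'a, 'b) bimod \<Rightarrow> ('k, 'n, 'a, 'b) bimod \<Rightarrow> (('m \<Rightarrow> 'm) \<times> ('n \<Rightarrow> 'n)) set" where
  "right_ops B M N = (\<lambda>b. (\<lambda>x. ract M x b, \<lambda>y. ract N y b)) ` carrier B"

definition left_ops ::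
  "('k, 'a) module \<Rightarrow> ('k, 'm, 'a, 'b) bimod \<Rightarrow> ('k, 'n, 'a, 'b) bimod \<Rightarrow> (('m \<Rightarrow> 'm) \<times> ('n \<Rightarrow> 'n)) set" where
  "left_ops A M N = (\<lambda>a. (lact M a, lact N a)) ` carrier A"

lemma hom_right_eq:
  "hom_right K B M N = module.extend (fun_module (carrier M) N (intertwiners K M N (right_ops B M N)))
     \<lparr>lact = (\<lambda>a h. \<lambda>x\<in>carrier M. lact N a (h x)), ract = (\<lambda>h a. \<lambda>x\<in>carrier M. h (lact M a x))\<rparr>"
  unfolding hom_right_def intertwiners_def right_ops_def right_linear_def
  by (intro arg_cong2[where f=module.extend] arg_cong[where f="fun_module _ _"] refl Collect_cong) auto

lemma hom_left_eq:
  "hom_left K A M N = module.extend (fun_module (carrier M) N (intertwiners K M N (left_ops A M N)))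
     \<lparr>lact = (\<lambda>b h. \<lambda>x\<in>carrier M. h (ract M x b)), ract = (\<lambda>h b. \<lambda>x\<in>carrier M. ract N (h x) b)\<rparr>"
  unfolding hom_left_def intertwiners_def left_ops_def left_linear_def
  by (intro arg_cong2[where f=module.extend] arg_cong[where f="fun_module _ _"] refl Collect_cong) auto

lemma hom_right_simps [simp]:
  "carrier (hom_right K B M N) = intertwiners K M N (right_ops B M N)"
  "lact (hom_right K B M N) = (\<lambda>a h. \<lambda>x\<in>carrier M. lact N a (h x))"
  "ract (hom_right K B M N) h a = (\<lambda>x\<in>carrier M. h (lact M a x))"
  by (simp_all add: hom_right_eq) (simp_all add: module.extend_def)

lemma hom_left_simps [simp]:
  "carrier (hom_left K A M N) = intertwiners K M N (left_ops A M N)"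
  "lact (hom_left K A M N) = (\<lambda>b h. \<lambda>x\<in>carrier M. h (ract M x b))"
  "ract (hom_left K A M N) h b = (\<lambda>x\<in>carrier M. ract N (h x) b)"
  by (simp_all add: hom_left_eq) (simp_all add: module.extend_def)

lemma intertwinersD:
  assumes "h \<in> intertwiners K M N S"
  shows "linmap K M N h" "x \<in> carrier M \<Longrightarrow> h x \<in> carrier N" "h \<in> extensional (carrier M)"
    "(\<phi>, \<psi>) \<in> S \<Longrightarrow> x \<in> carrier M \<Longrightarrow> h (\<phi> x) = \<psi> (h x)"
  using assms by (auto simp: intertwiners_def PiE_def)

context
  fixes K :: "'k ring" and A :: "('k, 'a) module" and B :: "('k, 'b) module"
    and M :: "('k, 'm, 'a, 'b) bimod" and N :: "('k, 'n, 'a, 'b) bimod"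
  assumes M: "bimodule K A B M" and N: "bimodule K A B N"
begin

text \<open>Applying \<open>a\<close> to the values keeps right linearity because the two actions on
  \<open>N\<close> commute; precomposing with the action of \<open>a\<close> keeps it because those
  on \<open>M\<close> do.\<close>

lemma coefficients_hom_right: "coefficients K A (hom_right K B M N)"
  unfolding coefficients_def
proof (intro conjI ballI)
  have m: "module K (fun_module (carrier M) N (intertwiners K M N (right_ops B M N)))"
    by (rule module_intertwiners[OF bimoduleD(1)[OF M] bimoduleD(1)[OF N]])
      (auto simp: right_ops_def bimodule_closed[OF M] bimoduleD(3)[OF N])
  then show "module K (hom_right K B M N)" unfolding hom_right_eq by (rule module_extend)
  fix a assume a: "a \<in> carrier A"
  have "linmap K (fun_module (carrier M) N (intertwiners K M N (right_ops B M N)))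
      (fun_module (carrier M) N (intertwiners K M N (right_ops B M N))) (\<lambda>h. \<lambda>x\<in>carrier M. lact N a (h x))"
  proof (rule linmap_into_intertwiners[OF m])
    fix h assume "h \<in> carrier (fun_module (carrier M) N (intertwiners K M N (right_ops B M N)))"
    then have h: "h \<in> intertwiners K M N (right_ops B M N)" by simp
    show "(\<lambda>x\<in>carrier M. lact N a (h x)) \<in> intertwiners K M N (right_ops B M N)"
      using intertwinersD(2,4)[OF h] a
      by (intro restrict_in_intertwiners bimoduleD(1)[OF M]
          linmap_comp[OF intertwinersD(1)[OF h] bimoduleD(2)[OF N]])
        (auto simp: right_ops_def bimodule_closed[OF M] bimoduleD(10)[OF N])
  next
    fix m assume m: "m \<in> carrier M"
    show "linmap K (fun_module (carrier M) N (intertwiners K M N (right_ops B M N))) N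
      (\<lambda>h. (\<lambda>x\<in>carrier M. lact N a (h x)) m)"
      using linmap_comp[OF linmap_intertwiners_eval[OF m] bimoduleD(2)[OF N a]] m by simp
  qed
  then show "linmap K (hom_right K B M N) (hom_right K B M N) (lact (hom_right K B M N) a)"
    by (subst (1 2) hom_right_eq) simp
  have "linmap K (fun_module (carrier M) N (intertwiners K M N (right_ops B M N)))
      (fun_module (carrier M) N (intertwiners K M N (right_ops B M N))) (\<lambda>h. \<lambda>x\<in>carrier M. h (lact M a x))"
  proof (rule linmap_into_intertwiners[OF m])
    fix h assume "h \<in> carrier (fun_module (carrier M) N (intertwiners K M N (right_ops B M N)))"
    then have h: "h \<in> intertwiners K M N (right_ops B M N)" by simp
    have "h (ract M x b) = ract N (h x) b" if "x \<in> carrier M" "b \<in> carrier B" for x b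
      using intertwinersD(4)[OF h, of "\<lambda>x. ract M x b" "\<lambda>y. ract N y b"] that by (auto simp: right_ops_def)
    then show "(\<lambda>x\<in>carrier M. h (lact M a x)) \<in> intertwiners K M N (right_ops B M N)"
      using a
      by (intro restrict_in_intertwiners bimoduleD(1)[OF M]
          linmap_comp[OF bimoduleD(2)[OF M] intertwinersD(1)[OF h]])
        (auto simp: right_ops_def bimodule_closed[OF M] bimoduleD(10)[OF M, symmetric])
  next
    fix m assume m: "m \<in> carrier M"
    show "linmap K (fun_module (carrier M) N (intertwiners K M N (right_ops B M N))) N
      (\<lambda>h. (\<lambda>x\<in>carrier M. h (lact M a x)) m)"
      using linmap_intertwiners_eval[OF bimodule_closed(1)[OF M m a]] m by simp
  qed
  then show "linmap K (hom_right K B M N) (hom_right K B M N) (\<lambda>h. ract (hom_right K B M N) h a)"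
    by (subst (1 2) hom_right_eq) simp
qed

text \<open>The mirror image of the right linear case: \<open>b\<close> acts on the left by
  precomposition and on the right through the values, and the commuting actions preserve linearity
  over \<open>A\<close>.\<close>

lemma coefficients_hom_left: "coefficients K B (hom_left K A M N)"
  unfolding coefficients_def
proof (intro conjI ballI)
  have m: "module K (fun_module (carrier M) N (intertwiners K M N (left_ops A M N)))"
    by (rule module_intertwiners[OF bimoduleD(1)[OF M] bimoduleD(1)[OF N]])
      (auto simp: left_ops_def bimodule_closed[OF M] bimoduleD(2)[OF N])
  then show "module K (hom_left K A M N)" unfolding hom_left_eq by (rule module_extend)
  fix b assume b: "b \<in> carrier B"
  have "linmap K (fun_module (carrier M) N (intertwiners K M N (left_ops A M N)))
      (fun_module (carrier M) N (intertwiners K M N (left_ops A M N))) (\<lambda>h. \<lambda>x\<in>carrier M. ract N (h x) b)"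
  proof (rule linmap_into_intertwiners[OF m])
    fix h assume "h \<in> carrier (fun_module (carrier M) N (intertwiners K M N (left_ops A M N)))"
    then have h: "h \<in> intertwiners K M N (left_ops A M N)" by simp
    show "(\<lambda>x\<in>carrier M. ract N (h x) b) \<in> intertwiners K M N (left_ops A M N)"
      using intertwinersD(2,4)[OF h] b
      by (intro restrict_in_intertwiners bimoduleD(1)[OF M]
          linmap_comp[OF intertwinersD(1)[OF h] bimoduleD(3)[OF N]])
        (auto simp: left_ops_def bimodule_closed[OF M] bimoduleD(10)[OF N])
  next
    fix m assume m: "m \<in> carrier M"
    show "linmap K (fun_module (carrier M) N (intertwiners K M N (left_ops A M N))) N
      (\<lambda>h. (\<lambda>x\<in>carrier M. ract N (h x) b) m)"
      using linmap_comp[OF linmap_intertwiners_eval[OF m] bimoduleD(3)[OF N b]] m by simp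
  qed
  then show "linmap K (hom_left K A M N) (hom_left K A M N) (\<lambda>h. ract (hom_left K A M N) h b)"
    by (subst (1 2) hom_left_eq) simp
  have "linmap K (fun_module (carrier M) N (intertwiners K M N (left_ops A M N)))
      (fun_module (carrier M) N (intertwiners K M N (left_ops A M N))) (\<lambda>h. \<lambda>x\<in>carrier M. h (ract M x b))"
  proof (rule linmap_into_intertwiners[OF m])
    fix h assume "h \<in> carrier (fun_module (carrier M) N (intertwiners K M N (left_ops A M N)))"
    then have h: "h \<in> intertwiners K M N (left_ops A M N)" by simp
    show "(\<lambda>x\<in>carrier M. h (ract M x b)) \<in> intertwiners K M N (left_ops A M N)"
      using intertwinersD(4)[OF h] b
      by (intro restrict_in_intertwiners bimoduleD(1)[OF M]
          linmap_comp[OF bimoduleD(3)[OF M] intertwinersD(1)[OF h]])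
        (auto simp: left_ops_def bimodule_closed[OF M] bimoduleD(10)[OF M])
  next
    fix m assume m: "m \<in> carrier M"
    show "linmap K (fun_module (carrier M) N (intertwiners K M N (left_ops A M N))) N
      (\<lambda>h. (\<lambda>x\<in>carrier M. h (ract M x b)) m)"
      using linmap_intertwiners_eval[OF bimodule_closed(2)[OF M m b]] m by simp
  qed
  then show "linmap K (hom_left K A M N) (hom_left K A M N) (lact (hom_left K A M N) b)"
    by (subst (1 2) hom_left_eq) simp
qed

lemma linmap_hom_right_eval: "m \<in> carrier M \<Longrightarrow> linmap K (hom_right K B M N) N (\<lambda>h. h m)"
  and linmap_hom_left_eval: "m \<in> carrier M \<Longrightarrow> linmap K (hom_left K A M N) N (\<lambda>h. h m)"
  by (simp_all add: hom_right_eq hom_left_eq linmap_intertwiners_eval)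

lemma linmap_into_hom_right:
  assumes "module K X" "\<And>x. x \<in> carrier X \<Longrightarrow> \<phi> x \<in> carrier (hom_right K B M N)"
    "\<And>m. m \<in> carrier M \<Longrightarrow> linmap K X N (\<lambda>x. \<phi> x m)"
  shows "linmap K X (hom_right K B M N) \<phi>"
  using linmap_into_intertwiners[of K X \<phi> M N "right_ops B M N"] assms
  by (simp add: hom_right_eq[of K B M N])

lemma linmap_into_hom_left:
  assumes "module K X" "\<And>x. x \<in> carrier X \<Longrightarrow> \<phi> x \<in> carrier (hom_left K A M N)"
    "\<And>m. m \<in> carrier M \<Longrightarrow> linmap K X N (\<lambda>x. \<phi> x m)"
  shows "linmap K X (hom_left K A M N) \<phi>"
  using linmap_into_intertwiners[of K X \<phi> M N "left_ops A M N"] assms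
  by (simp add: hom_left_eq[of K A M N])

end

section \<open>The triangular complex\<close>

lemma tri_words_iff:
  "(as, bs, m) \<in> tri_words A B M n \<longleftrightarrow> as \<in> tensor_words A (length as) \<and> bs \<in> tensor_words B (length bs) \<and>
     as \<noteq> [] \<and> bs \<noteq> [] \<and> length as + length bs = n + 3 \<and> m \<in> carrier M"
  by (auto simp: tri_words_def tensor_words_def)

text \<open>The membership conditions without extensionality, so that they can be tested on a
  function before it is restricted to words. Products in \<open>opp B\<close> and
  \<open>last\<close> are written out to match the lemmas on faces.\<close>

definition tri_conditions ::
  "'k ring \<Rightarrow> ('k, 'a) module \<Rightarrow> ('k, 'b) module \<Rightarrow> ('k, 'm, 'a, 'b) bimod \<Rightarrow>
   ('k, 'n, 'a, 'b) bimod \<Rightarrow> nat \<Rightarrow> ('a list \<times> 'b list \<times> 'm \<Rightarrow> 'n) \<Rightarrow> bool" where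
  "tri_conditions K A B M N n f \<longleftrightarrow> (\<forall>as bs m. (as, bs, m) \<in> tri_words A B M n \<longrightarrow>
     f (as, bs, m) \<in> carrier N \<and>
     (\<forall>i<length as. linmap K A N (\<lambda>x. f (as[i := x], bs, m))) \<and>
     (\<forall>j<length bs. linmap K B N (\<lambda>y. f (as, bs[j := y], m))) \<and>
     linmap K M N (\<lambda>z. f (as, bs, z)) \<and>
     (\<forall>a\<in>carrier A. f (as[0 := a \<otimes>\<^bsub>A\<^esub> as ! 0], bs, m) = lact N a (f (as, bs, m))) \<and>
     (\<forall>b\<in>carrier B. f (as, bs[0 := bs ! 0 \<otimes>\<^bsub>B\<^esub> b], m) = ract N (f (as, bs, m)) b) \<and>
     (\<forall>a\<in>carrier A. f (as[length as - 1 := as ! (length as - 1) \<otimes>\<^bsub>A\<^esub> a], bs, m) = f (as, bs, lact M a m)) \<and>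
     (\<forall>b\<in>carrier B. f (as, bs[length bs - 1 := b \<otimes>\<^bsub>B\<^esub> bs ! (length bs - 1)], m) = f (as, bs, ract M m b)))"

lemma tri_conditionsD:
  assumes "tri_conditions K A B M N n f" "(as, bs, m) \<in> tri_words A B M n"
  shows "f (as, bs, m) \<in> carrier N"
    and "i < length as \<Longrightarrow> linmap K A N (\<lambda>x. f (as[i := x], bs, m))"
    and "j < length bs \<Longrightarrow> linmap K B N (\<lambda>y. f (as, bs[j := y], m))"
    and "linmap K M N (\<lambda>z. f (as, bs, z))"
    and "a \<in> carrier A \<Longrightarrow> f (as[0 := a \<otimes>\<^bsub>A\<^esub> as ! 0], bs, m) = lact N a (f (as, bs, m))"
    and "b \<in> carrier B \<Longrightarrow> f (as, bs[0 := bs ! 0 \<otimes>\<^bsub>B\<^esub> b], m) = ract N (f (as, bs, m)) b"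
    and "a \<in> carrier A \<Longrightarrow>
      f (as[length as - 1 := as ! (length as - 1) \<otimes>\<^bsub>A\<^esub> a], bs, m) = f (as, bs, lact M a m)"
    and "b \<in> carrier B \<Longrightarrow>
      f (as, bs[length bs - 1 := b \<otimes>\<^bsub>B\<^esub> bs ! (length bs - 1)], m) = f (as, bs, ract M m b)"
  using assms unfolding tri_conditions_def by blast+

lemma tri_hom_iff:
  "f \<in> tri_hom K A B M N n \<longleftrightarrow> f \<in> extensional (tri_words A B M n) \<and> tri_conditions K A B M N n f"
proof -
  have last: "last as = as ! (length as - 1)" "last bs = bs ! (length bs - 1)"
    if "(as, bs, m) \<in> tri_words A B M n" for as bs m
    using that by (auto simp: tri_words_def last_conv_nth)
  show ?thesis
    unfolding tri_hom_def tri_conditions_def PiE_def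
    by (auto simp: last Pi_iff)
qed

text \<open>The value of the differential at one word, for an arbitrary function \<open>f\<close>.
  Kept apart from the restriction to words, it can be iterated and compared at different
  words.\<close>

definition tri_diff where
  "tri_diff A B N f as bs m =
     alternating_sum N (length as - 1) (\<lambda>i. f (face A i as, bs, m)) \<oplus>\<^bsub>N\<^esub>
     signed N (length as - 1) (alternating_sum N (length bs - 1) (\<lambda>j. f (as, face (opp B) j bs, m)))"

lemma deg_tri: "deg (tri_complex K A B M N) n = fun_module (tri_words A B M n) N (tri_hom K A B M N n)"
  by (simp add: tri_complex_def)

lemma carrier_tri: "carrier (deg (tri_complex K A B M N) n) = tri_hom K A B M N n"
  by (simp add: deg_tri)

lemma diff_tri:
  "diff (tri_complex K A B M N) n f = (\<lambda>(as, bs, m)\<in>tri_words A B M (Suc n). tri_diff A B N f as bs m)"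
  by (simp add: tri_complex_def tri_diff_def alternating_sum_def)

lemma tri_hom_subset: "tri_hom K A B M N n \<subseteq> tri_words A B M n \<rightarrow>\<^sub>E carrier N"
  by (auto simp: tri_hom_def)

context
  fixes K :: "'k ring" and A :: "('k, 'a) module" and B :: "('k, 'b) module"
    and M :: "('k, 'm, 'a, 'b) bimod"
  assumes A: "assoc_algebra K A" and B: "assoc_algebra K B" and M: "bimodule K A B M"
begin

interpretation A: ring A by (rule assoc_algebraD(2)[OF A])
interpretation B: ring B by (rule assoc_algebraD(2)[OF B])

lemma tri_words_update:
  assumes "(as, bs, m) \<in> tri_words A B M n"
  shows "x \<in> carrier A \<Longrightarrow> (as[i := x], bs, m) \<in> tri_words A B M n"
    and "y \<in> carrier B \<Longrightarrow> (as, bs[j := y], m) \<in> tri_words A B M n"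
    and "z \<in> carrier M \<Longrightarrow> (as, bs, z) \<in> tri_words A B M n"
  using assms tensor_words_update by (auto simp: tri_words_iff)

lemma tri_words_nth:
  assumes "(as, bs, m) \<in> tri_words A B M n"
  shows "i < length as \<Longrightarrow> as ! i \<in> carrier A" "j < length bs \<Longrightarrow> bs ! j \<in> carrier B"
    "as ! 0 \<in> carrier A" "as ! (length as - 1) \<in> carrier A" "bs ! 0 \<in> carrier B" "bs ! (length bs - 1) \<in> carrier B"
    "as ! (length as - Suc 0) \<in> carrier A" "bs ! (length bs - Suc 0) \<in> carrier B" "m \<in> carrier M"
  using assms by (auto simp: tri_words_iff intro: tensor_words_nth)

text \<open>The bound is the number of faces. If it is positive, the list has at least two letters,
  so a face never becomes empty and the result is again a generator.\<close>

lemma tri_words_face: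
  assumes "(as, bs, m) \<in> tri_words A B M (Suc n)"
  shows "i < length as - 1 \<Longrightarrow> (face A i as, bs, m) \<in> tri_words A B M n"
    and "j < length bs - 1 \<Longrightarrow> (as, face (opp B) j bs, m) \<in> tri_words A B M n"
proof -
  show "(face A i as, bs, m) \<in> tri_words A B M n" if i: "i < length as - 1"
  proof -
    have "as \<in> tensor_words A (Suc (length as - 1))" using assms by (auto simp: tri_words_iff)
    from face_closed[OF A this i] have "face A i as \<in> tensor_words A (length as - 1)" .
    then show ?thesis using assms i by (auto simp: tri_words_iff tensor_words_def)
  qed
  show "(as, face (opp B) j bs, m) \<in> tri_words A B M n" if j: "j < length bs - 1"
  proof -
    have "bs \<in> tensor_words (opp B) (Suc (length bs - 1))" using assms by (auto simp: tri_words_iff)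
    from face_closed[OF assoc_algebra_opp[OF B] this j] have "face (opp B) j bs \<in> tensor_words B (length bs - 1)" by simp
    then show ?thesis using assms j by (auto simp: tri_words_iff tensor_words_def)
  qed
qed

context
  fixes N :: "('k, 'n, 'a, 'b) bimod"
  assumes N: "bimodule K A B N"
begin

interpretation N: module K N by (rule bimoduleD(1)[OF N])

lemma restrict_in_tri_hom:
  assumes f: "tri_conditions K A B M N n f"
  shows "restrict f (tri_words A B M n) \<in> tri_hom K A B M N n"
  unfolding tri_hom_iff
proof (intro conjI)
  note D = tri_conditionsD[OF f]
  show "tri_conditions K A B M N n (restrict f (tri_words A B M n))"
    unfolding tri_conditions_def
  proof (intro allI impI conjI ballI)
    fix as bs m assume w: "(as, bs, m) \<in> tri_words A B M n"
    note u = tri_words_update[OF w] tri_words_nth[OF w]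
    show "linmap K A N (\<lambda>x. restrict f (tri_words A B M n) (as[i := x], bs, m))" if "i < length as" for i
      by (rule linmap_cong[OF D(2)[OF w that] assoc_algebraD(1)[OF A]]) (simp add: u)
    show "linmap K B N (\<lambda>y. restrict f (tri_words A B M n) (as, bs[i := y], m))" if "i < length bs" for i
      by (rule linmap_cong[OF D(3)[OF w that] assoc_algebraD(1)[OF B]]) (simp add: u)
    show "linmap K M N (\<lambda>z. restrict f (tri_words A B M n) (as, bs, z))"
      by (rule linmap_cong[OF D(4)[OF w] bimoduleD(1)[OF M]]) (simp add: u)
    show "restrict f (tri_words A B M n) (as, bs, m) \<in> carrier N" using D(1)[OF w] w by simp
  next
    fix as bs m a assume w: "(as, bs, m) \<in> tri_words A B M n" and a: "a \<in> carrier A"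
    note u = tri_words_update[OF w] tri_words_nth[OF w]
    show "restrict f (tri_words A B M n) (as[0 := a \<otimes>\<^bsub>A\<^esub> as ! 0], bs, m) =
        lact N a (restrict f (tri_words A B M n) (as, bs, m))"
      using D(5)[OF w a] w a u by simp
    show "restrict f (tri_words A B M n) (as[length as - 1 := as ! (length as - 1) \<otimes>\<^bsub>A\<^esub> a], bs, m) =
        restrict f (tri_words A B M n) (as, bs, lact M a m)"
      using D(7)[OF w a] w a u bimodule_closed(1)[OF M u(12) a] by simp
  next
    fix as bs m b assume w: "(as, bs, m) \<in> tri_words A B M n" and b: "b \<in> carrier B"
    note u = tri_words_update[OF w] tri_words_nth[OF w]
    show "restrict f (tri_words A B M n) (as, bs[0 := bs ! 0 \<otimes>\<^bsub>B\<^esub> b], m) =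
        ract N (restrict f (tri_words A B M n) (as, bs, m)) b"
      using D(6)[OF w b] w b u by simp
    show "restrict f (tri_words A B M n) (as, bs[length bs - 1 := b \<otimes>\<^bsub>B\<^esub> bs ! (length bs - 1)], m) =
        restrict f (tri_words A B M n) (as, bs, ract M m b)"
      using D(8)[OF w b] w b u bimodule_closed(2)[OF M u(12) b] by simp
  qed
qed simp

lemma module_tri: "module K (deg (tri_complex K A B M N) n)"
  unfolding deg_tri
proof (rule module_fun_module[OF bimoduleD(1)[OF N] tri_hom_subset])
  note z = linmap_zero[OF bimoduleD(2)[OF N] bimoduleD(1)[OF N] bimoduleD(1)[OF N]]
    linmap_zero[OF bimoduleD(3)[OF N] bimoduleD(1)[OF N] bimoduleD(1)[OF N]]
  show "(\<lambda>w\<in>tri_words A B M n. \<zero>\<^bsub>N\<^esub>) \<in> tri_hom K A B M N n"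
    by (rule restrict_in_tri_hom) (auto simp: tri_conditions_def z linmap_zero_fun[OF bimoduleD(1)[OF N]])
  fix f assume "f \<in> tri_hom K A B M N n"
  then have f: "tri_conditions K A B M N n f" by (simp add: tri_hom_iff)
  show "(\<lambda>w\<in>tri_words A B M n. f w \<oplus>\<^bsub>N\<^esub> g w) \<in> tri_hom K A B M N n" if "g \<in> tri_hom K A B M N n" for g
  proof (rule restrict_in_tri_hom)
    have g: "tri_conditions K A B M N n g" using that by (simp add: tri_hom_iff)
    show "tri_conditions K A B M N n (\<lambda>w. f w \<oplus>\<^bsub>N\<^esub> g w)"
      unfolding tri_conditions_def
    proof (intro allI impI conjI ballI)
      fix as bs m assume w: "(as, bs, m) \<in> tri_words A B M n"
      note F = tri_conditionsD[OF f w] and G = tri_conditionsD[OF g w]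
      show "f (as, bs, m) \<oplus>\<^bsub>N\<^esub> g (as, bs, m) \<in> carrier N" using F(1) G(1) by simp
      show "linmap K A N (\<lambda>x. f (as[i := x], bs, m) \<oplus>\<^bsub>N\<^esub> g (as[i := x], bs, m))" if "i < length as" for i
        by (rule linmap_plus_fun[OF F(2) G(2) bimoduleD(1)[OF N]]) (fact that)+
      show "linmap K B N (\<lambda>x. f (as, bs[i := x], m) \<oplus>\<^bsub>N\<^esub> g (as, bs[i := x], m))" if "i < length bs" for i
        by (rule linmap_plus_fun[OF F(3) G(3) bimoduleD(1)[OF N]]) (fact that)+
      show "linmap K M N (\<lambda>z. f (as, bs, z) \<oplus>\<^bsub>N\<^esub> g (as, bs, z))"
        by (rule linmap_plus_fun[OF F(4) G(4) bimoduleD(1)[OF N]])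
    qed (use tri_conditionsD(1,5-8)[OF f] tri_conditionsD(1,5-8)[OF g] in
        \<open>simp_all add: linmap_add[OF bimoduleD(2)[OF N]] linmap_add[OF bimoduleD(3)[OF N]]\<close>)
  qed
  show "(\<lambda>w\<in>tri_words A B M n. k \<odot>\<^bsub>N\<^esub> f w) \<in> tri_hom K A B M N n" if "k \<in> carrier K" for k
  proof (rule restrict_in_tri_hom)
    show "tri_conditions K A B M N n (\<lambda>w. k \<odot>\<^bsub>N\<^esub> f w)"
      unfolding tri_conditions_def
    proof (intro allI impI conjI ballI)
      fix as bs m assume w: "(as, bs, m) \<in> tri_words A B M n"
      note F = tri_conditionsD[OF f w]
      show "k \<odot>\<^bsub>N\<^esub> f (as, bs, m) \<in> carrier N" using F(1) that by simp
      show "linmap K A N (\<lambda>x. k \<odot>\<^bsub>N\<^esub> f (as[i := x], bs, m))" if "i < length as" for i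
        by (rule linmap_smult_fun[OF F(2)[OF that] bimoduleD(1)[OF N]]) fact
      show "linmap K B N (\<lambda>x. k \<odot>\<^bsub>N\<^esub> f (as, bs[i := x], m))" if "i < length bs" for i
        by (rule linmap_smult_fun[OF F(3)[OF that] bimoduleD(1)[OF N]]) fact
      show "linmap K M N (\<lambda>z. k \<odot>\<^bsub>N\<^esub> f (as, bs, z))"
        by (rule linmap_smult_fun[OF F(4) bimoduleD(1)[OF N]]) fact
    qed (use tri_conditionsD(1,5-8)[OF f] that in
        \<open>simp_all add: linmap_smult[OF bimoduleD(2)[OF N]] linmap_smult[OF bimoduleD(3)[OF N]]\<close>)
  qed
qed

lemma linmap_tri_eval:
  "w \<in> tri_words A B M n \<Longrightarrow> linmap K (deg (tri_complex K A B M N) n) N (\<lambda>f. f w)"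
  unfolding deg_tri by (rule linmap_fun_module_eval[OF tri_hom_subset])

lemma tri_diff_closed:
  assumes "\<And>w. w \<in> tri_words A B M n \<Longrightarrow> f w \<in> carrier N" "(as, bs, m) \<in> tri_words A B M (Suc n)"
  shows "tri_diff A B N f as bs m \<in> carrier N"
  unfolding tri_diff_def using assms(1) tri_words_face[OF assms(2)]
  by (intro N.a_closed signed_closed[OF bimoduleD(1)[OF N]] alternating_sum_closed[OF bimoduleD(1)[OF N]]) auto

text \<open>Naturality in the values. It serves for the outer actions on \<open>N\<close> as well as
  for maps from \<open>N\<close> to another bimodule.\<close>

lemma linmap_tri_diff:
  assumes h: "linmap K N N' h" "module K N'"
    and f: "\<And>w. w \<in> tri_words A B M n \<Longrightarrow> f w \<in> carrier N" and w: "(as, bs, m) \<in> tri_words A B M (Suc n)"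
  shows "h (tri_diff A B N f as bs m) = tri_diff A B N' (\<lambda>w. h (f w)) as bs m"
proof -
  note m = bimoduleD(1)[OF N]
  have c: "alternating_sum N (length as - 1) (\<lambda>i. f (face A i as, bs, m)) \<in> carrier N"
    "alternating_sum N (length bs - 1) (\<lambda>j. f (as, face (opp B) j bs, m)) \<in> carrier N"
    using f tri_words_face[OF w] by (intro alternating_sum_closed[OF m]; simp)+
  show ?thesis unfolding tri_diff_def
    using c f tri_words_face[OF w]
    by (simp add: linmap_add[OF h(1)] linmap_signed[OF h(1) m h(2)] signed_closed[OF m]
      linmap_alternating_sum[OF h(1) m h(2)])
qed

text \<open>Faces are matched between two words of equal shape but possibly different entries.
  Equivariance at the first letters, balancing at the last ones and precomposition with a map into
  \<open>M\<close> all have this form.\<close>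

lemma tri_diff_eqI:
  assumes "length as' = length as" "length bs' = length bs"
    "\<And>w. w \<in> tri_words A B M n \<Longrightarrow> g w \<in> carrier N" "(as, bs, m) \<in> tri_words A B M (Suc n)"
    "\<And>i. i < length as - 1 \<Longrightarrow> f (face A i as', bs', m') = g (face A i as, bs, m)"
    "\<And>j. j < length bs - 1 \<Longrightarrow> f (as', face (opp B) j bs', m') = g (as, face (opp B) j bs, m)"
  shows "tri_diff A B N f as' bs' m' = tri_diff A B N g as bs m"
proof -
  note m = bimoduleD(1)[OF N]
  have "alternating_sum N (length as - 1) (\<lambda>i. f (face A i as', bs', m')) =
      alternating_sum N (length as - 1) (\<lambda>i. g (face A i as, bs, m))"
    using assms(3,5) tri_words_face[OF assms(4)] by (intro alternating_sum_cong[OF m]) auto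
  moreover have "alternating_sum N (length bs - 1) (\<lambda>j. f (as', face (opp B) j bs', m')) =
      alternating_sum N (length bs - 1) (\<lambda>j. g (as, face (opp B) j bs, m))"
    using assms(3,6) tri_words_face[OF assms(4)] by (intro alternating_sum_cong[OF m]) auto
  ultimately show ?thesis using assms(1,2) by (simp add: tri_diff_def)
qed

lemma tri_conditions_tri_diff:
  assumes f: "tri_conditions K A B M N n f"
  shows "tri_conditions K A B M N (Suc n) (\<lambda>(as, bs, m). tri_diff A B N f as bs m)"
  unfolding tri_conditions_def
proof (intro allI impI conjI ballI; unfold prod.case)
  note D = tri_conditionsD[OF f] and mN = bimoduleD(1)[OF N] and B' = assoc_algebra_opp[OF B]
  have fc: "f w \<in> carrier N" if "w \<in> tri_words A B M n" for w using D(1) that by (cases w) auto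
  fix as bs m assume w: "(as, bs, m) \<in> tri_words A B M (Suc n)"
  note u = tri_words_update[OF w] tri_words_nth[OF w] and F = tri_words_face[OF w]
  have as: "as \<in> tensor_words A (Suc (length as - 1))" and bs: "bs \<in> tensor_words (opp B) (Suc (length bs - 1))"
    and len: "as \<noteq> []" "bs \<noteq> []" "length as + length bs = Suc n + 3" "m \<in> carrier M"
    using w by (auto simp: tri_words_iff)
  \<comment> \<open>The index \<open>k\<close> forces \<open>length as - 1\<close> to be positive,
    so that the shorter list \<open>v\<close> is not empty.\<close>
  have as_n: "(v, bs, m) \<in> tri_words A B M n" if "v \<in> tensor_words A (length as - 1)" "k < length as - 1" for v k
    using that w by (auto simp: tri_words_iff tensor_words_def)
  have bs_n: "(as, v, m) \<in> tri_words A B M n" if "v \<in> tensor_words B (length bs - 1)" "k < length bs - 1" for v k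
    using that w by (auto simp: tri_words_iff tensor_words_def)
  show "tri_diff A B N f as bs m \<in> carrier N" by (rule tri_diff_closed[OF fc w])
  have fA: "linmap K A N (\<lambda>x. f (v[k := x], bs, m))" if "v \<in> tensor_words A (length as - 1)" "k < length as - 1" for v k
    using D(2)[OF as_n[OF that], of k] that by (simp add: tensor_words_def)
  show "linmap K A N (\<lambda>x. tri_diff A B N f (as[i := x]) bs m)" if i: "i < length as" for i
    unfolding tri_diff_def length_list_update using i F
    by (intro linmap_plus_fun linmap_signed_fun linmap_alternating_sum_fun mN
        linmap_face[OF A fA as] D(2)) auto
  have fB: "linmap K (opp B) N (\<lambda>x. f (as, v[k := x], m))" if "v \<in> tensor_words (opp B) (length bs - 1)" "k < length bs - 1" for v k
    using D(3)[OF bs_n[of v k], of k] that by (simp add: tensor_words_def)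
  have faceB: "linmap K B N (\<lambda>x. f (as, face (opp B) j (bs[i := x]), m))" if "j < length bs - 1" "i < length bs" for i j
    using linmap_face[OF B' fB bs that(1), of i] that by simp
  show "linmap K B N (\<lambda>y. tri_diff A B N f as (bs[j := y]) m)" if j: "j < length bs" for j
    unfolding tri_diff_def length_list_update using j F
    by (intro linmap_plus_fun linmap_signed_fun linmap_alternating_sum_fun mN faceB D(3)) auto
  show "linmap K M N (\<lambda>z. tri_diff A B N f as bs z)"
    unfolding tri_diff_def using F
    by (intro linmap_plus_fun linmap_signed_fun linmap_alternating_sum_fun mN D(4)) auto
  {
    fix a assume a: "a \<in> carrier A"
    have "lact N a (tri_diff A B N f as bs m) = tri_diff A B N (\<lambda>w. lact N a (f w)) as bs m"
      by (rule linmap_tri_diff[OF bimoduleD(2)[OF N a] mN fc w])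
    moreover have "tri_diff A B N f (as[0 := a \<otimes>\<^bsub>A\<^esub> as ! 0]) bs m = tri_diff A B N (\<lambda>w. lact N a (f w)) as bs m"
      using a F linmap_closed[OF bimoduleD(2)[OF N a]] fc
      by (intro tri_diff_eqI[OF _ _ _ w]) (auto simp: face_outer_left[OF A as] D(5))
    ultimately show "tri_diff A B N f (as[0 := a \<otimes>\<^bsub>A\<^esub> as ! 0]) bs m = lact N a (tri_diff A B N f as bs m)"
      by simp
    \<comment> \<open>Faces of \<open>as\<close> are compatible with a factor on the last letter,
      and faces of \<open>bs\<close> leave it alone; so the balancing relation of \<open>f\<close>
      can be used term by term.\<close>
    show "tri_diff A B N f (as[length as - 1 := as ! (length as - 1) \<otimes>\<^bsub>A\<^esub> a]) bs m = tri_diff A B N f as bs (lact M a m)"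
    proof (rule tri_diff_eqI[OF _ _ fc u(3)])
      fix i assume i: "i < length as - 1"
      have "length (face A i as) = length as - 1" using length_face[OF _ i, of as A] len by simp
      then show "f (face A i (as[length as - 1 := as ! (length as - 1) \<otimes>\<^bsub>A\<^esub> a]), bs, m) = f (face A i as, bs, lact M a m)"
        using D(7)[OF F(1)[OF i] a] face_outer_right[OF A as i a] by simp
    next
      fix j assume j: "j < length bs - 1"
      show "f (as[length as - 1 := as ! (length as - 1) \<otimes>\<^bsub>A\<^esub> a], face (opp B) j bs, m) = f (as, face (opp B) j bs, lact M a m)"
        by (rule D(7)[OF F(2)[OF j] a])
    qed (simp_all add: bimodule_closed(1)[OF M len(4) a])
  }
  {
    fix b assume b: "b \<in> carrier B"
    \<comment> \<open>The list \<open>bs\<close> carries faces of \<open>opp B\<close>, so the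
      lemmas on outer letters are used for the opposite algebra.\<close>
    then have b': "b \<in> carrier (opp B)" by simp
    have "ract N (tri_diff A B N f as bs m) b = tri_diff A B N (\<lambda>w. ract N (f w) b) as bs m"
      by (rule linmap_tri_diff[OF bimoduleD(3)[OF N b] mN fc w])
    moreover have "tri_diff A B N f as (bs[0 := bs ! 0 \<otimes>\<^bsub>B\<^esub> b]) m = tri_diff A B N (\<lambda>w. ract N (f w) b) as bs m"
      using b F linmap_closed[OF bimoduleD(3)[OF N b]] fc
      by (intro tri_diff_eqI[OF _ _ _ w]) (auto simp: face_outer_left[OF B' bs _ b', simplified] D(6))
    ultimately show "tri_diff A B N f as (bs[0 := bs ! 0 \<otimes>\<^bsub>B\<^esub> b]) m = ract N (tri_diff A B N f as bs m) b"
      by simp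
    show "tri_diff A B N f as (bs[length bs - 1 := b \<otimes>\<^bsub>B\<^esub> bs ! (length bs - 1)]) m = tri_diff A B N f as bs (ract M m b)"
    proof (rule tri_diff_eqI[OF _ _ fc u(3)])
      fix i assume i: "i < length bs - 1"
      have "length (face (opp B) i bs) = length bs - 1" using length_face[OF _ i, of bs "opp B"] len by simp
      then show "f (as, face (opp B) i (bs[length bs - 1 := b \<otimes>\<^bsub>B\<^esub> bs ! (length bs - 1)]), m) = f (as, face (opp B) i bs, ract M m b)"
        using D(8)[OF F(2)[OF i] b] face_outer_right[OF B' bs i b'] by simp
    next
      fix i assume i: "i < length as - 1"
      show "f (face A i as, bs[length bs - 1 := b \<otimes>\<^bsub>B\<^esub> bs ! (length bs - 1)], m) = f (face A i as, bs, ract M m b)"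
        by (rule D(8)[OF F(1)[OF i] b])
    qed (simp_all add: bimodule_closed(2)[OF M len(4) b])
  }
qed

text \<open>This is the total complex of a tensor product. Two faces on the same list cancel by the
  face identity. A face on each list occurs twice, with opposite signs, because the sign of the
  B-part depends on the length of \<open>as\<close>.\<close>

lemma tri_diff_tri_diff:
  assumes f: "\<And>w. w \<in> tri_words A B M n \<Longrightarrow> f w \<in> carrier N" and w: "(as, bs, m) \<in> tri_words A B M (Suc (Suc n))"
  shows "tri_diff A B N (\<lambda>(as, bs, m). tri_diff A B N f as bs m) as bs m = \<zero>\<^bsub>N\<^esub>"
proof -
  note mN = bimoduleD(1)[OF N] and F = tri_words_face[OF w]
  define r q where "r = length as - 1" and "q = length bs - 1"
  have as: "as \<in> tensor_words A (Suc r)" and bs: "bs \<in> tensor_words (opp B) (Suc q)"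
    using w by (auto simp: tri_words_iff r_def q_def)
  have la: "length (face A i as) = r" if "i < r" for i using length_face[of as r i A] as that by (simp add: tensor_words_def)
  have lb: "length (face (opp B) j bs) = q" if "j < q" for j using length_face[of bs q j "opp B"] bs that by (simp add: tensor_words_def)
  note F = F[folded r_def q_def]
  let ?AA = "\<lambda>i k. f (face A k (face A i as), bs, m)"
  let ?AB = "\<lambda>i j. f (face A i as, face (opp B) j bs, m)"
  let ?BB = "\<lambda>j k. f (as, face (opp B) k (face (opp B) j bs), m)"
  have cAA: "?AA i k \<in> carrier N" if "i < r" "k < r - 1" for i k
    using f tri_words_face(1)[OF F(1)[OF that(1)], of k] that la by simp
  have cBB: "?BB j k \<in> carrier N" if "j < q" "k < q - 1" for j k
    using f tri_words_face(2)[OF F(2)[OF that(1)], of k] that lb by simp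
  have cAB: "?AB i j \<in> carrier N" if "i < r" "j < q" for i j
    using f tri_words_face(2)[OF F(1)[OF that(1)], of j] that q_def by simp
  have sAA: "alternating_sum N (r - 1) (?AA i) \<in> carrier N" if "i < r" for i
    using that cAA by (intro alternating_sum_closed[OF mN]) auto
  have sBB: "alternating_sum N (q - 1) (?BB i) \<in> carrier N" if "i < q" for i
    using that cBB by (intro alternating_sum_closed[OF mN]) auto
  have sAB: "alternating_sum N q (?AB i) \<in> carrier N" if "i < r" for i
    using that cAB by (intro alternating_sum_closed[OF mN]) auto
  have sAB': "alternating_sum N r (\<lambda>i. ?AB i j) \<in> carrier N" if "j < q" for j
    using that cAB by (intro alternating_sum_closed[OF mN]) auto
  have zAA: "alternating_sum N r (\<lambda>i. alternating_sum N (r - 1) (?AA i)) = \<zero>\<^bsub>N\<^esub>"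
  proof (rule alternating_sum_faces_zero[OF mN cAA])
    fix i j assume "j < i" "i < r"
    then show "?AA i j = ?AA j (i - 1)" using face_face[OF A, of as "r - 1" j i] as by simp
  qed
  have zBB: "alternating_sum N q (\<lambda>i. alternating_sum N (q - 1) (?BB i)) = \<zero>\<^bsub>N\<^esub>"
  proof (rule alternating_sum_faces_zero[OF mN cBB])
    fix i j assume "j < i" "i < q"
    then show "?BB i j = ?BB j (i - 1)" using face_face[OF assoc_algebra_opp[OF B], of bs "q - 1" j i] bs by simp
  qed
  let ?T = "alternating_sum N r (\<lambda>i. alternating_sum N q (?AB i))"
  have T: "?T \<in> carrier N" by (rule alternating_sum_closed[OF mN sAB])
  \<comment> \<open>A face of \<open>as\<close> is shorter by one letter, hence the exponent
    \<open>r - 1\<close> instead of \<open>r\<close>.\<close>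
  have 1: "alternating_sum N r (\<lambda>i. tri_diff A B N f (face A i as) bs m) = signed N (r - 1) ?T"
  proof -
    have "alternating_sum N r (\<lambda>i. tri_diff A B N f (face A i as) bs m) =
      alternating_sum N r (\<lambda>i. alternating_sum N (r - 1) (?AA i) \<oplus>\<^bsub>N\<^esub> signed N (r - 1) (alternating_sum N q (?AB i)))"
      using F(1) by (intro alternating_sum_cong[OF mN] tri_diff_closed[OF f]) (auto simp: tri_diff_def la q_def)
    also have "\<dots> = alternating_sum N r (\<lambda>i. alternating_sum N (r - 1) (?AA i)) \<oplus>\<^bsub>N\<^esub>
        alternating_sum N r (\<lambda>i. signed N (r - 1) (alternating_sum N q (?AB i)))"
      by (rule alternating_sum_add[OF mN sAA signed_closed[OF mN sAB]])
    also have "\<dots> = signed N (r - 1) ?T"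
    proof -
      have "alternating_sum N r (\<lambda>i. signed N (r - 1) (alternating_sum N q (?AB i))) = signed N (r - 1) ?T"
        by (rule alternating_sum_signed[OF mN sAB])
      then show ?thesis unfolding zAA using T signed_closed[OF mN] by simp
    qed
    finally show ?thesis .
  qed
  have 2: "alternating_sum N q (\<lambda>j. tri_diff A B N f as (face (opp B) j bs) m) = ?T"
  proof -
    have "alternating_sum N q (\<lambda>j. tri_diff A B N f as (face (opp B) j bs) m) =
      alternating_sum N q (\<lambda>j. alternating_sum N r (\<lambda>i. ?AB i j) \<oplus>\<^bsub>N\<^esub> signed N r (alternating_sum N (q - 1) (?BB j)))"
      using F(2) by (intro alternating_sum_cong[OF mN] tri_diff_closed[OF f]) (auto simp: tri_diff_def lb r_def)
    also have "\<dots> = alternating_sum N q (\<lambda>j. alternating_sum N r (\<lambda>i. ?AB i j)) \<oplus>\<^bsub>N\<^esub>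
        alternating_sum N q (\<lambda>j. signed N r (alternating_sum N (q - 1) (?BB j)))"
      by (rule alternating_sum_add[OF mN sAB' signed_closed[OF mN sBB]])
    also have "\<dots> = alternating_sum N q (\<lambda>j. alternating_sum N r (\<lambda>i. ?AB i j))"
    proof -
      have "alternating_sum N q (\<lambda>j. signed N r (alternating_sum N (q - 1) (?BB j))) =
          signed N r (alternating_sum N q (\<lambda>j. alternating_sum N (q - 1) (?BB j)))"
        by (rule alternating_sum_signed[OF mN sBB])
      moreover have "alternating_sum N q (\<lambda>j. alternating_sum N r (\<lambda>i. ?AB i j)) \<in> carrier N"
        by (rule alternating_sum_closed[OF mN sAB'])
      ultimately show ?thesis
        unfolding zBB by (simp add: linmap_zero[OF linmap_signed_id[OF mN] mN mN])
    qed
    also have "\<dots> = ?T" by (rule alternating_sum_swap[OF mN cAB])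
    finally show ?thesis .
  qed
  have "signed N (r - 1) ?T \<oplus>\<^bsub>N\<^esub> signed N r ?T = \<zero>\<^bsub>N\<^esub>"
  proof (cases r)
    \<comment> \<open>Truncated subtraction gives both terms the same sign here, but the mixed sum
      is empty, so nothing has to cancel.\<close>
    case 0
    then have "?T = \<zero>\<^bsub>N\<^esub>" by (simp add: alternating_sum_0[OF mN])
    then show ?thesis by (simp add: linmap_zero[OF linmap_signed_id[OF mN] mN mN])
  next
    case (Suc r')
    then show ?thesis using T by (simp add: signed_Suc[OF mN] N.r_neg signed_closed[OF mN])
  qed
  then show ?thesis unfolding tri_diff_def[of A B N "\<lambda>(as, bs, m). tri_diff A B N f as bs m"]
      prod.case r_def[symmetric] q_def[symmetric] 1 2 .
qed

lemma cochain_complex_tri: "cochain_complex K (tri_complex K A B M N)"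
  unfolding cochain_complex_def
proof (intro conjI allI ballI)
  fix n
  show "module K (deg (tri_complex K A B M N) n)" by (rule module_tri)
  have closed: "diff (tri_complex K A B M N) n f \<in> tri_hom K A B M N (Suc n)"
    if "f \<in> carrier (deg (tri_complex K A B M N) n)" for n f
    unfolding diff_tri using that
    by (intro restrict_in_tri_hom tri_conditions_tri_diff) (simp add: carrier_tri tri_hom_iff)
  show "linmap K (deg (tri_complex K A B M N) n) (deg (tri_complex K A B M N) (Suc n)) (diff (tri_complex K A B M N) n)"
  proof (subst deg_tri[of K A B M N "Suc n"], rule linmap_into_fun_module[OF closed tri_hom_subset _ module_tri])
    fix w assume "w \<in> tri_words A B M (Suc n)"
    then obtain as bs m where w: "w = (as, bs, m)" "(as, bs, m) \<in> tri_words A B M (Suc n)" by (cases w) auto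
    have "linmap K (deg (tri_complex K A B M N) n) N (\<lambda>f. tri_diff A B N f as bs m)"
      unfolding tri_diff_def using tri_words_face[OF w(2)]
      by (intro linmap_plus_fun linmap_signed_fun linmap_alternating_sum_fun bimoduleD(1)[OF N] linmap_tri_eval) auto
    then show "linmap K (deg (tri_complex K A B M N) n) N (\<lambda>f. diff (tri_complex K A B M N) n f w)"
      using w by (simp add: diff_tri)
  qed
  fix f assume "f \<in> carrier (deg (tri_complex K A B M N) n)"
  then have fc: "f w \<in> carrier N" if "w \<in> tri_words A B M n" for w
    using that tri_hom_subset by (fastforce simp: carrier_tri)
  have "tri_diff A B N (diff (tri_complex K A B M N) n f) as bs m = \<zero>\<^bsub>N\<^esub>"
    if w: "(as, bs, m) \<in> tri_words A B M (Suc (Suc n))" for as bs m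
  proof -
    have "tri_diff A B N (diff (tri_complex K A B M N) n f) as bs m =
        tri_diff A B N (\<lambda>(as, bs, m). tri_diff A B N f as bs m) as bs m"
      using tri_words_face[OF w]
      by (intro tri_diff_eqI[OF refl refl _ w]) (auto simp: diff_tri intro!: tri_diff_closed[OF fc])
    also have "\<dots> = \<zero>\<^bsub>N\<^esub>" by (rule tri_diff_tri_diff[OF fc w])
    finally show ?thesis .
  qed
  then show "diff (tri_complex K A B M N) (Suc n) (diff (tri_complex K A B M N) n f) =
      \<zero>\<^bsub>deg (tri_complex K A B M N) (Suc (Suc n))\<^esub>"
    by (subst diff_tri) (auto simp: deg_tri intro!: restrict_ext)
qed

end

end

section \<open>Functoriality of the triangular complex in both bimodules\<close>

lemma bimod_homD:
  assumes "bimod_hom K A B M N f"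
  shows "linmap K M N f" "a \<in> carrier A \<Longrightarrow> x \<in> carrier M \<Longrightarrow> f (lact M a x) = lact N a (f x)"
    "b \<in> carrier B \<Longrightarrow> x \<in> carrier M \<Longrightarrow> f (ract M x b) = ract N (f x) b"
  using assms by (auto simp: bimod_hom_def left_linear_def right_linear_def)

text \<open>Faces do not touch the module entry, so \<open>u\<close> commutes with them; and
  \<open>v\<close>, being linear, commutes with the alternating sums.\<close>

lemma cochain_map_tri_map:
  fixes K :: "'k ring"
  assumes A: "assoc_algebra K A" and B: "assoc_algebra K B"
    and X: "bimodule K A B X" "bimodule K A B X'" and Y: "bimodule K A B Y" "bimodule K A B Y'"
    and u: "bimod_hom K A B X' X u" and v: "bimod_hom K A B Y Y' v"
  shows "cochain_map K (tri_complex K A B X Y) (tri_complex K A B X' Y') (\<lambda>n. tri_map A B X' n u v)"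
  unfolding cochain_map_def
proof (intro conjI allI ballI)
  note bu = bimod_homD[OF u] and bv = bimod_homD[OF v]
  fix n
  have uw: "(as, bs, u x) \<in> tri_words A B X k" if "(as, bs, x) \<in> tri_words A B X' k" for as bs x k
    using that linmap_closed[OF bu(1)] by (auto simp: tri_words_iff)
  have map: "tri_map A B X' n u v f = (\<lambda>w\<in>tri_words A B X' n. (\<lambda>(as, bs, x). v (f (as, bs, u x))) w)" for f
    by (simp add: tri_map_def)
  show "linmap K (deg (tri_complex K A B X Y) n) (deg (tri_complex K A B X' Y') n) (tri_map A B X' n u v)"
  proof (subst deg_tri[of K A B X' Y' n], rule linmap_into_fun_module[OF _ tri_hom_subset _ module_tri[OF A B X(1) Y(1)]])
    fix f assume "f \<in> carrier (deg (tri_complex K A B X Y) n)"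
    then have f: "tri_conditions K A B X Y n f" by (simp add: carrier_tri tri_hom_iff)
    note D = tri_conditionsD[OF f uw]
    show "tri_map A B X' n u v f \<in> tri_hom K A B X' Y' n"
      unfolding map
    proof (rule restrict_in_tri_hom[OF A B X(2) Y(2)])
      show "tri_conditions K A B X' Y' n (\<lambda>(as, bs, x). v (f (as, bs, u x)))"
        unfolding tri_conditions_def prod.case
      proof (intro allI impI conjI ballI)
        fix as bs x assume w: "(as, bs, x) \<in> tri_words A B X' n"
        then have x: "x \<in> carrier X'" by (simp add: tri_words_iff)
        show "v (f (as, bs, u x)) \<in> carrier Y'" using linmap_closed[OF bv(1)] D(1)[OF w] by blast
        show "linmap K A Y' (\<lambda>y. v (f (as[i := y], bs, u x)))" if "i < length as" for i
          by (rule linmap_comp[OF D(2)[OF w that] bv(1)])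
        show "linmap K B Y' (\<lambda>y. v (f (as, bs[i := y], u x)))" if "i < length bs" for i
          by (rule linmap_comp[OF D(3)[OF w that] bv(1)])
        show "linmap K X' Y' (\<lambda>z. v (f (as, bs, u z)))"
          by (rule linmap_comp[OF linmap_comp[OF bu(1) D(4)[OF w]] bv(1)])
        show "v (f (as[length as - 1 := as ! (length as - 1) \<otimes>\<^bsub>A\<^esub> a], bs, u x)) = v (f (as, bs, u (lact X' a x)))"
          if a: "a \<in> carrier A" for a
          unfolding bu(2)[OF a x] D(7)[OF w a] ..
        show "v (f (as, bs[length bs - 1 := b \<otimes>\<^bsub>B\<^esub> bs ! (length bs - 1)], u x)) = v (f (as, bs, u (ract X' x b)))"
          if b: "b \<in> carrier B" for b
          unfolding bu(3)[OF b x] D(8)[OF w b] ..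
      qed (auto simp: D(5,6) bv D(1))
    qed
  next
    fix w assume "w \<in> tri_words A B X' n"
    then obtain as bs x where w: "w = (as, bs, x)" "(as, bs, x) \<in> tri_words A B X' n" by (cases w) auto
    then show "linmap K (deg (tri_complex K A B X Y) n) Y' (\<lambda>f. tri_map A B X' n u v f w)"
      using linmap_comp[OF linmap_tri_eval[OF A B X(1) Y(1) uw[OF w(2)]] bv(1)] by (simp add: tri_map_def)
  qed
  fix f assume "f \<in> carrier (deg (tri_complex K A B X Y) n)"
  then have f: "f w \<in> carrier Y" if "w \<in> tri_words A B X n" for w
    using that tri_hom_subset by (fastforce simp: carrier_tri)
  have "v (tri_diff A B Y f as bs (u x)) = tri_diff A B Y' (tri_map A B X' n u v f) as bs x"
    if w: "(as, bs, x) \<in> tri_words A B X' (Suc n)" for as bs x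
  proof -
    have "v (tri_diff A B Y f as bs (u x)) = tri_diff A B Y' (\<lambda>w. v (f w)) as bs (u x)"
      by (rule linmap_tri_diff[OF A B X(1) Y(1) bv(1) bimoduleD(1)[OF Y(2)] f uw[OF w]])
    also have "\<dots> = tri_diff A B Y' (tri_map A B X' n u v f) as bs x"
      using tri_words_face[OF A B X(2) w] linmap_closed[OF bv(1)] f uw
      by (intro tri_diff_eqI[OF A B X(2) Y(2) refl refl _ w]) (auto simp: tri_map_def)
    finally show ?thesis .
  qed
  then show "tri_map A B X' (Suc n) u v (diff (tri_complex K A B X Y) n f) =
      diff (tri_complex K A B X' Y') n (tri_map A B X' n u v f)"
    unfolding diff_tri by (auto simp: tri_map_def[of A B X' "Suc n"] uw intro!: restrict_ext)
qed

text \<open>Substituting \<open>r - j\<close> for \<open>j\<close> changes every sign by the same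
  factor, the parity of \<open>r\<close>. With \<open>face_opp_rev\<close> this is the sign by which
  reversing words alters the bar differential.\<close>

lemma alternating_sum_reverse:
  fixes K :: "'k ring"
  assumes N: "module K N" and g: "\<And>i. i \<le> r \<Longrightarrow> g i \<in> carrier N"
  shows "alternating_sum N (Suc r) (\<lambda>j. g (r - j)) = signed N r (alternating_sum N (Suc r) g)"
proof -
  interpret N: module K N by (rule N)
  note sc = signed_closed[OF N]
  have im: "(\<lambda>j. r - j) ` {..<Suc r} = {..<Suc r}"
  proof -
    have "x \<in> (\<lambda>j. r - j) ` {..<Suc r}" if "x < Suc r" for x
      using that by (intro image_eqI[of _ _ "r - x"]) auto
    then show ?thesis by auto
  qed
  have "signed N r (alternating_sum N (Suc r) g) = alternating_sum N (Suc r) (\<lambda>i. signed N r (g i))"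
    using alternating_sum_signed[OF N, of "Suc r" g r] g by simp
  also have "\<dots> = finsum N (\<lambda>i. signed N i (signed N r (g i))) ((\<lambda>j. r - j) ` {..<Suc r})"
    by (simp add: alternating_sum_def im)
  also have "\<dots> = finsum N (\<lambda>j. signed N (r - j) (signed N r (g (r - j)))) {..<Suc r}"
    using g by (intro N.finsum_reindex) (auto simp: inj_on_def intro!: sc)
  also have "\<dots> = finsum N (\<lambda>j. signed N j (g (r - j))) {..<Suc r}"
  proof (intro N.finsum_cong' refl)
    fix j assume "j \<in> {..<Suc r}"
    then show "signed N (r - j) (signed N r (g (r - j))) = signed N j (g (r - j))"
      using g by (auto simp: signed_signed[OF N] intro!: signed_cong)
  qed (auto intro!: sc g)
  finally show ?thesis by (simp add: alternating_sum_def)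
qed

lemma diff_hochschild':
  "diff (hochschild K T \<Lambda>) n f = (\<lambda>w\<in>tensor_words T (n + 3). alternating_sum \<Lambda> (n + 2) (\<lambda>i. f (face T i w)))"
  unfolding diff_hochschild alternating_sum_def ..

lemma carrier_hochschild_mem:
  "f \<in> carrier (deg (hochschild K T \<Lambda>) n) \<Longrightarrow> w \<in> tensor_words T (n + 2) \<Longrightarrow> f w \<in> carrier \<Lambda>"
  using hochschild_subset by blast

lemma hochschild_eqI:
  assumes "f \<in> carrier (deg (hochschild K T \<Lambda>) n)" "g \<in> carrier (deg (hochschild K T \<Lambda>) n)"
    "\<And>w. w \<in> tensor_words T (n + 2) \<Longrightarrow> f w = g w"
  shows "f = g"
  by (rule PiE_ext[OF subsetD[OF hochschild_subset assms(1)] subsetD[OF hochschild_subset assms(2)] assms(3)])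

section \<open>Restriction to the subcomplexes of the two algebras\<close>

context
  fixes K :: "'k ring" and A :: "('k, 'a) module" and B :: "('k, 'b) module"
    and M :: "('k, 'm, 'a, 'b) bimod" and N :: "('k, 'n, 'a, 'b) bimod"
  assumes A: "assoc_algebra K A" and B: "assoc_algebra K B"
    and M: "bimodule K A B M" and N: "bimodule K A B N"
begin

interpretation A: ring A by (rule assoc_algebraD(2)[OF A])
interpretation B: ring B by (rule assoc_algebraD(2)[OF B])

text \<open>On words whose second list is \<open>[\<one>]\<close> the B-part of the differential has
  no faces, and only the bar differential on the first list is left. What requires an argument is
  right linearity of the value as a function of the module element.\<close>

lemma cochain_map_iA:
  "cochain_map K (tri_complex K A B M N) (hochschild K A (hom_right K B M N)) (\<lambda>n. iA A B M n)"
  unfolding cochain_map_def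
proof (intro conjI allI ballI)
  note H = coefficients_hom_right[OF M N] and mN = bimoduleD(1)[OF N]
  fix n
  have w1: "(w, [\<one>\<^bsub>B\<^esub>], m) \<in> tri_words A B M k" if "w \<in> tensor_words A (k + 2)" "m \<in> carrier M" for w m k
    using that by (auto simp: tri_words_iff tensor_words_def)
  have len: "length w = n + 2" if "w \<in> tensor_words A (n + 2)" for w using that by (simp add: tensor_words_def)
  have mem: "iA A B M n f \<in> carrier (deg (hochschild K A (hom_right K B M N)) n)"
    if "f \<in> carrier (deg (tri_complex K A B M N) n)" for f
  proof -
    have f: "tri_conditions K A B M N n f" using that by (simp add: carrier_tri tri_hom_iff)
    note D = tri_conditionsD[OF f w1]
    have in_hom: "(\<lambda>m\<in>carrier M. f (w, [\<one>\<^bsub>B\<^esub>], m)) \<in> carrier (hom_right K B M N)"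
      if w: "w \<in> tensor_words A (n + 2)" for w
      unfolding hom_right_simps
    proof (rule restrict_in_intertwiners[OF bimoduleD(1)[OF M]])
      show "linmap K M N (\<lambda>m. f (w, [\<one>\<^bsub>B\<^esub>], m))"
        using tri_conditionsD(4)[OF f w1[OF w]] M by (meson abelian_group_def abelian_monoid.zero_closed bimoduleD(1) module_def)
      fix \<phi> \<psi> m assume "(\<phi>, \<psi>) \<in> right_ops B M N" and m: "m \<in> carrier M"
      then obtain b where b: "b \<in> carrier B" "\<phi> = (\<lambda>x. ract M x b)" "\<psi> = (\<lambda>y. ract N y b)"
        by (auto simp: right_ops_def)
      show "\<phi> m \<in> carrier M" using b m bimodule_closed[OF M] by simp
      \<comment> \<open>The first and the last letter of a one-letter list coincide: the outer
        action and the balancing relation both replace the letter \<open>\<one>\<close> by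
        \<open>b\<close>.\<close>
      show "f (w, [\<one>\<^bsub>B\<^esub>], \<phi> m) = \<psi> (f (w, [\<one>\<^bsub>B\<^esub>], m))"
        using D(6)[OF w m b(1)] D(8)[OF w m b(1)] b by simp
    qed
    have "restrict (\<lambda>w. \<lambda>m\<in>carrier M. f (w, [\<one>\<^bsub>B\<^esub>], m)) (tensor_words A (n + 2)) \<in>
        carrier (deg (hochschild K A (hom_right K B M N)) n)"
    proof (rule restrict_in_hochschild[OF A H in_hom])
      fix w i assume w: "w \<in> tensor_words A (n + 2)" and i: "i < n + 2"
      show "linmap K A (hom_right K B M N) (\<lambda>x. \<lambda>m\<in>carrier M. f (w[i := x], [\<one>\<^bsub>B\<^esub>], m))"
      proof (rule linmap_into_hom_right[OF M N assoc_algebraD(1)[OF A]])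
        show "(\<lambda>m\<in>carrier M. f (w[i := x], [\<one>\<^bsub>B\<^esub>], m)) \<in> carrier (hom_right K B M N)" if "x \<in> carrier A" for x
          by (rule in_hom[OF tensor_words_update[OF w that]])
        show "linmap K A N (\<lambda>x. (\<lambda>m\<in>carrier M. f (w[i := x], [\<one>\<^bsub>B\<^esub>], m)) m)" if "m \<in> carrier M" for m
          using D(2)[OF w that, of i] i w that by (simp add: len)
      qed
    next
      fix w t assume w: "w \<in> tensor_words A (n + 2)" and t: "t \<in> carrier A"
      show "(\<lambda>m\<in>carrier M. f (w[0 := t \<otimes>\<^bsub>A\<^esub> w ! 0], [\<one>\<^bsub>B\<^esub>], m)) =
          lact (hom_right K B M N) t (\<lambda>m\<in>carrier M. f (w, [\<one>\<^bsub>B\<^esub>], m))"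
        using D(5)[OF w _ t] by (auto intro!: restrict_ext)
      show "(\<lambda>m\<in>carrier M. f (w[n + 1 := w ! (n + 1) \<otimes>\<^bsub>A\<^esub> t], [\<one>\<^bsub>B\<^esub>], m)) =
          ract (hom_right K B M N) (\<lambda>m\<in>carrier M. f (w, [\<one>\<^bsub>B\<^esub>], m)) t"
        using D(7)[OF w _ t] len[OF w] bimodule_closed[OF M] t by (auto intro!: restrict_ext)
    qed simp_all
    then show ?thesis by (simp add: iA_def)
  qed
  show "linmap K (deg (tri_complex K A B M N) n) (deg (hochschild K A (hom_right K B M N)) n) (iA A B M n)"
  proof (subst deg_hochschild, rule linmap_into_fun_module[OF mem hochschild_subset _ module_tri[OF A B M N]])
    fix w assume w: "w \<in> tensor_words A (n + 2)"
    show "linmap K (deg (tri_complex K A B M N) n) (hom_right K B M N) (\<lambda>f. iA A B M n f w)"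
    proof (rule linmap_into_hom_right[OF M N module_tri[OF A B M N]])
      show "iA A B M n f w \<in> carrier (hom_right K B M N)" if "f \<in> carrier (deg (tri_complex K A B M N) n)" for f
        by (rule carrier_hochschild_mem[OF mem[OF that] w])
      show "linmap K (deg (tri_complex K A B M N) n) N (\<lambda>f. iA A B M n f w m)" if "m \<in> carrier M" for m
        using linmap_tri_eval[OF A B M N w1[OF w that]] w that by (simp add: iA_def)
    qed
  qed
  fix f assume f: "f \<in> carrier (deg (tri_complex K A B M N) n)"
  have mH: "module K (hom_right K B M N)" by (rule coefficientsD(1)[OF A H])
  have fc: "f v \<in> carrier N" if "v \<in> tri_words A B M n" for v
    using f that tri_hom_subset by (fastforce simp: carrier_tri)
  have "tri_diff A B N f w [\<one>\<^bsub>B\<^esub>] m = alternating_sum (hom_right K B M N) (n + 2) (\<lambda>i. iA A B M n f (face A i w)) m"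
    if w: "w \<in> tensor_words A (n + 3)" and m: "m \<in> carrier M" for w m
  proof -
    have face: "face A i w \<in> tensor_words A (n + 2)" if "i < n + 2" for i
      using face_closed[OF A, of w "n + 2" i] w that by (simp add: numeral_3_eq_3)
    have lw: "length w = n + 3" using w by (simp add: tensor_words_def)
    have "alternating_sum (hom_right K B M N) (n + 2) (\<lambda>i. iA A B M n f (face A i w)) m =
        alternating_sum N (n + 2) (\<lambda>i. iA A B M n f (face A i w) m)"
      by (rule linmap_alternating_sum[OF linmap_hom_right_eval[OF M N m] mH mN]) (rule carrier_hochschild_mem[OF mem[OF f] face])
    also have "\<dots> = alternating_sum N (n + 2) (\<lambda>i. f (face A i w, [\<one>\<^bsub>B\<^esub>], m))"
      using face m fc w1[of _ n m] by (intro alternating_sum_cong[OF mN]) (auto simp: iA_def)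
    moreover have "alternating_sum N (n + 2) (\<lambda>i. f (face A i w, [\<one>\<^bsub>B\<^esub>], m)) \<in> carrier N"
      using face m fc w1[of _ n m] by (intro alternating_sum_closed[OF mN]) auto
    \<comment> \<open>The list \<open>[\<one>]\<close> has no faces, so the B-part is a signed empty
      sum.\<close>
    ultimately show ?thesis
      using bimoduleD(1)[OF N]
      by (simp add: tri_diff_def lw alternating_sum_0[OF mN] linmap_zero[OF linmap_signed_id[OF mN] mN mN]
        module_def abelian_group_def abelian_monoid.r_zero del: One_nat_def)
  qed
  moreover have "alternating_sum (hom_right K B M N) (n + 2) (\<lambda>i. iA A B M n f (face A i w)) \<in> extensional (carrier M)"
    if w: "w \<in> tensor_words A (n + 3)" for w
  proof -
    have "face A i w \<in> tensor_words A (n + 2)" if "i < n + 2" for i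
      using face_closed[OF A, of w "n + 2" i] w that by (simp add: numeral_3_eq_3)
    then have "alternating_sum (hom_right K B M N) (n + 2) (\<lambda>i. iA A B M n f (face A i w)) \<in> carrier (hom_right K B M N)"
      by (intro alternating_sum_closed[OF mH] carrier_hochschild_mem[OF mem[OF f]])
    then show ?thesis by (simp add: intertwinersD(3))
  qed
  ultimately show "iA A B M (Suc n) (diff (tri_complex K A B M N) n f) = diff (hochschild K A (hom_right K B M N)) n (iA A B M n f)"
    unfolding diff_hochschild' diff_tri iA_def[of A B M "Suc n"]
    by (auto simp: w1[of _ "Suc n", simplified] numeral_3_eq_3 intro!: restrict_ext extensionalityI[of _ "carrier M"])
qed

text \<open>On words whose first list is \<open>[\<one>]\<close> the differential is the bar
  differential of \<open>opp B\<close>. Reading words backwards turns it into that of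
  \<open>B\<close> up to the sign of \<open>n + 1\<close>; the factor in \<open>iB\<close> absorbs
  these signs over all degrees.\<close>

lemma cochain_map_iB:
  "cochain_map K (tri_complex K A B M N) (hochschild K B (hom_left K A M N)) (\<lambda>n. iB A B M N n)"
  unfolding cochain_map_def
proof (intro conjI allI ballI)
  note H = coefficients_hom_left[OF M N] and mN = bimoduleD(1)[OF N]
  fix n
  define e where "e k = k * (k + 1) div 2" for k :: nat
  have iB: "iB A B M N k f = (\<lambda>w\<in>tensor_words B (k + 2). \<lambda>m\<in>carrier M. signed N (e k) (f ([\<one>\<^bsub>A\<^esub>], rev w, m)))" for k f
    by (simp add: iB_def e_def)
  have w1: "([\<one>\<^bsub>A\<^esub>], rev w, m) \<in> tri_words A B M k" if "w \<in> tensor_words B (k + 2)" "m \<in> carrier M" for w m k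
    using that by (auto simp: tri_words_iff tensor_words_def)
  have len: "length w = n + 2" if "w \<in> tensor_words B (n + 2)" for w using that by (simp add: tensor_words_def)
  have mem: "iB A B M N n f \<in> carrier (deg (hochschild K B (hom_left K A M N)) n)"
    if "f \<in> carrier (deg (tri_complex K A B M N) n)" for f
  proof -
    have f: "tri_conditions K A B M N n f" using that by (simp add: carrier_tri tri_hom_iff)
    note D = tri_conditionsD[OF f w1]
    have in_hom: "(\<lambda>m\<in>carrier M. signed N (e n) (f ([\<one>\<^bsub>A\<^esub>], rev w, m))) \<in> carrier (hom_left K A M N)"
      if w: "w \<in> tensor_words B (n + 2)" for w
      unfolding hom_left_simps
    proof (rule restrict_in_intertwiners[OF bimoduleD(1)[OF M]])
      show "linmap K M N (\<lambda>m. signed N (e n) (f ([\<one>\<^bsub>A\<^esub>], rev w, m)))"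
        using tri_conditionsD(4)[OF f w1[OF w]] M
        by (intro linmap_signed_fun mN) (meson abelian_group_def abelian_monoid.zero_closed bimoduleD(1) module_def)
      fix \<phi> \<psi> m assume "(\<phi>, \<psi>) \<in> left_ops A M N" and m: "m \<in> carrier M"
      then obtain a where a: "a \<in> carrier A" "\<phi> = lact M a" "\<psi> = lact N a"
        by (auto simp: left_ops_def)
      show "\<phi> m \<in> carrier M" using a m bimodule_closed[OF M] by simp
      show "signed N (e n) (f ([\<one>\<^bsub>A\<^esub>], rev w, \<phi> m)) = \<psi> (signed N (e n) (f ([\<one>\<^bsub>A\<^esub>], rev w, m)))"
        using D(5)[OF w m a(1)] D(7)[OF w m a(1)] a linmap_signed[OF bimoduleD(2)[OF N a(1)] mN mN D(1)[OF w m]]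
        by simp
    qed
    \<comment> \<open>Letter \<open>i\<close> of a word is letter \<open>n + 1 - i\<close> of its
      reversal. In particular the outer left and outer right letters are exchanged, which matches
      the two actions of \<open>hom_left\<close>.\<close>
    have rev_up: "rev (w[i := x]) = (rev w)[n + 1 - i := x]" if "length w = n + 2" "i < n + 2" for i x and w :: "'b list"
      using that by (simp add: rev_update)
    have "restrict (\<lambda>w. \<lambda>m\<in>carrier M. signed N (e n) (f ([\<one>\<^bsub>A\<^esub>], rev w, m))) (tensor_words B (n + 2)) \<in>
        carrier (deg (hochschild K B (hom_left K A M N)) n)"
    proof (rule restrict_in_hochschild[OF B H in_hom])
      fix w i assume w: "w \<in> tensor_words B (n + 2)" and i: "i < n + 2"
      show "linmap K B (hom_left K A M N) (\<lambda>x. \<lambda>m\<in>carrier M. signed N (e n) (f ([\<one>\<^bsub>A\<^esub>], rev (w[i := x]), m)))"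
      proof (rule linmap_into_hom_left[OF M N assoc_algebraD(1)[OF B]])
        show "(\<lambda>m\<in>carrier M. signed N (e n) (f ([\<one>\<^bsub>A\<^esub>], rev (w[i := x]), m))) \<in> carrier (hom_left K A M N)" if "x \<in> carrier B" for x
          by (rule in_hom[OF tensor_words_update[OF w that]])
        show "linmap K B N (\<lambda>x. (\<lambda>m\<in>carrier M. signed N (e n) (f ([\<one>\<^bsub>A\<^esub>], rev (w[i := x]), m))) m)" if "m \<in> carrier M" for m
          using linmap_signed_fun[OF D(3)[OF w that, of "n + 1 - i"] mN] i w that by (simp add: len rev_up)
      qed
    next
      fix w t assume w: "w \<in> tensor_words B (n + 2)" and t: "t \<in> carrier B"
      note lw = len[OF w]
      have nth: "rev w ! (n + 1) = w ! 0" "rev w ! 0 = w ! (n + 1)" using lw by (simp_all add: rev_nth)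
      show "(\<lambda>m\<in>carrier M. signed N (e n) (f ([\<one>\<^bsub>A\<^esub>], rev (w[0 := t \<otimes>\<^bsub>B\<^esub> w ! 0]), m))) =
          lact (hom_left K A M N) t (\<lambda>m\<in>carrier M. signed N (e n) (f ([\<one>\<^bsub>A\<^esub>], rev w, m)))"
        using D(8)[OF w _ t] lw nth bimodule_closed[OF M] t by (auto simp: rev_up intro!: restrict_ext)
      show "(\<lambda>m\<in>carrier M. signed N (e n) (f ([\<one>\<^bsub>A\<^esub>], rev (w[n + 1 := w ! (n + 1) \<otimes>\<^bsub>B\<^esub> t]), m))) =
          ract (hom_left K A M N) (\<lambda>m\<in>carrier M. signed N (e n) (f ([\<one>\<^bsub>A\<^esub>], rev w, m))) t"
        using D(6)[OF w _ t] lw nth linmap_signed[OF bimoduleD(3)[OF N t] mN mN D(1)[OF w]]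
        by (auto simp: rev_up intro!: restrict_ext)
    qed simp_all
    then show ?thesis by (simp add: iB)
  qed
  show "linmap K (deg (tri_complex K A B M N) n) (deg (hochschild K B (hom_left K A M N)) n) (iB A B M N n)"
  proof (subst deg_hochschild, rule linmap_into_fun_module[OF mem hochschild_subset _ module_tri[OF A B M N]])
    fix w assume w: "w \<in> tensor_words B (n + 2)"
    show "linmap K (deg (tri_complex K A B M N) n) (hom_left K A M N) (\<lambda>f. iB A B M N n f w)"
    proof (rule linmap_into_hom_left[OF M N module_tri[OF A B M N]])
      show "iB A B M N n f w \<in> carrier (hom_left K A M N)" if "f \<in> carrier (deg (tri_complex K A B M N) n)" for f
        by (rule carrier_hochschild_mem[OF mem[OF that] w])
      show "linmap K (deg (tri_complex K A B M N) n) N (\<lambda>f. iB A B M N n f w m)" if "m \<in> carrier M" for m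
        using linmap_signed_fun[OF linmap_tri_eval[OF A B M N w1[OF w that]] mN] w that by (simp add: iB)
    qed
  qed
  fix f assume f: "f \<in> carrier (deg (tri_complex K A B M N) n)"
  have mH: "module K (hom_left K A M N)" by (rule coefficientsD(1)[OF B H])
  have fc: "f v \<in> carrier N" if "v \<in> tri_words A B M n" for v
    using f that tri_hom_subset by (fastforce simp: carrier_tri)
  have "signed N (e (Suc n)) (tri_diff A B N f [\<one>\<^bsub>A\<^esub>] (rev w) m) =
      alternating_sum (hom_left K A M N) (n + 2) (\<lambda>i. iB A B M N n f (face B i w)) m"
    if w: "w \<in> tensor_words B (n + 3)" and m: "m \<in> carrier M" for w m
  proof -
    have face: "face B i w \<in> tensor_words B (n + 2)" if "i < n + 2" for i
      using face_closed[OF B, of w "n + 2" i] w that by (simp add: numeral_3_eq_3)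
    have lw: "length w = n + 3" using w by (simp add: tensor_words_def)
    let ?g = "\<lambda>i. f ([\<one>\<^bsub>A\<^esub>], rev (face B i w), m)"
    have gc: "?g i \<in> carrier N" if "i \<le> n + 1" for i using fc w1[OF face m, of i] that by simp
    have sc: "alternating_sum N (Suc (n + 1)) ?g \<in> carrier N"
      by (rule alternating_sum_closed[OF mN]) (auto intro: gc)
    have "tri_diff A B N f [\<one>\<^bsub>A\<^esub>] (rev w) m = alternating_sum N (n + 2) (\<lambda>j. f ([\<one>\<^bsub>A\<^esub>], face (opp B) j (rev w), m))"
    proof -
      have "alternating_sum N (n + 2) (\<lambda>j. f ([\<one>\<^bsub>A\<^esub>], face (opp B) j (rev w), m)) \<in> carrier N"
        using fc tri_words_face(2)[OF A B M w1[OF _ m, of w "Suc n"]] w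
        by (intro alternating_sum_closed[OF mN]) (auto simp: lw numeral_3_eq_3)
      then show ?thesis using mN
        by (simp add: tri_diff_def lw alternating_sum_0[OF mN] signed_def module_def abelian_group_def abelian_monoid.l_zero
            del: One_nat_def)
    qed
    also have "\<dots> = alternating_sum N (Suc (n + 1)) (\<lambda>j. ?g (n + 1 - j))"
    proof -
      have "alternating_sum N (n + 2) (\<lambda>j. ?g (n + 1 - j)) = alternating_sum N (n + 2) (\<lambda>j. f ([\<one>\<^bsub>A\<^esub>], face (opp B) j (rev w), m))"
      proof (rule alternating_sum_cong[OF mN])
        fix j assume j: "j < n + 2"
        show "?g (n + 1 - j) = f ([\<one>\<^bsub>A\<^esub>], face (opp B) j (rev w), m)"
          using face_opp_rev[of w "n + 2" j B] j lw by simp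
      qed (rule gc, simp)
      then show ?thesis by simp
    qed
    also have "\<dots> = signed N (n + 1) (alternating_sum N (Suc (n + 1)) ?g)"
      by (rule alternating_sum_reverse[OF mN gc])
    finally have 1: "signed N (e (Suc n)) (tri_diff A B N f [\<one>\<^bsub>A\<^esub>] (rev w) m) =
        signed N (e (Suc n) + (n + 1)) (alternating_sum N (Suc (n + 1)) ?g)"
      by (simp add: signed_signed[OF mN sc] del: One_nat_def)
    \<comment> \<open>Triangular numbers: adding the reversal sign \<open>n + 1\<close> once more
      gives \<open>e n + 2 * (n + 1)\<close>, of the same parity as \<open>e n\<close>. This
      recursion is the reason for the exponent in \<open>iB\<close>.\<close>
    have "e (Suc n) = e n + (n + 1)"
      using gauss_sum_nat[of n] gauss_sum_nat[of "Suc n"] by (simp add: e_def)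
    then have "signed N (e (Suc n) + (n + 1)) x = signed N (e n) x" for x
      by (intro signed_cong) auto
    then have "signed N (e (Suc n)) (tri_diff A B N f [\<one>\<^bsub>A\<^esub>] (rev w) m) = signed N (e n) (alternating_sum N (Suc (n + 1)) ?g)"
      using 1 by simp
    also have "\<dots> = alternating_sum N (n + 2) (\<lambda>i. signed N (e n) (?g i))"
      using alternating_sum_signed[OF mN, of "Suc (n + 1)" ?g "e n"] gc by simp
    also have "\<dots> = alternating_sum N (n + 2) (\<lambda>i. iB A B M N n f (face B i w) m)"
      using face m gc by (intro alternating_sum_cong[OF mN] signed_closed[OF mN]) (auto simp: iB)
    also have "\<dots> = alternating_sum (hom_left K A M N) (n + 2) (\<lambda>i. iB A B M N n f (face B i w)) m"
      by (rule linmap_alternating_sum[OF linmap_hom_left_eval[OF M N m] mH mN, symmetric]) (rule carrier_hochschild_mem[OF mem[OF f] face])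
    finally show ?thesis .
  qed
  moreover have "alternating_sum (hom_left K A M N) (n + 2) (\<lambda>i. iB A B M N n f (face B i w)) \<in> extensional (carrier M)"
    if w: "w \<in> tensor_words B (n + 3)" for w
  proof -
    have "face B i w \<in> tensor_words B (n + 2)" if "i < n + 2" for i
      using face_closed[OF B, of w "n + 2" i] w that by (simp add: numeral_3_eq_3)
    then have "alternating_sum (hom_left K A M N) (n + 2) (\<lambda>i. iB A B M N n f (face B i w)) \<in> carrier (hom_left K A M N)"
      by (intro alternating_sum_closed[OF mH] carrier_hochschild_mem[OF mem[OF f]])
    then show ?thesis by (simp add: intertwinersD(3))
  qed
  ultimately show "iB A B M N (Suc n) (diff (tri_complex K A B M N) n f) = diff (hochschild K B (hom_left K A M N)) n (iB A B M N n f)"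
    unfolding diff_hochschild' diff_tri iB[of "Suc n"]
    by (auto simp: w1[of _ "Suc n", simplified] numeral_3_eq_3 intro!: restrict_ext extensionalityI[of _ "carrier M"])
qed

end

context
  fixes K :: "'k ring" and A :: "('k, 'a) module" and B :: "('k, 'b) module"
    and X :: "('k, 'x, 'a, 'b) bimod" and Y :: "('k, 'y, 'a, 'b) bimod"
    and X' :: "('k, 'x1, 'a, 'b) bimod" and Y' :: "('k, 'y1, 'a, 'b) bimod" and u v
  assumes A: "assoc_algebra K A" and B: "assoc_algebra K B"
    and X: "bimodule K A B X" "bimodule K A B X'" and Y: "bimodule K A B Y" "bimodule K A B Y'"
    and u: "bimod_hom K A B X' X u" and v: "bimod_hom K A B Y Y' v"
begin

text \<open>The coefficient map sends \<open>h\<close> to \<open>v\<close> after \<open>h\<close>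
  after \<open>u\<close>. It respects both actions of \<open>A\<close> because \<open>u\<close> and
  \<open>v\<close> are left linear, and it preserves right linear maps because they are right
  linear.\<close>

lemma cochain_map_hom_map_right:
  "cochain_map K (hochschild K A (hom_right K B X Y)) (hochschild K A (hom_right K B X' Y')) (\<lambda>n. hom_map A X' n u v)"
  unfolding hom_map_def
proof (rule cochain_map_hochschild[OF A coefficients_hom_right[OF X(1) Y(1)] coefficients_hom_right[OF X(2) Y(2)]])
  note bu = bimod_homD[OF u] and bv = bimod_homD[OF v]
  show "linmap K (hom_right K B X Y) (hom_right K B X' Y') (\<lambda>h. \<lambda>x\<in>carrier X'. v (h (u x)))"
  proof (rule linmap_into_hom_right[OF X(2) Y(2) coefficientsD(1)[OF A coefficients_hom_right[OF X(1) Y(1)]]])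
    fix h assume "h \<in> carrier (hom_right K B X Y)"
    then have h: "h \<in> intertwiners K X Y (right_ops B X Y)" by simp
    have hr: "h (ract X x b) = ract Y (h x) b" if "x \<in> carrier X" "b \<in> carrier B" for x b
      using intertwinersD(4)[OF h, of "\<lambda>x. ract X x b" "\<lambda>y. ract Y y b"] that by (auto simp: right_ops_def)
    show "(\<lambda>x\<in>carrier X'. v (h (u x))) \<in> carrier (hom_right K B X' Y')"
      unfolding hom_right_simps
      by (rule restrict_in_intertwiners[OF bimoduleD(1)[OF X(2)]
            linmap_comp[OF linmap_comp[OF bu(1) intertwinersD(1)[OF h]] bv(1)]])
        (auto simp: right_ops_def bimodule_closed[OF X(2)] bu bv hr linmap_closed[OF bu(1)] intertwinersD(2)[OF h])
  next
    fix x assume x: "x \<in> carrier X'"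
    show "linmap K (hom_right K B X Y) Y' (\<lambda>h. (\<lambda>x\<in>carrier X'. v (h (u x))) x)"
      using linmap_comp[OF linmap_hom_right_eval[OF X(1) Y(1) linmap_closed[OF bu(1) x]] bv(1)] x by simp
  qed
qed (auto simp: linmap_closed[OF bimod_homD(1)[OF u]] bimod_homD(2)[OF u] bimod_homD(2)[OF v]
    bimodule_closed[OF X(2)] intertwinersD(2) intro!: restrict_ext)

lemma cochain_map_hom_map_left:
  "cochain_map K (hochschild K B (hom_left K A X Y)) (hochschild K B (hom_left K A X' Y')) (\<lambda>n. hom_map B X' n u v)"
  unfolding hom_map_def
proof (rule cochain_map_hochschild[OF B coefficients_hom_left[OF X(1) Y(1)] coefficients_hom_left[OF X(2) Y(2)]])
  note bu = bimod_homD[OF u] and bv = bimod_homD[OF v]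
  show "linmap K (hom_left K A X Y) (hom_left K A X' Y') (\<lambda>h. \<lambda>x\<in>carrier X'. v (h (u x)))"
  proof (rule linmap_into_hom_left[OF X(2) Y(2) coefficientsD(1)[OF B coefficients_hom_left[OF X(1) Y(1)]]])
    fix h assume "h \<in> carrier (hom_left K A X Y)"
    then have h: "h \<in> intertwiners K X Y (left_ops A X Y)" by simp
    have hr: "h (lact X a x) = lact Y a (h x)" if "x \<in> carrier X" "a \<in> carrier A" for x a
      using intertwinersD(4)[OF h, of "lact X a" "lact Y a"] that by (auto simp: left_ops_def)
    show "(\<lambda>x\<in>carrier X'. v (h (u x))) \<in> carrier (hom_left K A X' Y')"
      unfolding hom_left_simps
      by (rule restrict_in_intertwiners[OF bimoduleD(1)[OF X(2)]
            linmap_comp[OF linmap_comp[OF bu(1) intertwinersD(1)[OF h]] bv(1)]])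
        (auto simp: left_ops_def bimodule_closed[OF X(2)] bu bv hr linmap_closed[OF bu(1)] intertwinersD(2)[OF h])
  next
    fix x assume x: "x \<in> carrier X'"
    show "linmap K (hom_left K A X Y) Y' (\<lambda>h. (\<lambda>x\<in>carrier X'. v (h (u x))) x)"
      using linmap_comp[OF linmap_hom_left_eval[OF X(1) Y(1) linmap_closed[OF bu(1) x]] bv(1)] x by simp
  qed
qed (auto simp: linmap_closed[OF bimod_homD(1)[OF u]] bimod_homD(3)[OF u] bimod_homD(3)[OF v]
    bimodule_closed[OF X(2)] intertwinersD(2) intro!: restrict_ext)

end

section \<open>The structure maps of a bimodule as cochain maps\<close>

lemma regular_simps [simp]:
  "carrier (regular T) = carrier T" "lact (regular T) = mult T" "ract (regular T) = mult T"
  by (simp_all add: regular_def)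

lemma linmap_regular [simp]: "linmap K (regular T) N f = linmap K T N f"
  by (simp add: linmap_def regular_def)

context
  fixes K :: "'k ring" and A :: "('k, 'a) module" and B :: "('k, 'b) module" and M :: "('k, 'm, 'a, 'b) bimod"
  assumes A: "assoc_algebra K A" and B: "assoc_algebra K B" and M: "bimodule K A B M"
begin

text \<open>A left multiplication on \<open>M\<close> is right linear because the actions commute,
  and multiplicativity of the left action makes the coefficient map compatible with both actions of
  \<open>A\<close>.\<close>

lemma cochain_map_alphaM:
  "cochain_map K (hochschild K A (regular A)) (hochschild K A (hom_right K B M M)) (\<lambda>n. alphaM A M n)"
  unfolding alphaM_def
proof (rule cochain_map_hochschild[OF A coefficients_regular[OF A] coefficients_hom_right[OF M M]])
  have "linmap K A (hom_right K B M M) (\<lambda>a. \<lambda>m\<in>carrier M. lact M a m)"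
  proof (rule linmap_into_hom_right[OF M M assoc_algebraD(1)[OF A]])
    show "(\<lambda>m\<in>carrier M. lact M a m) \<in> carrier (hom_right K B M M)" if "a \<in> carrier A" for a
      unfolding hom_right_simps using that
      by (intro restrict_in_intertwiners bimoduleD(1,2)[OF M])
        (auto simp: right_ops_def bimodule_closed[OF M] bimoduleD(10)[OF M])
    show "linmap K A M (\<lambda>a. (\<lambda>m\<in>carrier M. lact M a m) m)" if "m \<in> carrier M" for m
      using bimoduleD(4)[OF M that] that by simp
  qed
  then show "linmap K (regular A) (hom_right K B M M) (\<lambda>a. \<lambda>m\<in>carrier M. lact M a m)" by simp
qed (auto simp: bimoduleD(6)[OF M] bimodule_closed[OF M] intro!: restrict_ext)

text \<open>Right multiplications, as operators, reverse products. The bimodule structure of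
  \<open>hom_left\<close> is the one coming from the opposite endomorphism algebra, for which
  \<beta> is compatible on both sides.\<close>

lemma cochain_map_betaM:
  "cochain_map K (hochschild K B (regular B)) (hochschild K B (hom_left K A M M)) (\<lambda>n. betaM B M n)"
  unfolding betaM_def
proof (rule cochain_map_hochschild[OF B coefficients_regular[OF B] coefficients_hom_left[OF M M]])
  have "linmap K B (hom_left K A M M) (\<lambda>b. \<lambda>m\<in>carrier M. ract M m b)"
  proof (rule linmap_into_hom_left[OF M M assoc_algebraD(1)[OF B]])
    show "(\<lambda>m\<in>carrier M. ract M m b) \<in> carrier (hom_left K A M M)" if "b \<in> carrier B" for b
      unfolding hom_left_simps using that
      by (intro restrict_in_intertwiners bimoduleD(1,3)[OF M])
        (auto simp: left_ops_def bimodule_closed[OF M] bimoduleD(10)[OF M])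
    show "linmap K B M (\<lambda>b. (\<lambda>m\<in>carrier M. ract M m b) m)" if "m \<in> carrier M" for m
      using bimoduleD(5)[OF M that] that by simp
  qed
  then show "linmap K (regular B) (hom_left K A M M) (\<lambda>b. \<lambda>m\<in>carrier M. ract M m b)" by simp
qed (auto simp: bimoduleD(7)[OF M] bimodule_closed[OF M] intro!: restrict_ext)

end

section \<open>Cones\<close>

lemma previous_simps [simp]: "previous F 0 = zero_submodule (F 0)" "previous F (Suc n) = F n"
  by (simp_all add: previous_def)

text \<open>In degree zero \<open>previous F\<close> is the zero submodule of \<open>F 0\<close>,
  and \<open>0 - 1 = 0\<close> on natural numbers. So the operations are those of
  \<open>F (n - 1)\<close> in every degree, and only the carrier tells degree zero apart.\<close>

lemma previous_ops:
  "\<zero>\<^bsub>previous F n\<^esub> = \<zero>\<^bsub>F (n - 1)\<^esub>" "add (previous F n) = add (F (n - 1))" "smult (previous F n) = smult (F (n - 1))"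
  by (cases n; simp add: zero_submodule_def)+

lemma module_previous: "(\<And>n. module K (F n)) \<Longrightarrow> module K (previous F n)"
  by (cases n) (simp_all add: module_zero_submodule)

lemma carrier_previous_subset:
  assumes "module K (F (n - 1))" shows "carrier (previous F n) \<subseteq> carrier (F (n - 1))"
  using assms by (cases n) (auto simp: zero_submodule_def module_def abelian_group_def abelian_monoid.zero_closed)

lemma linmap_previous:
  assumes "linmap K (F (n - 1)) Y f" "module K (F (n - 1))"
  shows "linmap K (previous F n) Y f"
  using carrier_previous_subset[where F=F and n=n, OF assms(2)] assms(1)
  by (auto simp: linmap_def previous_ops subset_iff Pi_iff)

lemma linmap_previous_previous:
  assumes f: "\<And>n. linmap K (F n) (G n) (f n)" and "\<And>n. module K (F n)" "\<And>n. module K (G n)"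
  shows "linmap K (previous F n) (previous G n) (f (n - 1))"
proof (cases n)
  \<comment> \<open>The domain is the zero module here; its single element stays zero by
    linearity.\<close>
  case 0
  then show ?thesis using f[of 0] linmap_zero[OF f[of 0] assms(2,3)] assms(2)[of 0]
    by (auto simp: linmap_def zero_submodule_def module_def abelian_group_def abelian_monoid.zero_closed)
qed (simp add: f)

lemma cochain_map_plus:
  assumes "cochain_map K X Y \<phi>" "cochain_map K X Y \<psi>" "cochain_complex K Y"
  shows "cochain_map K X Y (\<lambda>n x. \<phi> n x \<oplus>\<^bsub>deg Y n\<^esub> \<psi> n x)"
  using cochain_mapD[OF assms(1)] cochain_mapD[OF assms(2)]
    linmap_closed[OF cochain_mapD(1)[OF assms(1)]] linmap_closed[OF cochain_mapD(1)[OF assms(2)]]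
  by (auto simp: cochain_map_def linmap_add[OF cochain_complexD(2)[OF assms(3)]] cochain_complexD(1)[OF assms(3)]
      intro!: linmap_plus_fun)

lemma prod_cochains_simps [simp]:
  "deg (prod_cochains X Y) n = prod_module (deg X n) (deg Y n)"
  "diff (prod_cochains X Y) n (x, y) = (diff X n x, diff Y n y)"
  by (simp_all add: prod_cochains_def)

lemma linmap_map_prod:
  assumes "linmap K X X' f" "linmap K Y Y' g"
  shows "linmap K (prod_module X Y) (prod_module X' Y') (\<lambda>(x, y). (f x, g y))"
  using linmap_Pair[OF linmap_comp[OF linmap_fst[of K X Y] assms(1)] linmap_comp[OF linmap_snd[of K X Y] assms(2)]]
  by (simp add: case_prod_unfold)

lemma cochain_complex_prod:
  assumes "cochain_complex K X" "cochain_complex K Y"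
  shows "cochain_complex K (prod_cochains X Y)"
  unfolding cochain_complex_def
proof (intro conjI allI ballI)
  fix n
  show "linmap K (deg (prod_cochains X Y) n) (deg (prod_cochains X Y) (Suc n)) (diff (prod_cochains X Y) n)"
    using linmap_map_prod[OF cochain_complexD(2)[OF assms(1)] cochain_complexD(2)[OF assms(2)]]
    by (simp add: prod_cochains_def)
qed (use cochain_complexD[OF assms(1)] cochain_complexD[OF assms(2)] in \<open>auto intro: module_prod_module\<close>)

lemma cochain_map_Pair:
  "cochain_map K Z X \<phi> \<Longrightarrow> cochain_map K Z Y \<psi> \<Longrightarrow> cochain_map K Z (prod_cochains X Y) (\<lambda>n z. (\<phi> n z, \<psi> n z))"
  by (auto simp: cochain_map_def intro: linmap_Pair)

lemma cochain_map_fst: "cochain_map K (prod_cochains X Y) X (\<lambda>n. fst)"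
  and cochain_map_snd: "cochain_map K (prod_cochains X Y) Y (\<lambda>n. snd)"
  by (auto simp: cochain_map_def linmap_fst linmap_snd)

lemma deg_cone: "deg (cone X Y f) n = prod_module (deg X n) (previous (deg Y) n)"
  by (simp add: cone_def)

lemma diff_cone:
  "diff (cone X Y f) n (x, y) =
     (diff X n x, case n of 0 \<Rightarrow> f 0 x | Suc m \<Rightarrow> f n x \<ominus>\<^bsub>deg Y n\<^esub> diff Y m y)"
  by (simp add: cone_def)

lemma cochain_complex_cone:
  assumes X: "cochain_complex K X" and Y: "cochain_complex K Y" and f: "cochain_map K X Y f"
  shows "cochain_complex K (cone X Y f)"
  unfolding cochain_complex_def
proof (intro conjI allI ballI)
  fix n
  note mX = cochain_complexD(1)[OF X] and mY = cochain_complexD(1)[OF Y]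
  show "module K (deg (cone X Y f) n)"
    unfolding deg_cone by (intro module_prod_module module_previous mX mY)
  have "linmap K (prod_module (deg X n) (previous (deg Y) n)) (deg Y n)
      (\<lambda>z. case n of 0 \<Rightarrow> f 0 (fst z) | Suc m \<Rightarrow> f n (fst z) \<ominus>\<^bsub>deg Y n\<^esub> diff Y m (snd z))"
    using linmap_comp[OF linmap_fst cochain_mapD(1)[OF f]] linmap_comp[OF linmap_snd cochain_complexD(2)[OF Y]]
    by (cases n) (auto intro!: linmap_minus_fun mY)
  from linmap_Pair[OF linmap_comp[OF linmap_fst cochain_complexD(2)[OF X]] this]
  show "linmap K (deg (cone X Y f) n) (deg (cone X Y f) (Suc n)) (diff (cone X Y f) n)"
    unfolding deg_cone by (simp add: cone_def case_prod_unfold)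
  fix z assume "z \<in> carrier (deg (cone X Y f) n)"
  then obtain x y where z: "z = (x, y)" "x \<in> carrier (deg X n)" "y \<in> carrier (previous (deg Y) n)"
    by (auto simp: deg_cone)
  interpret Yn: module K "deg Y (Suc n)" by (rule mY)
  have fx: "f n x \<in> carrier (deg Y n)" "diff Y n (f n x) \<in> carrier (deg Y (Suc n))"
    using z linmap_closed[OF cochain_mapD(1)[OF f]] linmap_closed[OF cochain_complexD(2)[OF Y]] by auto
  have self: "diff Y n (f n x) \<ominus>\<^bsub>deg Y (Suc n)\<^esub> diff Y n (f n x) = \<zero>\<^bsub>deg Y (Suc n)\<^esub>"
    using fx by (simp add: a_minus_def Yn.r_neg)
  \<comment> \<open>Two successive differentials of \<open>y\<close> give zero, so \<open>y\<close>
    contributes nothing to the second differential of the cone.\<close>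
  have "diff Y n (f n x \<ominus>\<^bsub>deg Y n\<^esub> diff Y m y) = diff Y n (f n x)" if "n = Suc m" for m
  proof -
    have "y \<in> carrier (deg Y m)" using z that by simp
    then have "diff Y m y \<in> carrier (deg Y n)" "diff Y n (diff Y m y) = \<zero>\<^bsub>deg Y (Suc n)\<^esub>"
      using that linmap_closed[OF cochain_complexD(2)[OF Y]] cochain_complexD(3)[OF Y] by auto
    then show ?thesis using fx
      by (simp add: linmap_minus[OF cochain_complexD(2)[OF Y] mY mY] module_minus_zero[OF mY])
  qed
  then show "diff (cone X Y f) (Suc n) (diff (cone X Y f) n z) = \<zero>\<^bsub>deg (cone X Y f) (Suc (Suc n))\<^esub>"
    using z self by (cases n) (simp_all add: diff_cone deg_cone cochain_mapD(2)[OF f] cochain_complexD(3)[OF X])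
qed

text \<open>The square formed with \<open>f\<close> and \<open>f'\<close> commutes strictly on
  cochains, so the pair passes to the cones without a homotopy term.\<close>

lemma cochain_map_cone:
  assumes X: "cochain_complex K X" "cochain_complex K X'" and Y: "cochain_complex K Y" "cochain_complex K Y'"
    and f: "cochain_map K X Y f" and \<phi>: "cochain_map K X X' \<phi>" and \<psi>: "cochain_map K Y Y' \<psi>"
    and comm: "\<And>n x. x \<in> carrier (deg X n) \<Longrightarrow> \<psi> n (f n x) = f' n (\<phi> n x)"
  shows "cochain_map K (cone X Y f) (cone X' Y' f') (\<lambda>n (x, y). (\<phi> n x, \<psi> (n - 1) y))"
  unfolding cochain_map_def
proof (intro conjI allI ballI)
  fix n
  note mY = cochain_complexD(1)[OF Y(1)] cochain_complexD(1)[OF Y(2)]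
  show "linmap K (deg (cone X Y f) n) (deg (cone X' Y' f') n) (\<lambda>(x, y). (\<phi> n x, \<psi> (n - 1) y))"
    unfolding deg_cone
    by (intro linmap_map_prod cochain_mapD(1)[OF \<phi>] linmap_previous_previous cochain_mapD(1)[OF \<psi>] mY)
  fix z assume "z \<in> carrier (deg (cone X Y f) n)"
  then obtain x y where z: "z = (x, y)" "x \<in> carrier (deg X n)" "y \<in> carrier (previous (deg Y) n)"
    by (auto simp: deg_cone)
  show "(case diff (cone X Y f) n z of (x, y) \<Rightarrow> (\<phi> (Suc n) x, \<psi> (Suc n - 1) y)) =
      diff (cone X' Y' f') n (case z of (x, y) \<Rightarrow> (\<phi> n x, \<psi> (n - 1) y))"
  proof (cases n)
    case 0
    then show ?thesis using z comm[of x 0] by (simp add: diff_cone cochain_mapD(2)[OF \<phi>])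
  next
    case (Suc m)
    have "f n x \<in> carrier (deg Y n)" "diff Y m y \<in> carrier (deg Y n)"
      using z Suc linmap_closed[OF cochain_mapD(1)[OF f]] linmap_closed[OF cochain_complexD(2)[OF Y(1)]] by auto
    then show ?thesis using z Suc comm[of x n]
      by (simp add: diff_cone cochain_mapD(2)[OF \<phi>] cochain_mapD(2)[OF \<psi>] linmap_minus[OF cochain_mapD(1)[OF \<psi>] mY])
  qed
qed

section \<open>The complexes attached to a bimodule\<close>

text \<open>An element of \<open>Sigma_complex\<close> has three components with different kinds of
  arguments. A probe fixes every argument except the module element, so a cochain becomes a family
  of linear maps between two bimodules, to which block matrices apply.\<close>

datatype ('a, 'b) probe = Middle "'a list" "'b list" | Left "'a list" | Right "'b list"

text \<open>The outer components live in degree \<open>n - 1\<close>, whence words of length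
  \<open>n - 1 + 2\<close>. In degree zero the truncation agrees with the convention of
  \<open>previous\<close>.\<close>

definition probes :: "('k, 'a) module \<Rightarrow> ('k, 'b) module \<Rightarrow> nat \<Rightarrow> ('a, 'b) probe set" where
  "probes A B n = {Middle as bs | as bs. as \<noteq> [] \<and> bs \<noteq> [] \<and> length as + length bs = n + 3 \<and>
       set as \<subseteq> carrier A \<and> set bs \<subseteq> carrier B} \<union>
     Left ` tensor_words A (n - 1 + 2) \<union> Right ` tensor_words B (n - 1 + 2)"

fun probe_eval ::
  "('a, 'b) probe \<Rightarrow> ('a list \<times> 'b list \<times> 'm \<Rightarrow> 'n) \<times> ('a list \<Rightarrow> 'm \<Rightarrow> 'n) \<times> ('b list \<Rightarrow> 'm \<Rightarrow> 'n) \<Rightarrow> 'm \<Rightarrow> 'n" where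
  "probe_eval (Middle as bs) (g, f, h) x = g (as, bs, x)"
| "probe_eval (Left w) (g, f, h) x = f w x"
| "probe_eval (Right w) (g, f, h) x = h w x"

lemma end_deg:
  "deg (end_complex K A B X Y) n =
     prod_module (deg (hochschild K A (hom_right K B X Y)) n) (deg (hochschild K B (hom_left K A X Y)) n)"
  by (simp add: end_complex_def)

lemma Sigma_deg:
  "deg (Sigma_complex K A B X Y) n =
     prod_module (deg (tri_complex K A B X Y) n) (previous (deg (end_complex K A B X Y)) n)"
  by (simp add: Sigma_complex_def deg_cone)

context
  fixes K :: "'k ring" and A :: "('k, 'a) module" and B :: "('k, 'b) module"
  assumes A: "assoc_algebra K A" and B: "assoc_algebra K B"
begin

context
  fixes X :: "('k, 'x, 'a, 'b) bimod" and Y :: "('k, 'y, 'a, 'b) bimod"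
  assumes X: "bimodule K A B X" and Y: "bimodule K A B Y"
begin

lemma cochain_complex_end: "cochain_complex K (end_complex K A B X Y)"
  unfolding end_complex_def
  by (intro cochain_complex_prod cochain_complex_hochschild A B coefficients_hom_right[OF X Y] coefficients_hom_left[OF X Y])

lemma cochain_complex_Sigma: "cochain_complex K (Sigma_complex K A B X Y)"
  unfolding Sigma_complex_def
  by (intro cochain_complex_cone cochain_complex_tri A B X Y cochain_complex_end, unfold end_complex_def)
    (intro cochain_map_Pair cochain_map_iA cochain_map_iB A B X Y)

lemma Sigma_carrier:
  "carrier (deg (Sigma_complex K A B X Y) n) \<subseteq> tri_hom K A B X Y n \<times>
     carrier (deg (hochschild K A (hom_right K B X Y)) (n - 1)) \<times> carrier (deg (hochschild K B (hom_left K A X Y)) (n - 1))"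
  using carrier_previous_subset[where F="deg (end_complex K A B X Y)" and n=n, OF cochain_complexD(1)[OF cochain_complex_end]]
  by (auto simp: Sigma_deg carrier_tri end_deg)

text \<open>Linearity in the cochain: it moves sums and differences of cochains past a
  probe.\<close>

lemma linmap_probe:
  assumes p: "p \<in> probes A B n" and x: "x \<in> carrier X"
  shows "linmap K (deg (Sigma_complex K A B X Y) n) Y (\<lambda>s. probe_eval p s x)"
proof -
  note HA = coefficients_hom_right[OF X Y] and HB = coefficients_hom_left[OF X Y]
  note prev = linmap_previous[where F="deg (end_complex K A B X Y)" and n=n, OF _ cochain_complexD(1)[OF cochain_complex_end]]
  show ?thesis unfolding Sigma_deg
  proof (cases p)
    case (Middle as bs)
    then have "(as, bs, x) \<in> tri_words A B X n" using p x by (auto simp: probes_def tri_words_def)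
    from linmap_comp[OF linmap_fst linmap_tri_eval[OF A B X Y this]]
    have "linmap K (prod_module (deg (tri_complex K A B X Y) n) (previous (deg (end_complex K A B X Y)) n)) Y
      (\<lambda>s. fst s (as, bs, x))" .
    moreover have "(\<lambda>s. probe_eval p s x :: 'y) = (\<lambda>s. fst s (as, bs, x))" using Middle by (auto simp: fun_eq_iff)
    ultimately show "linmap K (prod_module (deg (tri_complex K A B X Y) n) (previous (deg (end_complex K A B X Y)) n)) Y
      (\<lambda>s. probe_eval p s x)" by simp
  next
    case (Left w)
    then have "w \<in> tensor_words A (n - 1 + 2)" using p by (auto simp: probes_def)
    from linmap_comp[OF linmap_hochschild_eval[OF A HA this] linmap_hom_right_eval[OF X Y x]]
    have "linmap K (deg (end_complex K A B X Y) (n - 1)) Y (\<lambda>s. fst s w x)"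
      unfolding end_deg by (rule linmap_comp[OF linmap_fst])
    from linmap_comp[OF linmap_snd prev[OF this]]
    have "linmap K (prod_module (deg (tri_complex K A B X Y) n) (previous (deg (end_complex K A B X Y)) n)) Y
      (\<lambda>s. fst (snd s) w x)" .
    moreover have "(\<lambda>s. probe_eval p s x :: 'y) = (\<lambda>s. fst (snd s) w x)" using Left by (auto simp: fun_eq_iff)
    ultimately show "linmap K (prod_module (deg (tri_complex K A B X Y) n) (previous (deg (end_complex K A B X Y)) n)) Y
      (\<lambda>s. probe_eval p s x)" by simp
  next
    case (Right w)
    then have "w \<in> tensor_words B (n - 1 + 2)" using p by (auto simp: probes_def)
    from linmap_comp[OF linmap_hochschild_eval[OF B HB this] linmap_hom_left_eval[OF X Y x]]
    have "linmap K (deg (end_complex K A B X Y) (n - 1)) Y (\<lambda>s. snd s w x)"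
      unfolding end_deg by (rule linmap_comp[OF linmap_snd])
    from linmap_comp[OF linmap_snd prev[OF this]]
    have "linmap K (prod_module (deg (tri_complex K A B X Y) n) (previous (deg (end_complex K A B X Y)) n)) Y
      (\<lambda>s. snd (snd s) w x)" .
    moreover have "(\<lambda>s. probe_eval p s x :: 'y) = (\<lambda>s. snd (snd s) w x)" using Right by (auto simp: fun_eq_iff)
    ultimately show "linmap K (prod_module (deg (tri_complex K A B X Y) n) (previous (deg (end_complex K A B X Y)) n)) Y
      (\<lambda>s. probe_eval p s x)" by simp
  qed
qed

lemma Sigma_cases:
  assumes "s \<in> carrier (deg (Sigma_complex K A B X Y) n)"
  obtains g f h where "s = (g, f, h)" "g \<in> tri_hom K A B X Y n"
    "f \<in> carrier (deg (hochschild K A (hom_right K B X Y)) (n - 1))"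
    "h \<in> carrier (deg (hochschild K B (hom_left K A X Y)) (n - 1))"
  using assms Sigma_carrier[of n] by blast

lemma hom_right_cochain:
  assumes "f \<in> carrier (deg (hochschild K A (hom_right K B X Y)) n)" "w \<in> tensor_words A (n + 2)"
  shows "linmap K X Y (f w)" "f w \<in> extensional (carrier X)"
  using carrier_hochschild_mem[OF assms] by (auto dest: intertwinersD)

lemma hom_left_cochain:
  assumes "f \<in> carrier (deg (hochschild K B (hom_left K A X Y)) n)" "w \<in> tensor_words B (n + 2)"
  shows "linmap K X Y (f w)" "f w \<in> extensional (carrier X)"
  using carrier_hochschild_mem[OF assms] by (auto dest: intertwinersD)

text \<open>Linearity in the module element: it allows an element of a direct sum to be expanded
  into its coordinates inside a cochain.\<close>

lemma linmap_probe_eval: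
  assumes p: "p \<in> probes A B n" and s: "s \<in> carrier (deg (Sigma_complex K A B X Y) n)"
  shows "linmap K X Y (probe_eval p s)"
proof -
  obtain g f h where s: "s = (g, f, h)" "g \<in> tri_hom K A B X Y n"
    "f \<in> carrier (deg (hochschild K A (hom_right K B X Y)) (n - 1))"
    "h \<in> carrier (deg (hochschild K B (hom_left K A X Y)) (n - 1))" by (rule Sigma_cases[OF s])
  show ?thesis
  proof (cases p)
    case (Middle as bs)
    \<comment> \<open>Linearity in the last entry is part of the conditions at a full word, so some
      element must fill that place; zero does.\<close>
    obtain x where "x \<in> carrier X"
      using bimoduleD(1)[OF X] by (meson abelian_group_def abelian_monoid.zero_closed module_def)
    then have "(as, bs, x) \<in> tri_words A B X n" using p Middle by (auto simp: probes_def tri_words_def)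
    from tri_conditionsD(4)[OF _ this, of K Y g] s(2) have "linmap K X Y (\<lambda>z. g (as, bs, z))" by (simp add: tri_hom_iff)
    moreover have "probe_eval p s = (\<lambda>z. g (as, bs, z))" using Middle s(1) by (simp add: fun_eq_iff)
    ultimately show ?thesis by simp
  next
    case (Left w)
    then have "linmap K X Y (f w)" using p s(3) by (auto simp: probes_def dest: hom_right_cochain)
    moreover have "probe_eval p s = f w" using Left s(1) by (simp add: fun_eq_iff)
    ultimately show ?thesis by simp
  next
    case (Right w)
    then have "linmap K X Y (h w)" using p s(4) by (auto simp: probes_def dest: hom_left_cochain)
    moreover have "probe_eval p s = h w" using Right s(1) by (simp add: fun_eq_iff)
    ultimately show ?thesis by simp
  qed
qed

text \<open>All components are extensional functions, so probes separate cochains. The identities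
  between blocks are proved through this lemma.\<close>

lemma Sigma_eqI:
  assumes s: "s \<in> carrier (deg (Sigma_complex K A B X Y) n)" "s' \<in> carrier (deg (Sigma_complex K A B X Y) n)"
    and eq: "\<And>p x. p \<in> probes A B n \<Longrightarrow> x \<in> carrier X \<Longrightarrow> probe_eval p s x = probe_eval p s' x"
  shows "s = s'"
proof -
  obtain g f h where t: "s = (g, f, h)" "g \<in> tri_hom K A B X Y n"
    "f \<in> carrier (deg (hochschild K A (hom_right K B X Y)) (n - 1))"
    "h \<in> carrier (deg (hochschild K B (hom_left K A X Y)) (n - 1))" by (rule Sigma_cases[OF s(1)])
  obtain g' f' h' where t': "s' = (g', f', h')" "g' \<in> tri_hom K A B X Y n"
    "f' \<in> carrier (deg (hochschild K A (hom_right K B X Y)) (n - 1))"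
    "h' \<in> carrier (deg (hochschild K B (hom_left K A X Y)) (n - 1))" by (rule Sigma_cases[OF s(2)])
  have "g = g'"
  proof (rule PiE_ext[OF subsetD[OF tri_hom_subset t(2)] subsetD[OF tri_hom_subset t'(2)]])
    fix w assume "w \<in> tri_words A B X n"
    then obtain as bs x where w: "w = (as, bs, x)" "x \<in> carrier X" "Middle as bs \<in> probes A B n"
      by (auto simp: tri_words_def probes_def)
    then show "g w = g' w" using eq[OF w(3,2)] t t' by simp
  qed
  moreover have "f = f'"
  proof (rule hochschild_eqI[OF t(3) t'(3)])
    fix w assume w: "w \<in> tensor_words A (n - 1 + 2)"
    then have "Left w \<in> probes A B n" by (simp add: probes_def)
    from eq[OF this] show "f w = f' w" using t(1) t'(1)
      by (intro extensionalityI[OF hom_right_cochain(2)[OF t(3) w] hom_right_cochain(2)[OF t'(3) w]]) simp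
  qed
  moreover have "h = h'"
  proof (rule hochschild_eqI[OF t(4) t'(4)])
    fix w assume w: "w \<in> tensor_words B (n - 1 + 2)"
    then have "Right w \<in> probes A B n" by (simp add: probes_def)
    from eq[OF this] show "h w = h' w" using t(1) t'(1)
      by (intro extensionalityI[OF hom_left_cochain(2)[OF t(4) w] hom_left_cochain(2)[OF t'(4) w]]) simp
  qed
  ultimately show ?thesis using t(1) t'(1) by simp
qed

end

text \<open>Under a probe an induced map becomes composition with \<open>u\<close> before and
  \<open>v\<close> after. Composites of induced maps are thereby governed by composites of bimodule
  maps.\<close>

lemma probe_Sigma_map:
  assumes "p \<in> probes A B n" "x \<in> carrier X'"
  shows "probe_eval p (Sigma_map A B X' n u v s) x = v (probe_eval p s (u x))"
  using assms by (cases s; cases p) (auto simp: probes_def Sigma_map_def tri_map_def hom_map_def tri_words_def)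

lemma cochain_map_Sigma_map:
  fixes X :: "('k, 'x, 'a, 'b) bimod" and Y :: "('k, 'y, 'a, 'b) bimod"
    and X' :: "('k, 'x1, 'a, 'b) bimod" and Y' :: "('k, 'y1, 'a, 'b) bimod"
  assumes X: "bimodule K A B X" "bimodule K A B X'" and Y: "bimodule K A B Y" "bimodule K A B Y'"
    and u: "bimod_hom K A B X' X u" and v: "bimod_hom K A B Y Y' v"
  shows "cochain_map K (Sigma_complex K A B X Y) (Sigma_complex K A B X' Y') (\<lambda>n. Sigma_map A B X' n u v)"
proof -
  have e: "(\<lambda>n. Sigma_map A B X' n u v) = (\<lambda>n (g, y). (tri_map A B X' n u v g,
      (\<lambda>n y. (hom_map A X' n u v (fst y), hom_map B X' n u v (snd y))) (n - 1) y))"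
    by (simp add: Sigma_map_def fun_eq_iff case_prod_unfold)
  have i: "cochain_map K (tri_complex K A B X Y) (end_complex K A B X Y) (\<lambda>n f. (iA A B X n f, iB A B X Y n f))"
    unfolding end_complex_def by (intro cochain_map_Pair cochain_map_iA cochain_map_iB A B X Y)
  show ?thesis
    unfolding e Sigma_complex_def
  proof (rule cochain_map_cone[OF cochain_complex_tri[OF A B X(1) Y(1)] cochain_complex_tri[OF A B X(2) Y(2)]
        cochain_complex_end[OF X(1) Y(1)] cochain_complex_end[OF X(2) Y(2)] i cochain_map_tri_map[OF A B X Y u v]])
    show "cochain_map K (end_complex K A B X Y) (end_complex K A B X' Y')
        (\<lambda>n y. (hom_map A X' n u v (fst y), hom_map B X' n u v (snd y)))"
      unfolding end_complex_def
      by (intro cochain_map_Pair cochain_map_comp[OF cochain_map_fst cochain_map_hom_map_right[OF A B X Y u v]]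
        cochain_map_comp[OF cochain_map_snd cochain_map_hom_map_left[OF A B X Y u v]])
    fix n f assume "f \<in> carrier (deg (tri_complex K A B X Y) n)"
    then have fc: "f w \<in> carrier Y" if "w \<in> tri_words A B X n" for w
      using that tri_hom_subset by (fastforce simp: carrier_tri)
    interpret A: ring A by (rule assoc_algebraD(2)[OF A])
    interpret B: ring B by (rule assoc_algebraD(2)[OF B])
    \<comment> \<open>The sign in \<open>iB\<close> is taken in the target module, so
      \<open>v\<close> has to be moved past it.\<close>
    have s: "v (signed Y k (f ([\<one>\<^bsub>A\<^esub>], rev w, u x))) = signed Y' k (v (f ([\<one>\<^bsub>A\<^esub>], rev w, u x)))"
      if "w \<in> tensor_words B (n + 2)" "x \<in> carrier X'" for k w x
      using that linmap_closed[OF bimod_homD(1)[OF u]]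
      by (intro linmap_signed[OF bimod_homD(1)[OF v] bimoduleD(1)[OF Y(1)] bimoduleD(1)[OF Y(2)]] fc)
        (auto simp: tri_words_def tensor_words_def)
    show "(hom_map A X' n u v (fst (iA A B X n f, iB A B X Y n f)), hom_map B X' n u v (snd (iA A B X n f, iB A B X Y n f))) =
      (iA A B X' n (tri_map A B X' n u v f), iB A B X' Y' n (tri_map A B X' n u v f))"
      using linmap_closed[OF bimod_homD(1)[OF u]] s
      by (auto simp: hom_map_def iA_def iB_def tri_map_def tri_words_def tensor_words_def intro!: restrict_ext)
  qed
qed

end

text \<open>An element \<open>((f, g, h), e)\<close> of the cone \<open>C_cone\<close> is regarded as \<open>(f, h)\<close> together with the
  element \<open>(g, e)\<close> of \<open>Sigma_complex\<close>. In these terms the differential of the cone is that of the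
  direct sum of the complexes, plus the twisting term \<open>tau f h\<close> in \<open>Sigma_complex\<close>.\<close>

definition tau where
  "tau K A B X n f h = (\<zero>\<^bsub>deg (tri_complex K A B X X) (Suc n)\<^esub>, alphaM A X n f, betaM B X n h)"

definition wrap :: "'f \<Rightarrow> 'h \<Rightarrow> 'g \<times> 'e \<Rightarrow> ('f \<times> 'g \<times> 'h) \<times> 'e" where
  "wrap f h s = ((f, fst s, h), snd s)"

definition sigma_part :: "('f \<times> 'g \<times> 'h) \<times> 'e \<Rightarrow> 'g \<times> 'e" where
  "sigma_part c = (fst (snd (fst c)), snd c)"

lemma wrap_simps [simp]:
  "sigma_part (wrap f h s) = s" "fst (fst (wrap f h s)) = f" "snd (snd (fst (wrap f h s))) = h"
  by (simp_all add: sigma_part_def wrap_def)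

context
  fixes K :: "'k ring" and A :: "('k, 'a) module" and B :: "('k, 'b) module" and X :: "('k, 'x, 'a, 'b) bimod"
  assumes A: "assoc_algebra K A" and B: "assoc_algebra K B" and X: "bimodule K A B X"
begin

abbreviation (input) "HA \<equiv> hochschild K A (regular A)"
abbreviation (input) "HB \<equiv> hochschild K B (regular B)"
abbreviation (input) "SX \<equiv> Sigma_complex K A B X X"
abbreviation (input) "CX \<equiv> C_cone K A B X"

lemma cochain_complex_HA: "cochain_complex K HA" and cochain_complex_HB: "cochain_complex K HB"
  by (intro cochain_complex_hochschild A B coefficients_regular)+

lemma C_deg:
  "deg CX n = prod_module (prod_module (deg HA n) (prod_module (deg (tri_complex K A B X X) n) (deg HB n)))
     (previous (deg (end_complex K A B X X)) n)"
  by (simp add: C_cone_def deg_cone)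

lemma wrap_in_C:
  "wrap f h s \<in> carrier (deg CX n) \<longleftrightarrow> f \<in> carrier (deg HA n) \<and> h \<in> carrier (deg HB n) \<and> s \<in> carrier (deg SX n)"
  by (cases s) (auto simp: C_deg wrap_def Sigma_deg)

lemma C_cases:
  assumes "c \<in> carrier (deg CX n)"
  obtains f h s where "c = wrap f h s" "f \<in> carrier (deg HA n)" "h \<in> carrier (deg HB n)" "s \<in> carrier (deg SX n)"
proof -
  obtain f g h e where c: "c = ((f, g, h), e)" by (metis prod.collapse)
  then have "c = wrap f h (g, e)" by (simp add: wrap_def)
  then show ?thesis using that[of f h "(g, e)"] assms wrap_in_C by metis
qed

lemma wrap_ops:
  "\<zero>\<^bsub>deg CX n\<^esub> = wrap \<zero>\<^bsub>deg HA n\<^esub> \<zero>\<^bsub>deg HB n\<^esub> \<zero>\<^bsub>deg SX n\<^esub>"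
  "wrap f h s \<oplus>\<^bsub>deg CX n\<^esub> wrap f' h' s' = wrap (f \<oplus>\<^bsub>deg HA n\<^esub> f') (h \<oplus>\<^bsub>deg HB n\<^esub> h') (s \<oplus>\<^bsub>deg SX n\<^esub> s')"
  "k \<odot>\<^bsub>deg CX n\<^esub> wrap f h s = wrap (k \<odot>\<^bsub>deg HA n\<^esub> f) (k \<odot>\<^bsub>deg HB n\<^esub> h) (k \<odot>\<^bsub>deg SX n\<^esub> s)"
  by (cases s; cases s'; simp add: C_deg wrap_def Sigma_deg)+

lemma linmap_sigma_part: "linmap K (deg CX n) (deg SX n) sigma_part"
  by (rule linmapI; elim C_cases) (simp_all add: wrap_ops)

lemma linmap_wrap:
  assumes "linmap K Z (deg HA n) a" "linmap K Z (deg HB n) b" "linmap K Z (deg SX n) s"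
  shows "linmap K Z (deg CX n) (\<lambda>z. wrap (a z) (b z) (s z))"
  by (rule linmapI) (simp_all add: wrap_ops wrap_in_C linmap_closed[OF assms(1)] linmap_closed[OF assms(2)]
      linmap_closed[OF assms(3)] linmap_add[OF assms(1)] linmap_add[OF assms(2)] linmap_add[OF assms(3)]
      linmap_smult[OF assms(1)] linmap_smult[OF assms(2)] linmap_smult[OF assms(3)])

lemma linmap_C_fst: "linmap K (deg CX n) (deg HA n) (\<lambda>c. fst (fst c))"
  and linmap_C_snd: "linmap K (deg CX n) (deg HB n) (\<lambda>c. snd (snd (fst c)))"
  by (rule linmapI; elim C_cases; simp add: wrap_ops; simp add: wrap_def)+

lemma cochain_complex_C_cone: "cochain_complex K CX"
  unfolding C_cone_def
proof (rule cochain_complex_cone)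
  let ?P = "prod_cochains HA (prod_cochains (tri_complex K A B X X) HB)"
  note tri = cochain_complex_tri[OF A B X X]
  show P: "cochain_complex K ?P"
    by (intro cochain_complex_prod cochain_complex_HA cochain_complex_HB tri)
  show "cochain_complex K (end_complex K A B X X)" by (rule cochain_complex_end[OF A B X X])
  have fst_snd: "cochain_map K ?P (tri_complex K A B X X) (\<lambda>n x. fst (snd x))"
    and snd_snd: "cochain_map K ?P HB (\<lambda>n x. snd (snd x))"
    by (rule cochain_map_comp[OF cochain_map_snd cochain_map_fst] cochain_map_comp[OF cochain_map_snd cochain_map_snd])+
  have "cochain_map K ?P (end_complex K A B X X) (\<lambda>n x.
      (alphaM A X n (fst x) \<oplus>\<^bsub>deg (hochschild K A (hom_right K B X X)) n\<^esub> iA A B X n (fst (snd x)),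
       betaM B X n (snd (snd x)) \<oplus>\<^bsub>deg (hochschild K B (hom_left K A X X)) n\<^esub> iB A B X X n (fst (snd x))))"
    unfolding end_complex_def
    by (intro cochain_map_Pair cochain_map_plus
      cochain_map_comp[OF cochain_map_fst cochain_map_alphaM[OF A B X]]
      cochain_map_comp[OF fst_snd cochain_map_iA[OF A B X X]]
      cochain_map_comp[OF snd_snd cochain_map_betaM[OF A B X]]
      cochain_map_comp[OF fst_snd cochain_map_iB[OF A B X X]]
      cochain_complex_hochschild A B coefficients_hom_right[OF X X] coefficients_hom_left[OF X X])
  then show "cochain_map K ?P (end_complex K A B X X) (\<lambda>n (f, g, h).
      (alphaM A X n f \<oplus>\<^bsub>deg (hochschild K A (hom_right K B X X)) n\<^esub> iA A B X n g,
       betaM B X n h \<oplus>\<^bsub>deg (hochschild K B (hom_left K A X X)) n\<^esub> iB A B X X n g))"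
    by (simp add: case_prod_unfold)
qed

lemma tau_closed:
  assumes "f \<in> carrier (deg HA n)" "h \<in> carrier (deg HB n)"
  shows "tau K A B X n f h \<in> carrier (deg SX (Suc n))"
  using linmap_closed[OF cochain_mapD(1)[OF cochain_map_alphaM[OF A B X]] assms(1)]
    linmap_closed[OF cochain_mapD(1)[OF cochain_map_betaM[OF A B X]] assms(2)]
    cochain_complexD(1)[OF cochain_complex_tri[OF A B X X], of "Suc n"]
  by (simp add: tau_def Sigma_deg end_deg module_def abelian_group_def abelian_monoid.zero_closed)

lemma probe_tau:
  assumes "p \<in> probes A B (Suc n)" "x \<in> carrier X"
  shows "probe_eval p (tau K A B X n f h) x =
    (case p of Middle as bs \<Rightarrow> \<zero>\<^bsub>X\<^esub> | Left w \<Rightarrow> lact X (f w) x | Right w \<Rightarrow> ract X x (h w))"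
  using assms by (cases p) (auto simp: tau_def probes_def deg_tri tri_words_def alphaM_def betaM_def)

lemma diff_C_cone:
  assumes f: "f \<in> carrier (deg HA n)" and h: "h \<in> carrier (deg HB n)" and s: "s \<in> carrier (deg SX n)"
  shows "diff CX n (wrap f h s) =
    wrap (diff HA n f) (diff HB n h) (diff SX n s \<oplus>\<^bsub>deg SX (Suc n)\<^esub> tau K A B X n f h)"
proof -
  obtain g e where ge: "s = (g, e)" "g \<in> carrier (deg (tri_complex K A B X X) n)"
      "e \<in> carrier (previous (deg (end_complex K A B X X)) n)"
    using s by (auto simp: Sigma_deg)
  let ?E = "deg (end_complex K A B X X) n"
  interpret E: module K ?E by (rule cochain_complexD[OF cochain_complex_end[OF A B X X]])
  interpret T: module K "deg (tri_complex K A B X X) (Suc n)" by (rule cochain_complexD[OF cochain_complex_tri[OF A B X X]])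
  let ?a = "(alphaM A X n f, betaM B X n h)" and ?i = "(iA A B X n g, iB A B X X n g)"
  have a: "?a \<in> carrier ?E"
    using linmap_closed[OF cochain_mapD(1)[OF cochain_map_alphaM[OF A B X]] f]
      linmap_closed[OF cochain_mapD(1)[OF cochain_map_betaM[OF A B X]] h] by (simp add: end_deg)
  have i: "?i \<in> carrier ?E"
    using linmap_closed[OF cochain_mapD(1)[OF cochain_map_iA[OF A B X X]] ge(2)]
      linmap_closed[OF cochain_mapD(1)[OF cochain_map_iB[OF A B X X]] ge(2)] by (simp add: end_deg)
  have ai: "(alphaM A X n f \<oplus>\<^bsub>deg (hochschild K A (hom_right K B X X)) n\<^esub> iA A B X n g,
       betaM B X n h \<oplus>\<^bsub>deg (hochschild K B (hom_left K A X X)) n\<^esub> iB A B X X n g) = ?a \<oplus>\<^bsub>?E\<^esub> ?i"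
    by (simp add: end_deg)
  have dg: "diff (tri_complex K A B X X) n g \<in> carrier (deg (tri_complex K A B X X) (Suc n))"
    using ge linmap_closed[OF cochain_complexD(2)[OF cochain_complex_tri[OF A B X X]]] by blast
  have dg0: "diff (tri_complex K A B X X) n g \<oplus>\<^bsub>deg (tri_complex K A B X X) (Suc n)\<^esub>
      \<zero>\<^bsub>deg (tri_complex K A B X X) (Suc n)\<^esub> = diff (tri_complex K A B X X) n g"
    by (rule T.r_zero[OF dg])
  show ?thesis
  proof (cases n)
    case 0
    then show ?thesis using dg0 ge(1) ai E.a_comm[OF a i]
      by (simp add: C_cone_def Sigma_complex_def wrap_def diff_cone deg_cone tau_def)
  next
    case (Suc m)
    let ?d = "diff (end_complex K A B X X) m e"
    have d: "?d \<in> carrier ?E"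
      using ge(3) Suc linmap_closed[OF cochain_complexD(2)[OF cochain_complex_end[OF A B X X]], of e m] by simp
    \<comment> \<open>Only the order of summands differs: the cone of \<lambda> adds the structure
      maps before subtracting the differential, the twisted sum adds them last.\<close>
    have "(?a \<oplus>\<^bsub>?E\<^esub> ?i) \<ominus>\<^bsub>?E\<^esub> ?d = (?i \<ominus>\<^bsub>?E\<^esub> ?d) \<oplus>\<^bsub>?E\<^esub> ?a"
      using a i d unfolding a_minus_def by (metis E.a_assoc E.a_comm E.a_inv_closed E.add.m_closed)
    then show ?thesis using dg0 ge(1) ai Suc
      by (simp add: C_cone_def Sigma_complex_def wrap_def diff_cone deg_cone tau_def)
  qed
qed

text \<open>By itself \<open>sigma_part\<close> commutes with the differentials only up to the
  twisting term. A map that annihilates this term repairs the defect; the retractions onto blocks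
  arise in this way.\<close>

lemma cochain_map_sigma_part:
  assumes W: "cochain_complex K W" and \<Phi>: "cochain_map K SX W \<Phi>"
    and tau: "\<And>n f h. f \<in> carrier (deg HA n) \<Longrightarrow> h \<in> carrier (deg HB n) \<Longrightarrow>
      \<Phi> (Suc n) (tau K A B X n f h) = \<zero>\<^bsub>deg W (Suc n)\<^esub>"
  shows "cochain_map K CX W (\<lambda>n c. \<Phi> n (sigma_part c))"
  unfolding cochain_map_def
proof (intro conjI allI ballI)
  fix n c assume "c \<in> carrier (deg CX n)"
  then obtain f h s where c: "c = wrap f h s" "f \<in> carrier (deg HA n)" "h \<in> carrier (deg HB n)" "s \<in> carrier (deg SX n)"
    by (rule C_cases)
  interpret W: module K "deg W (Suc n)" by (rule cochain_complexD[OF W])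
  have ds: "diff SX n s \<in> carrier (deg SX (Suc n))"
    using c linmap_closed[OF cochain_complexD(2)[OF cochain_complex_Sigma[OF A B X X]]] by blast
  have "\<Phi> (Suc n) (diff SX n s) \<in> carrier (deg W (Suc n))"
    by (rule linmap_closed[OF cochain_mapD(1)[OF \<Phi>] ds])
  then show "\<Phi> (Suc n) (sigma_part (diff CX n c)) = diff W n (\<Phi> n (sigma_part c))"
    using c tau tau_closed[of f n h] ds
    by (simp add: diff_C_cone linmap_add[OF cochain_mapD(1)[OF \<Phi>]] cochain_mapD(2)[OF \<Phi>])
qed (rule linmap_comp[OF linmap_sigma_part cochain_mapD(1)[OF \<Phi>]])

lemma tau_zero: "tau K A B X n \<zero>\<^bsub>deg HA n\<^esub> \<zero>\<^bsub>deg HB n\<^esub> = \<zero>\<^bsub>deg SX (Suc n)\<^esub>"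
  using linmap_zero[OF cochain_mapD(1)[OF cochain_map_alphaM[OF A B X]] cochain_complexD(1)[OF cochain_complex_HA]
      coefficients_hom_right[OF X X, THEN cochain_complex_hochschild[OF A], THEN cochain_complexD(1)], of n]
    linmap_zero[OF cochain_mapD(1)[OF cochain_map_betaM[OF A B X]] cochain_complexD(1)[OF cochain_complex_HB]
      coefficients_hom_left[OF X X, THEN cochain_complex_hochschild[OF B], THEN cochain_complexD(1)], of n]
  by (simp add: tau_def Sigma_deg end_deg)

text \<open>The twisting term of zero cochains is zero, by \<open>tau_zero\<close>, so
  \<open>Sigma_complex\<close> is a subcomplex of the cone. This inclusion induces
  \<open>l\<close>.\<close>

lemma cochain_map_wrap:
  "cochain_map K SX CX (\<lambda>n s. wrap \<zero>\<^bsub>deg HA n\<^esub> \<zero>\<^bsub>deg HB n\<^esub> s)"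
  unfolding cochain_map_def
proof (intro conjI allI ballI)
  fix n
  note mA = cochain_complexD(1)[OF cochain_complex_HA] and mB = cochain_complexD(1)[OF cochain_complex_HB]
  interpret HA: module K "deg HA n" by (rule mA)
  interpret HB: module K "deg HB n" by (rule mB)
  interpret S: module K "deg SX (Suc n)" by (rule cochain_complexD[OF cochain_complex_Sigma[OF A B X X]])
  show "linmap K (deg SX n) (deg CX n) (\<lambda>s. wrap \<zero>\<^bsub>deg HA n\<^esub> \<zero>\<^bsub>deg HB n\<^esub> s)"
    by (rule linmap_wrap[OF linmap_zero_fun[OF mA] linmap_zero_fun[OF mB] linmap_id])
  fix s assume s: "s \<in> carrier (deg SX n)"
  then have "diff SX n s \<in> carrier (deg SX (Suc n))"
    using linmap_closed[OF cochain_complexD(2)[OF cochain_complex_Sigma[OF A B X X]]] by blast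
  then show "wrap \<zero>\<^bsub>deg HA (Suc n)\<^esub> \<zero>\<^bsub>deg HB (Suc n)\<^esub> (diff SX n s) =
      diff CX n (wrap \<zero>\<^bsub>deg HA n\<^esub> \<zero>\<^bsub>deg HB n\<^esub> s)"
    using s by (simp add: diff_C_cone tau_zero linmap_zero[OF cochain_complexD(2)[OF cochain_complex_HA] mA mA]
        linmap_zero[OF cochain_complexD(2)[OF cochain_complex_HB] mB mB])
qed

end

text \<open>Twisting terms are the only coupling between the algebra cochains and
  \<open>Sigma_complex\<close>. A map that carries one twisting term to the other therefore extends
  by the identity on the cochains of \<open>A\<close> and \<open>B\<close>; restriction to the first
  copies is of this kind.\<close>

lemma cochain_map_wrap_sigma_part:
  fixes K :: "'k ring" and X :: "('k, 'x, 'a, 'b) bimod" and Y :: "('k, 'y, 'a, 'b) bimod"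
  assumes A: "assoc_algebra K A" and B: "assoc_algebra K B" and X: "bimodule K A B X" and Y: "bimodule K A B Y"
    and \<Phi>: "cochain_map K (Sigma_complex K A B X X) (Sigma_complex K A B Y Y) \<Phi>"
    and tau: "\<And>n f h. f \<in> carrier (deg (hochschild K A (regular A)) n) \<Longrightarrow>
      h \<in> carrier (deg (hochschild K B (regular B)) n) \<Longrightarrow> \<Phi> (Suc n) (tau K A B X n f h) = tau K A B Y n f h"
  shows "cochain_map K (C_cone K A B X) (C_cone K A B Y)
    (\<lambda>n c. wrap (fst (fst c)) (snd (snd (fst c))) (\<Phi> n (sigma_part c)))"
  unfolding cochain_map_def
proof (intro conjI allI ballI)
  fix n
  show "linmap K (deg (C_cone K A B X) n) (deg (C_cone K A B Y) n)
      (\<lambda>c. wrap (fst (fst c)) (snd (snd (fst c))) (\<Phi> n (sigma_part c)))"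
    by (intro linmap_wrap linmap_C_fst linmap_C_snd linmap_comp[OF linmap_sigma_part cochain_mapD(1)[OF \<Phi>]] A B X Y)
  fix c assume "c \<in> carrier (deg (C_cone K A B X) n)"
  then obtain f h s where c: "c = wrap f h s" "f \<in> carrier (deg (hochschild K A (regular A)) n)"
      "h \<in> carrier (deg (hochschild K B (regular B)) n)" "s \<in> carrier (deg (Sigma_complex K A B X X) n)"
    by (rule C_cases[OF A B X])
  have "diff (Sigma_complex K A B X X) n s \<in> carrier (deg (Sigma_complex K A B X X) (Suc n))"
    using c linmap_closed[OF cochain_complexD(2)[OF cochain_complex_Sigma[OF A B X X]]] by blast
  moreover have "\<Phi> n s \<in> carrier (deg (Sigma_complex K A B Y Y) n)"
    using c linmap_closed[OF cochain_mapD(1)[OF \<Phi>]] by blast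
  ultimately show "wrap (fst (fst (diff (C_cone K A B X) n c))) (snd (snd (fst (diff (C_cone K A B X) n c))))
      (\<Phi> (Suc n) (sigma_part (diff (C_cone K A B X) n c))) =
    diff (C_cone K A B Y) n (wrap (fst (fst c)) (snd (snd (fst c))) (\<Phi> n (sigma_part c)))"
    using c tau tau_closed[OF A B X c(2,3)]
    by (simp add: diff_C_cone[OF A B X] diff_C_cone[OF A B Y] linmap_add[OF cochain_mapD(1)[OF \<Phi>]] cochain_mapD(2)[OF \<Phi>])
qed

section \<open>Modules in the second part of the theorem\<close>

lemma as_module_simps [simp]:
  "carrier (as_module M) = carrier M" "\<zero>\<^bsub>as_module M\<^esub> = \<zero>\<^bsub>M\<^esub>" "add (as_module M) = add M"
  "smult (as_module M) = smult M"
  by (simp_all add: as_module_def module.truncate_def)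

lemma module_as_module: "module K M \<Longrightarrow> module K (as_module M)"
  by (rule module_by_surjection[where f="\<lambda>x. x"]) auto

lemma assoc_algebra_tri:
  fixes K :: "'k ring"
  assumes A: "assoc_algebra K A" and B: "assoc_algebra K B" and X: "bimodule K A B X"
  shows "assoc_algebra K (tri_algebra A X B)"
proof -
  note X' = bimodule_closed[OF X]
  note lin = linmap_add[OF bimoduleD(2)[OF X]] linmap_add[OF bimoduleD(3)[OF X]]
    linmap_add[OF bimoduleD(4)[OF X]] linmap_add[OF bimoduleD(5)[OF X]]
    linmap_smult[OF bimoduleD(2)[OF X]] linmap_smult[OF bimoduleD(3)[OF X]]
    linmap_smult[OF bimoduleD(4)[OF X]] linmap_smult[OF bimoduleD(5)[OF X]]
  interpret A: ring A by (rule assoc_algebraD(2)[OF A])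
  interpret B: ring B by (rule assoc_algebraD(2)[OF B])
  interpret X: module K X by (rule bimoduleD(1)[OF X])
  have z: "lact X a \<zero>\<^bsub>X\<^esub> = \<zero>\<^bsub>X\<^esub>" if "a \<in> carrier A" for a
    by (rule linmap_zero[OF bimoduleD(2)[OF X that] X.module_axioms X.module_axioms])
  have z': "ract X \<zero>\<^bsub>X\<^esub> b = \<zero>\<^bsub>X\<^esub>" if "b \<in> carrier B" for b
    by (rule linmap_zero[OF bimoduleD(3)[OF X that] X.module_axioms X.module_axioms])
  let ?T = "tri_algebra A X B"
  have simps: "carrier ?T = carrier A \<times> carrier X \<times> carrier B" "\<one>\<^bsub>?T\<^esub> = (\<one>\<^bsub>A\<^esub>, \<zero>\<^bsub>X\<^esub>, \<one>\<^bsub>B\<^esub>)"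
    "\<zero>\<^bsub>?T\<^esub> = (\<zero>\<^bsub>A\<^esub>, \<zero>\<^bsub>X\<^esub>, \<zero>\<^bsub>B\<^esub>)"
    "(a, x, b) \<otimes>\<^bsub>?T\<^esub> (a', x', b') = (a \<otimes>\<^bsub>A\<^esub> a', lact X a x' \<oplus>\<^bsub>X\<^esub> ract X x b', b \<otimes>\<^bsub>B\<^esub> b')"
    "(a, x, b) \<oplus>\<^bsub>?T\<^esub> (a', x', b') = (a \<oplus>\<^bsub>A\<^esub> a', x \<oplus>\<^bsub>X\<^esub> x', b \<oplus>\<^bsub>B\<^esub> b')"
    "k \<odot>\<^bsub>?T\<^esub> (a, x, b) = (k \<odot>\<^bsub>A\<^esub> a, k \<odot>\<^bsub>X\<^esub> x, k \<odot>\<^bsub>B\<^esub> b)" for a x b a' x' b' k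
    by (simp_all add: tri_algebra_def)
  have m: "module K ?T"
    by (rule module_by_surjection[OF module_prod_module[OF assoc_algebraD(1)[OF A]
          module_prod_module[OF module_as_module[OF bimoduleD(1)[OF X]] assoc_algebraD(1)[OF B]]], where f="\<lambda>x. x"])
      (auto simp: simps)
  moreover have "ring ?T"
  proof (rule ringI)
    show "abelian_group ?T" using m by (simp add: module_def)
    show "Group.monoid ?T"
    proof (rule monoidI)
      fix x y z assume "x \<in> carrier ?T" "y \<in> carrier ?T" "z \<in> carrier ?T"
      \<comment> \<open>The corner entries agree by all three mixed associativity laws of the
        bimodule.\<close>
      then show "x \<otimes>\<^bsub>?T\<^esub> y \<otimes>\<^bsub>?T\<^esub> z = x \<otimes>\<^bsub>?T\<^esub> (y \<otimes>\<^bsub>?T\<^esub> z)"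
        by (auto simp: simps A.m_assoc B.m_assoc lin X' bimoduleD(6,7,10)[OF X] X.a_assoc)
    qed (auto simp: simps X' bimoduleD(8,9)[OF X] z z')
  next
    fix x y z assume "x \<in> carrier ?T" "y \<in> carrier ?T" "z \<in> carrier ?T"
    then show "(x \<oplus>\<^bsub>?T\<^esub> y) \<otimes>\<^bsub>?T\<^esub> z = x \<otimes>\<^bsub>?T\<^esub> z \<oplus>\<^bsub>?T\<^esub> y \<otimes>\<^bsub>?T\<^esub> z"
      and "z \<otimes>\<^bsub>?T\<^esub> (x \<oplus>\<^bsub>?T\<^esub> y) = z \<otimes>\<^bsub>?T\<^esub> x \<oplus>\<^bsub>?T\<^esub> z \<otimes>\<^bsub>?T\<^esub> y"
      by (auto simp: simps A.l_distr A.r_distr B.l_distr B.r_distr lin X' X.a_ac)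
  qed
  ultimately show ?thesis
    using A B by (auto simp: assoc_algebra_def simps lin X' X.smult_r_distr)
qed

lemma module_HH: "assoc_algebra K T \<Longrightarrow> module K (HH K T k)"
  unfolding HH_def by (intro module_cohomology cochain_complex_hochschild coefficients_regular)

lemma cochain_complex_hom:
  fixes K :: "'k ring"
  assumes res: "projective_resolution K A B M P d e" and N: "bimodule K A B N"
  shows "cochain_complex K (hom_complex K A B P d N)"
proof -
  have P: "bimodule K A B (P n)" for n
    using res by (simp add: projective_resolution_def projective_bimodule_def)
  have d: "bimod_hom K A B (P (Suc n)) (P n) (d n)" for n using res by (simp add: projective_resolution_def)
  note dD = bimod_homD[OF d]
  have dd: "d n (d (Suc n) x) = \<zero>\<^bsub>P n\<^esub>" if "x \<in> carrier (P (Suc (Suc n)))" for n x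
    using res that unfolding projective_resolution_def by blast
  let ?ops = "\<lambda>n. left_ops A (P n) N \<union> right_ops B (P n) N"
  \<comment> \<open>Bimodule homomorphisms intertwine both families of operators at once, so the
    module lemma for intertwiners covers this case too.\<close>
  have set_eq: "{f \<in> carrier (P n) \<rightarrow>\<^sub>E carrier N. bimod_hom K A B (P n) N f} = intertwiners K (P n) N (?ops n)" for n
    unfolding intertwiners_def bimod_hom_def left_linear_def right_linear_def left_ops_def right_ops_def
    by (intro Collect_cong) (simp add: ball_Un)
  have deg: "deg (hom_complex K A B P d N) n = fun_module (carrier (P n)) N (intertwiners K (P n) N (?ops n))" for n
    by (simp add: hom_complex_def set_eq)
  have m: "module K (deg (hom_complex K A B P d N) n)" for n
    unfolding deg
    by (rule module_intertwiners[OF bimoduleD(1)[OF P] bimoduleD(1)[OF N]])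
      (auto simp: left_ops_def right_ops_def bimodule_closed[OF P] bimoduleD(2,3)[OF N])
  have diff: "diff (hom_complex K A B P d N) n f = (\<lambda>x\<in>carrier (P (Suc n)). f (d n x))" for n f
    by (simp add: hom_complex_def)
  have closed: "diff (hom_complex K A B P d N) n f \<in> intertwiners K (P (Suc n)) N (?ops (Suc n))"
    if "f \<in> carrier (deg (hom_complex K A B P d N) n)" for n f
  proof -
    have f: "f \<in> intertwiners K (P n) N (?ops n)" using that by (simp add: deg)
    then have "bimod_hom K A B (P n) N f" by (simp flip: set_eq)
    note fD = bimod_homD[OF this]
    show ?thesis unfolding diff
      by (rule restrict_in_intertwiners[OF bimoduleD(1)[OF P] linmap_comp[OF dD(1) fD(1)]])
        (auto simp: left_ops_def right_ops_def bimodule_closed[OF P] dD fD linmap_closed[OF dD(1)])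
  qed
  show ?thesis
    unfolding cochain_complex_def
  proof (intro conjI allI ballI)
    fix n
    show "module K (deg (hom_complex K A B P d N) n)" by (rule m)
    show "linmap K (deg (hom_complex K A B P d N) n) (deg (hom_complex K A B P d N) (Suc n)) (diff (hom_complex K A B P d N) n)"
    proof (subst deg[of "Suc n"], rule linmap_into_intertwiners[OF m closed])
      fix x assume x: "x \<in> carrier (P (Suc n))"
      show "linmap K (deg (hom_complex K A B P d N) n) N (\<lambda>f. diff (hom_complex K A B P d N) n f x)"
        using linmap_intertwiners_eval[OF linmap_closed[OF dD(1) x], of K N] x by (simp add: diff deg)
    qed
    fix f assume f: "f \<in> carrier (deg (hom_complex K A B P d N) n)"
    \<comment> \<open>Two differentials send \<open>x\<close> to \<open>f\<close> at a composite of
      consecutive maps of the resolution, which is zero.\<close>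
    have "f \<zero>\<^bsub>P n\<^esub> = \<zero>\<^bsub>N\<^esub>"
      using f linmap_zero[OF _ bimoduleD(1)[OF P] bimoduleD(1)[OF N]] by (auto simp: deg dest: intertwinersD(1))
    then show "diff (hom_complex K A B P d N) (Suc n) (diff (hom_complex K A B P d N) n f) =
        \<zero>\<^bsub>deg (hom_complex K A B P d N) (Suc (Suc n))\<^esub>"
      using linmap_closed[OF dD(1)] by (auto simp: diff deg dd intro!: restrict_ext)
  qed
qed

lemma module_Ext_shift:
  fixes K :: "'k ring"
  assumes "projective_resolution K A B M P d e" "bimodule K A B N"
  shows "module K (Ext_shift K A B P d N k)"
  unfolding Ext_shift_def
  by (rule module_previous) (simp add: Ext_def module_cohomology[OF cochain_complex_hom[OF assms]])

section \<open>Direct sums of copies\<close>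

lemma bimoduleI:
  assumes "module K M"
    and "\<And>a. a \<in> carrier A \<Longrightarrow> linmap K M M (lact M a)"
    and "\<And>b. b \<in> carrier B \<Longrightarrow> linmap K M M (\<lambda>x. ract M x b)"
    and "\<And>x. x \<in> carrier M \<Longrightarrow> linmap K A M (\<lambda>a. lact M a x)"
    and "\<And>x. x \<in> carrier M \<Longrightarrow> linmap K B M (\<lambda>b. ract M x b)"
    and "\<And>a a' x. a \<in> carrier A \<Longrightarrow> a' \<in> carrier A \<Longrightarrow> x \<in> carrier M \<Longrightarrow> lact M (a \<otimes>\<^bsub>A\<^esub> a') x = lact M a (lact M a' x)"
    and "\<And>b b' x. b \<in> carrier B \<Longrightarrow> b' \<in> carrier B \<Longrightarrow> x \<in> carrier M \<Longrightarrow> ract M x (b \<otimes>\<^bsub>B\<^esub> b') = ract M (ract M x b) b'"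
    and "\<And>x. x \<in> carrier M \<Longrightarrow> lact M \<one>\<^bsub>A\<^esub> x = x"
    and "\<And>x. x \<in> carrier M \<Longrightarrow> ract M x \<one>\<^bsub>B\<^esub> = x"
    and "\<And>a b x. a \<in> carrier A \<Longrightarrow> b \<in> carrier B \<Longrightarrow> x \<in> carrier M \<Longrightarrow> ract M (lact M a x) b = lact M a (ract M x b)"
  shows "bimodule K A B M"
proof -
  note l = linmap_closed[OF assms(2)] linmap_closed[OF assms(3)]
    linmap_add[OF assms(2)] linmap_add[OF assms(3)] linmap_add[OF assms(4)] linmap_add[OF assms(5)]
    linmap_smult[OF assms(2)] linmap_smult[OF assms(3)] linmap_smult[OF assms(4)] linmap_smult[OF assms(5)]
  show ?thesis unfolding bimodule_def by (intro conjI ballI assms(1) assms(6-10) l)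
qed

lemma copies_simps [simp]:
  "carrier (copies_sum M I) = (\<Pi>\<^sub>E p\<in>I. carrier (M (fst p)))"
  "\<zero>\<^bsub>copies_sum M I\<^esub> = (\<lambda>p\<in>I. \<zero>\<^bsub>M (fst p)\<^esub>)"
  "x \<oplus>\<^bsub>copies_sum M I\<^esub> y = (\<lambda>p\<in>I. x p \<oplus>\<^bsub>M (fst p)\<^esub> y p)"
  "k \<odot>\<^bsub>copies_sum M I\<^esub> x = (\<lambda>p\<in>I. k \<odot>\<^bsub>M (fst p)\<^esub> x p)"
  "lact (copies_sum M I) = (\<lambda>a x. \<lambda>p\<in>I. lact (M (fst p)) a (x p))"
  "ract (copies_sum M I) = (\<lambda>x b. \<lambda>p\<in>I. ract (M (fst p)) (x p) b)"
  unfolding copies_sum_def bimod_sum_def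
  by (simp_all add: case_prod_unfold) (simp_all add: module.extend_def)

lemma linmap_into_copies:
  assumes "\<And>x. x \<in> carrier X \<Longrightarrow> \<phi> x \<in> extensional I"
    "\<And>p. p \<in> I \<Longrightarrow> linmap K X (M (fst p)) (\<lambda>x. \<phi> x p)" "module K X"
  shows "linmap K X (copies_sum M I) \<phi>"
proof -
  interpret X: module K X by fact
  show ?thesis
    by (rule linmapI) (auto simp: PiE_def Pi_iff assms(1) linmap_closed[OF assms(2)] linmap_add[OF assms(2)]
      linmap_smult[OF assms(2)] intro!: extensionalityI[OF assms(1)])
qed

context
  fixes K :: "'k ring" and A :: "('k, 'a) module" and B :: "('k, 'b) module"
    and M :: "nat \<Rightarrow> ('k, 'm, 'a, 'b) bimod" and I :: "(nat \<times> nat) set"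
  assumes K: "cring K" and A: "assoc_algebra K A" and B: "assoc_algebra K B"
    and M: "\<And>p. p \<in> I \<Longrightarrow> bimodule K A B (M (fst p))"
begin

lemma linmap_copies_proj: "p \<in> I \<Longrightarrow> linmap K (copies_sum M I) (M (fst p)) (\<lambda>x. x p)"
  by (rule linmapI) auto

lemma module_copies: "module K (copies_sum M I)"
  unfolding copies_sum_def bimod_sum_def case_prod_unfold
  by (intro module_extend module_family_product module_as_module bimoduleD(1)[OF M] K)

lemma bimodule_copies: "bimodule K A B (copies_sum M I)"
proof (rule bimoduleI)
  show "module K (copies_sum M I)" by (rule module_copies)
  note into = linmap_into_copies[where I=I and M=M]
  show "linmap K (copies_sum M I) (copies_sum M I) (lact (copies_sum M I) a)" if "a \<in> carrier A" for a
    by (rule into) (auto simp: module_copies intro!: linmap_comp[OF linmap_copies_proj bimoduleD(2)[OF M that]])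
  show "linmap K (copies_sum M I) (copies_sum M I) (\<lambda>x. ract (copies_sum M I) x b)" if "b \<in> carrier B" for b
    by (rule into) (auto simp: module_copies intro!: linmap_comp[OF linmap_copies_proj bimoduleD(3)[OF M that]])
  show "linmap K A (copies_sum M I) (\<lambda>a. lact (copies_sum M I) a x)" if "x \<in> carrier (copies_sum M I)" for x
    by (rule into) (use that in \<open>auto simp: assoc_algebraD(1)[OF A] intro!: bimoduleD(4)[OF M]\<close>)
  show "linmap K B (copies_sum M I) (\<lambda>b. ract (copies_sum M I) x b)" if "x \<in> carrier (copies_sum M I)" for x
    by (rule into) (use that in \<open>auto simp: assoc_algebraD(1)[OF B] intro!: bimoduleD(5)[OF M]\<close>)
next
  have mem: "x p \<in> carrier (M (fst p))" if "x \<in> (\<Pi>\<^sub>E p\<in>I. carrier (M (fst p)))" "p \<in> I" for x p using that by auto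
  {
  fix a a' x assume "a \<in> carrier A" "a' \<in> carrier A" "x \<in> carrier (copies_sum M I)"
  then show "lact (copies_sum M I) (a \<otimes>\<^bsub>A\<^esub> a') x = lact (copies_sum M I) a (lact (copies_sum M I) a' x)"
    by (intro ext) (simp add: bimoduleD(6)[OF M] mem)
  next
  fix b b' x assume "b \<in> carrier B" "b' \<in> carrier B" "x \<in> carrier (copies_sum M I)"
  then show "ract (copies_sum M I) x (b \<otimes>\<^bsub>B\<^esub> b') = ract (copies_sum M I) (ract (copies_sum M I) x b) b'"
    by (intro ext) (simp add: bimoduleD(7)[OF M] mem)
  next
  fix a b x assume "a \<in> carrier A" "b \<in> carrier B" "x \<in> carrier (copies_sum M I)"
  then show "ract (copies_sum M I) (lact (copies_sum M I) a x) b = lact (copies_sum M I) a (ract (copies_sum M I) x b)"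
    by (intro ext) (simp add: bimoduleD(10)[OF M] mem)
  }
next
  fix x assume x: "x \<in> carrier (copies_sum M I)"
  then have e: "x \<in> extensional I" by (simp add: PiE_def)
  show "lact (copies_sum M I) \<one>\<^bsub>A\<^esub> x = x" "ract (copies_sum M I) x \<one>\<^bsub>B\<^esub> = x"
    by (rule extensionalityI[OF _ e]; use x in \<open>simp add: bimoduleD(8,9)[OF M] PiE_iff\<close>)+
qed

lemma bimod_hom_copies_proj: "p \<in> I \<Longrightarrow> bimod_hom K A B (copies_sum M I) (M (fst p)) (\<lambda>x. x p)"
  by (simp add: bimod_hom_def linmap_copies_proj left_linear_def right_linear_def)

text \<open>Both kinds of inclusion extend by zero, so their compatibility with the actions rests on
  this.\<close>

lemma copies_act_zero:
  assumes "p \<in> I"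
  shows "a \<in> carrier A \<Longrightarrow> lact (M (fst p)) a \<zero>\<^bsub>M (fst p)\<^esub> = \<zero>\<^bsub>M (fst p)\<^esub>"
    "b \<in> carrier B \<Longrightarrow> ract (M (fst p)) \<zero>\<^bsub>M (fst p)\<^esub> b = \<zero>\<^bsub>M (fst p)\<^esub>"
  using linmap_zero[OF bimoduleD(2)[OF M[OF assms]] bimoduleD(1)[OF M[OF assms]] bimoduleD(1)[OF M[OF assms]]]
    linmap_zero[OF bimoduleD(3)[OF M[OF assms]] bimoduleD(1)[OF M[OF assms]] bimoduleD(1)[OF M[OF assms]]] by auto

lemma bimod_hom_incl_one: "p \<in> I \<Longrightarrow> bimod_hom K A B (M (fst p)) (copies_sum M I) (incl_one M I p)"
  unfolding bimod_hom_def
proof (intro conjI)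
  assume p: "p \<in> I"
  show "linmap K (M (fst p)) (copies_sum M I) (incl_one M I p)"
  proof (rule linmap_into_copies)
    fix q assume q: "q \<in> I"
    show "linmap K (M (fst p)) (M (fst q)) (\<lambda>x. incl_one M I p x q)"
      using q linmap_id linmap_zero_fun[OF bimoduleD(1)[OF M[OF q]]] by (cases "q = p") (simp_all add: incl_one_def)
  qed (simp_all add: incl_one_def bimoduleD(1)[OF M[OF p]])
  show "left_linear A (M (fst p)) (copies_sum M I) (incl_one M I p)"
    unfolding left_linear_def by (intro ballI ext) (simp add: incl_one_def copies_act_zero)
  show "right_linear B (M (fst p)) (copies_sum M I) (incl_one M I p)"
    unfolding right_linear_def by (intro ballI ext) (simp add: incl_one_def copies_act_zero)
qed

lemma linmap_incl_one: "p \<in> I \<Longrightarrow> linmap K (M (fst p)) (copies_sum M I) (incl_one M I p)"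
  using bimod_hom_incl_one by (simp add: bimod_hom_def)

text \<open>In coordinate \<open>q\<close> all terms but one vanish. Finiteness of \<open>I\<close>
  enters because \<open>finsum\<close> over an infinite set is zero by convention.\<close>

lemma copies_sum_decomposition:
  assumes fin: "finite I" and x: "x \<in> carrier (copies_sum M I)"
  shows "finsum (copies_sum M I) (\<lambda>p. incl_one M I p (x p)) I = x"
proof (rule extensionalityI)
  interpret X: module K "copies_sum M I" by (rule module_copies)
  have c: "incl_one M I p (x p) \<in> carrier (copies_sum M I)" if "p \<in> I" for p
    using linmap_closed[OF linmap_incl_one[OF that]] x that by auto
  then have "finsum (copies_sum M I) (\<lambda>p. incl_one M I p (x p)) I \<in> carrier (copies_sum M I)"
    by (intro X.finsum_closed) auto
  then show "finsum (copies_sum M I) (\<lambda>p. incl_one M I p (x p)) I \<in> extensional I" by (simp add: PiE_def)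
  show "x \<in> extensional I" using x by (simp add: PiE_def)
  fix q assume q: "q \<in> I"
  interpret Mq: module K "M (fst q)" by (rule bimoduleD(1)[OF M[OF q]])
  have xq: "x q \<in> carrier (M (fst q))" using x q by auto
  have "finsum (copies_sum M I) (\<lambda>p. incl_one M I p (x p)) I q = finsum (M (fst q)) (\<lambda>p. incl_one M I p (x p) q) I"
    by (rule linmap_finsum[OF linmap_copies_proj[OF q] X.module_axioms Mq.module_axioms c])
  also have "\<dots> = finsum (M (fst q)) (\<lambda>p. if q = p then x q else \<zero>\<^bsub>M (fst q)\<^esub>) I"
    using q xq by (intro Mq.finsum_cong' refl) (auto simp: incl_one_def)
  also have "\<dots> = x q" using Mq.finsum_singleton[OF q fin, of "\<lambda>_. x q"] xq by simp
  finally show "finsum (copies_sum M I) (\<lambda>p. incl_one M I p (x p)) I q = x q" .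
qed

lemma bimod_hom_copies_restrict:
  assumes "J \<subseteq> I"
  shows "bimod_hom K A B (copies_sum M I) (copies_sum M J) (\<lambda>x. restrict x J)"
  unfolding bimod_hom_def
proof (intro conjI)
  show "linmap K (copies_sum M I) (copies_sum M J) (\<lambda>x. restrict x J)"
    using assms linmap_copies_proj by (intro linmap_into_copies module_copies) auto
qed (use assms in \<open>auto simp: left_linear_def right_linear_def restrict_def fun_eq_iff\<close>)

end

lemma bimod_hom_incl_part:
  fixes K :: "'k ring"
  assumes K: "cring K" and A: "assoc_algebra K A" and B: "assoc_algebra K B"
    and M: "\<And>p. p \<in> I \<Longrightarrow> bimodule K A B (M (fst p))" and J: "J \<subseteq> I"
  shows "bimod_hom K A B (copies_sum M J) (copies_sum M I) (incl_part M I J)"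
  unfolding bimod_hom_def
proof (intro conjI)
  have MJ: "bimodule K A B (M (fst p))" if "p \<in> J" for p using M J that by blast
  show "linmap K (copies_sum M J) (copies_sum M I) (incl_part M I J)"
  proof (rule linmap_into_copies)
    fix p assume p: "p \<in> I"
    show "linmap K (copies_sum M J) (M (fst p)) (\<lambda>x. incl_part M I J x p)"
      using p linmap_copies_proj[where I=J and M=M, OF K A B MJ] linmap_zero_fun[OF bimoduleD(1)[OF M[OF p]]]
      by (cases "p \<in> J") (simp_all add: incl_part_def)
  qed (simp_all add: incl_part_def module_copies[where I=J and M=M, OF K A B MJ])
  note z = copies_act_zero[where I=I and M=M, OF K A B M]
  show "left_linear A (copies_sum M J) (copies_sum M I) (incl_part M I J)"
    unfolding left_linear_def by (intro ballI ext) (simp add: incl_part_def z)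
  show "right_linear B (copies_sum M J) (copies_sum M I) (incl_part M I J)"
    unfolding right_linear_def by (intro ballI ext) (simp add: incl_part_def z)
qed

section \<open>The splitting\<close>

text \<open>Both \<open>u\<close> and \<open>v\<close> respect the actions, so the twisting term is
  seen only through the composite of the two. Whether induced maps agree on it, or kill it, is
  decided by comparing bimodule maps from \<open>X'\<close> to \<open>Y\<close>.\<close>

lemma probe_Sigma_map_tau:
  fixes K :: "'k ring" and X :: "('k, 'x, 'a, 'b) bimod" and X' :: "('k, 'y, 'a, 'b) bimod" and Y :: "('k, 'z, 'a, 'b) bimod"
  assumes A: "assoc_algebra K A" and B: "assoc_algebra K B"
    and X: "bimodule K A B X" and Y: "bimodule K A B Y"
    and u: "bimod_hom K A B X' X u" and v: "bimod_hom K A B X Y v"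
    and f: "f \<in> carrier (deg (hochschild K A (regular A)) n)" and h: "h \<in> carrier (deg (hochschild K B (regular B)) n)"
    and p: "p \<in> probes A B (Suc n)" and x: "x \<in> carrier X'"
  shows "probe_eval p (Sigma_map A B X' (Suc n) u v (tau K A B X n f h)) x =
    (case p of Middle as bs \<Rightarrow> \<zero>\<^bsub>Y\<^esub> | Left w \<Rightarrow> lact Y (f w) (v (u x)) | Right w \<Rightarrow> ract Y (v (u x)) (h w))"
proof -
  have ux: "u x \<in> carrier X" using linmap_closed[OF bimod_homD(1)[OF u] x] .
  have "f w \<in> carrier A" if "w \<in> tensor_words A (n + 2)" for w using carrier_hochschild_mem[OF f that] by simp
  moreover have "h w \<in> carrier B" if "w \<in> tensor_words B (n + 2)" for w using carrier_hochschild_mem[OF h that] by simp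
  ultimately show ?thesis
    using p ux linmap_zero[OF bimod_homD(1)[OF v] bimoduleD(1)[OF X] bimoduleD(1)[OF Y]]
    by (auto simp: probe_Sigma_map[OF A B p x] probe_tau[OF A B X p ux] bimod_homD(2,3)[OF v] probes_def
        split: probe.splits)
qed

text \<open>\<open>power_index\<close> lists the two module indices before the two copy numbers.
  \<open>source\<close>, \<open>target\<close> and \<open>block\<close> regroup them into the two
  copies between which a block goes.\<close>

definition source :: "(nat \<times> nat) \<times> (nat \<times> nat) \<Rightarrow> nat \<times> nat" where
  "source y = (fst (fst y), fst (snd y))"

definition target :: "(nat \<times> nat) \<times> (nat \<times> nat) \<Rightarrow> nat \<times> nat" where
  "target y = (snd (fst y), snd (snd y))"

definition block :: "nat \<times> nat \<Rightarrow> nat \<times> nat \<Rightarrow> (nat \<times> nat) \<times> (nat \<times> nat)" where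
  "block p q = ((fst p, fst q), (snd p, snd q))"

lemma block_simps [simp]: "source (block p q) = p" "target (block p q) = q" "block (source y) (target y) = y"
  by (simp_all add: source_def target_def block_def)

lemma source_target_eqI: "source x = source y \<Longrightarrow> target x = target y \<Longrightarrow> x = y"
  by (metis block_simps(3))

section \<open>Blocks relative to a chosen set of first copies\<close>

context
  fixes K :: "'k ring" and A :: "('k, 'a) module" and B :: "('k, 'b) module"
    and M :: "nat \<Rightarrow> ('k, 'm, 'a, 'b) bimod" and I F :: "(nat \<times> nat) set" and P :: "((nat \<times> nat) \<times> (nat \<times> nat)) set"
  assumes K: "cring K" and A: "assoc_algebra K A" and B: "assoc_algebra K B"
    and M: "\<And>p. p \<in> I \<Longrightarrow> bimodule K A B (M (fst p))"
    and I: "finite I" and F: "F \<subseteq> I" and first: "\<And>p. p \<in> I \<Longrightarrow> (fst p, 1) \<in> F"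
    and P: "\<And>y. y \<in> P \<longleftrightarrow> source y \<in> I \<and> target y \<in> I \<and> \<not> (source y \<in> F \<and> target y \<in> F)"
begin

abbreviation (input) "X \<equiv> copies_sum M I"
abbreviation (input) "N \<equiv> copies_sum M F"
abbreviation (input) "S p q \<equiv> Sigma_complex K A B (M (fst p)) (M (fst q))"

lemma bimodule_X: "bimodule K A B X" by (rule bimodule_copies[where I=I and M=M, OF K A B M])

lemma MF: "p \<in> F \<Longrightarrow> bimodule K A B (M (fst p))" using M F by blast

lemma bimodule_N: "bimodule K A B N" by (rule bimodule_copies[where I=F and M=M, OF K A B MF])

lemma hom_proj: "p \<in> I \<Longrightarrow> bimod_hom K A B X (M (fst p)) (\<lambda>x. x p)"
  by (rule bimod_hom_copies_proj[where I=I and M=M, OF K A B M])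

lemma hom_incl: "p \<in> I \<Longrightarrow> bimod_hom K A B (M (fst p)) X (incl_one M I p)"
  by (rule bimod_hom_incl_one[where I=I and M=M, OF K A B M])

lemma hom_restrict: "bimod_hom K A B X N (\<lambda>x. restrict x F)"
  by (rule bimod_hom_copies_restrict[where I=I and M=M, OF K A B M F])

lemma hom_incl_part: "bimod_hom K A B N X (incl_part M I F)"
  by (rule bimod_hom_incl_part[where I=I and M=M, OF K A B M F])

lemma cochain_complex_S: "p \<in> I \<Longrightarrow> q \<in> I \<Longrightarrow> cochain_complex K (S p q)"
  by (rule cochain_complex_Sigma[OF A B M M])

lemma finite_P: "finite P"
proof -
  have "P \<subseteq> (\<lambda>(p, q). block p q) ` (I \<times> I)"
  proof
    fix y assume "y \<in> P"
    then show "y \<in> (\<lambda>(p, q). block p q) ` (I \<times> I)" using P[of y] by (intro image_eqI[of _ _ "(source y, target y)"]) auto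
  qed
  then show ?thesis using I finite_subset by blast
qed

text \<open>Expand \<open>x\<close> into coordinates and \<open>g\<close> into matrix entries.
  Entries in \<open>F \<times> F\<close> are zero by assumption, so those indexed by
  \<open>P\<close> suffice to rebuild \<open>g x\<close>.\<close>

lemma block_decomposition:
  assumes g: "linmap K X X g" and x: "x \<in> carrier X"
    and vanish: "\<And>p q a. p \<in> F \<Longrightarrow> q \<in> F \<Longrightarrow> a \<in> carrier (M (fst p)) \<Longrightarrow> g (incl_one M I p a) q = \<zero>\<^bsub>M (fst q)\<^esub>"
  shows "finsum X (\<lambda>y. incl_one M I (target y) (g (incl_one M I (source y) (x (source y))) (target y))) P = g x"
proof (rule extensionalityI)
  let ?G = "\<lambda>p. g (incl_one M I p (x p))"
  let ?t = "\<lambda>y. incl_one M I (target y) (?G (source y) (target y))"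
  interpret X: module K X by (rule bimoduleD(1)[OF bimodule_X])
  have xp: "incl_one M I p (x p) \<in> carrier X" if "p \<in> I" for p
    using linmap_closed[OF bimod_homD(1)[OF hom_incl[OF that]]] x that by auto
  have G: "?G p \<in> carrier X" if "p \<in> I" for p using linmap_closed[OF g xp[OF that]] .
  have Gq: "?G p q \<in> carrier (M (fst q))" if "p \<in> I" "q \<in> I" for p q using G[OF that(1)] that(2) by auto
  have t: "?t y \<in> carrier X" if "y \<in> P" for y
    using linmap_closed[OF bimod_homD(1)[OF hom_incl]] Gq P that by blast
  have "finsum X ?t P \<in> carrier X" using t by (intro X.finsum_closed) auto
  then show "finsum X ?t P \<in> extensional I" by (simp add: PiE_def)
  show "g x \<in> extensional I" using linmap_closed[OF g x] by (simp add: PiE_def)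
  fix q assume q: "q \<in> I"
  interpret Mq: module K "M (fst q)" by (rule bimoduleD(1)[OF M[OF q]])
  \<comment> \<open>In coordinate \<open>q\<close> only blocks with target \<open>q\<close> count;
    these are their sources.\<close>
  let ?S = "{p \<in> I. \<not> (p \<in> F \<and> q \<in> F)}"
  have tq: "?t y q \<in> carrier (M (fst q))" if "y \<in> P" for y using t[OF that] q by (simp add: PiE_iff)
  have im: "(\<lambda>p. block p q) ` ?S \<subseteq> P"
    using q by (intro image_subsetI) (simp add: P)
  have "finsum X ?t P q = finsum (M (fst q)) (\<lambda>y. ?t y q) P"
    by (rule linmap_finsum[OF bimod_homD(1)[OF hom_proj[OF q]] X.module_axioms Mq.module_axioms t])
  also have "\<dots> = finsum (M (fst q)) (\<lambda>y. ?t y q) ((\<lambda>p. block p q) ` ?S)"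
  proof (rule Mq.add.finprod_mono_neutral_cong_right[OF finite_P im, folded finsum_def])
    fix y assume y: "y \<in> P - (\<lambda>p. block p q) ` ?S"
    have "target y \<noteq> q"
    proof
      assume "target y = q"
      then have "y = block (source y) q" by (metis block_simps(3))
      then show False using y P[of y] \<open>target y = q\<close> by blast
    qed
    then show "?t y q = \<zero>\<^bsub>M (fst q)\<^esub>" using q by (simp add: incl_one_def)
  next
    show "(\<lambda>y. ?t y q) \<in> P \<rightarrow> carrier (M (fst q))" using tq by blast
  qed simp
  also have "\<dots> = finsum (M (fst q)) (\<lambda>p. ?t (block p q) q) ?S"
  proof (rule Mq.finsum_reindex)
    show "(\<lambda>y. ?t y q) \<in> (\<lambda>p. block p q) ` ?S \<rightarrow> carrier (M (fst q))" using tq im by blast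
    show "inj_on (\<lambda>p. block p q) ?S" by (rule inj_onI) (metis block_simps(1))
  qed
  \<comment> \<open>The omitted sources belong to entries in \<open>F \<times> F\<close>, which are
    zero, so the sum may run over all of \<open>I\<close> again.\<close>
  also have "\<dots> = finsum (M (fst q)) (\<lambda>p. ?G p q) I"
  proof (rule Mq.add.finprod_mono_neutral_cong_left[OF I, folded finsum_def])
    fix p assume "p \<in> I - ?S"
    then have "p \<in> F" "q \<in> F" "x p \<in> carrier (M (fst p))" using x by auto
    then show "?G p q = \<zero>\<^bsub>M (fst q)\<^esub>" by (rule vanish)
  qed (use q Gq in \<open>auto simp: incl_one_def\<close>)
  also have "\<dots> = finsum X ?G I q"
    by (rule linmap_finsum[OF bimod_homD(1)[OF hom_proj[OF q]] X.module_axioms Mq.module_axioms G, symmetric])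
  also have "finsum X ?G I = g (finsum X (\<lambda>p. incl_one M I p (x p)) I)"
    by (rule linmap_finsum[OF g X.module_axioms X.module_axioms xp, symmetric])
  also have "finsum X (\<lambda>p. incl_one M I p (x p)) I = x"
    by (rule copies_sum_decomposition[OF K A B M I x])
  finally show "finsum X ?t P q = g x q" .
qed

text \<open>Including one block and projecting to another behaves like a product of matrix units,
  since a coordinate of \<open>incl_one\<close> is the identity or zero.\<close>

lemma Sigma_map_block:
  assumes pq: "p \<in> I" "q \<in> I" "p' \<in> I" "q' \<in> I" and e: "e \<in> carrier (deg (S p' q') n)"
  shows "Sigma_map A B (M (fst p)) n (incl_one M I p) (\<lambda>x. x q)
      (Sigma_map A B X n (\<lambda>x. x p') (incl_one M I q') e) =
    (if p = p' \<and> q = q' then e else \<zero>\<^bsub>deg (S p q) n\<^esub>)" (is "?l = ?r")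
proof (rule Sigma_eqI[OF A B M[OF pq(1)] M[OF pq(2)]])
  note c1 = cochain_map_Sigma_map[OF A B bimodule_X M[OF pq(1)] bimodule_X M[OF pq(2)] hom_incl[OF pq(1)] hom_proj[OF pq(2)]]
  note c2 = cochain_map_Sigma_map[OF A B M[OF pq(3)] bimodule_X M[OF pq(4)] bimodule_X hom_proj[OF pq(3)] hom_incl[OF pq(4)]]
  interpret S: module K "deg (S p q) n" by (rule cochain_complexD[OF cochain_complex_S[OF pq(1,2)]])
  show "?l \<in> carrier (deg (S p q) n)"
    by (rule linmap_closed[OF cochain_mapD(1)[OF c1] linmap_closed[OF cochain_mapD(1)[OF c2] e]])
  show "?r \<in> carrier (deg (S p q) n)" using e by auto
  fix \<pi> x assume \<pi>: "\<pi> \<in> probes A B n" and x: "x \<in> carrier (M (fst p))"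
  have ix: "incl_one M I p x \<in> carrier X" by (rule linmap_closed[OF bimod_homD(1)[OF hom_incl[OF pq(1)]] x])
  note g = linmap_probe_eval[OF A B M[OF pq(3)] M[OF pq(4)] \<pi> e]
  \<comment> \<open>If the sources differ, the cochain is evaluated at zero; linearity in the module
    element settles that case.\<close>
  have g0: "probe_eval \<pi> e \<zero>\<^bsub>M (fst p')\<^esub> = \<zero>\<^bsub>M (fst q')\<^esub>"
    by (rule linmap_zero[OF g bimoduleD(1)[OF M[OF pq(3)]] bimoduleD(1)[OF M[OF pq(4)]]])
  have z: "probe_eval \<pi> \<zero>\<^bsub>deg (S p q) n\<^esub> x = \<zero>\<^bsub>M (fst q)\<^esub>"
    by (rule linmap_zero[OF linmap_probe[OF A B M[OF pq(1)] M[OF pq(2)] \<pi> x] S.module_axioms bimoduleD(1)[OF M[OF pq(2)]]])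
  show "probe_eval \<pi> ?l x = probe_eval \<pi> ?r x"
    unfolding probe_Sigma_map[OF A B \<pi> x] probe_Sigma_map[OF A B \<pi> ix]
    using pq z g0 by (auto simp: incl_one_def)
qed

text \<open>The projection of the cone of \<open>X\<close> to the component of \<open>Sigma_complex\<close> with index \<open>y\<close>; on
  the diagonal, where it would not commute with the twisting term, the component of the first copy
  is subtracted.\<close>

definition component where
  "component y n s =
     (let T = Sigma_map A B (M (fst (source y))) n (incl_one M I (source y)) (\<lambda>x. x (target y)) s;
          T1 = Sigma_map A B (M (fst (source y))) n (incl_one M I (fst (source y), 1)) (\<lambda>x. x (fst (target y), 1)) s
      in if source y = target y then T \<ominus>\<^bsub>deg (S (source y) (target y)) n\<^esub> T1 else T)"

lemma first_in_I: "p \<in> I \<Longrightarrow> (fst p, 1) \<in> I"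
  using first F by blast

lemma hom_incl_first: "p \<in> I \<Longrightarrow> bimod_hom K A B (M (fst p)) X (incl_one M I (fst p, 1))"
  and hom_proj_first: "p \<in> I \<Longrightarrow> bimod_hom K A B X (M (fst p)) (\<lambda>x. x (fst p, 1))"
  using hom_incl[OF first_in_I] hom_proj[OF first_in_I] by simp_all

text \<open>By \<open>cochain_map_sigma_part\<close> it suffices that the twisting term is killed.
  Its entry at an off-diagonal block is an action on zero. At a diagonal block it is the action on
  \<open>M (fst p)\<close>, the same for every copy, so it cancels against that of the first
  copy.\<close>

lemma cochain_map_component:
  assumes y: "y \<in> P"
  shows "cochain_map K (C_cone K A B X) (S (source y) (target y)) (\<lambda>n c. component y n (sigma_part c))"
proof -
  define p q where "p = source y" and "q = target y"
  have pq: "p \<in> I" "q \<in> I" using y P by (auto simp: p_def q_def)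
  let ?T = "\<lambda>n. Sigma_map A B (M (fst p)) n (incl_one M I p) (\<lambda>x. x q)"
  let ?T1 = "\<lambda>n. Sigma_map A B (M (fst p)) n (incl_one M I (fst p, 1)) (\<lambda>x. x (fst q, 1))"
  note cS = cochain_complex_S[OF pq] and mp = M[OF pq(1)] and mq = M[OF pq(2)]
  have T: "cochain_map K (Sigma_complex K A B X X) (S p q) ?T"
    by (rule cochain_map_Sigma_map[OF A B bimodule_X mp bimodule_X mq hom_incl[OF pq(1)] hom_proj[OF pq(2)]])
  have T1: "cochain_map K (Sigma_complex K A B X X) (S p q) ?T1"
    by (rule cochain_map_Sigma_map[OF A B bimodule_X mp bimodule_X mq hom_incl_first[OF pq(1)] hom_proj_first[OF pq(2)]])
  show ?thesis
  proof (cases "p = q")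
    case True
    have "cochain_map K (C_cone K A B X) (S p q) (\<lambda>n c. ?T n (sigma_part c) \<ominus>\<^bsub>deg (S p q) n\<^esub> ?T1 n (sigma_part c))"
    proof (rule cochain_map_sigma_part[OF A B bimodule_X cS cochain_map_minus[OF T T1 cS]])
      fix n f h assume fh: "f \<in> carrier (deg (hochschild K A (regular A)) n)" "h \<in> carrier (deg (hochschild K B (regular B)) n)"
      let ?t = "tau K A B X n f h"
      interpret Sn: module K "deg (S p q) (Suc n)" by (rule cochain_complexD[OF cS])
      note t = tau_closed[OF A B bimodule_X fh]
      note c = linmap_closed[OF cochain_mapD(1)[OF T] t] linmap_closed[OF cochain_mapD(1)[OF T1] t]
      have "?T (Suc n) ?t = ?T1 (Suc n) ?t"
      proof (rule Sigma_eqI[OF A B mp mq c])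
        fix \<pi> x assume \<pi>: "\<pi> \<in> probes A B (Suc n)" and x: "x \<in> carrier (M (fst p))"
        \<comment> \<open>Inclusion followed by projection is the identity for the copy
          \<open>p\<close> and for the first copy alike.\<close>
        have e: "incl_one M I p x q = x" "incl_one M I (fst p, 1) x (fst q, 1) = x"
          using pq True first_in_I[OF pq(1)] by (simp_all add: incl_one_def)
        show "probe_eval \<pi> (?T (Suc n) ?t) x = probe_eval \<pi> (?T1 (Suc n) ?t) x"
          unfolding probe_Sigma_map_tau[OF A B bimodule_X mq hom_incl[OF pq(1)] hom_proj[OF pq(2)] fh \<pi> x]
            probe_Sigma_map_tau[OF A B bimodule_X mq hom_incl_first[OF pq(1)] hom_proj_first[OF pq(2)] fh \<pi> x] e ..
      qed
      then show "?T (Suc n) ?t \<ominus>\<^bsub>deg (S p q) (Suc n)\<^esub> ?T1 (Suc n) ?t = \<zero>\<^bsub>deg (S p q) (Suc n)\<^esub>"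
        using c by (simp add: a_minus_def Sn.r_neg)
    qed
    then show ?thesis using True by (simp add: component_def Let_def p_def q_def)
  next
    case False
    have "cochain_map K (C_cone K A B X) (S p q) (\<lambda>n c. ?T n (sigma_part c))"
    proof (rule cochain_map_sigma_part[OF A B bimodule_X cS T])
      fix n f h assume fh: "f \<in> carrier (deg (hochschild K A (regular A)) n)" "h \<in> carrier (deg (hochschild K B (regular B)) n)"
      let ?t = "tau K A B X n f h"
      interpret Sn: module K "deg (S p q) (Suc n)" by (rule cochain_complexD[OF cS])
      note t = tau_closed[OF A B bimodule_X fh]
      show "?T (Suc n) ?t = \<zero>\<^bsub>deg (S p q) (Suc n)\<^esub>"
      proof (rule Sigma_eqI[OF A B mp mq linmap_closed[OF cochain_mapD(1)[OF T] t] Sn.zero_closed])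
        fix \<pi> x assume \<pi>: "\<pi> \<in> probes A B (Suc n)" and x: "x \<in> carrier (M (fst p))"
        have "f w \<in> carrier A" if "w \<in> tensor_words A (n + 2)" for w using carrier_hochschild_mem[OF fh(1) that] by simp
        moreover have "h w \<in> carrier B" if "w \<in> tensor_words B (n + 2)" for w using carrier_hochschild_mem[OF fh(2) that] by simp
        \<comment> \<open>Off the diagonal the projection reads a zero coordinate.\<close>
        moreover have "incl_one M I p x q = \<zero>\<^bsub>M (fst q)\<^esub>" using pq False by (simp add: incl_one_def)
        moreover have "probe_eval \<pi> \<zero>\<^bsub>deg (S p q) (Suc n)\<^esub> x = \<zero>\<^bsub>M (fst q)\<^esub>"
          by (rule linmap_zero[OF linmap_probe[OF A B mp mq \<pi> x] Sn.module_axioms bimoduleD(1)[OF mq]])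
        ultimately show "probe_eval \<pi> (?T (Suc n) ?t) x = probe_eval \<pi> \<zero>\<^bsub>deg (S p q) (Suc n)\<^esub> x"
          unfolding probe_Sigma_map_tau[OF A B bimodule_X mq hom_incl[OF pq(1)] hom_proj[OF pq(2)] fh \<pi> x]
          using \<pi> copies_act_zero[where I=I and M=M, OF K A B M pq(2)]
          by (auto simp: probes_def split: probe.splits)
      qed
    qed
    then show ?thesis using False by (simp add: component_def Let_def p_def q_def)
  qed
qed

definition inject where
  "inject y n e = wrap \<zero>\<^bsub>deg (hochschild K A (regular A)) n\<^esub> \<zero>\<^bsub>deg (hochschild K B (regular B)) n\<^esub>
     (Sigma_map A B X n (\<lambda>x. x (source y)) (incl_one M I (target y)) e)"

lemma cochain_map_inject:
  assumes y: "source y \<in> I" "target y \<in> I"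
  shows "cochain_map K (S (source y) (target y)) (C_cone K A B X) (inject y)"
  using cochain_map_comp[OF cochain_map_Sigma_map[OF A B M[OF y(1)] bimodule_X M[OF y(2)] bimodule_X hom_proj[OF y(1)] hom_incl[OF y(2)]]
      cochain_map_wrap[OF A B bimodule_X]]
  by (simp add: inject_def[abs_def])

definition restrict_cone where
  "restrict_cone n c = wrap (fst (fst c)) (snd (snd (fst c)))
     (Sigma_map A B N n (incl_part M I F) (\<lambda>x. restrict x F) (sigma_part c))"

lemma Sigma_restrict:
  "cochain_map K (Sigma_complex K A B X X) (Sigma_complex K A B N N)
     (\<lambda>n. Sigma_map A B N n (incl_part M I F) (\<lambda>x. restrict x F))"
  by (rule cochain_map_Sigma_map[OF A B bimodule_X bimodule_N bimodule_X bimodule_N hom_incl_part hom_restrict])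

lemma Sigma_extend:
  "cochain_map K (Sigma_complex K A B N N) (Sigma_complex K A B X X)
     (\<lambda>n. Sigma_map A B X n (\<lambda>x. restrict x F) (incl_part M I F))"
  by (rule cochain_map_Sigma_map[OF A B bimodule_N bimodule_X bimodule_N bimodule_X hom_restrict hom_incl_part])

lemma restrict_incl_part: "x \<in> carrier N \<Longrightarrow> restrict (incl_part M I F x) F = x"
  using F by (intro extensionalityI[of _ F]) (auto simp: incl_part_def PiE_def)

text \<open>The twisting term records the actions, and \<open>restrict\<close> after
  \<open>incl_part\<close> is the identity of \<open>N\<close>; so the twist of \<open>X\<close> is
  carried to that of \<open>N\<close>.\<close>

lemma cochain_map_restrict_cone: "cochain_map K (C_cone K A B X) (C_cone K A B N) restrict_cone"
  unfolding restrict_cone_def[abs_def]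
proof (rule cochain_map_wrap_sigma_part[OF A B bimodule_X bimodule_N Sigma_restrict])
  fix n f h assume fh: "f \<in> carrier (deg (hochschild K A (regular A)) n)" "h \<in> carrier (deg (hochschild K B (regular B)) n)"
  let ?l = "Sigma_map A B N (Suc n) (incl_part M I F) (\<lambda>x. restrict x F) (tau K A B X n f h)"
  show "?l = tau K A B N n f h"
  proof (rule Sigma_eqI[OF A B bimodule_N bimodule_N linmap_closed[OF cochain_mapD(1)[OF Sigma_restrict] tau_closed[OF A B bimodule_X fh]]
        tau_closed[OF A B bimodule_N fh]])
    fix \<pi> x assume \<pi>: "\<pi> \<in> probes A B (Suc n)" and x: "x \<in> carrier N"
    show "probe_eval \<pi> ?l x = probe_eval \<pi> (tau K A B N n f h) x"
      unfolding probe_Sigma_map_tau[OF A B bimodule_X bimodule_N hom_incl_part hom_restrict fh \<pi> x]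
        probe_tau[OF A B bimodule_N \<pi> x] restrict_incl_part[OF x] ..
  qed
qed

text \<open>Up to the correction this is the product rule for matrix units. The subtracted
  projection reads the block of two first copies, which is not in \<open>P\<close>, so it vanishes
  on every injected block.\<close>

lemma component_inject:
  assumes x: "x \<in> P" and y: "y \<in> P" and e: "e \<in> carrier (deg (S (source y) (target y)) n)"
  shows "component x n (sigma_part (inject y n e)) = (if x = y then e else \<zero>\<^bsub>deg (S (source x) (target x)) n\<^esub>)"
proof -
  have i: "source x \<in> I" "target x \<in> I" "source y \<in> I" "target y \<in> I" using x y P by auto
  have eq: "source x = source y \<and> target x = target y \<longleftrightarrow> x = y" using source_target_eqI by blast
  have neq: "\<not> ((fst (source x), 1) = source y \<and> (fst (target x), 1) = target y)"
    using P[of y] y first[OF i(1)] first[OF i(2)] by auto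
  let ?s = "Sigma_map A B X n (\<lambda>x. x (source y)) (incl_one M I (target y)) e"
  let ?r = "if x = y then e else \<zero>\<^bsub>deg (S (source x) (target x)) n\<^esub>"
  note mS = cochain_complexD(1)[OF cochain_complex_S[OF i(1,2)], of n]
  interpret Sx: module K "deg (S (source x) (target x)) n" by (rule mS)
  have T: "Sigma_map A B (M (fst (source x))) n (incl_one M I (source x)) (\<lambda>z. z (target x)) ?s = ?r"
    using Sigma_map_block[OF i e] unfolding eq .
  have T1: "Sigma_map A B (M (fst (source x))) n (incl_one M I (fst (source x), 1)) (\<lambda>z. z (fst (target x), 1)) ?s =
      \<zero>\<^bsub>deg (S (source x) (target x)) n\<^esub>"
    using Sigma_map_block[OF first_in_I[OF i(1)] first_in_I[OF i(2)] i(3,4) e] unfolding if_not_P[OF neq] fst_conv .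
  have r: "?r \<in> carrier (deg (S (source x) (target x)) n)" using e by auto
  show ?thesis
    unfolding inject_def wrap_simps component_def Let_def T T1 module_minus_zero[OF mS r] by simp
qed

text \<open>A block outside \<open>F \<times> F\<close> misses \<open>N\<close> at one end: if its
  source is outside \<open>F\<close>, extension by zero has a zero coordinate there; if its target
  is, restriction forgets it.\<close>

lemma restrict_cone_inject:
  assumes y: "y \<in> P" and e: "e \<in> carrier (deg (S (source y) (target y)) n)"
  shows "restrict_cone n (inject y n e) = \<zero>\<^bsub>deg (C_cone K A B N) n\<^esub>"
proof -
  have i: "source y \<in> I" "target y \<in> I" "\<not> (source y \<in> F \<and> target y \<in> F)" using y P by auto
  let ?s = "Sigma_map A B X n (\<lambda>x. x (source y)) (incl_one M I (target y)) e"
  note c = cochain_map_Sigma_map[OF A B M[OF i(1)] bimodule_X M[OF i(2)] bimodule_X hom_proj[OF i(1)] hom_incl[OF i(2)]]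
  have s: "?s \<in> carrier (deg (Sigma_complex K A B X X) n)" by (rule linmap_closed[OF cochain_mapD(1)[OF c] e])
  interpret SN: module K "deg (Sigma_complex K A B N N) n" by (rule cochain_complexD[OF cochain_complex_Sigma[OF A B bimodule_N bimodule_N]])
  have "Sigma_map A B N n (incl_part M I F) (\<lambda>x. restrict x F) ?s = \<zero>\<^bsub>deg (Sigma_complex K A B N N) n\<^esub>"
  proof (rule Sigma_eqI[OF A B bimodule_N bimodule_N linmap_closed[OF cochain_mapD(1)[OF Sigma_restrict] s] SN.zero_closed])
    fix \<pi> x assume \<pi>: "\<pi> \<in> probes A B n" and x: "x \<in> carrier N"
    have ix: "incl_part M I F x \<in> carrier X" by (rule linmap_closed[OF bimod_homD(1)[OF hom_incl_part] x])
    note g = linmap_probe_eval[OF A B M[OF i(1)] M[OF i(2)] \<pi> e]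
    have g0: "probe_eval \<pi> e \<zero>\<^bsub>M (fst (source y))\<^esub> = \<zero>\<^bsub>M (fst (target y))\<^esub>"
      by (rule linmap_zero[OF g bimoduleD(1)[OF M[OF i(1)]] bimoduleD(1)[OF M[OF i(2)]]])
    have "restrict (incl_one M I (target y) (probe_eval \<pi> e (incl_part M I F x (source y)))) F = (\<lambda>p\<in>F. \<zero>\<^bsub>M (fst p)\<^esub>)"
      using i g0 F by (intro restrict_ext) (auto simp: incl_one_def incl_part_def)
    moreover have "probe_eval \<pi> \<zero>\<^bsub>deg (Sigma_complex K A B N N) n\<^esub> x = \<zero>\<^bsub>N\<^esub>"
      by (rule linmap_zero[OF linmap_probe[OF A B bimodule_N bimodule_N \<pi> x] SN.module_axioms bimoduleD(1)[OF bimodule_N]])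
    ultimately show "probe_eval \<pi> (Sigma_map A B N n (incl_part M I F) (\<lambda>x. restrict x F) ?s) x =
        probe_eval \<pi> \<zero>\<^bsub>deg (Sigma_complex K A B N N) n\<^esub> x"
      by (simp add: probe_Sigma_map[OF A B \<pi> x] probe_Sigma_map[OF A B \<pi> ix])
  qed
  then show ?thesis by (simp add: restrict_cone_def inject_def wrap_ops[OF A B bimodule_N])
qed

text \<open>In the kernel of \<open>r\<close> the cochains of \<open>A\<close> and \<open>B\<close>
  are zero and so are all blocks in \<open>F \<times> F\<close>. The correction in
  \<open>component\<close> then disappears, and reassembling the other blocks is the expansion of a
  linear map into matrix entries, applied to each probe.\<close>

lemma sum_inject_component:
  assumes c: "c \<in> carrier (deg (C_cone K A B X) n)" and rc: "restrict_cone n c = \<zero>\<^bsub>deg (C_cone K A B N) n\<^esub>"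
  shows "finsum (deg (C_cone K A B X) n) (\<lambda>y. inject y n (component y n (sigma_part c))) P = c"
proof -
  note cSX = cochain_complex_Sigma[OF A B bimodule_X bimodule_X]
  note cSN = cochain_complex_Sigma[OF A B bimodule_N bimodule_N]
  interpret SX: module K "deg (Sigma_complex K A B X X) n" by (rule cochain_complexD[OF cSX])
  interpret SN: module K "deg (Sigma_complex K A B N N) n" by (rule cochain_complexD[OF cSN])
  interpret X: module K X by (rule bimoduleD(1)[OF bimodule_X])
  obtain f h s where c': "c = wrap f h s" and s: "s \<in> carrier (deg (Sigma_complex K A B X X) n)"
    using c by (rule C_cases[OF A B bimodule_X])
  have eqs: "wrap f h (Sigma_map A B N n (incl_part M I F) (\<lambda>x. restrict x F) s) =
      wrap \<zero>\<^bsub>deg (hochschild K A (regular A)) n\<^esub> \<zero>\<^bsub>deg (hochschild K B (regular B)) n\<^esub> \<zero>\<^bsub>deg (Sigma_complex K A B N N) n\<^esub>"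
    using rc unfolding c' by (simp add: restrict_cone_def wrap_ops[OF A B bimodule_N])
  have f: "f = \<zero>\<^bsub>deg (hochschild K A (regular A)) n\<^esub>" using arg_cong[OF eqs, of "\<lambda>c. fst (fst c)"] by simp
  have h: "h = \<zero>\<^bsub>deg (hochschild K B (regular B)) n\<^esub>" using arg_cong[OF eqs, of "\<lambda>c. snd (snd (fst c))"] by simp
  have rs: "Sigma_map A B N n (incl_part M I F) (\<lambda>x. restrict x F) s = \<zero>\<^bsub>deg (Sigma_complex K A B N N) n\<^esub>"
    using arg_cong[OF eqs, of sigma_part] by simp
  \<comment> \<open>Entries in \<open>F \<times> F\<close> are read off by feeding a single summand
    of \<open>N\<close> to the restricted cochain, which is zero.\<close>
  have vanish: "probe_eval \<pi> s (incl_one M I p a) q = \<zero>\<^bsub>M (fst q)\<^esub>"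
    if \<pi>: "\<pi> \<in> probes A B n" and pq: "p \<in> F" "q \<in> F" and a: "a \<in> carrier (M (fst p))" for \<pi> p q a
  proof -
    let ?z = "incl_one M F p a"
    have z: "?z \<in> carrier N"
      by (rule linmap_closed[OF bimod_homD(1)[OF bimod_hom_incl_one[where I=F and M=M, OF K A B MF pq(1)]] a])
    have "incl_part M I F ?z = incl_one M I p a"
      using pq F by (intro ext) (auto simp: incl_part_def incl_one_def)
    then have "probe_eval \<pi> \<zero>\<^bsub>deg (Sigma_complex K A B N N) n\<^esub> ?z q = probe_eval \<pi> s (incl_one M I p a) q"
      using probe_Sigma_map[OF A B \<pi> z, of "incl_part M I F" "\<lambda>x. restrict x F" s] rs pq by simp
    moreover have "probe_eval \<pi> \<zero>\<^bsub>deg (Sigma_complex K A B N N) n\<^esub> ?z = \<zero>\<^bsub>N\<^esub>"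
      by (rule linmap_zero[OF linmap_probe[OF A B bimodule_N bimodule_N \<pi> z] SN.module_axioms bimoduleD(1)[OF bimodule_N]])
    ultimately show ?thesis using pq by simp
  qed
  let ?t = "\<lambda>y. Sigma_map A B X n (\<lambda>x. x (source y)) (incl_one M I (target y)) (component y n s)"
  have i: "source y \<in> I" "target y \<in> I" if "y \<in> P" for y using that P by auto
  have comp: "component y n s \<in> carrier (deg (S (source y) (target y)) n)" if "y \<in> P" for y
    using linmap_closed[OF cochain_mapD(1)[OF cochain_map_component[OF that]] c] by (simp add: c')
  have t: "?t y \<in> carrier (deg (Sigma_complex K A B X X) n)" if "y \<in> P" for y
    by (rule linmap_closed[OF cochain_mapD(1)[OF cochain_map_Sigma_map[OF A B M[OF i(1)[OF that]] bimodule_X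
      M[OF i(2)[OF that]] bimodule_X hom_proj[OF i(1)[OF that]] hom_incl[OF i(2)[OF that]]]] comp[OF that]])
  have probe_comp: "probe_eval \<pi> (component y n s) a = probe_eval \<pi> s (incl_one M I (source y) a) (target y)"
    if \<pi>: "\<pi> \<in> probes A B n" and y: "y \<in> P" and a: "a \<in> carrier (M (fst (source y)))" for \<pi> y a
  proof -
    note iy = i[OF y] and iF = first[OF i(1)[OF y]] first[OF i(2)[OF y]]
    let ?T = "Sigma_map A B (M (fst (source y))) n (incl_one M I (source y)) (\<lambda>x. x (target y)) s"
    let ?T1 = "Sigma_map A B (M (fst (source y))) n (incl_one M I (fst (source y), 1)) (\<lambda>x. x (fst (target y), 1)) s"
    note c1 = cochain_map_Sigma_map[OF A B bimodule_X M[OF iy(1)] bimodule_X M[OF iy(2)]]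
    have T: "?T \<in> carrier (deg (S (source y) (target y)) n)" "?T1 \<in> carrier (deg (S (source y) (target y)) n)"
      by (rule linmap_closed[OF cochain_mapD(1)[OF c1[OF hom_incl[OF iy(1)] hom_proj[OF iy(2)]]] s]
          linmap_closed[OF cochain_mapD(1)[OF c1[OF hom_incl_first[OF iy(1)] hom_proj_first[OF iy(2)]]] s])+
    have pT: "probe_eval \<pi> ?T a = probe_eval \<pi> s (incl_one M I (source y) a) (target y)"
      by (rule probe_Sigma_map[OF A B \<pi> a])
    have ia: "incl_one M I (source y) a \<in> carrier X" by (rule linmap_closed[OF bimod_homD(1)[OF hom_incl[OF iy(1)]] a])
    \<comment> \<open>The subtracted block sits on two first copies, where \<open>vanish\<close>
      applies.\<close>
    have pT1: "probe_eval \<pi> ?T1 a = \<zero>\<^bsub>M (fst (target y))\<^esub>"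
      using vanish[OF \<pi> iF, of a] a by (simp add: probe_Sigma_map[OF A B \<pi> a])
    have pc: "probe_eval \<pi> s (incl_one M I (source y) a) (target y) \<in> carrier (M (fst (target y)))"
      using linmap_closed[OF linmap_probe_eval[OF A B bimodule_X bimodule_X \<pi> s] ia] iy by auto
    show ?thesis
    proof (cases "source y = target y")
      case True
      have "component y n s = ?T \<ominus>\<^bsub>deg (S (source y) (target y)) n\<^esub> ?T1"
        unfolding component_def Let_def by (rule if_P[OF True])
      then have "probe_eval \<pi> (component y n s) a = probe_eval \<pi> ?T a \<ominus>\<^bsub>M (fst (target y))\<^esub> probe_eval \<pi> ?T1 a"
        using linmap_minus[OF linmap_probe[OF A B M[OF iy(1)] M[OF iy(2)] \<pi> a]
          cochain_complexD(1)[OF cochain_complex_S[OF iy]] bimoduleD(1)[OF M[OF iy(2)]] T] by (simp only:)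
      then show ?thesis unfolding pT pT1 module_minus_zero[OF bimoduleD(1)[OF M[OF iy(2)]] pc] .
    next
      case False
      have "component y n s = ?T" unfolding component_def Let_def by (rule if_not_P[OF False])
      then show ?thesis using pT by (simp only:)
    qed
  qed
  have "finsum (deg (Sigma_complex K A B X X) n) ?t P = s"
  proof (rule Sigma_eqI[OF A B bimodule_X bimodule_X _ s])
    show "finsum (deg (Sigma_complex K A B X X) n) ?t P \<in> carrier (deg (Sigma_complex K A B X X) n)"
      using t by (intro SX.finsum_closed) auto
    fix \<pi> x assume \<pi>: "\<pi> \<in> probes A B n" and x: "x \<in> carrier X"
    let ?g = "probe_eval \<pi> s"
    have xs: "x (source y) \<in> carrier (M (fst (source y)))" if "y \<in> P" for y using x i[OF that] by auto
    have "probe_eval \<pi> (finsum (deg (Sigma_complex K A B X X) n) ?t P) x = finsum X (\<lambda>y. probe_eval \<pi> (?t y) x) P"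
      by (rule linmap_finsum[OF linmap_probe[OF A B bimodule_X bimodule_X \<pi> x] SX.module_axioms X.module_axioms t])
    also have "\<dots> = finsum X (\<lambda>y. incl_one M I (target y) (?g (incl_one M I (source y) (x (source y))) (target y))) P"
    proof (intro X.finsum_cong' refl)
      fix y assume y: "y \<in> P"
      show eq: "probe_eval \<pi> (?t y) x = incl_one M I (target y) (?g (incl_one M I (source y) (x (source y))) (target y))"
        unfolding probe_Sigma_map[OF A B \<pi> x] probe_comp[OF \<pi> y xs[OF y]] ..
    next
      show "(\<lambda>y. incl_one M I (target y) (?g (incl_one M I (source y) (x (source y))) (target y))) \<in> P \<rightarrow> carrier X"
      proof
        fix y assume y: "y \<in> P"
        have "probe_eval \<pi> (?t y) x \<in> carrier X"
          by (rule linmap_closed[OF linmap_probe_eval[OF A B bimodule_X bimodule_X \<pi> t[OF y]] x])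
        then show "incl_one M I (target y) (?g (incl_one M I (source y) (x (source y))) (target y)) \<in> carrier X"
          unfolding probe_Sigma_map[OF A B \<pi> x] probe_comp[OF \<pi> y xs[OF y]] .
      qed
    qed
    also have "\<dots> = ?g x"
      by (rule block_decomposition[OF linmap_probe_eval[OF A B bimodule_X bimodule_X \<pi> s] x vanish[OF \<pi>]])
    finally show "probe_eval \<pi> (finsum (deg (Sigma_complex K A B X X) n) ?t P) x = ?g x" .
  qed
  moreover have "wrap \<zero>\<^bsub>deg (hochschild K A (regular A)) n\<^esub> \<zero>\<^bsub>deg (hochschild K B (regular B)) n\<^esub> (finsum (deg (Sigma_complex K A B X X) n) ?t P) =
      finsum (deg (C_cone K A B X) n) (\<lambda>y. inject y n (component y n s)) P"
    unfolding inject_def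
    by (rule linmap_finsum[OF cochain_mapD(1)[OF cochain_map_wrap[OF A B bimodule_X]] SX.module_axioms
      cochain_complexD(1)[OF cochain_complex_C_cone[OF A B bimodule_X]] t])
  ultimately have "finsum (deg (C_cone K A B X) n) (\<lambda>y. inject y n (component y n s)) P =
      wrap \<zero>\<^bsub>deg (hochschild K A (regular A)) n\<^esub> \<zero>\<^bsub>deg (hochschild K B (regular B)) n\<^esub> s"
    by (simp only:)
  then show ?thesis unfolding c' f h wrap_simps .
qed

lemma split_exact_cones:
  "split_exact K (family_product P (\<lambda>y. cohomology (S (source y) (target y)) k))
     (cohomology (C_cone K A B X) k) (cohomology (C_cone K A B N) k)
     (\<lambda>e. finsum (cohomology (C_cone K A B X) k) (\<lambda>y. coh_map (C_cone K A B X) k (inject y k) (e y)) P)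
     (coh_map (C_cone K A B N) k (restrict_cone k))"
proof (rule split_exact_cohomology[where D="\<lambda>y n c. component y n (sigma_part c)"])
  have i: "source y \<in> I" "target y \<in> I" if "y \<in> P" for y using that P by auto
  show "cochain_complex K (S (source y) (target y))" if "y \<in> P" for y
    by (rule cochain_complex_S[OF i[OF that]])
  show "cochain_map K (S (source y) (target y)) (C_cone K A B X) (inject y)" if "y \<in> P" for y
    by (rule cochain_map_inject[OF i[OF that]])
  \<comment> \<open>Extension by zero. In general it is no cochain map, because the twisting term of
    \<open>X\<close> has diagonal blocks outside \<open>F\<close> as well.\<close>
  let ?j = "\<lambda>n c. wrap (fst (fst c)) (snd (snd (fst c))) (Sigma_map A B X n (\<lambda>x. restrict x F) (incl_part M I F) (sigma_part c))"
  show "linmap K (deg (C_cone K A B N) n) (deg (C_cone K A B X) n) (?j n)" for n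
    by (intro linmap_wrap linmap_C_fst linmap_C_snd linmap_comp[OF linmap_sigma_part cochain_mapD(1)[OF Sigma_extend]]
      A B bimodule_X bimodule_N)
  fix n z assume "z \<in> carrier (deg (C_cone K A B N) n)"
  then obtain f h s where z: "z = wrap f h s" and s: "s \<in> carrier (deg (Sigma_complex K A B N N) n)"
    by (rule C_cases[OF A B bimodule_N])
  have "Sigma_map A B N n (incl_part M I F) (\<lambda>x. restrict x F) (Sigma_map A B X n (\<lambda>x. restrict x F) (incl_part M I F) s) = s"
  proof (rule Sigma_eqI[OF A B bimodule_N bimodule_N _ s])
    show "Sigma_map A B N n (incl_part M I F) (\<lambda>x. restrict x F) (Sigma_map A B X n (\<lambda>x. restrict x F) (incl_part M I F) s)
        \<in> carrier (deg (Sigma_complex K A B N N) n)"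
      by (rule linmap_closed[OF cochain_mapD(1)[OF Sigma_restrict] linmap_closed[OF cochain_mapD(1)[OF Sigma_extend] s]])
    fix \<pi> x assume \<pi>: "\<pi> \<in> probes A B n" and x: "x \<in> carrier N"
    have ix: "incl_part M I F x \<in> carrier X" by (rule linmap_closed[OF bimod_homD(1)[OF hom_incl_part] x])
    have "probe_eval \<pi> s x \<in> carrier N"
      by (rule linmap_closed[OF linmap_probe_eval[OF A B bimodule_N bimodule_N \<pi> s] x])
    then show "probe_eval \<pi> (Sigma_map A B N n (incl_part M I F) (\<lambda>x. restrict x F)
        (Sigma_map A B X n (\<lambda>x. restrict x F) (incl_part M I F) s)) x = probe_eval \<pi> s x"
      by (simp only: probe_Sigma_map[OF A B \<pi> x] probe_Sigma_map[OF A B \<pi> ix] restrict_incl_part[OF x] restrict_incl_part)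
  qed
  then show "restrict_cone n (?j n z) = z" by (simp add: restrict_cone_def z)
qed (fact finite_P cochain_complex_C_cone[OF A B bimodule_X] cochain_complex_C_cone[OF A B bimodule_N]
    cochain_map_component cochain_map_restrict_cone component_inject restrict_cone_inject sum_inject_component)+

section \<open>Comparison with the maps \<open>l\<close> and \<open>r\<close> of the
  statement\<close>

lemma r_cone_eq: "r_cone K A B N (incl_part M I F) (\<lambda>x. restrict x F) k = coh_map (C_cone K A B N) k (restrict_cone k)"
  unfolding r_cone_def
  by (rule arg_cong[where f="coh_map _ _"])
    (simp add: fun_eq_iff restrict_cone_def wrap_def sigma_part_def Sigma_map_def)

lemma l_cone_eq:
  "l_cone K A B X k = coh_map (C_cone K A B X) k
     (wrap \<zero>\<^bsub>deg (hochschild K A (regular A)) k\<^esub> \<zero>\<^bsub>deg (hochschild K B (regular B)) k\<^esub>)"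
  unfolding l_cone_def by (rule arg_cong[where f="coh_map _ _"]) (simp add: fun_eq_iff wrap_def)

lemma linmap_Sigma_coh_map_block:
  assumes J: "J \<subseteq> I" "J' \<subseteq> I"
  shows "linmap K (cohomology (Sigma_complex K A B (copies_sum M J) (copies_sum M J')) k) (cohomology (Sigma_complex K A B X X) k)
    (Sigma_coh_map K A B X X k (\<lambda>x. restrict x J) (incl_part M I J'))"
proof -
  have bim: "bimodule K A B (copies_sum M L)" if "L \<subseteq> I" for L
    using that by (intro bimodule_copies[where I=L and M=M, OF K A B M]) auto
  show ?thesis unfolding Sigma_coh_map_def
    by (rule linmap_coh_map[OF cochain_complex_Sigma[OF A B bim[OF J(1)] bim[OF J(2)]] cochain_complex_Sigma[OF A B bimodule_X bimodule_X]
        cochain_map_Sigma_map[OF A B bim[OF J(1)] bimodule_X bim[OF J(2)] bimodule_X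
          bimod_hom_copies_restrict[where I=I and M=M, OF K A B M J(1)] bimod_hom_incl_part[where I=I and M=M, OF K A B M J(2)]]])
qed

text \<open>A class for one pair of summands travels to \<open>X\<close> in two stages, through the
  partial sums over \<open>J\<close> and \<open>J'\<close>. On cochains the stages compose to the
  direct embedding of the block, so assembling amounts to summing the \<open>inject\<close>
  maps.\<close>

lemma Ext_assemble_block:
  assumes J: "J \<subseteq> I" "J' \<subseteq> I"
    and e: "\<And>p q. p \<in> J \<Longrightarrow> q \<in> J' \<Longrightarrow> e (block p q) \<in> carrier (cohomology (S p q) k)"
  shows "Ext_assemble K A B M k J J' e \<in> carrier (cohomology (Sigma_complex K A B (copies_sum M J) (copies_sum M J')) k)"
    and "l_cone K A B X k (Sigma_coh_map K A B X X k (\<lambda>x. restrict x J) (incl_part M I J') (Ext_assemble K A B M k J J' e)) =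
      finsum (cohomology (C_cone K A B X) k) (\<lambda>y. coh_map (C_cone K A B X) k (inject y k) (e y)) ((\<lambda>(p, q). block p q) ` (J \<times> J'))"
proof -
  let ?S = "Sigma_complex K A B (copies_sum M J) (copies_sum M J')" and ?SX = "Sigma_complex K A B X X" and ?C = "C_cone K A B X"
  let ?w = "wrap \<zero>\<^bsub>deg (hochschild K A (regular A)) k\<^esub> \<zero>\<^bsub>deg (hochschild K B (regular B)) k\<^esub>"
  have MJ: "bimodule K A B (M (fst p))" if "p \<in> J" for p using that J M by blast
  have MJ': "bimodule K A B (M (fst p))" if "p \<in> J'" for p using that J M by blast
  have bJ: "bimodule K A B (copies_sum M J)" by (rule bimodule_copies[where I=J and M=M, OF K A B MJ])
  have bJ': "bimodule K A B (copies_sum M J')" by (rule bimodule_copies[where I=J' and M=M, OF K A B MJ'])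
  note cS = cochain_complex_Sigma[OF A B bJ bJ'] and cSX = cochain_complex_Sigma[OF A B bimodule_X bimodule_X]
    and cC = cochain_complex_C_cone[OF A B bimodule_X]
  interpret HS: module K "cohomology ?S k" by (rule module_cohomology[OF cS])
  interpret HC: module K "cohomology ?C k" by (rule module_cohomology[OF cC])
  have c1: "cochain_map K (S p q) ?S (\<lambda>n. Sigma_map A B (copies_sum M J) n (\<lambda>y. y p) (incl_one M J' q))"
    if "p \<in> J" "q \<in> J'" for p q
    by (rule cochain_map_Sigma_map[OF A B MJ[OF that(1)] bJ MJ'[OF that(2)] bJ'
          bimod_hom_copies_proj[where I=J and M=M, OF K A B MJ that(1)] bimod_hom_incl_one[where I=J' and M=M, OF K A B MJ' that(2)]])
  have c2: "cochain_map K ?S ?SX (\<lambda>n. Sigma_map A B X n (\<lambda>x. restrict x J) (incl_part M I J'))"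
    by (rule cochain_map_Sigma_map[OF A B bJ bimodule_X bJ' bimodule_X
          bimod_hom_copies_restrict[where I=I and M=M, OF K A B M J(1)] bimod_hom_incl_part[where I=I and M=M, OF K A B M J(2)]])
  note c3 = cochain_map_wrap[OF A B bimodule_X]
  let ?G = "\<lambda>(p, q). coh_map ?S k (Sigma_map A B (copies_sum M J) k (\<lambda>y. y p) (incl_one M J' q)) (e (block p q))"
  have G: "?G x \<in> carrier (cohomology ?S k)" if "x \<in> J \<times> J'" for x
    using that linmap_closed[OF linmap_coh_map[OF cochain_complex_Sigma[OF A B MJ MJ'] cS c1] e] by auto
  have EA: "Ext_assemble K A B M k J J' e = finsum (cohomology ?S k) ?G (J \<times> J')"
    unfolding Ext_assemble_def
    by (rule arg_cong[where f="\<lambda>g. finsum _ g _"]) (simp add: fun_eq_iff Sigma_coh_map_def block_def)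
  show "Ext_assemble K A B M k J J' e \<in> carrier (cohomology ?S k)"
    unfolding EA using G by (intro HS.finsum_closed) auto
  let ?\<Psi> = "\<lambda>c. l_cone K A B X k (Sigma_coh_map K A B X X k (\<lambda>x. restrict x J) (incl_part M I J') c)"
  have \<Psi>: "linmap K (cohomology ?S k) (cohomology ?C k) ?\<Psi>"
    unfolding l_cone_eq by (rule linmap_comp[OF linmap_Sigma_coh_map_block[OF J] linmap_coh_map[OF cSX cC c3]])
  have \<Psi>G: "?\<Psi> (?G (p, q)) = coh_map ?C k (inject (block p q) k) (e (block p q))" if pq: "p \<in> J" "q \<in> J'" for p q
  proof -
    have pqI: "p \<in> I" "q \<in> I" using pq J by auto
    note cpq = cochain_complex_S[OF pqI]
    have "?\<Psi> (?G (p, q)) = coh_map ?C k (\<lambda>z. ?w (Sigma_map A B X k (\<lambda>x. restrict x J) (incl_part M I J')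
        (Sigma_map A B (copies_sum M J) k (\<lambda>y. y p) (incl_one M J' q) z))) (e (block p q))"
      unfolding l_cone_eq Sigma_coh_map_def prod.case
      by (simp only: coh_map_comp[OF cpq cS cSX c1[OF pq] c2 e[OF pq]]
          coh_map_comp[OF cpq cSX cC cochain_map_comp[OF c1[OF pq] c2] c3 e[OF pq]])
    also have "\<dots> = coh_map ?C k (inject (block p q) k) (e (block p q))"
    proof (rule coh_map_cong[OF cpq _ e[OF pq]])
      fix z assume z: "z \<in> carrier (deg (S p q) k)"
      note c4 = cochain_map_Sigma_map[OF A B M[OF pqI(1)] bimodule_X M[OF pqI(2)] bimodule_X hom_proj[OF pqI(1)] hom_incl[OF pqI(2)]]
      \<comment> \<open>Both sides are composites of induced maps, so probes reduce the claim to
        composing inclusions and projections of coordinates.\<close>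
      have "Sigma_map A B X k (\<lambda>x. restrict x J) (incl_part M I J') (Sigma_map A B (copies_sum M J) k (\<lambda>y. y p) (incl_one M J' q) z) =
          Sigma_map A B X k (\<lambda>x. x p) (incl_one M I q) z"
      proof (rule Sigma_eqI[OF A B bimodule_X bimodule_X linmap_closed[OF cochain_mapD(1)[OF c2] linmap_closed[OF cochain_mapD(1)[OF c1[OF pq]] z]]
            linmap_closed[OF cochain_mapD(1)[OF c4] z]])
        fix \<pi> x assume \<pi>: "\<pi> \<in> probes A B k" and x: "x \<in> carrier X"
        have xJ: "restrict x J \<in> carrier (copies_sum M J)" using x J by auto
        have "incl_part M I J' (incl_one M J' q a) = incl_one M I q a" for a
          using pq J by (intro ext) (auto simp: incl_part_def incl_one_def)
        then show "probe_eval \<pi> (Sigma_map A B X k (\<lambda>x. restrict x J) (incl_part M I J')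
            (Sigma_map A B (copies_sum M J) k (\<lambda>y. y p) (incl_one M J' q) z)) x =
          probe_eval \<pi> (Sigma_map A B X k (\<lambda>x. x p) (incl_one M I q) z) x"
          using pq by (simp only: probe_Sigma_map[OF A B \<pi> x] probe_Sigma_map[OF A B \<pi> xJ] restrict_apply' if_True)
      qed
      then show "?w (Sigma_map A B X k (\<lambda>x. restrict x J) (incl_part M I J')
          (Sigma_map A B (copies_sum M J) k (\<lambda>y. y p) (incl_one M J' q) z)) = inject (block p q) k z"
        by (simp only: inject_def block_simps)
    qed
    finally show ?thesis .
  qed
  have "?\<Psi> (Ext_assemble K A B M k J J' e) = finsum (cohomology ?C k) (\<lambda>x. ?\<Psi> (?G x)) (J \<times> J')"
    unfolding EA by (rule linmap_finsum[OF \<Psi> HS.module_axioms HC.module_axioms G])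
  also have "\<dots> = finsum (cohomology ?C k) (\<lambda>x. coh_map ?C k (inject (case x of (p, q) \<Rightarrow> block p q) k) (e (case x of (p, q) \<Rightarrow> block p q))) (J \<times> J')"
  proof (intro HC.finsum_cong' refl)
    fix x assume x: "x \<in> J \<times> J'"
    then obtain p q where "x = (p, q)" "p \<in> J" "q \<in> J'" by blast
    then show "?\<Psi> (?G x) = coh_map ?C k (inject (case x of (p, q) \<Rightarrow> block p q) k) (e (case x of (p, q) \<Rightarrow> block p q))"
      using \<Psi>G by (simp only: prod.case)
  next
    show "(\<lambda>x. coh_map ?C k (inject (case x of (p, q) \<Rightarrow> block p q) k) (e (case x of (p, q) \<Rightarrow> block p q))) \<in> J \<times> J' \<rightarrow> carrier (cohomology ?C k)"
    proof
      fix x assume x: "x \<in> J \<times> J'"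
      then obtain p q where "x = (p, q)" "p \<in> J" "q \<in> J'" by blast
      then show "coh_map ?C k (inject (case x of (p, q) \<Rightarrow> block p q) k) (e (case x of (p, q) \<Rightarrow> block p q)) \<in> carrier (cohomology ?C k)"
        using linmap_closed[OF \<Psi> G[OF x]] \<Psi>G by (simp only: prod.case)
    qed
  qed
  also have "\<dots> = finsum (cohomology ?C k) (\<lambda>y. coh_map ?C k (inject y k) (e y)) ((\<lambda>(p, q). block p q) ` (J \<times> J'))"
  proof (rule HC.finsum_reindex[symmetric])
    show "inj_on (\<lambda>(p, q). block p q) (J \<times> J')" by (rule inj_onI) (auto simp: block_def prod_eq_iff)
    show "(\<lambda>y. coh_map ?C k (inject y k) (e y)) \<in> (\<lambda>(p, q). block p q) ` (J \<times> J') \<rightarrow> carrier (cohomology ?C k)"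
    proof
      fix y assume "y \<in> (\<lambda>(p, q). block p q) ` (J \<times> J')"
      then obtain p q where y: "y = block p q" "p \<in> J" "q \<in> J'" by auto
      then show "coh_map ?C k (inject y k) (e y) \<in> carrier (cohomology ?C k)"
        using linmap_closed[OF \<Psi> G[of "(p, q)"]] \<Psi>G[OF y(2,3)] by simp
    qed
  qed
  finally show "?\<Psi> (Ext_assemble K A B M k J J' e) = finsum (cohomology ?C k) (\<lambda>y. coh_map ?C k (inject y k) (e y))
      ((\<lambda>(p, q). block p q) ` (J \<times> J'))" .
qed

text \<open>Pairs not contained in \<open>F \<times> F\<close> split disjointly into
  \<open>F \<times> R\<close>, \<open>R \<times> R\<close> and \<open>R \<times> F\<close>. These
  are the three Ext factors on which \<open>l\<close> is defined, so their contributions combine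
  into one sum over \<open>P\<close>.\<close>

lemma l_cone_sum_assemble:
  assumes e: "e \<in> carrier (family_product P (\<lambda>y. cohomology (S (source y) (target y)) k))" and R: "R = I - F"
  shows "l_cone_sum K A B X (incl_part M I F) (\<lambda>x. restrict x F) (incl_part M I R) (\<lambda>x. restrict x R) k
      (Ext_assemble K A B M k F R e, Ext_assemble K A B M k R R e, Ext_assemble K A B M k R F e) =
    finsum (cohomology (C_cone K A B X) k) (\<lambda>y. coh_map (C_cone K A B X) k (inject y k) (e y)) P"
proof -
  let ?SX = "Sigma_complex K A B X X" and ?C = "C_cone K A B X"
  let ?B = "\<lambda>J J'. (\<lambda>(p, q). block p q) ` (J \<times> J')"
  let ?h = "\<lambda>y. coh_map ?C k (inject y k) (e y)"
  let ?a = "\<lambda>J J'. Sigma_coh_map K A B X X k (\<lambda>x. restrict x J) (incl_part M I J') (Ext_assemble K A B M k J J' e)"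
  note cSX = cochain_complex_Sigma[OF A B bimodule_X bimodule_X] and cC = cochain_complex_C_cone[OF A B bimodule_X]
  interpret HSX: module K "cohomology ?SX k" by (rule module_cohomology[OF cSX])
  interpret HC: module K "cohomology ?C k" by (rule module_cohomology[OF cC])
  have RI: "R \<subseteq> I" using R by blast
  have eP: "e (block p q) \<in> carrier (cohomology (S p q) k)" if "block p q \<in> P" for p q
    using PiE_mem[OF e[unfolded family_product_simps] that] by simp
  have BP: "?B F R \<union> ?B R R \<union> ?B R F = P"
  proof (intro equalityI subsetI)
    fix y assume "y \<in> ?B F R \<union> ?B R R \<union> ?B R F"
    then show "y \<in> P" using F R P by auto
  next
    fix y assume "y \<in> P"
    then have "y = block (source y) (target y)" "(source y, target y) \<in> F \<times> R \<union> R \<times> R \<union> R \<times> F"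
      using P[of y] R by auto
    then show "y \<in> ?B F R \<union> ?B R R \<union> ?B R F" by (metis (no_types, lifting) UnCI UnE case_prod_conv image_eqI)
  qed
  have blockP: "block p q \<in> P" if "(p, q) \<in> F \<times> R \<union> R \<times> R \<union> R \<times> F" for p q using that F R P by auto
  have sub: "J \<subseteq> I" "J' \<subseteq> I" "\<And>p q. p \<in> J \<Longrightarrow> q \<in> J' \<Longrightarrow> e (block p q) \<in> carrier (cohomology (S p q) k)"
    if "(J, J') \<in> {(F, R), (R, R), (R, F)}" for J J'
    using that F RI eP blockP by blast+
  have EA1: "Ext_assemble K A B M k J J' e \<in> carrier (cohomology (Sigma_complex K A B (copies_sum M J) (copies_sum M J')) k)"
    if "(J, J') \<in> {(F, R), (R, R), (R, F)}" for J J'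
    by (rule Ext_assemble_block(1)[OF sub[OF that]])
  have EA2: "l_cone K A B X k (?a J J') = finsum (cohomology ?C k) ?h (?B J J')"
    if "(J, J') \<in> {(F, R), (R, R), (R, F)}" for J J'
    by (rule Ext_assemble_block(2)[OF sub[OF that]])
  have ac: "?a J J' \<in> carrier (cohomology ?SX k)" if "(J, J') \<in> {(F, R), (R, R), (R, F)}" for J J'
    by (rule linmap_closed[OF linmap_Sigma_coh_map_block[OF sub(1,2)[OF that]] EA1[OF that]])
  have l: "linmap K (cohomology ?SX k) (cohomology ?C k) (l_cone K A B X k)"
    unfolding l_cone_eq by (rule linmap_coh_map[OF cSX cC cochain_map_wrap[OF A B bimodule_X]])
  have hc: "?h y \<in> carrier (cohomology ?C k)" if "y \<in> P" for y
  proof -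
    have i: "source y \<in> I" "target y \<in> I" using that P by auto
    show ?thesis
      using linmap_closed[OF linmap_coh_map[OF cochain_complex_S[OF i] cC cochain_map_inject[OF i]]]
        eP[of "source y" "target y"] that by simp
  qed
  have pi: "?h \<in> Q \<rightarrow> carrier (cohomology ?C k)" if "Q \<subseteq> P" for Q
    by (rule Pi_I) (use hc that in blast)
  have disj: "?B F R \<inter> ?B R R = {}" "(?B F R \<union> ?B R R) \<inter> ?B R F = {}"
    using R by (auto simp: block_def)
  have fin: "finite (?B J J')" if "J \<subseteq> I" "J' \<subseteq> I" for J J' using that I finite_subset by blast
  have "l_cone_sum K A B X (incl_part M I F) (\<lambda>x. restrict x F) (incl_part M I R) (\<lambda>x. restrict x R) k
      (Ext_assemble K A B M k F R e, Ext_assemble K A B M k R R e, Ext_assemble K A B M k R F e) =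
    l_cone K A B X k (?a F R \<oplus>\<^bsub>cohomology ?SX k\<^esub> ?a R R \<oplus>\<^bsub>cohomology ?SX k\<^esub> ?a R F)"
    by (simp add: l_cone_sum_def)
  also have "\<dots> = l_cone K A B X k (?a F R) \<oplus>\<^bsub>cohomology ?C k\<^esub> l_cone K A B X k (?a R R) \<oplus>\<^bsub>cohomology ?C k\<^esub> l_cone K A B X k (?a R F)"
    using ac[of F R] ac[of R R] ac[of R F] by (simp add: linmap_add[OF l])
  also have "\<dots> = finsum (cohomology ?C k) ?h (?B F R) \<oplus>\<^bsub>cohomology ?C k\<^esub> finsum (cohomology ?C k) ?h (?B R R)
      \<oplus>\<^bsub>cohomology ?C k\<^esub> finsum (cohomology ?C k) ?h (?B R F)"
    using EA2[of F R] EA2[of R R] EA2[of R F] by simp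
  also have "\<dots> = finsum (cohomology ?C k) ?h (?B F R \<union> ?B R R) \<oplus>\<^bsub>cohomology ?C k\<^esub> finsum (cohomology ?C k) ?h (?B R F)"
    by (subst HC.finsum_Un_disjoint[OF fin[OF F RI] fin[OF RI RI] disj(1) pi pi]) (use BP in auto)
  also have "\<dots> = finsum (cohomology ?C k) ?h (?B F R \<union> ?B R R \<union> ?B R F)"
    by (rule HC.finsum_Un_disjoint[symmetric, OF finite_UnI[OF fin[OF F RI] fin[OF RI RI]] fin[OF RI F] disj(2) pi pi])
      (use BP in auto)
  finally show ?thesis unfolding BP .
qed

end

section \<open>Transport along the identifications of Ext and HH\<close>

lemma lin_iso_family_product:
  assumes iso: "\<And>i. i \<in> I \<Longrightarrow> lin_iso K (F i) (G i) (f i)"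
    and mF: "\<And>i. i \<in> I \<Longrightarrow> module K (F i)"
  shows "lin_iso K (family_product I F) (family_product I G) (\<lambda>x. \<lambda>i\<in>I. f i (x i))"
proof -
  have l: "linmap K (F i) (G i) (f i)" and b: "bij_betw (f i) (carrier (F i)) (carrier (G i))" if "i \<in> I" for i
    using iso[OF that] by (auto simp: lin_iso_def)
  let ?f = "\<lambda>x. \<lambda>i\<in>I. f i (x i)"
  have mem: "x i \<in> carrier (F i)" if "x \<in> (\<Pi>\<^sub>E i\<in>I. carrier (F i))" "i \<in> I" for x i using that by auto
  have "linmap K (family_product I F) (family_product I G) ?f"
    by (rule linmapI) (auto simp: mem linmap_add[OF l] linmap_smult[OF l]
      intro!: restrict_ext linmap_closed[OF l])
  moreover have "bij_betw ?f (\<Pi>\<^sub>E i\<in>I. carrier (F i)) (\<Pi>\<^sub>E i\<in>I. carrier (G i))"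
  proof (rule bij_betw_byWitness[where f'="\<lambda>y. \<lambda>i\<in>I. inv_into (carrier (F i)) (f i) (y i)"])
    show "\<forall>x\<in>(\<Pi>\<^sub>E i\<in>I. carrier (F i)). (\<lambda>i\<in>I. inv_into (carrier (F i)) (f i) (?f x i)) = x"
      by (rule ballI, rule extensionalityI[of _ I]) (auto simp: PiE_def bij_betw_inv_into_left[OF b] dest: Pi_mem)
    show "\<forall>y\<in>(\<Pi>\<^sub>E i\<in>I. carrier (G i)). ?f (\<lambda>i\<in>I. inv_into (carrier (F i)) (f i) (y i)) = y"
      by (rule ballI, rule extensionalityI[of _ I]) (auto simp: PiE_def bij_betw_inv_into_right[OF b] dest: Pi_mem)
    show "?f ` (\<Pi>\<^sub>E i\<in>I. carrier (F i)) \<subseteq> (\<Pi>\<^sub>E i\<in>I. carrier (G i))"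
      using linmap_closed[OF l] mem by auto
    show "(\<lambda>y. \<lambda>i\<in>I. inv_into (carrier (F i)) (f i) (y i)) ` (\<Pi>\<^sub>E i\<in>I. carrier (G i)) \<subseteq> (\<Pi>\<^sub>E i\<in>I. carrier (F i))"
      using linmap_closed[OF lin_iso_inv_into[OF iso mF, unfolded lin_iso_def, THEN conjunct1]]
      by (auto dest: PiE_mem)
  qed
  ultimately show ?thesis by (simp add: lin_iso_def)
qed

text \<open>In regrouped indices, the excluded pair of copy numbers \<open>(1, 1)\<close> is exactly
  a pair of first copies.\<close>

lemma power_index_iff:
  "y \<in> power_index n m \<longleftrightarrow> source y \<in> all_copies n m \<and> target y \<in> all_copies n m \<and>
     \<not> (source y \<in> first_copies n \<and> target y \<in> first_copies n)"
  by (cases y) (auto simp: power_index_def all_copies_def first_copies_def source_def target_def)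

theorem mainTheorem1:
  fixes K :: "'k ring" and A :: "('k, 'a) module" and B :: "('k, 'b) module"
    and M :: "nat \<Rightarrow> ('k, 'm, 'a, 'b) bimod" and n :: nat and m :: "nat \<Rightarrow> nat"
  assumes "cring K" and "assoc_algebra K A" and "assoc_algebra K B"
    and "\<And>i. i \<in> {1..n} \<Longrightarrow> bimodule K A B (M i)"
    and "projective_module K A" and "projective_module K B"
    and "\<And>i. i \<in> {1..n} \<Longrightarrow> projective_module K (as_module (M i))"
    and "\<And>i. i \<in> {1..n} \<Longrightarrow> 1 \<le> m i"
  defines "MM \<equiv> copies_sum M (all_copies n m)" and "MM' \<equiv> copies_sum M (first_copies n)"
  shows
    "(\<forall>k. split_exact K
        (Ext_power n m (\<lambda>i j. cohomology (Sigma_complex K A B (M i) (M j)) k))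
        (cohomology (C_cone K A B MM) k)
        (cohomology (C_cone K A B MM') k)
        (l_map K A B M n m k)
        (r_map K A B M n m k)) \<and>
     (\<forall>(P :: nat \<Rightarrow> nat \<Rightarrow> ('k, 'p, 'a, 'b) bimod) d e \<theta> \<phi> \<phi>'.
        (\<forall>i\<in>{1..n}. projective_resolution K A B (M i) (P i) (d i) (e i)) \<longrightarrow>
        (\<forall>i\<in>{1..n}. \<forall>j\<in>{1..n}. \<forall>k.
           lin_iso K (Ext_shift K A B (P i) (d i) (M j) k)
             (cohomology (Sigma_complex K A B (M i) (M j)) k) (\<theta> i j k)) \<longrightarrow>
        (\<forall>k. lin_iso K (HH K (tri_algebra A MM B) k) (cohomology (C_cone K A B MM) k) (\<phi> k)) \<longrightarrow>
        (\<forall>k. lin_iso K (HH K (tri_algebra A MM' B) k) (cohomology (C_cone K A B MM') k) (\<phi>' k)) \<longrightarrow>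
        (\<forall>k. split_exact K
           (Ext_power n m (\<lambda>i j. Ext_shift K A B (P i) (d i) (M j) k))
           (HH K (tri_algebra A MM B) k)
           (HH K (tri_algebra A MM' B) k)
           (\<lambda>x. inv_into (carrier (HH K (tri_algebra A MM B) k)) (\<phi> k)
              (l_map K A B M n m k (\<lambda>((i, j), (s, t))\<in>power_index n m. \<theta> i j k (x ((i, j), (s, t))))))
           (\<lambda>y. inv_into (carrier (HH K (tri_algebra A MM' B) k)) (\<phi>' k)
              (r_map K A B M n m k (\<phi> k y)))))"
proof -
  note K = assms(1) and A = assms(2) and B = assms(3)
  let ?I = "all_copies n m" and ?F = "first_copies n" and ?R = "other_copies n m" and ?P = "power_index n m"
  let ?S = "\<lambda>p q. Sigma_complex K A B (M (fst p)) (M (fst q))"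
  have M: "bimodule K A B (M (fst p))" if "p \<in> ?I" for p
    using assms(4)[of "fst p"] that by (auto simp: all_copies_def)
  have fin: "finite ?I" by (simp add: all_copies_def)
  \<comment> \<open>The hypothesis \<open>1 <= m i\<close> enters here: the first copy of each
    \<open>M i\<close> occurs in the full sum.\<close>
  have F: "?F \<subseteq> ?I" using assms(8) by (auto simp: first_copies_def all_copies_def)
  have first: "(fst p, 1) \<in> ?F" if "p \<in> ?I" for p
    using that by (auto simp: first_copies_def all_copies_def)
  have R: "?R = ?I - ?F" by (auto simp: first_copies_def all_copies_def other_copies_def)
  have MF: "bimodule K A B (M (fst p))" if "p \<in> ?F" for p using M F that by blast
  \<comment> \<open>\<open>Ext_power\<close> matches on nested pairs; \<open>source\<close> and
    \<open>target\<close> bring it into the shape of the splitting lemma.\<close>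
  have Ext_power_eq: "Ext_power n m E = family_product ?P (\<lambda>y. E (fst (source y)) (fst (target y)))"
    for E :: "nat \<Rightarrow> nat \<Rightarrow> ('k, 'e) module"
    by (simp add: Ext_power_def case_prod_unfold source_def target_def)
  have part1: "split_exact K
        (Ext_power n m (\<lambda>i j. cohomology (Sigma_complex K A B (M i) (M j)) k))
        (cohomology (C_cone K A B MM) k) (cohomology (C_cone K A B MM') k)
        (l_map K A B M n m k) (r_map K A B M n m k)" for k
    unfolding MM_def MM'_def Ext_power_eq
  proof (rule split_exact_cong[OF split_exact_cones[where M=M and I="?I" and F="?F" and P="?P", OF K A B M fin F first power_index_iff]])
    fix e assume "e \<in> carrier (family_product ?P (\<lambda>y. cohomology (?S (source y) (target y)) k))"
    from l_cone_sum_assemble[where M=M and I="?I" and F="?F" and P="?P", OF K A B M fin F first power_index_iff this R]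
    show "l_map K A B M n m k e = finsum (cohomology (C_cone K A B (copies_sum M ?I)) k)
        (\<lambda>y. coh_map (C_cone K A B (copies_sum M ?I)) k (inject K A B M ?I y k) (e y)) ?P"
      by (simp only: l_map_def Let_def)
  next
    show "r_map K A B M n m k y = coh_map (C_cone K A B (copies_sum M ?F)) k (restrict_cone A B M ?I ?F k) y" for y
      using r_cone_eq[where M=M and I="?I" and F="?F" and P="?P", OF K A B M fin F first power_index_iff, of k] by (simp only: r_map_def Let_def)
  qed
  show ?thesis
  proof (intro conjI allI impI)
    fix k show "split_exact K
        (Ext_power n m (\<lambda>i j. cohomology (Sigma_complex K A B (M i) (M j)) k))
        (cohomology (C_cone K A B MM) k) (cohomology (C_cone K A B MM') k)
        (l_map K A B M n m k) (r_map K A B M n m k)" by (rule part1)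
  next
    fix P :: "nat \<Rightarrow> nat \<Rightarrow> ('k, 'p, 'a, 'b) bimod" and d e \<theta> \<phi> \<phi>' k
    assume res: "\<forall>i\<in>{1..n}. projective_resolution K A B (M i) (P i) (d i) (e i)"
      and \<theta>: "\<forall>i\<in>{1..n}. \<forall>j\<in>{1..n}. \<forall>k. lin_iso K (Ext_shift K A B (P i) (d i) (M j) k)
             (cohomology (Sigma_complex K A B (M i) (M j)) k) (\<theta> i j k)"
      and \<phi>: "\<forall>k. lin_iso K (HH K (tri_algebra A MM B) k) (cohomology (C_cone K A B MM) k) (\<phi> k)"
      and \<phi>': "\<forall>k. lin_iso K (HH K (tri_algebra A MM' B) k) (cohomology (C_cone K A B MM') k) (\<phi>' k)"
    have idx: "fst (source y) \<in> {1..n}" "fst (target y) \<in> {1..n}" if "y \<in> ?P" for y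
      using that by (auto simp: power_index_iff all_copies_def)
    have mE: "module K (Ext_shift K A B (P (fst (source y))) (d (fst (source y))) (M (fst (target y))) k)" if "y \<in> ?P" for y
      by (rule module_Ext_shift[OF bspec[OF res idx(1)[OF that]] assms(4)[OF idx(2)[OF that]]])
    have iso: "lin_iso K (Ext_power n m (\<lambda>i j. Ext_shift K A B (P i) (d i) (M j) k))
        (Ext_power n m (\<lambda>i j. cohomology (Sigma_complex K A B (M i) (M j)) k))
        (\<lambda>x. \<lambda>((i, j), (s, t))\<in>?P. \<theta> i j k (x ((i, j), (s, t))))"
    proof -
      have "lin_iso K (Ext_power n m (\<lambda>i j. Ext_shift K A B (P i) (d i) (M j) k))
          (Ext_power n m (\<lambda>i j. cohomology (Sigma_complex K A B (M i) (M j)) k))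
          (\<lambda>x. \<lambda>y\<in>?P. \<theta> (fst (source y)) (fst (target y)) k (x y))"
        unfolding Ext_power_eq
        by (rule lin_iso_family_product) (use \<theta> idx mE in blast)+
      then show ?thesis by (simp add: case_prod_unfold source_def target_def)
    qed
    have mX: "module K (Ext_power n m (\<lambda>i j. Ext_shift K A B (P i) (d i) (M j) k))"
      unfolding Ext_power_eq by (rule module_family_product[OF K mE])
    \<comment> \<open>Transport starts from modules; for HH this rests on the triangular matrices
      forming an associative algebra.\<close>
    have mHH: "module K (HH K (tri_algebra A MM B) k)" "module K (HH K (tri_algebra A MM' B) k)"
      unfolding MM_def MM'_def
      using module_HH[OF assoc_algebra_tri[OF A B bimodule_copies[where I="?I" and M=M, OF K A B M]]]
        module_HH[OF assoc_algebra_tri[OF A B bimodule_copies[where I="?F" and M=M, OF K A B MF]]] by blast+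
    \<comment> \<open>Conjugation at all three places, so the result holds for any choice of the
      identifications.\<close>
    show "split_exact K
           (Ext_power n m (\<lambda>i j. Ext_shift K A B (P i) (d i) (M j) k))
           (HH K (tri_algebra A MM B) k)
           (HH K (tri_algebra A MM' B) k)
           (\<lambda>x. inv_into (carrier (HH K (tri_algebra A MM B) k)) (\<phi> k)
              (l_map K A B M n m k (\<lambda>((i, j), (s, t))\<in>?P. \<theta> i j k (x ((i, j), (s, t))))))
           (\<lambda>y. inv_into (carrier (HH K (tri_algebra A MM' B) k)) (\<phi>' k)
              (r_map K A B M n m k (\<phi> k y)))"
      by (rule split_exact_transport[OF part1 mX iso mHH(1) spec[OF \<phi>] mHH(2) spec[OF \<phi>']])
  qed
qed

end
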